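(* There is an algorithm (a refinement of Algorithm 2 below, obtained by choosing a specific order of the recursive calls, followed by deamortization) that enumerates all antichains of a finite poset $P$ on $n$ elements with constant worst-case delay, such that any two consecutively visited antichains differ in at most three elements (symmetric difference of size at most $3$). It requires $O(n(n+q))$ space and $O(n(n+q))$ time for initialization, where $q$ is the number of incomparable pairs of $P$, and the first $k$ antichains are visited in time $O(k+n(n+q))$.
   Context: An antichain is a set of pairwise incomparable elements; an incomparable pair is a 2-element antichain. Algorithm 2 (basic version): the input poset is given by its comparability matrix and relabeled so that $u\preceq v$ implies $u\le v$. The recursive procedure Enumerate$(P,A)$ does: if $P$ is empty, visit $A$; otherwise compute a longest chain $C=\{c_1\prec\cdots\prec c_k\}$, call Enumerate$(P_i,A\cup\{c_i\})$ for $i=1,\dots,k$, where $P_i$ is the set of elements incomparable with $c_i$, and then call Enumerate$(P\setminus C,A)$. Worst-case delay means the maximum time between consecutive outputs; outputs are given by a pointer to a data structure modified between outputs, on a RAM. *)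

theory Defs
  imports Main "HOL-Library.Multiset"
begin

section \<open>Posets, antichains, and the enumeration procedure\<close>

text \<open>A poset is a relation r with \<open>partial_order_on V r\<close>, so \<open>(u, v) \<in> r\<close> means
  \<open>u \<preceq> v\<close> (reflexive).\<close>

definition incomparable :: "'a rel \<Rightarrow> 'a \<Rightarrow> 'a \<Rightarrow> bool" where
  "incomparable r u v \<longleftrightarrow> (u, v) \<notin> r \<and> (v, u) \<notin> r"

definition antichains :: "'a set \<Rightarrow> 'a rel \<Rightarrow> 'a set set" where
  "antichains V r = {A. A \<subseteq> V \<and> (\<forall>u\<in>A. \<forall>v\<in>A. u \<noteq> v \<longrightarrow> incomparable r u v)}"

definition incomparable_pairs :: "'a set \<Rightarrow> 'a rel \<Rightarrow> 'a set set" where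
  "incomparable_pairs V r = {A \<in> antichains V r. card A = 2}"

definition chain_list :: "'a rel \<Rightarrow> 'a set \<Rightarrow> 'a list \<Rightarrow> bool" where
  "chain_list r P cs \<longleftrightarrow> set cs \<subseteq> P \<and> sorted_wrt (\<lambda>a b. (a, b) \<in> r \<and> a \<noteq> b) cs"

definition longest_chain :: "'a rel \<Rightarrow> 'a set \<Rightarrow> 'a list \<Rightarrow> bool" where
  "longest_chain r P cs \<longleftrightarrow>
     chain_list r P cs \<and> (\<forall>ds. chain_list r P ds \<longrightarrow> length ds \<le> length cs)"

text \<open>\<open>enumerate_order r P A As\<close>: the call Enumerate(P, A) can visit the sets \<open>As\<close>, in this
  order, when each invocation is free to choose which longest chain it uses and in which order
  it makes its recursive calls.  The list \<open>calls\<close> holds the pairs of arguments of the recursive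
  calls in the chosen order, and \<open>Ass\<close> the sequences visited by them.\<close>

inductive enumerate_order :: "'a rel \<Rightarrow> 'a set \<Rightarrow> 'a set \<Rightarrow> 'a set list \<Rightarrow> bool" for r where
  visit: "enumerate_order r {} A [A]"
| branch: "\<lbrakk> P \<noteq> {}; longest_chain r P cs;
     mset calls = mset (map (\<lambda>c. ({x \<in> P. incomparable r x c}, insert c A)) cs
                        @ [(P - set cs, A)]);
     list_all2 (\<lambda>call Bs. enumerate_order r (fst call) (snd call) Bs) calls Ass \<rbrakk>
   \<Longrightarrow> enumerate_order r P A (concat Ass)"


section \<open>A random access machine\<close>

text \<open>A fixed finite program works on registers and on an addressable memory, every instruction
  taking one unit of time.  The arithmetic itself is unbounded; that a run only uses words of
  \<open>O(log n)\<close> bits is a separate requirement (see \<open>word_bounded\<close>).\<close>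

datatype instr =
    Const nat nat      \<comment> \<open>\<open>Const i k\<close>: register i := k\<close>
  | Copy nat nat       \<comment> \<open>\<open>Copy i j\<close>: register i := register j\<close>
  | Add nat nat nat    \<comment> \<open>\<open>Add i j k\<close>: register i := register j + register k\<close>
  | Sub nat nat nat    \<comment> \<open>truncated at 0\<close>
  | Mul nat nat nat
  | Load nat nat       \<comment> \<open>\<open>Load i j\<close>: register i := memory[register j]\<close>
  | Store nat nat      \<comment> \<open>\<open>Store i j\<close>: memory[register i] := register j\<close>
  | Jump nat
  | JumpZero nat nat   \<comment> \<open>\<open>JumpZero i l\<close>: jump to l if register i is 0\<close>
  | Output nat         \<comment> \<open>\<open>Output i\<close>: emit register i as a pointer into the memory\<close>

type_synonym program = "instr list"

record config =
  pc :: nat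
  reg :: "nat \<Rightarrow> nat"
  mem :: "nat \<Rightarrow> nat"

definition set_reg :: "nat \<Rightarrow> nat \<Rightarrow> config \<Rightarrow> config" where
  "set_reg i x s = s\<lparr>pc := Suc (pc s), reg := (reg s)(i := x)\<rparr>"

fun exec :: "instr \<Rightarrow> config \<Rightarrow> config" where
  "exec (Const i k) s = set_reg i k s"
| "exec (Copy i j) s = set_reg i (reg s j) s"
| "exec (Add i j k) s = set_reg i (reg s j + reg s k) s"
| "exec (Sub i j k) s = set_reg i (reg s j - reg s k) s"
| "exec (Mul i j k) s = set_reg i (reg s j * reg s k) s"
| "exec (Load i j) s = set_reg i (mem s (reg s j)) s"
| "exec (Store i j) s = s\<lparr>pc := Suc (pc s), mem := (mem s)(reg s i := reg s j)\<rparr>"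
| "exec (Jump l) s = s\<lparr>pc := l\<rparr>"
| "exec (JumpZero i l) s = s\<lparr>pc := (if reg s i = 0 then l else Suc (pc s))\<rparr>"
| "exec (Output i) s = s\<lparr>pc := Suc (pc s)\<rparr>"

definition halted :: "program \<Rightarrow> config \<Rightarrow> bool" where
  "halted p s \<longleftrightarrow> length p \<le> pc s"

definition step :: "program \<Rightarrow> config \<Rightarrow> config" where
  "step p s = (if halted p s then s else exec (p ! pc s) s)"

definition run :: "program \<Rightarrow> config \<Rightarrow> nat \<Rightarrow> config" where
  "run p s t = (step p ^^ t) s"

definition output_pointer :: "program \<Rightarrow> config \<Rightarrow> nat option" where
  "output_pointer p s =
     (if halted p s then None else case p ! pc s of Output i \<Rightarrow> Some (reg s i) | _ \<Rightarrow> None)"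

definition output_times :: "program \<Rightarrow> config \<Rightarrow> nat \<Rightarrow> nat list" where
  "output_times p s T = filter (\<lambda>t. output_pointer p (run p s t) \<noteq> None) [0..<T]"

text \<open>The data structure representing a finite set at address a: the cell a holds the cardinality
  m, the next m cells hold the elements, in any order and without repetition.\<close>

definition represents :: "(nat \<Rightarrow> nat) \<Rightarrow> nat \<Rightarrow> nat set \<Rightarrow> bool" where
  "represents M a A \<longleftrightarrow>
     distinct (map M [Suc a..<Suc a + M a]) \<and> set (map M [Suc a..<Suc a + M a]) = A"

definition visits :: "program \<Rightarrow> config \<Rightarrow> nat set \<Rightarrow> bool" where
  "visits p s A \<longleftrightarrow> (\<exists>a. output_pointer p s = Some a \<and> represents (mem s) a A)"

text \<open>The addresses used by the next instruction; an output uses the cells of the set it emits.\<close>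

definition accessed :: "program \<Rightarrow> config \<Rightarrow> nat set" where
  "accessed p s =
     (if halted p s then {} else
      case p ! pc s of
        Load i j \<Rightarrow> {reg s j}
      | Store i j \<Rightarrow> {reg s i}
      | Output i \<Rightarrow> {reg s i..reg s i + mem s (reg s i)}
      | _ \<Rightarrow> {})"

definition space_bounded :: "program \<Rightarrow> config \<Rightarrow> nat \<Rightarrow> bool" where
  "space_bounded p s S \<longleftrightarrow> (\<forall>t. accessed p (run p s t) \<subseteq> {..<S})"

definition word_bounded :: "program \<Rightarrow> config \<Rightarrow> nat \<Rightarrow> bool" where
  "word_bounded p s W \<longleftrightarrow>
     (\<forall>t. (\<forall>i. reg (run p s t) i \<le> W) \<and> (\<forall>a. mem (run p s t) a \<le> W))"

text \<open>The input is n at address 0, followed by the comparability matrix of the poset r on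
  \<open>{0, \<dots>, n - 1}\<close>, row by row: the entry (u, v) is 1 if \<open>u \<preceq> v\<close>, and 0 otherwise.
  No relation between r and the order of the labels is assumed, so relabeling along a linear
  extension is part of the computation.\<close>

definition input_config :: "nat \<Rightarrow> nat rel \<Rightarrow> config" where
  "input_config n r =
     \<lparr>pc = 0, reg = (\<lambda>_. 0),
      mem = (\<lambda>a. if a = 0 then n
                 else if a \<le> n * n \<and> ((a - 1) div n, (a - 1) mod n) \<in> r then 1 else 0)\<rparr>"

end

theory Submission
  imports Defs Complex_Main
begin

text \<open>
  Calls at even depth visit their antichain before, and calls at odd depth after the recursive calls.
  Hence at most three insertions and deletions separate consecutive visits.  A call on m candidates
  with i incomparable pairs among them repeatedly extracts a longest chain, which costs O(m + i) steps
  each time: heights are computed by scanning backwards along a list sorted by height, so that every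
  step of a scan is charged to an incomparable pair, and the elements incomparable to a given one form
  an interval of the chain.  Up to a constant factor, the cost of the next extraction is at most the
  number of antichains of at most four elements that meet the chain just removed, because the chain is
  longest; so the sum of all these costs is linear in the
  number of such antichains.  Charging them to the antichains below the call, each of which is charged
  by boundedly many calls, gives constant amortized cost.  A stretch of the run without outputs
  costs O(n (n + q)), so a queue that holds O(n (n + q)) visits and releases one of them every
  constant number of steps makes the delay constant.  The queue stores insertions, deletions and
  visits, and replays them on the output set.

  Programs of a structured language are verified against traces of events, with one tick for each
  loop iteration; the compiled program, interleaved with the queue, simulates such a trace.\<close>

text \<open>Only the antichains that meet the removed chain may pay for the next extraction, which
  costs O(m + i). Since the chain is longest, every other element is incomparable to a nonempty
  interval of it, and the intervals of two incomparable elements overlap or touch. Overlap yields a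
  three-element antichain at once. Touching pairs are the obstacle: they are bounded through pairs
  of elements whose intervals share an endpoint. In a large class of such elements, either many have
  the same height, so that they form large antichains, or the heights spread and the intervals
  become long. Balancing the two effects takes antichains of one chain element and three others,
  hence the bound four, and the sum of inverse square roots.

  Constant amortized cost alone does not keep a queue filled: every contiguous stretch of the trace
  must have few ticks in relation to its visits, up to an additive O(n (n + q)). Nested calls
  threaten this, as their openings and closings may pile up. The alternation prevents it: the
  initial visit of one kind of call pays for the openings below it, the final visit of the other
  kind for the closings below it.\<close>

section \<open>Square root sums and counting by fibres\<close>

lemma sum_inverse_sqrt_le: "(\<Sum>i=1..m. 1 / sqrt (real i)) \<le> 2 * sqrt (real m)"
proof (induction m)
  case (Suc m)
  \<comment> \<open>Multiplied by \<open>a\<close>, this is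
    \<open>2 * a * b \<le> a\<^sup>2 + b\<^sup>2\<close> together with
    \<open>a\<^sup>2 = b\<^sup>2 + 1\<close>.\<close>
  have "1 / sqrt (real (Suc m)) \<le> 2 * sqrt (real (Suc m)) - 2 * sqrt (real m)"
  proof -
    define a where "a = sqrt (real (Suc m))"
    define b where "b = sqrt (real m)"
    have ab: "a > 0" "b \<ge> 0" "a^2 = b^2 + 1" by (auto simp: a_def b_def)
    have "0 \<le> (a - b)^2" by simp
    then have "2 * a * b \<le> a^2 + b^2" by (simp add: power2_diff)
    then have "1 \<le> (2 * a - 2 * b) * a" using ab(3) by (simp add: algebra_simps power2_eq_square)
    then show ?thesis unfolding a_def[symmetric] b_def[symmetric] using ab(1) by (simp only: divide_le_eq if_True)
  qed
  with Suc show ?case by simp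
qed simp

lemma two_mult_le_squares: "2 * (a * b) \<le> a\<^sup>2 + (b :: nat)\<^sup>2"
proof -
  have "real (2 * (a * b)) \<le> real (a\<^sup>2 + b\<^sup>2)"
    using sum_squares_bound[of "real a" "real b"] by simp
  then show ?thesis by (simp only: of_nat_le_iff)
qed

lemma card_sum_fibers:
  assumes "finite A"
  shows "card A = (\<Sum>y\<in>f ` A. card {x\<in>A. f x = y})"
  using sum.group[OF assms finite_imageI[OF assms, of f] subset_refl, of "\<lambda>_. 1::nat"] by simp

text \<open>Links the two shapes of the count below: pairs of elements with a common interval
  endpoint, and sums of squares to which \<open>card_squared_le_level_sum\<close> applies fibre by
  fibre.\<close>

lemma card_same_fiber_pairs:
  assumes "finite A"
  shows "card {(x, y). x \<in> A \<and> y \<in> A \<and> f x = f y} = (\<Sum>z\<in>f ` A. (card {x\<in>A. f x = z})\<^sup>2)"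
proof -
  have "{(x, y). x \<in> A \<and> y \<in> A \<and> f x = f y} = (SIGMA x:A. {y\<in>A. f y = f x})"
    by auto
  then have "card {(x, y). x \<in> A \<and> y \<in> A \<and> f x = f y} = (\<Sum>x\<in>A. card {y\<in>A. f y = f x})"
    using assms by (simp add: card_SigmaI)
  also have "\<dots> = (\<Sum>z\<in>f ` A. \<Sum>x\<in>{x\<in>A. f x = z}. card {y\<in>A. f y = f x})"
    by (rule sum.group[symmetric]) (use assms in auto)
  also have "\<dots> = (\<Sum>z\<in>f ` A. (card {x\<in>A. f x = z})\<^sup>2)"
    by (rule sum.cong) (auto simp: power2_eq_square)
  finally show ?thesis .
qed

text \<open>Elements with \<open>4 * t v * (n v)\<^sup>2 < card A\<close> make up at most half of A, because the sum of
  \<open>1 / sqrt i\<close> over \<open>i \<le> m\<close> is at most \<open>2 * sqrt m\<close>; the other half yields the bound.\<close>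

lemma card_squared_le_level_sum:
  fixes t :: "'a \<Rightarrow> nat"
  assumes fin: "finite A" and pos: "\<And>v. v \<in> A \<Longrightarrow> 1 \<le> t v"
  defines "n \<equiv> \<lambda>v. card {w\<in>A. t w = t v}"
  shows "(card A)\<^sup>2 \<le> 8 * (\<Sum>v\<in>A. t v * (n v)\<^sup>2)"
proof -
  define N where "N = card A"
  \<comment> \<open>The factor 4 is what makes the final estimate one half of \<open>N\<close>: the
    sum runs up to \<open>N div 4\<close> and is at most \<open>2 * sqrt (N / 4)\<close>, that is,
    \<open>sqrt N\<close>, and it is multiplied by \<open>sqrt N / 2\<close>.\<close>
  define bad where "bad = {v\<in>A. 4 * (t v * (n v)\<^sup>2) < N}"
  have finb: "finite bad" using fin by (auto simp: bad_def)
  have n1: "n v \<ge> 1" if "v \<in> A" for v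
    using that fin unfolding n_def by (auto simp: Suc_le_eq card_gt_0_iff)
  \<comment> \<open>Every class has at least one element, so a bad level is at most a quarter of
    \<open>N\<close>; this truncates the sum.\<close>
  have t_le: "t v \<in> {1..N div 4}" if "v \<in> bad" for v
  proof -
    have v: "v \<in> A" using that by (auto simp: bad_def)
    have "t v * 1 \<le> t v * (n v)\<^sup>2" using n1[OF v] by (intro mult_le_mono) auto
    moreover have "4 * (t v * (n v)\<^sup>2) < N" using that by (auto simp: bad_def)
    ultimately have "4 * t v < N" by linarith
    then show ?thesis using pos[OF v] by auto
  qed
  \<comment> \<open>All bad elements on level y lie in one class, whose squared size is at most
    \<open>N / (4 * y)\<close>.\<close>
  have fib: "real (card {w\<in>bad. t w = y}) \<le> sqrt (real N) / 2 * (1 / sqrt (real y))" if y: "y \<in> t ` bad" for y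
  proof -
    obtain v where v: "v \<in> bad" "y = t v" using y by auto
    have "card {w\<in>bad. t w = y} \<le> n v"
      unfolding n_def using fin v by (intro card_mono) (auto simp: bad_def)
    moreover have "(real (n v))\<^sup>2 \<le> real N / (4 * y)"
    proof -
      have "4 * (y * (n v)\<^sup>2) \<le> N" using v by (auto simp: bad_def)
      then have "real (4 * (y * (n v)\<^sup>2)) \<le> real N" by (simp only: of_nat_le_iff)
      moreover have "y > 0" using t_le[OF v(1)] v(2) by auto
      ultimately show ?thesis by (simp add: field_simps)
    qed
    then have "real (n v) \<le> sqrt (real N / (4 * y))"
      by (rule real_le_rsqrt)
    moreover have "sqrt (real N / (4 * y)) = sqrt (real N) / 2 * (1 / sqrt (real y))"
      by (simp add: real_sqrt_divide real_sqrt_mult)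
    ultimately show ?thesis by linarith
  qed
  have "real (card bad) = (\<Sum>y\<in>t ` bad. real (card {w\<in>bad. t w = y}))"
    by (subst card_sum_fibers[OF finb, of t]) simp
  also have "\<dots> \<le> (\<Sum>y\<in>t ` bad. sqrt (real N) / 2 * (1 / sqrt (real y)))"
    by (rule sum_mono) (rule fib)
  also have "\<dots> = sqrt (real N) / 2 * (\<Sum>y\<in>t ` bad. 1 / sqrt (real y))"
    by (simp add: sum_distrib_left)
  also have "(\<Sum>y\<in>t ` bad. 1 / sqrt (real y)) \<le> (\<Sum>y=1..N div 4. 1 / sqrt (real y))"
    by (rule sum_mono2) (use t_le in auto)
  also have "\<dots> \<le> 2 * sqrt (real (N div 4))" by (rule sum_inverse_sqrt_le)
  also have "\<dots> \<le> 2 * sqrt (real N / 4)" by simp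
  also have "\<dots> = sqrt (real N)" by (simp add: real_sqrt_divide)
  finally have "real (card bad) \<le> sqrt (real N) / 2 * sqrt (real N)"
    by (simp add: mult_left_mono)
  then have "2 * card bad \<le> N" by simp
  moreover have "card A = card bad + card (A - bad)"
    using fin finb by (subst card_Diff_subset) (auto simp: bad_def card_mono)
  ultimately have good: "N \<le> 2 * card (A - bad)" by (simp add: N_def)
  have "N * card (A - bad) = (\<Sum>v\<in>A - bad. N)" by simp
  also have "\<dots> \<le> (\<Sum>v\<in>A - bad. 4 * (t v * (n v)\<^sup>2))"
    by (rule sum_mono) (auto simp: bad_def not_less)
  also have "\<dots> \<le> (\<Sum>v\<in>A. 4 * (t v * (n v)\<^sup>2))"
    by (rule sum_mono2) (use fin in auto)
  finally have "N * card (A - bad) \<le> 4 * (\<Sum>v\<in>A. t v * (n v)\<^sup>2)"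
    by (simp add: sum_distrib_left)
  moreover have "N * N \<le> N * (2 * card (A - bad))" using good by (rule mult_le_mono2)
  ultimately have "N * N \<le> 8 * (\<Sum>v\<in>A. t v * (n v)\<^sup>2)" by linarith
  then show ?thesis by (simp add: N_def power2_eq_square)
qed

section \<open>Longest chains and the small antichains that meet them\<close>

lemma incomparable_converse [simp]: "incomparable (r\<inverse>) u v = incomparable r u v"
  by (auto simp: incomparable_def)

lemma incomparable_commute: "incomparable r u v = incomparable r v u"
  by (auto simp: incomparable_def)

lemma antichains_converse [simp]: "antichains V (r\<inverse>) = antichains V r"
  by (simp add: antichains_def)

lemma chain_list_converse: "chain_list (r\<inverse>) Q cs \<longleftrightarrow> chain_list r Q (rev cs)"
  by (auto simp: chain_list_def sorted_wrt_rev intro: sorted_wrt_mono_rel[rotated])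

lemma longest_chain_converse: "longest_chain (r\<inverse>) Q cs \<longleftrightarrow> longest_chain r Q (rev cs)"
  unfolding longest_chain_def chain_list_converse
  by (metis length_rev rev_rev_ident)

text \<open>These are the small antichains that are lost when the chain \<open>C\<close> is removed
  from \<open>Q\<close>, so over successive removals each of them is charged only once. Four leaves
  room for one chain element and three others.\<close>

definition small_meeting :: "'a rel \<Rightarrow> 'a set \<Rightarrow> 'a set \<Rightarrow> 'a set set" where
  "small_meeting r Q C = {B \<in> antichains Q r. card B \<le> 4 \<and> B \<inter> C \<noteq> {}}"

locale longest =
  fixes V :: "'a set" and r :: "'a rel" and Q :: "'a set" and cs :: "'a list"
  assumes po: "partial_order_on V r" and QV: "Q \<subseteq> V" and fin: "finite Q"
    and lc: "longest_chain r Q cs"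
begin

lemma trans_r: "(x, y) \<in> r \<Longrightarrow> (y, z) \<in> r \<Longrightarrow> (x, z) \<in> r"
  using partial_order_onD(2)[OF po] by (auto dest: transD)

lemma antisym_r: "(x, y) \<in> r \<Longrightarrow> (y, x) \<in> r \<Longrightarrow> x = y"
  using partial_order_onD(3)[OF po] by (auto dest: antisymD)

lemma refl_r: "x \<in> Q \<Longrightarrow> (x, x) \<in> r"
  using partial_order_onD(1)[OF po] QV by (auto simp: refl_on_def)

lemma ch: "chain_list r Q cs" and len: "chain_list r Q ds \<Longrightarrow> length ds \<le> length cs"
  using lc by (auto simp: longest_chain_def)

lemma cs_less: "i < j \<Longrightarrow> j < length cs \<Longrightarrow> (cs ! i, cs ! j) \<in> r \<and> cs ! i \<noteq> cs ! j"
  using ch by (auto simp: chain_list_def sorted_wrt_iff_nth_less)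

lemma csQ: "set cs \<subseteq> Q"
  using ch by (auto simp: chain_list_def)

lemma dist: "distinct cs"
  using cs_less by (metis distinct_conv_nth linorder_neqE_nat)

abbreviation "R \<equiv> Q - set cs"

text \<open>The elements of the chain below v are those with index less than \<open>lo v\<close>, and those not above
  v are those with index less than \<open>hi v\<close>; the indices in between are incomparable to v.\<close>

definition lo :: "'a \<Rightarrow> nat" where
  "lo v = length (takeWhile (\<lambda>c. (c, v) \<in> r) cs)"

definition hi :: "'a \<Rightarrow> nat" where
  "hi v = length (takeWhile (\<lambda>c. (v, c) \<notin> r) cs)"

lemma less_lo_iff:
  assumes "j < length cs"
  shows "(cs ! j, v) \<in> r \<longleftrightarrow> j < lo v"
proof
  assume "j < lo v"
  then show "(cs ! j, v) \<in> r"
    unfolding lo_def by (metis nth_mem set_takeWhileD takeWhile_nth)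
next
  assume a: "(cs ! j, v) \<in> r"
  show "j < lo v"
  proof (rule ccontr)
    assume n: "\<not> j < lo v"
    then have "lo v < length cs" using assms by simp
    then have "(cs ! lo v, v) \<notin> r" unfolding lo_def using nth_length_takeWhile by blast
    moreover have "lo v = j \<or> (cs ! lo v, cs ! j) \<in> r" using cs_less[of "lo v" j] n assms by (metis linorder_neqE_nat)
    ultimately show False using a trans_r by auto
  qed
qed

lemma less_hi_iff:
  assumes "j < length cs"
  shows "(v, cs ! j) \<notin> r \<longleftrightarrow> j < hi v"
proof
  assume "j < hi v"
  then show "(v, cs ! j) \<notin> r"
    unfolding hi_def by (metis nth_mem set_takeWhileD takeWhile_nth)
next
  assume a: "(v, cs ! j) \<notin> r"
  show "j < hi v"
  proof (rule ccontr)
    assume n: "\<not> j < hi v"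
    then have "hi v < length cs" using assms by simp
    then have "(v, cs ! hi v) \<in> r" unfolding hi_def using nth_length_takeWhile by blast
    moreover have "hi v = j \<or> (cs ! hi v, cs ! j) \<in> r" using cs_less[of "hi v" j] n assms by (metis linorder_neqE_nat)
    ultimately show False using a trans_r by auto
  qed
qed

lemma lo_le: "lo v \<le> length cs" and hi_le: "hi v \<le> length cs"
  by (auto simp: lo_def hi_def length_takeWhile_le)

lemma incomparable_iff:
  "j < length cs \<Longrightarrow> incomparable r (cs ! j) v \<longleftrightarrow> lo v \<le> j \<and> j < hi v"
  unfolding incomparable_def using less_lo_iff[of j v] less_hi_iff[of j v] by auto

text \<open>The height in the converse order, counted from 0. Distinct elements with equal values
  are incomparable.\<close>

definition coheight :: "'a \<Rightarrow> nat" where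
  "coheight v = Max {length xs | xs. chain_list r Q (v # xs)}"

lemma coheight_set:
  assumes "v \<in> Q"
  shows "finite {length xs | xs. chain_list r Q (v # xs)}" "0 \<in> {length xs | xs. chain_list r Q (v # xs)}"
proof -
  show "finite {length xs | xs. chain_list r Q (v # xs)}"
    by (rule finite_subset[of _ "{..length cs}"]) (auto dest: len)
  show "0 \<in> {length xs | xs. chain_list r Q (v # xs)}"
    using assms by (auto simp: chain_list_def)
qed

lemma coheight_ge:
  assumes "chain_list r Q (v # xs)"
  shows "length xs \<le> coheight v"
proof -
  have "v \<in> Q" using assms by (simp add: chain_list_def)
  from Max_ge[OF coheight_set(1)[OF this]] show ?thesis
    unfolding coheight_def using assms by blast
qed

lemma coheight_attained:
  assumes "v \<in> Q" obtains xs where "chain_list r Q (v # xs)" "length xs = coheight v"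
  using Max_in[OF coheight_set(1)[OF assms]] coheight_set(2)[OF assms]
  unfolding coheight_def by fastforce

lemma sorted_app: "sorted_wrt (\<lambda>a b. (a, b) \<in> r \<and> a \<noteq> b) (x # xs) \<Longrightarrow> (y, x) \<in> r \<Longrightarrow> y \<noteq> x \<Longrightarrow>
   sorted_wrt (\<lambda>a b. (a, b) \<in> r \<and> a \<noteq> b) (y # x # xs)"
  using trans_r antisym_r by auto

lemma coheight_less:
  assumes "(v, w) \<in> r" "v \<noteq> w" "v \<in> Q" "w \<in> Q"
  shows "coheight w < coheight v"
proof -
  obtain xs where xs: "chain_list r Q (w # xs)" "length xs = coheight w"
    using coheight_attained[OF assms(4)] .
  have "chain_list r Q (v # w # xs)"
    using xs assms sorted_app[of w xs v] by (auto simp: chain_list_def)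
  from coheight_ge[OF this] xs show ?thesis by simp
qed

text \<open>The part of the chain above \<open>v\<close> is a chain in front of which
  \<open>v\<close> can be put.\<close>

lemma coheight_lower:
  assumes v: "v \<in> R"
  shows "length cs - hi v \<le> coheight v"
proof -
  have "chain_list r Q (v # drop (hi v) cs)"
  proof -
    have "(v, c) \<in> r \<and> v \<noteq> c" if "c \<in> set (drop (hi v) cs)" for c
    proof -
      obtain i where "i < length (drop (hi v) cs)" "c = drop (hi v) cs ! i"
        using \<open>c \<in> set (drop (hi v) cs)\<close> unfolding in_set_conv_nth by blast
      then have "hi v + i < length cs" "c = cs ! (hi v + i)" by auto
      then have "(v, c) \<in> r" using less_hi_iff[of "hi v + i" v] by simp
      moreover have "v \<noteq> c" using in_set_dropD[OF \<open>c \<in> set (drop (hi v) cs)\<close>] v by blast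
      ultimately show ?thesis ..
    qed
    moreover have "sorted_wrt (\<lambda>a b. (a, b) \<in> r \<and> a \<noteq> b) (drop (hi v) cs)"
      using ch by (auto simp: chain_list_def sorted_wrt_drop)
    ultimately show ?thesis using v csQ by (auto simp: chain_list_def dest: in_set_dropD)
  qed
  from coheight_ge[OF this] show ?thesis by simp
qed

text \<open>Maximality of the chain enters here: the chain elements below \<open>v\<close>, then
  \<open>v\<close>, then a longest chain above \<open>v\<close> form a chain of \<open>Q\<close>,
  which cannot be longer than \<open>cs\<close>.\<close>

lemma coheight_upper:
  assumes v: "v \<in> R"
  shows "coheight v + lo v < length cs"
proof -
  obtain xs where xs: "chain_list r Q (v # xs)" "length xs = coheight v"
    using coheight_attained v by blast
  have *: "(c, x) \<in> r \<and> c \<noteq> x" if c: "c \<in> set (take (lo v) cs)" and x: "x \<in> set (v # xs)" for c x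
  proof -
    obtain j where j: "j < lo v" "j < length cs" "c = cs ! j"
      using c by (auto simp: in_set_conv_nth)
    then have cv: "(c, v) \<in> r" "c \<noteq> v" using less_lo_iff[of j v] v by auto
    show ?thesis
    proof (cases "x = v")
      case False
      then have "(v, x) \<in> r" "v \<noteq> x" using x xs(1) by (auto simp: chain_list_def)
      then show ?thesis using cv trans_r antisym_r by blast
    qed (use cv in auto)
  qed
  have "chain_list r Q (take (lo v) cs @ v # xs)"
    using xs(1) ch * by (auto simp: chain_list_def sorted_wrt_append sorted_wrt_take dest: in_set_takeD)
  from len[OF this] show ?thesis using xs(2) lo_le[of v] by simp
qed

text \<open>One plus the excess of the longest chain above \<open>v\<close> over the part of
  \<open>cs\<close> above \<open>v\<close>. For fixed \<open>hi\<close>, level and coheight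
  determine each other, while a level t forces at least t chain elements incomparable to
  \<open>v\<close>. This is the exchange between large classes and long intervals.\<close>

definition level :: "'a \<Rightarrow> nat" where
  "level v = coheight v + 1 - (length cs - hi v)"

lemma level_bounds:
  assumes "v \<in> R"
  shows "1 \<le> level v" "level v + lo v \<le> hi v"
  using coheight_lower[OF assms] coheight_upper[OF assms] hi_le[of v] by (auto simp: level_def)

lemma finF: "finite (small_meeting r Q C)"
  using finite_subset[OF _ finite_Pow_iff[THEN iffD2, OF fin]]
  by (metis (no_types, lifting) antichains_def mem_Collect_eq PowI small_meeting_def subsetI)

lemma chain_inter:
  assumes "B \<in> antichains Q r" "c \<in> B" "c \<in> set cs" "d \<in> B" "d \<in> set cs"
  shows "c = d"
proof (rule ccontr)
  assume ne: "c \<noteq> d"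
  obtain i j where ij: "i < length cs" "c = cs ! i" "j < length cs" "d = cs ! j"
    using assms by (auto simp: in_set_conv_nth)
  have "i \<noteq> j" using ne ij by auto
  then have "(c, d) \<in> r \<or> (d, c) \<in> r" using cs_less[of i j] cs_less[of j i] ij by (cases "i < j") auto
  with assms ne show False by (auto simp: antichains_def incomparable_def)
qed

text \<open>An element off a longest chain is incomparable to some member of the chain, for instance
  the one at index \<open>lo v\<close>; otherwise it could be inserted.\<close>

lemma card_R_le: "card R \<le> card (small_meeting r Q (set cs))"
proof -
  define \<phi> where "\<phi> = (\<lambda>v. {cs ! lo v, v})"
  have j: "lo v < length cs" "incomparable r (cs ! lo v) v" if "v \<in> R" for v
    using level_bounds[OF that] incomparable_iff[of "lo v" v] hi_le[of v] by auto
  have "inj_on \<phi> R"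
  proof (rule inj_onI)
    fix v w assume vw: "v \<in> R" "w \<in> R" "\<phi> v = \<phi> w"
    have "cs ! lo w \<in> set cs" using j[OF vw(2)] by auto
    then show "v = w" using vw by (auto simp: \<phi>_def doubleton_eq_iff)
  qed
  moreover have "\<phi> ` R \<subseteq> small_meeting r Q (set cs)"
  proof
    fix B assume "B \<in> \<phi> ` R"
    then obtain v where v: "v \<in> R" "B = {cs ! lo v, v}" by (auto simp: \<phi>_def)
    have "card B \<le> 4" using v(2) by (auto intro!: order_trans[OF card_insert_le_m1])
    then show "B \<in> small_meeting r Q (set cs)"
      using v j[OF v(1)] csQ by (auto simp: small_meeting_def antichains_def incomparable_commute)
  qed
  ultimately show ?thesis using finF by (intro card_inj_on_le)
qed

text \<open>In a class of equal \<open>hi\<close> and equal \<open>level\<close> all coheights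
  agree, so the class is an antichain, and the last \<open>level v\<close> chain elements before
  index \<open>hi v\<close> are incomparable to all of it. One of these chain elements and three
  members of the class, not necessarily distinct, form a set in \<open>small_meeting\<close>. Hence
  such sets control the squared class sizes weighted by levels, and
  \<open>card_squared_le_level_sum\<close> passes from these to the squared fibre sizes of
  \<open>hi\<close>.\<close>

lemma card_same_hi_pairs_le:
  "card {(v, w). v \<in> R \<and> w \<in> R \<and> hi v = hi w} \<le> 216 * card (small_meeting r Q (set cs))"
proof -
  define F where "F = small_meeting r Q (set cs)"
  define cls where "cls = (\<lambda>v. {w\<in>R. hi w = hi v \<and> level w = level v})"
  define Z where "Z = (SIGMA v:R. {hi v - level v..<hi v} \<times> (cls v \<times> cls v))"
  have finR: "finite R" using fin by auto
  have finc: "finite (cls v)" for v using finR by (auto simp: cls_def)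
  have cls_inc: "incomparable r x y" if "v \<in> R" "x \<in> cls v" "y \<in> cls v" "x \<noteq> y" for v x y
  proof -
    have eq: "x \<in> R" "y \<in> R" "hi x = hi y" "level x = level y" using that by (auto simp: cls_def)
    have "coheight x = coheight y"
      using eq(3,4) coheight_lower[OF eq(1)] coheight_lower[OF eq(2)] unfolding level_def by linarith
    note eq = this eq(1,2)
    show ?thesis using coheight_less[of x y] coheight_less[of y x] eq that(4)
      by (auto simp: incomparable_def)
  qed
  have jinc: "j < length cs" "incomparable r (cs ! j) x"
    if "v \<in> R" "x \<in> cls v" "j \<in> {hi v - level v..<hi v}" for v x j
  proof -
    have x: "x \<in> R" "hi x = hi v" "level x = level v" using that by (auto simp: cls_def)
    show jl: "j < length cs" using that(3) hi_le[of v] by auto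
    show "incomparable r (cs ! j) x"
      using incomparable_iff[OF jl, of x] level_bounds(2)[OF x(1)] x that(3) by auto
  qed
  have vcls: "v \<in> cls v" if "v \<in> R" for v using that by (auto simp: cls_def)
  \<comment> \<open>The triple is recorded beside the set, since the set does not tell which members
    play which role; the chain element, and with it the index, can be recovered from the
    set.\<close>
  define \<psi> where "\<psi> = (\<lambda>(v, j, x, y). ({cs ! j, v, x, y}, (v, x, y)))"
  have inF: "{cs ! j, v, x, y} \<in> F" "cs ! j \<in> set cs" "v \<notin> set cs" "x \<notin> set cs" "y \<notin> set cs"
    if "(v, j, x, y) \<in> Z" for v j x y
  proof -
    have z: "v \<in> R" "j \<in> {hi v - level v..<hi v}" "x \<in> cls v" "y \<in> cls v"
      using that by (auto simp: Z_def)
    have c4: "card {cs ! j, v, x, y} \<le> 4"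
      by (simp add: card_insert_if)
    have xy: "x \<in> R" "y \<in> R" using z by (auto simp: cls_def)
    show "cs ! j \<in> set cs" using jinc(1)[OF z(1) vcls[OF z(1)] z(2)] by auto
    then show "{cs ! j, v, x, y} \<in> F"
      using c4 xy z(1) csQ jinc(2)[OF z(1) vcls[OF z(1)] z(2)] jinc(2)[OF z(1) z(3) z(2)]
        jinc(2)[OF z(1) z(4) z(2)] cls_inc[OF z(1) z(3) z(4)] cls_inc[OF z(1) z(3) vcls[OF z(1)]]
        cls_inc[OF z(1) z(4) vcls[OF z(1)]]
      by (auto simp: F_def small_meeting_def antichains_def incomparable_commute)
    show "v \<notin> set cs" "x \<notin> set cs" "y \<notin> set cs" using z xy by auto
  qed
  define T where "T = (SIGMA B:F. (B - set cs) \<times> ((B - set cs) \<times> (B - set cs)))"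
  have "inj_on \<psi> Z"
  proof (rule inj_onI)
    fix a b assume ab: "a \<in> Z" "b \<in> Z" "\<psi> a = \<psi> b"
    obtain v j x y where a: "a = (v, j, x, y)" by (cases a) auto
    obtain v' j' x' y' where b: "b = (v', j', x', y')" by (cases b) auto
    have eq: "v' = v" "x' = x" "y' = y" "{cs ! j, v, x, y} = {cs ! j', v, x, y}"
      using ab(3) by (auto simp: \<psi>_def a b)
    have "cs ! j = cs ! j'"
      using eq(4) inF[OF ab(1)[unfolded a]] inF[OF ab(2)[unfolded b]] by blast
    moreover have "j < length cs" "j' < length cs"
      using ab jinc(1)[OF _ vcls] by (auto simp: Z_def a b)
    ultimately have "j = j'" using dist by (simp add: nth_eq_iff_index_eq)
    then show "a = b" by (simp add: a b eq)
  qed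
  moreover have "\<psi> ` Z \<subseteq> T"
    using inF by (force simp: \<psi>_def T_def)
  moreover have finT: "finite T"
  proof -
    have "finite B" if "B \<in> F" for B
      using that fin by (auto simp: F_def small_meeting_def antichains_def intro: finite_subset)
    then show ?thesis unfolding T_def using finF F_def by auto
  qed
  ultimately have ZT: "card Z \<le> card T" by (intro card_inj_on_le)
  have "card T = (\<Sum>B\<in>F. card (B - set cs) * (card (B - set cs) * card (B - set cs)))"
    unfolding T_def
  proof (subst card_SigmaI)
    show "finite F" using finF F_def by auto
    have "finite B" if "B \<in> F" for B
      using that fin by (auto simp: F_def small_meeting_def antichains_def intro: finite_subset)
    then show "\<forall>B\<in>F. finite ((B - set cs) \<times> (B - set cs) \<times> (B - set cs))"
      by (intro ballI finite_cartesian_product finite_Diff)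
  qed (simp add: card_cartesian_product)
  \<comment> \<open>At most three elements of \<open>B\<close> lie off the chain, and each of the
    three places of the triple takes one of them. With the factor 8 of the square bound this gives
    216.\<close>
  also have "\<dots> \<le> (\<Sum>B\<in>F. 27)"
  proof (rule sum_mono)
    fix B assume B: "B \<in> F"
    then have "finite B" using fin by (auto simp: F_def small_meeting_def antichains_def intro: finite_subset)
    moreover obtain c where "c \<in> B" "c \<in> set cs" using B by (auto simp: F_def small_meeting_def)
    ultimately have "card (B - set cs) < card B" by (intro psubset_card_mono) auto
    then have "card (B - set cs) \<le> 3" using B by (auto simp: F_def small_meeting_def)
    then have "card (B - set cs) * (card (B - set cs) * card (B - set cs)) \<le> 3 * (3 * 3)"
      by (intro mult_le_mono) auto
    then show "card (B - set cs) * (card (B - set cs) * card (B - set cs)) \<le> 27" by simp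
  qed
  finally have T27: "card T \<le> 27 * card F" by simp
  have "card Z = (\<Sum>v\<in>R. level v * (card (cls v))\<^sup>2)"
    unfolding Z_def
  proof (subst card_SigmaI)
    show "(\<Sum>v\<in>R. card ({hi v - level v..<hi v} \<times> cls v \<times> cls v)) = (\<Sum>v\<in>R. level v * (card (cls v))\<^sup>2)"
    proof (rule sum.cong)
      fix v assume "v \<in> R"
      from level_bounds[OF this] have "hi v - (hi v - level v) = level v" by auto
      then show "card ({hi v - level v..<hi v} \<times> cls v \<times> cls v) = level v * (card (cls v))\<^sup>2"
        by (simp add: card_cartesian_product power2_eq_square)
    qed simp
  qed (use finR finc in auto)
  have "card {(v, w). v \<in> R \<and> w \<in> R \<and> hi v = hi w} = (\<Sum>z\<in>hi ` R. (card {v\<in>R. hi v = z})\<^sup>2)"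
    by (rule card_same_fiber_pairs[OF finR])
  \<comment> \<open>The square bound is applied inside one fibre of \<open>hi\<close>, where the
    classes of equal level are the sets \<open>cls v\<close>.\<close>
  also have "\<dots> \<le> (\<Sum>z\<in>hi ` R. 8 * (\<Sum>v\<in>{v\<in>R. hi v = z}. level v * (card (cls v))\<^sup>2))"
  proof (rule sum_mono)
    fix z assume "z \<in> hi ` R"
    have "(card {v\<in>R. hi v = z})\<^sup>2 \<le> 8 * (\<Sum>v\<in>{v\<in>R. hi v = z}.
        level v * (card {w\<in>{v\<in>R. hi v = z}. level w = level v})\<^sup>2)"
      by (rule card_squared_le_level_sum) (use finR level_bounds in auto)
    also have "(\<Sum>v\<in>{v\<in>R. hi v = z}. level v * (card {w\<in>{v\<in>R. hi v = z}. level w = level v})\<^sup>2)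
        = (\<Sum>v\<in>{v\<in>R. hi v = z}. level v * (card (cls v))\<^sup>2)"
      by (rule sum.cong) (auto simp: cls_def intro!: arg_cong[of _ _ card])
    finally show "(card {v\<in>R. hi v = z})\<^sup>2 \<le> 8 * (\<Sum>v\<in>{v\<in>R. hi v = z}. level v * (card (cls v))\<^sup>2)" .
  qed
  also have "\<dots> = 8 * (\<Sum>v\<in>R. level v * (card (cls v))\<^sup>2)"
    by (simp only: sum_distrib_left[symmetric] sum.group[OF finR finite_imageI[OF finR] subset_refl])
  also have "\<dots> = 8 * card Z" using \<open>card Z = _\<close> by simp
  also have "\<dots> \<le> 216 * card F" using ZT T27 by simp
  finally show ?thesis unfolding F_def .
qed

lemma converse_longest: "longest V (r\<inverse>) Q (rev cs)"
  using po QV fin lc by unfold_locales (auto simp: longest_chain_converse)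

lemma converse_hi: "longest.hi (r\<inverse>) (rev cs) v = length cs - lo v"
proof -
  interpret D: longest V "r\<inverse>" Q "rev cs" by (rule converse_longest)
  have *: "j < D.hi v \<longleftrightarrow> j < length cs - lo v" if "j < length cs" for j
  proof -
    have "j < D.hi v \<longleftrightarrow> (cs ! (length cs - Suc j), v) \<notin> r"
      using D.less_hi_iff[of j v] that by (simp add: rev_nth)
    also have "\<dots> \<longleftrightarrow> \<not> length cs - Suc j < lo v"
      using less_lo_iff[of "length cs - Suc j" v] that by auto
    finally show ?thesis using that by auto
  qed
  show ?thesis
  proof (rule ccontr)
    assume "D.hi v \<noteq> length cs - lo v"
    then consider "D.hi v < length cs - lo v" | "length cs - lo v < D.hi v" by linarith
    then show False
    proof cases
      case 1 then show False using *[of "D.hi v"] by linarith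
    next
      case 2 then show False using *[of "length cs - lo v"] D.hi_le[of v] by simp
    qed
  qed
qed

text \<open>In the converse order the reversed chain is longest and its \<open>hi\<close> is
  \<open>length cs - lo\<close>, so the count for \<open>hi\<close> applies.\<close>

lemma card_same_lo_pairs_le:
  "card {(v, w). v \<in> R \<and> w \<in> R \<and> lo v = lo w} \<le> 216 * card (small_meeting r Q (set cs))"
proof -
  interpret D: longest V "r\<inverse>" Q "rev cs" by (rule converse_longest)
  have "lo v = lo w \<longleftrightarrow> D.hi v = D.hi w" for v w
    unfolding converse_hi using lo_le[of v] lo_le[of w] by linarith
  then have "{(v, w). v \<in> R \<and> w \<in> R \<and> lo v = lo w} = {(v, w). v \<in> R \<and> w \<in> R \<and> D.hi v = D.hi w}"
    by simp
  then show ?thesis using D.card_same_hi_pairs_le by (simp add: small_meeting_def)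
qed

text \<open>Fibre by fibre, \<open>2 * (h * l)\<close> is at most the sum of the two squares, and
  these count the pairs with equal \<open>hi\<close> and those with equal \<open>lo\<close>.\<close>

lemma card_hi_lo_pairs_le:
  "card {(v, w). v \<in> R \<and> w \<in> R \<and> hi v = lo w} \<le> 216 * card (small_meeting r Q (set cs))"
proof -
  define Z where "Z = hi ` R \<union> lo ` R"
  define h where "h = (\<lambda>z. card {v\<in>R. hi v = z})"
  define l where "l = (\<lambda>z. card {v\<in>R. lo v = z})"
  have finR: "finite R" and finZ: "finite Z" using fin by (auto simp: Z_def)
  have zero: "h z = 0" if "z \<notin> hi ` R" for z
    using that by (auto simp: h_def intro!: card_eq_0_iff[THEN iffD2])
  have zero': "l z = 0" if "z \<notin> lo ` R" for z
    using that by (auto simp: l_def intro!: card_eq_0_iff[THEN iffD2])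
  have h2: "(\<Sum>z\<in>Z. (h z)\<^sup>2) = card {(v, w). v \<in> R \<and> w \<in> R \<and> hi v = hi w}"
    unfolding card_same_fiber_pairs[OF finR] h_def
    by (rule sum.mono_neutral_right[OF finZ]) (use zero in \<open>auto simp: Z_def h_def\<close>)
  have l2: "(\<Sum>z\<in>Z. (l z)\<^sup>2) = card {(v, w). v \<in> R \<and> w \<in> R \<and> lo v = lo w}"
    unfolding card_same_fiber_pairs[OF finR] l_def
    by (rule sum.mono_neutral_right[OF finZ]) (use zero' in \<open>auto simp: Z_def l_def\<close>)
  have "{(v, w). v \<in> R \<and> w \<in> R \<and> hi v = lo w} \<subseteq> (\<Union>z\<in>Z. {v\<in>R. hi v = z} \<times> {w\<in>R. lo w = z})"
    by (auto simp: Z_def)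
  then have "card {(v, w). v \<in> R \<and> w \<in> R \<and> hi v = lo w} \<le> card (\<Union>z\<in>Z. {v\<in>R. hi v = z} \<times> {w\<in>R. lo w = z})"
    by (intro card_mono) (use finZ finR in auto)
  also have "\<dots> \<le> (\<Sum>z\<in>Z. h z * l z)"
    by (rule order_trans[OF card_UN_le[OF finZ]]) (simp add: card_cartesian_product h_def l_def)
  finally have "2 * card {(v, w). v \<in> R \<and> w \<in> R \<and> hi v = lo w} \<le> (\<Sum>z\<in>Z. 2 * (h z * l z))"
    unfolding sum_distrib_left[symmetric] by linarith
  also have "\<dots> \<le> (\<Sum>z\<in>Z. (h z)\<^sup>2 + (l z)\<^sup>2)"
    by (rule sum_mono) (rule two_mult_le_squares)
  also have "\<dots> \<le> 2 * (216 * card (small_meeting r Q (set cs)))"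
    using card_same_hi_pairs_le card_same_lo_pairs_le by (simp add: sum.distrib h2 l2)
  finally show ?thesis by simp
qed

text \<open>If the interval of \<open>u\<close> ended strictly before that of \<open>v\<close>
  begins, the chain element at index \<open>hi u\<close> would lie above \<open>u\<close> and below
  \<open>v\<close>. So the two intervals overlap or touch.\<close>

lemma incomparable_cases:
  assumes u: "u \<in> R" and v: "v \<in> R" and uv: "incomparable r u v"
  obtains c where "c \<in> set cs" "incomparable r c u" "incomparable r c v"
    | "hi u = lo v" | "hi v = lo u"
proof -
  have *: "(\<exists>c\<in>set cs. incomparable r c u \<and> incomparable r c v) \<or> hi u = lo v"
    if v: "v \<in> R" and uv: "incomparable r u v" and le: "lo u \<le> lo v" for u v
  proof (cases "lo v < hi u")
    case True
    have lv: "lo v < length cs" "lo v < hi v" using level_bounds[OF v] hi_le[of v] by auto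
    have "incomparable r (cs ! lo v) u" "incomparable r (cs ! lo v) v"
      using incomparable_iff[OF lv(1)] le lv(2) True by auto
    then show ?thesis using lv(1) by auto
  next
    case False
    have lv: "lo v < length cs" using level_bounds[OF v] hi_le[of v] by auto
    show ?thesis
    proof (rule ccontr)
      assume "\<not> ?thesis"
      then have hl: "hi u < lo v" using False by auto
      then have "(u, cs ! hi u) \<in> r" "(cs ! hi u, v) \<in> r"
        using less_hi_iff[of "hi u" u] less_lo_iff[of "hi u" v] lv by auto
      then have "(u, v) \<in> r" by (rule trans_r)
      then show False using uv by (auto simp: incomparable_def)
    qed
  qed
  show thesis
  proof (cases "lo u \<le> lo v")
    case True
    from *[OF v uv True] show thesis
    proof
      assume "\<exists>c\<in>set cs. incomparable r c u \<and> incomparable r c v"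
      then obtain c where "c \<in> set cs" "incomparable r c u" "incomparable r c v" by blast
      then show thesis by (rule that(1))
    qed (rule that(2))
  next
    case False
    then have "lo v \<le> lo u" by simp
    from *[OF u _ this] uv[unfolded incomparable_commute[of r u v]]
    have "(\<exists>c\<in>set cs. incomparable r c v \<and> incomparable r c u) \<or> hi v = lo u" by simp
    then show thesis
    proof
      assume "\<exists>c\<in>set cs. incomparable r c v \<and> incomparable r c u"
      then obtain c where "c \<in> set cs" "incomparable r c v" "incomparable r c u" by blast
      then show thesis by (intro that(1)[of c])
    qed (rule that(3))
  qed
qed

text \<open>A pair with a common incomparable chain element lies in a three-element member of
  \<open>small_meeting\<close>, and a member accounts for at most nine pairs. The other pairs have
  touching intervals, in one of two orders: 9 + 2 * 216 = 441.\<close>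

lemma card_incomparable_le:
  "card {(u, v). u \<in> R \<and> v \<in> R \<and> incomparable r u v} \<le> 441 * card (small_meeting r Q (set cs))"
proof -
  define F where "F = small_meeting r Q (set cs)"
  define T where "T = {(u, v). u \<in> R \<and> v \<in> R \<and> incomparable r u v \<and>
    (\<exists>c\<in>set cs. incomparable r c u \<and> incomparable r c v)}"
  define N where "N = {(u, v). u \<in> R \<and> v \<in> R \<and> hi u = lo v}"
  have finR: "finite R" using fin by auto
  have finT: "finite T" by (rule finite_subset[of _ "R \<times> R"]) (use finR in \<open>auto simp: T_def\<close>)
  have finN: "finite N" by (rule finite_subset[of _ "R \<times> R"]) (use finR in \<open>auto simp: N_def\<close>)
  have finB: "finite B" if "B \<in> F" for B
    using that fin by (auto simp: F_def small_meeting_def antichains_def intro: finite_subset)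
  have "T \<subseteq> (\<Union>B\<in>F. (B - set cs) \<times> (B - set cs))"
  proof
    fix p assume "p \<in> T"
    then obtain u v c where p: "p = (u, v)" "u \<in> R" "v \<in> R" "incomparable r u v"
      "c \<in> set cs" "incomparable r c u" "incomparable r c v"
      unfolding T_def by blast
    have "card {c, u, v} \<le> 4" by (simp add: card_insert_if)
    moreover have "{c, u, v} \<in> antichains Q r"
    proof -
      note i = p(4,6,7)
      note j = i[THEN incomparable_commute[THEN iffD1]]
      have "c \<in> Q" using p(5) csQ by auto
      then show ?thesis using i j p(2,3) unfolding antichains_def by blast
    qed
    ultimately have "{c, u, v} \<in> F" using p(5) by (simp add: F_def small_meeting_def)
    moreover have "p \<in> ({c, u, v} - set cs) \<times> ({c, u, v} - set cs)" using p(1,2,3) by simp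
    ultimately show "p \<in> (\<Union>B\<in>F. (B - set cs) \<times> (B - set cs))" by (rule UN_I)
  qed
  then have "card T \<le> card (\<Union>B\<in>F. (B - set cs) \<times> (B - set cs))"
    using finB finF F_def by (intro card_mono) auto
  also have "\<dots> \<le> (\<Sum>B\<in>F. card ((B - set cs) \<times> (B - set cs)))"
    by (rule card_UN_le) (use finF F_def in auto)
  also have "\<dots> \<le> (\<Sum>B\<in>F. 9)"
  proof (rule sum_mono)
    fix B assume B: "B \<in> F"
    obtain c where "c \<in> B" "c \<in> set cs" using B by (auto simp: F_def small_meeting_def)
    then have "card (B - set cs) < card B" using finB[OF B] by (intro psubset_card_mono) auto
    then have "card (B - set cs) \<le> 3" using B by (auto simp: F_def small_meeting_def)
    then have "card (B - set cs) * card (B - set cs) \<le> 3 * 3" by (intro mult_le_mono) auto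
    then show "card ((B - set cs) \<times> (B - set cs)) \<le> 9" by (simp add: card_cartesian_product)
  qed
  finally have cT: "card T \<le> 9 * card F" by simp
  have cN: "card N \<le> 216 * card F" unfolding N_def F_def by (rule card_hi_lo_pairs_le)
  have "{(u, v). u \<in> R \<and> v \<in> R \<and> incomparable r u v} \<subseteq> T \<union> (N \<union> prod.swap ` N)"
  proof
    fix p assume "p \<in> {(u, v). u \<in> R \<and> v \<in> R \<and> incomparable r u v}"
    then obtain u v where p: "p = (u, v)" "u \<in> R" "v \<in> R" "incomparable r u v" by auto
    from incomparable_cases[OF p(2-4)] show "p \<in> T \<union> (N \<union> prod.swap ` N)"
    proof cases
      case 3
      then have "(v, u) \<in> N" using p by (auto simp: N_def)
      then show ?thesis using p(1) by (force simp: image_iff)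
    qed (use p in \<open>auto simp: T_def N_def\<close>)
  qed
  then have "card {(u, v). u \<in> R \<and> v \<in> R \<and> incomparable r u v} \<le> card (T \<union> (N \<union> prod.swap ` N))"
    using finT finN by (intro card_mono) auto
  also have "\<dots> \<le> card T + (card N + card (prod.swap ` N))"
    by (meson add_left_mono card_Un_le order_trans)
  also have "card (prod.swap ` N) \<le> card N" by (rule card_image_le[OF finN])
  finally show ?thesis using cT cN unfolding F_def by linarith
qed

end

section \<open>A structured language for the random access machine\<close>

datatype exp = N nat | V nat | Plus exp exp | Minus exp exp | Times exp exp | Ld exp

text \<open>Two levels share this syntax: \<open>Enq\<close> has a meaning only in the trace
  semantics and is translated away by \<open>lower\<close>, \<open>Out\<close> only in the semantics
  with machine time.\<close>

datatype com =
    Skip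
  | Asg nat exp
  | Sto exp exp
  | Seq com com  (infixr \<open>;;\<close> 60)
  | If exp com com
  | While exp com
  | Out exp
  | Enq exp

record 'g st =
  rg :: "nat \<Rightarrow> nat"
  mm :: "nat \<Rightarrow> nat"
  gh :: 'g

fun eval :: "exp \<Rightarrow> 'g st \<Rightarrow> nat" where
  "eval (N k) s = k"
| "eval (V x) s = rg s x"
| "eval (Plus a b) s = eval a s + eval b s"
| "eval (Minus a b) s = eval a s - eval b s"
| "eval (Times a b) s = eval a s * eval b s"
| "eval (Ld a) s = mm s (eval a s)"

text \<open>\<open>ok S W e s\<close>: evaluating e reads only addresses below S and computes only values up to W,
  provided that registers and memory hold such values.\<close>

fun ok :: "nat \<Rightarrow> nat \<Rightarrow> exp \<Rightarrow> 'g st \<Rightarrow> bool" where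
  "ok S W (N k) s \<longleftrightarrow> k \<le> W"
| "ok S W (V x) s \<longleftrightarrow> True"
| "ok S W (Plus a b) s \<longleftrightarrow> ok S W a s \<and> ok S W b s \<and> eval a s + eval b s \<le> W"
| "ok S W (Minus a b) s \<longleftrightarrow> ok S W a s \<and> ok S W b s"
| "ok S W (Times a b) s \<longleftrightarrow> ok S W a s \<and> ok S W b s \<and> eval a s * eval b s \<le> W"
| "ok S W (Ld a) s \<longleftrightarrow> ok S W a s \<and> eval a s < S"

text \<open>Registers from here on are the evaluation stack for expressions. Those below 40 belong
  to the enumeration, 40 to 49 to the queue.\<close>

abbreviation tmp :: nat where "tmp \<equiv> 100"

fun vars :: "exp \<Rightarrow> nat set" where
  "vars (N k) = {}"
| "vars (V x) = {x}"
| "vars (Plus a b) = vars a \<union> vars b"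
| "vars (Minus a b) = vars a \<union> vars b"
| "vars (Times a b) = vars a \<union> vars b"
| "vars (Ld a) = vars a"

fun cvars :: "com \<Rightarrow> nat set" where
  "cvars Skip = {}"
| "cvars (Asg x e) = insert x (vars e)"
| "cvars (Sto a e) = vars a \<union> vars e"
| "cvars (Seq c d) = cvars c \<union> cvars d"
| "cvars (If e c d) = vars e \<union> cvars c \<union> cvars d"
| "cvars (While e c) = vars e \<union> cvars c"
| "cvars (Out e) = vars e"
| "cvars (Enq e) = vars e"

fun cexp :: "exp \<Rightarrow> nat \<Rightarrow> instr list" where
  "cexp (N k) d = [Const d k]"
| "cexp (V x) d = [Copy d x]"
| "cexp (Plus a b) d = cexp a d @ cexp b (Suc d) @ [Add d d (Suc d)]"
| "cexp (Minus a b) d = cexp a d @ cexp b (Suc d) @ [Sub d d (Suc d)]"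
| "cexp (Times a b) d = cexp a d @ cexp b (Suc d) @ [Mul d d (Suc d)]"
| "cexp (Ld a) d = cexp a d @ [Load d d]"

abbreviation elen :: "exp \<Rightarrow> nat" where "elen e \<equiv> length (cexp e tmp)"

fun clen :: "com \<Rightarrow> nat" where
  "clen Skip = 0"
| "clen (Asg x e) = elen e + 1"
| "clen (Sto a e) = elen a + length (cexp e (Suc tmp)) + 1"
| "clen (Seq c d) = clen c + clen d"
| "clen (If e c d) = elen e + clen c + clen d + 2"
| "clen (While e c) = elen e + clen c + 2"
| "clen (Out e) = elen e + 1"
| "clen (Enq e) = 0"

fun ccom :: "com \<Rightarrow> nat \<Rightarrow> instr list" where
  "ccom Skip l = []"
| "ccom (Asg x e) l = cexp e tmp @ [Copy x tmp]"
| "ccom (Sto a e) l = cexp a tmp @ cexp e (Suc tmp) @ [Store tmp (Suc tmp)]"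
| "ccom (Seq c d) l = ccom c l @ ccom d (l + clen c)"
| "ccom (If e c d) l = cexp e tmp @ [JumpZero tmp (l + elen e + clen c + 2)]
     @ ccom c (l + elen e + 1) @ [Jump (l + elen e + clen c + clen d + 2)]
     @ ccom d (l + elen e + clen c + 2)"
| "ccom (While e c) l = cexp e tmp @ [JumpZero tmp (l + elen e + clen c + 2)]
     @ ccom c (l + elen e + 1) @ [Jump l]"
| "ccom (Out e) l = cexp e tmp @ [Output tmp]"
| "ccom (Enq e) l = []"

lemma length_ccom [simp]: "length (ccom c l) = clen c"
  by (induction c arbitrary: l) auto

text \<open>Ghost state of the machine level: the number of instructions executed so far, and the visited
  sets with the times of their visits.\<close>

type_synonym clock = "nat \<times> (nat \<times> nat set) list"

definition tick :: "nat \<Rightarrow> clock st \<Rightarrow> clock st" where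
  "tick k s = s\<lparr>gh := (fst (gh s) + k, snd (gh s))\<rparr>"

abbreviation upd_rg :: "nat \<Rightarrow> nat \<Rightarrow> 'g st \<Rightarrow> 'g st" where
  "upd_rg x v s \<equiv> s\<lparr>rg := (rg s)(x := v)\<rparr>"

abbreviation upd_mm :: "nat \<Rightarrow> nat \<Rightarrow> 'g st \<Rightarrow> 'g st" where
  "upd_mm a v s \<equiv> s\<lparr>mm := (mm s)(a := v)\<rparr>"

text \<open>The clock advances by the exact number of instructions, so the recorded output times are
  exact too. A conditional whose first branch is taken pays one more, for the jump over the
  second.\<close>

inductive big :: "nat \<Rightarrow> nat \<Rightarrow> com \<Rightarrow> clock st \<Rightarrow> clock st \<Rightarrow> bool" for S W where
  Skip: "big S W Skip s s"
| Asg: "ok S W e s \<Longrightarrow> big S W (Asg x e) s (tick (elen e + 1) (upd_rg x (eval e s) s))"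
| Sto: "ok S W a s \<Longrightarrow> ok S W e s \<Longrightarrow> eval a s < S \<Longrightarrow>
    big S W (Sto a e) s (tick (clen (Sto a e)) (upd_mm (eval a s) (eval e s) s))"
| Seq: "big S W c s s' \<Longrightarrow> big S W d s' s'' \<Longrightarrow> big S W (Seq c d) s s''"
| IfT: "ok S W e s \<Longrightarrow> eval e s \<noteq> 0 \<Longrightarrow> big S W c (tick (elen e + 1) s) s' \<Longrightarrow> s'' = tick 1 s' \<Longrightarrow>
    big S W (If e c d) s s''"
| IfF: "ok S W e s \<Longrightarrow> eval e s = 0 \<Longrightarrow> big S W d (tick (elen e + 1) s) s' \<Longrightarrow> big S W (If e c d) s s'"
| WhileF: "ok S W e s \<Longrightarrow> eval e s = 0 \<Longrightarrow> big S W (While e c) s (tick (elen e + 1) s)"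
| WhileT: "ok S W e s \<Longrightarrow> eval e s \<noteq> 0 \<Longrightarrow> big S W c (tick (elen e + 1) s) s' \<Longrightarrow>
    big S W (While e c) (tick 1 s') s'' \<Longrightarrow> big S W (While e c) s s''"
| Out: "ok S W e s \<Longrightarrow> represents (mm s) (eval e s) A \<Longrightarrow> eval e s + mm s (eval e s) < S \<Longrightarrow>
    big S W (Out e) s (s\<lparr>gh := (fst (gh s) + elen e + 1, snd (gh s) @ [(fst (gh s) + elen e, A)])\<rparr>)"

text \<open>The machine started in \<open>s0\<close> is in configuration \<open>s\<close> after k steps, has respected all
  bounds so far, and has visited the sets recorded in \<open>outs\<close>.\<close>

definition reach :: "nat \<Rightarrow> nat \<Rightarrow> program \<Rightarrow> config \<Rightarrow> nat \<Rightarrow> config \<Rightarrow> (nat \<times> nat set) list \<Rightarrow> bool" where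
  "reach S W p s0 k s outs \<longleftrightarrow> run p s0 k = s
     \<and> (\<forall>t\<le>k. (\<forall>i. reg (run p s0 t) i \<le> W) \<and> (\<forall>a. mem (run p s0 t) a \<le> W))
     \<and> (\<forall>t<k. accessed p (run p s0 t) \<subseteq> {..<S})
     \<and> output_times p s0 k = map fst outs
     \<and> list_all2 (\<lambda>t A. visits p (run p s0 t) A) (map fst outs) (map snd outs)"

lemma run_Suc: "run p s (Suc k) = step p (run p s k)"
  by (simp add: run_def)

lemma reach_step:
  assumes r: "reach S W p s0 k s outs" and pc: "pc s < length p" "p ! pc s = i"
    and ni: "\<And>j. i \<noteq> Output j" and acc: "accessed p s \<subseteq> {..<S}"
    and bnd: "\<forall>j. reg (exec i s) j \<le> W" "\<forall>a. mem (exec i s) a \<le> W"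
  shows "reach S W p s0 (Suc k) (exec i s) outs"
proof -
  have rs: "run p s0 k = s" using r by (simp add: reach_def)
  have st: "run p s0 (Suc k) = exec i s"
    using pc rs by (simp add: run_Suc step_def halted_def)
  have "output_pointer p s = None"
    using pc ni by (auto simp: output_pointer_def split: instr.split)
  then have "output_times p s0 (Suc k) = output_times p s0 k"
    using rs by (simp add: output_times_def)
  then show ?thesis
    using r st bnd acc rs by (auto simp: reach_def le_Suc_eq less_Suc_eq)
qed

lemma reach_output:
  assumes r: "reach S W p s0 k s outs" and pc: "pc s < length p" "p ! pc s = Output j"
    and rep: "represents (mem s) (reg s j) A" and acc: "reg s j + mem s (reg s j) < S"
  shows "reach S W p s0 (Suc k) (s\<lparr>pc := Suc (pc s)\<rparr>) (outs @ [(k, A)])"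
proof -
  have rs: "run p s0 k = s" using r by (simp add: reach_def)
  have st: "run p s0 (Suc k) = s\<lparr>pc := Suc (pc s)\<rparr>"
    using pc rs by (simp add: run_Suc step_def halted_def)
  have op: "output_pointer p s = Some (reg s j)"
    using pc by (auto simp: output_pointer_def halted_def)
  then have ot: "output_times p s0 (Suc k) = output_times p s0 k @ [k]"
    using rs by (simp add: output_times_def)
  have "visits p s A" using op rep by (auto simp: visits_def)
  moreover have "accessed p s \<subseteq> {..<S}" using pc acc by (auto simp: accessed_def halted_def)
  moreover have "\<forall>i. reg s i \<le> W" "\<forall>a. mem s a \<le> W" using r rs by (auto simp: reach_def)
  ultimately show ?thesis
    using r st rs ot by (auto simp: reach_def le_Suc_eq less_Suc_eq list_all2_append)
qed

lemma reach_bounds: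
  assumes "reach S W p s0 k s outs" shows "reg s i \<le> W" "mem s a \<le> W"
  using assms by (auto simp: reach_def)

section \<open>Correctness of the compiled code\<close>

definition code_at :: "program \<Rightarrow> nat \<Rightarrow> instr list \<Rightarrow> bool" where
  "code_at p l is \<longleftrightarrow> (\<exists>xs ys. p = xs @ is @ ys \<and> length xs = l)"

lemma code_at_append: "code_at p l (is @ js) \<longleftrightarrow> code_at p l is \<and> code_at p (l + length is) js"
proof
  assume "code_at p l (is @ js)"
  then show "code_at p l is \<and> code_at p (l + length is) js"
    unfolding code_at_def by (metis append.assoc length_append)
next
  assume a: "code_at p l is \<and> code_at p (l + length is) js"
  then obtain xs ys xs' ys' where *: "p = xs @ is @ ys" "length xs = l"
    "p = xs' @ js @ ys'" "length xs' = l + length is"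
    unfolding code_at_def by blast
  have "xs @ is = xs'"
    using *(1,3) *(2,4) by (metis append.assoc append_eq_append_conv length_append)
  then have "p = xs @ (is @ js) @ ys'" using *(3) by simp
  then show "code_at p l (is @ js)" unfolding code_at_def using *(2) by blast
qed

lemma code_at_Cons: "code_at p l (i # is) \<longleftrightarrow> l < length p \<and> p ! l = i \<and> code_at p (Suc l) is"
proof -
  have "code_at p l [i] \<longleftrightarrow> l < length p \<and> p ! l = i"
  proof
    assume "code_at p l [i]" then show "l < length p \<and> p ! l = i" by (auto simp: code_at_def)
  next
    assume "l < length p \<and> p ! l = i"
    then show "code_at p l [i]" unfolding code_at_def
      by (intro exI[of _ "take l p"] exI[of _ "drop (Suc l) p"]) (auto simp: id_take_nth_drop[symmetric])
  qed
  then show ?thesis using code_at_append[of p l "[i]" "is"] by simp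
qed

lemma set_reg_update: "set_reg d x (s\<lparr>pc := a, reg := h\<rparr>) = s\<lparr>pc := Suc a, reg := h(d := x)\<rparr>"
  by (simp add: set_reg_def)

text \<open>Stack discipline: code with target \<open>d\<close> leaves the registers below
  \<open>d\<close> alone, so a left operand survives the evaluation of the right one.\<close>

lemma reach_cexp:
  assumes "reach S W p s0 k s outs" "code_at p (pc s) (cexp e d)"
    "\<And>i. i < tmp \<Longrightarrow> reg s i = rg \<sigma> i" "mem s = mm \<sigma>" "ok S W e \<sigma>" "vars e \<subseteq> {..<tmp}" "tmp \<le> d"
  shows "\<exists>g. reach S W p s0 (k + length (cexp e d)) (s\<lparr>pc := pc s + length (cexp e d), reg := g\<rparr>) outs \<and>
     g d = eval e \<sigma> \<and> (\<forall>i<d. g i = reg s i)"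
  using assms
proof (induction e arbitrary: k s d)
  case (N x)
  have "reach S W p s0 (Suc k) (exec (Const d x) s) outs"
    by (rule reach_step[OF N(1)])
      (use N reach_bounds[OF N(1)] in \<open>auto simp: code_at_Cons accessed_def set_reg_def\<close>)
  then show ?case by (auto simp: set_reg_def intro!: exI[of _ "(reg s)(d := x)"])
next
  case (V x)
  have "reach S W p s0 (Suc k) (exec (Copy d x) s) outs"
    by (rule reach_step[OF V(1)])
      (use V(2,5,7) reach_bounds[OF V(1)] in \<open>auto simp: code_at_Cons accessed_def set_reg_def\<close>)
  then show ?case using V by (auto simp: set_reg_def intro!: exI[of _ "(reg s)(d := reg s x)"])
next
  case (Plus a b)
  from Plus.prems have *: "code_at p (pc s) (cexp a d)" "code_at p (pc s + length (cexp a d)) (cexp b (Suc d))"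
    "code_at p (pc s + length (cexp a d) + length (cexp b (Suc d))) [Add d d (Suc d)]"
    by (auto simp: code_at_append)
  obtain g where g: "reach S W p s0 (k + length (cexp a d)) (s\<lparr>pc := pc s + length (cexp a d), reg := g\<rparr>) outs"
     "g d = eval a \<sigma>" "\<forall>i<d. g i = reg s i"
    using Plus.IH(1)[OF Plus.prems(1) *(1) Plus.prems(3,4)] Plus.prems by auto
  obtain h where h: "reach S W p s0 (k + length (cexp a d) + length (cexp b (Suc d)))
     (s\<lparr>pc := pc s + length (cexp a d) + length (cexp b (Suc d)), reg := h\<rparr>) outs"
     "h (Suc d) = eval b \<sigma>" "\<forall>i<Suc d. h i = g i"
    using Plus.IH(2)[OF g(1), of "Suc d"] Plus.prems g(3) *(2) by auto
  have "reach S W p s0 (Suc (k + length (cexp a d) + length (cexp b (Suc d))))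
     (exec (Add d d (Suc d)) (s\<lparr>pc := pc s + length (cexp a d) + length (cexp b (Suc d)), reg := h\<rparr>)) outs"
    by (rule reach_step[OF h(1)])
      (use *(3) g(2,3) h(2,3) reach_bounds[OF h(1)] Plus.prems(5) in \<open>auto simp: code_at_Cons accessed_def set_reg_def\<close>)
  then have "reach S W p s0 (k + length (cexp (Plus a b) d))
     (s\<lparr>pc := pc s + length (cexp (Plus a b) d), reg := h(d := h d + h (Suc d))\<rparr>) outs"
    by (simp add: set_reg_update add.assoc del: fun_upd_apply)
  moreover have "(h(d := h d + h (Suc d))) d = eval a \<sigma> + eval b \<sigma>" "\<forall>i<d. (h(d := h d + h (Suc d))) i = reg s i"
    using g(2,3) h(2,3) by auto
  ultimately show ?case unfolding eval.simps by blast
next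
  case (Minus a b)
  from Minus.prems have *: "code_at p (pc s) (cexp a d)" "code_at p (pc s + length (cexp a d)) (cexp b (Suc d))"
    "code_at p (pc s + length (cexp a d) + length (cexp b (Suc d))) [Sub d d (Suc d)]"
    by (auto simp: code_at_append)
  obtain g where g: "reach S W p s0 (k + length (cexp a d)) (s\<lparr>pc := pc s + length (cexp a d), reg := g\<rparr>) outs"
     "g d = eval a \<sigma>" "\<forall>i<d. g i = reg s i"
    using Minus.IH(1)[OF Minus.prems(1) *(1) Minus.prems(3,4)] Minus.prems by auto
  obtain h where h: "reach S W p s0 (k + length (cexp a d) + length (cexp b (Suc d)))
     (s\<lparr>pc := pc s + length (cexp a d) + length (cexp b (Suc d)), reg := h\<rparr>) outs"
     "h (Suc d) = eval b \<sigma>" "\<forall>i<Suc d. h i = g i"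
    using Minus.IH(2)[OF g(1), of "Suc d"] Minus.prems g(3) *(2) by auto
  have "h d - h (Suc d) \<le> W" using reach_bounds(1)[OF h(1), of d] by simp
  then have "reach S W p s0 (Suc (k + length (cexp a d) + length (cexp b (Suc d))))
     (exec (Sub d d (Suc d)) (s\<lparr>pc := pc s + length (cexp a d) + length (cexp b (Suc d)), reg := h\<rparr>)) outs"
    by (intro reach_step[OF h(1)])
      (use *(3) g(2,3) h(2,3) reach_bounds[OF h(1)] in \<open>auto simp: code_at_Cons accessed_def set_reg_def\<close>)
  then have "reach S W p s0 (k + length (cexp (Minus a b) d))
     (s\<lparr>pc := pc s + length (cexp (Minus a b) d), reg := h(d := h d - h (Suc d))\<rparr>) outs"
    by (simp add: set_reg_update add.assoc del: fun_upd_apply)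
  moreover have "(h(d := h d - h (Suc d))) d = eval a \<sigma> - eval b \<sigma>" "\<forall>i<d. (h(d := h d - h (Suc d))) i = reg s i"
    using g(2,3) h(2,3) by auto
  ultimately show ?case unfolding eval.simps by blast
next
  case (Times a b)
  from Times.prems have *: "code_at p (pc s) (cexp a d)" "code_at p (pc s + length (cexp a d)) (cexp b (Suc d))"
    "code_at p (pc s + length (cexp a d) + length (cexp b (Suc d))) [Mul d d (Suc d)]"
    by (auto simp: code_at_append)
  obtain g where g: "reach S W p s0 (k + length (cexp a d)) (s\<lparr>pc := pc s + length (cexp a d), reg := g\<rparr>) outs"
     "g d = eval a \<sigma>" "\<forall>i<d. g i = reg s i"
    using Times.IH(1)[OF Times.prems(1) *(1) Times.prems(3,4)] Times.prems by auto
  obtain h where h: "reach S W p s0 (k + length (cexp a d) + length (cexp b (Suc d)))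
     (s\<lparr>pc := pc s + length (cexp a d) + length (cexp b (Suc d)), reg := h\<rparr>) outs"
     "h (Suc d) = eval b \<sigma>" "\<forall>i<Suc d. h i = g i"
    using Times.IH(2)[OF g(1), of "Suc d"] Times.prems g(3) *(2) by auto
  have "reach S W p s0 (Suc (k + length (cexp a d) + length (cexp b (Suc d))))
     (exec (Mul d d (Suc d)) (s\<lparr>pc := pc s + length (cexp a d) + length (cexp b (Suc d)), reg := h\<rparr>)) outs"
    by (rule reach_step[OF h(1)])
      (use *(3) g(2,3) h(2,3) reach_bounds[OF h(1)] Times.prems(5) in \<open>auto simp: code_at_Cons accessed_def set_reg_def\<close>)
  then have "reach S W p s0 (k + length (cexp (Times a b) d))
     (s\<lparr>pc := pc s + length (cexp (Times a b) d), reg := h(d := h d * h (Suc d))\<rparr>) outs"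
    by (simp add: set_reg_update add.assoc del: fun_upd_apply)
  moreover have "(h(d := h d * h (Suc d))) d = eval a \<sigma> * eval b \<sigma>" "\<forall>i<d. (h(d := h d * h (Suc d))) i = reg s i"
    using g(2,3) h(2,3) by auto
  ultimately show ?case unfolding eval.simps by blast
next
  case (Ld a)
  from Ld.prems have *: "code_at p (pc s) (cexp a d)" "code_at p (pc s + length (cexp a d)) [Load d d]"
    by (auto simp: code_at_append)
  obtain g where g: "reach S W p s0 (k + length (cexp a d)) (s\<lparr>pc := pc s + length (cexp a d), reg := g\<rparr>) outs"
     "g d = eval a \<sigma>" "\<forall>i<d. g i = reg s i"
    using Ld.IH[OF Ld.prems(1) *(1) Ld.prems(3,4)] Ld.prems by auto
  have "reach S W p s0 (Suc (k + length (cexp a d)))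
     (exec (Load d d) (s\<lparr>pc := pc s + length (cexp a d), reg := g\<rparr>)) outs"
    by (rule reach_step[OF g(1)])
      (use *(2) g(2,3) reach_bounds[OF g(1)] reach_bounds(2)[OF Ld.prems(1)] Ld.prems(5) in
        \<open>auto simp: code_at_Cons accessed_def set_reg_def\<close>)
  then have "reach S W p s0 (k + length (cexp (Ld a) d))
     (s\<lparr>pc := pc s + length (cexp (Ld a) d), reg := g(d := mem s (g d))\<rparr>) outs"
    by (simp add: set_reg_update del: fun_upd_apply)
  moreover have "(g(d := mem s (g d))) d = mm \<sigma> (eval a \<sigma>)" "\<forall>i<d. (g(d := mem s (g d))) i = reg s i"
    using g(2,3) Ld.prems(4) by auto
  ultimately show ?case unfolding eval.simps by blast
qed

lemma code_at_Nil: "code_at p l [] \<longleftrightarrow> l \<le> length p"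
proof
  assume "l \<le> length p"
  then show "code_at p l []" unfolding code_at_def by (intro exI[of _ "take l p"] exI[of _ "drop l p"]) simp
qed (auto simp: code_at_def)

definition sim :: "nat \<Rightarrow> nat \<Rightarrow> program \<Rightarrow> config \<Rightarrow> nat \<Rightarrow> clock st \<Rightarrow> bool" where
  "sim S W p s0 l \<sigma> \<longleftrightarrow> (\<exists>s. reach S W p s0 (fst (gh \<sigma>)) s (snd (gh \<sigma>)) \<and> pc s = l
     \<and> (\<forall>i<tmp. reg s i = rg \<sigma> i) \<and> mem s = mm \<sigma>)"

lemma sim_cexp:
  assumes "sim S W p s0 l \<sigma>" "code_at p l (cexp e tmp)" "ok S W e \<sigma>" "vars e \<subseteq> {..<tmp}"
  obtains s where "reach S W p s0 (fst (gh \<sigma>) + elen e) s (snd (gh \<sigma>))" "pc s = l + elen e"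
    "\<forall>i<tmp. reg s i = rg \<sigma> i" "mem s = mm \<sigma>" "reg s tmp = eval e \<sigma>"
proof -
  obtain s where s: "reach S W p s0 (fst (gh \<sigma>)) s (snd (gh \<sigma>))" "pc s = l"
    "\<forall>i<tmp. reg s i = rg \<sigma> i" "mem s = mm \<sigma>" using assms(1) unfolding sim_def by blast
  from reach_cexp[OF s(1), of e tmp \<sigma>] s assms
  obtain g where "reach S W p s0 (fst (gh \<sigma>) + elen e) (s\<lparr>pc := l + elen e, reg := g\<rparr>) (snd (gh \<sigma>))"
     "g tmp = eval e \<sigma>" "\<forall>i<tmp. g i = reg s i" by auto
  then show thesis using s by (intro that[of "s\<lparr>pc := l + elen e, reg := g\<rparr>"]) auto
qed

lemma sim_test:
  assumes "sim S W p s0 l \<sigma>" "code_at p l (cexp e tmp @ [JumpZero tmp l'])" "ok S W e \<sigma>" "vars e \<subseteq> {..<tmp}"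
  shows "sim S W p s0 (if eval e \<sigma> = 0 then l' else l + elen e + 1) (tick (elen e + 1) \<sigma>)"
proof -
  obtain s where s: "reach S W p s0 (fst (gh \<sigma>) + elen e) s (snd (gh \<sigma>))" "pc s = l + elen e"
    "\<forall>i<tmp. reg s i = rg \<sigma> i" "mem s = mm \<sigma>" "reg s tmp = eval e \<sigma>"
    by (rule sim_cexp[OF assms(1) _ assms(3,4)]) (use assms(2) in \<open>auto simp: code_at_append\<close>)
  have "reach S W p s0 (Suc (fst (gh \<sigma>) + elen e)) (exec (JumpZero tmp l') s) (snd (gh \<sigma>))"
    by (rule reach_step[OF s(1)])
      (use s(2) assms(2) reach_bounds[OF s(1)] in \<open>auto simp: code_at_append code_at_Cons accessed_def\<close>)
  then show ?thesis unfolding sim_def using s by (intro exI[of _ "exec (JumpZero tmp l') s"]) (auto simp: tick_def)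
qed

lemma sim_jump:
  assumes "sim S W p s0 l \<sigma>" "code_at p l [Jump l']"
  shows "sim S W p s0 l' (tick 1 \<sigma>)"
proof -
  obtain s where s: "reach S W p s0 (fst (gh \<sigma>)) s (snd (gh \<sigma>))" "pc s = l"
    "\<forall>i<tmp. reg s i = rg \<sigma> i" "mem s = mm \<sigma>" using assms(1) unfolding sim_def by blast
  have "reach S W p s0 (Suc (fst (gh \<sigma>))) (exec (Jump l') s) (snd (gh \<sigma>))"
    by (rule reach_step[OF s(1)])
      (use s(2) assms(2) reach_bounds[OF s(1)] in \<open>auto simp: code_at_Cons accessed_def\<close>)
  then show ?thesis unfolding sim_def using s by (intro exI[of _ "exec (Jump l') s"]) (auto simp: tick_def)
qed

text \<open>The induction is on the run and not on the command, because a loop enters its own code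
  again at the same address.\<close>

theorem big_sim:
  assumes "big S W c \<sigma> \<sigma>'" "sim S W p s0 l \<sigma>" "code_at p l (ccom c l)" "cvars c \<subseteq> {..<tmp}"
  shows "sim S W p s0 (l + clen c) \<sigma>'"
  using assms
proof (induction arbitrary: l rule: big.induct)
  case (Skip s)
  then show ?case by simp
next
  case (Asg e \<sigma> x)
  obtain s where s: "reach S W p s0 (fst (gh \<sigma>) + elen e) s (snd (gh \<sigma>))" "pc s = l + elen e"
    "\<forall>i<tmp. reg s i = rg \<sigma> i" "mem s = mm \<sigma>" "reg s tmp = eval e \<sigma>"
    by (rule sim_cexp[OF Asg.prems(1) _ Asg.hyps]) (use Asg.prems(2,3) in \<open>auto simp: code_at_append\<close>)
  have "reach S W p s0 (Suc (fst (gh \<sigma>) + elen e)) (exec (Copy x tmp) s) (snd (gh \<sigma>))"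
    by (rule reach_step[OF s(1)])
      (use s(2) Asg reach_bounds[OF s(1)] in \<open>auto simp: code_at_append code_at_Cons accessed_def set_reg_def\<close>)
  then show ?case unfolding sim_def using s Asg.prems(3)
    by (intro exI[of _ "exec (Copy x tmp) s"]) (auto simp: tick_def set_reg_def)
next
  case (Sto a \<sigma> e)
  obtain s where s: "reach S W p s0 (fst (gh \<sigma>) + elen a) s (snd (gh \<sigma>))" "pc s = l + elen a"
    "\<forall>i<tmp. reg s i = rg \<sigma> i" "mem s = mm \<sigma>" "reg s tmp = eval a \<sigma>"
    by (rule sim_cexp[OF Sto.prems(1) _ Sto.hyps(1)]) (use Sto.prems(2,3) in \<open>auto simp: code_at_append\<close>)
  let ?L = "length (cexp e (Suc tmp))"
  obtain g where g: "reach S W p s0 (fst (gh \<sigma>) + elen a + ?L) (s\<lparr>pc := pc s + ?L, reg := g\<rparr>) (snd (gh \<sigma>))"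
     "g (Suc tmp) = eval e \<sigma>" "\<forall>i<Suc tmp. g i = reg s i"
    using reach_cexp[OF s(1), of e "Suc tmp" \<sigma>] s Sto by (auto simp: code_at_append code_at_Cons code_at_Nil)
  have "reach S W p s0 (Suc (fst (gh \<sigma>) + elen a + ?L)) (exec (Store tmp (Suc tmp)) (s\<lparr>pc := pc s + ?L, reg := g\<rparr>)) (snd (gh \<sigma>))"
    by (rule reach_step[OF g(1)])
      (use s g Sto reach_bounds[OF g(1)] reach_bounds(1)[OF g(1), of "Suc tmp"] in \<open>auto simp: code_at_append code_at_Cons accessed_def add.assoc\<close>)
  then show ?case unfolding sim_def using s g Sto.prems(3)
    by (intro exI[of _ "exec (Store tmp (Suc tmp)) (s\<lparr>pc := pc s + ?L, reg := g\<rparr>)"])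
      (auto simp: tick_def add.assoc)
next
  case (Seq c s s' d s'')
  have "sim S W p s0 (l + clen c) s'" using Seq by (auto simp: code_at_append code_at_Cons code_at_Nil)
  then have "sim S W p s0 (l + clen c + clen d) s''" using Seq by (auto simp: code_at_append code_at_Cons code_at_Nil)
  then show ?case by (simp add: add.assoc)
next
  case (IfT e s c s' s'' d)
  have "sim S W p s0 (l + elen e + 1) (tick (elen e + 1) s)"
    using sim_test[OF IfT.prems(1), of e "l + elen e + clen c + 2"] IfT by (auto simp: code_at_append code_at_Cons code_at_Nil)
  then have 1: "sim S W p s0 (l + elen e + 1 + clen c) s'"
    using IfT.IH[of "l + elen e + 1"] IfT.prems by (auto simp: code_at_append code_at_Cons)
  show ?case unfolding \<open>s'' = tick 1 s'\<close>
    using sim_jump[OF 1, of "l + elen e + clen c + clen d + 2"] IfT.prems(2)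
    by (auto simp: code_at_append code_at_Cons code_at_Nil add.assoc add.commute add.left_commute)
next
  case (IfF e s d s' c)
  have "sim S W p s0 (l + elen e + clen c + 2) (tick (elen e + 1) s)"
    using sim_test[OF IfF.prems(1), of e "l + elen e + clen c + 2"] IfF by (auto simp: code_at_append code_at_Cons code_at_Nil)
  then have "sim S W p s0 (l + elen e + clen c + 2 + clen d) s'"
    using IfF.IH[of "l + elen e + clen c + 2"] IfF.prems by (auto simp: code_at_append code_at_Cons)
  then show ?case by (simp add: add.assoc add.commute add.left_commute)
next
  case (WhileF e s c)
  then show ?case using sim_test[OF WhileF.prems(1), of e "l + elen e + clen c + 2"]
    by (auto simp: code_at_append code_at_Cons code_at_Nil add.assoc)
next
  case (WhileT e s c s' s'')
  have "sim S W p s0 (l + elen e + 1) (tick (elen e + 1) s)"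
    using sim_test[OF WhileT.prems(1), of e "l + elen e + clen c + 2"] WhileT by (auto simp: code_at_append code_at_Cons code_at_Nil)
  then have 1: "sim S W p s0 (l + elen e + 1 + clen c) s'"
    using WhileT.IH(1)[of "l + elen e + 1"] WhileT.prems by (auto simp: code_at_append code_at_Cons)
  have "sim S W p s0 l (tick 1 s')"
    by (rule sim_jump[OF 1]) (use WhileT.prems(2) in \<open>auto simp: code_at_append code_at_Cons code_at_Nil add.assoc add.commute add.left_commute\<close>)
  then show ?case using WhileT.IH(2)[of l] WhileT.prems by auto
next
  case (Out e \<sigma> A)
  obtain s where s: "reach S W p s0 (fst (gh \<sigma>) + elen e) s (snd (gh \<sigma>))" "pc s = l + elen e"
    "\<forall>i<tmp. reg s i = rg \<sigma> i" "mem s = mm \<sigma>" "reg s tmp = eval e \<sigma>"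
    by (rule sim_cexp[OF Out.prems(1) _ Out.hyps(1)]) (use Out.prems(2,3) in \<open>auto simp: code_at_append\<close>)
  have "reach S W p s0 (Suc (fst (gh \<sigma>) + elen e)) (s\<lparr>pc := Suc (pc s)\<rparr>) (snd (gh \<sigma>) @ [(fst (gh \<sigma>) + elen e, A)])"
    by (rule reach_output[OF s(1)]) (use s Out in \<open>auto simp: code_at_append code_at_Cons\<close>)
  then show ?case unfolding sim_def using s by (intro exI[of _ "s\<lparr>pc := Suc (pc s)\<rparr>"]) auto
qed

lemma big_clock_mono: "big S W c s s' \<Longrightarrow> fst (gh s) \<le> fst (gh s')"
  by (induction rule: big.induct) (auto simp: tick_def)

text \<open>Without backward jumps no instruction is executed twice, so the length of the code
  bounds its time. This is the source of the constants for all queue operations.\<close>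

fun loopfree :: "com \<Rightarrow> bool" where
  "loopfree (While e c) = False"
| "loopfree (Seq c d) = (loopfree c \<and> loopfree d)"
| "loopfree (If e c d) = (loopfree c \<and> loopfree d)"
| "loopfree c = True"

lemma big_loopfree_clock:
  "big S W c s s' \<Longrightarrow> loopfree c \<Longrightarrow> fst (gh s') \<le> fst (gh s) + clen c"
  by (induction rule: big.induct) (auto simp: tick_def)

section \<open>Decoupling computation from output by a bounded queue\<close>

datatype ev = Tick | Emit | Pop | Push nat

text \<open>The shift by two leaves 0 and 1 to the events without argument. Ticks never enter the
  queue, so \<open>Tick\<close> may share the word of \<open>Pop\<close>.\<close>

fun code :: "ev \<Rightarrow> nat" where
  "code (Push v) = v + 2"
| "code Emit = 1"
| "code _ = 0"

definition decode :: "nat \<Rightarrow> ev" where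
  "decode k = (if k = 0 then Pop else if k = 1 then Emit else Push (k - 2))"

lemma code_decode [simp]: "code (decode k) = k"
  by (auto simp: decode_def)

lemma decode_not_Tick [simp]: "decode k \<noteq> Tick"
  by (simp add: decode_def)

abbreviation logev :: "ev \<Rightarrow> ev list st \<Rightarrow> ev list st" where
  "logev x s \<equiv> s\<lparr>gh := gh s @ [x]\<rparr>"

text \<open>Time is visible only as one \<open>Tick\<close> per loop iteration. The code between two
  ticks is bounded by the program text, so that machine time is recovered up to a constant
  factor.\<close>

inductive lbig :: "nat \<Rightarrow> nat \<Rightarrow> com \<Rightarrow> ev list st \<Rightarrow> ev list st \<Rightarrow> bool" for S W where
  Skip: "lbig S W Skip s s"
| Asg: "ok S W e s \<Longrightarrow> lbig S W (Asg x e) s (upd_rg x (eval e s) s)"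
| Sto: "ok S W a s \<Longrightarrow> ok S W e s \<Longrightarrow> eval a s < S \<Longrightarrow> lbig S W (Sto a e) s (upd_mm (eval a s) (eval e s) s)"
| Seq: "lbig S W c s s' \<Longrightarrow> lbig S W d s' s'' \<Longrightarrow> lbig S W (Seq c d) s s''"
| IfT: "ok S W e s \<Longrightarrow> eval e s \<noteq> 0 \<Longrightarrow> lbig S W c s s' \<Longrightarrow> lbig S W (If e c d) s s'"
| IfF: "ok S W e s \<Longrightarrow> eval e s = 0 \<Longrightarrow> lbig S W d s s' \<Longrightarrow> lbig S W (If e c d) s s'"
| WhileF: "ok S W e s \<Longrightarrow> eval e s = 0 \<Longrightarrow> lbig S W (While e c) s s"
| WhileT: "ok S W e s \<Longrightarrow> eval e s \<noteq> 0 \<Longrightarrow> lbig S W c (logev Tick s) s' \<Longrightarrow> lbig S W (While e c) s' s'' \<Longrightarrow>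
    lbig S W (While e c) s s''"
| Enq: "ok S W e s \<Longrightarrow> lbig S W (Enq e) s (logev (decode (eval e s)) s)"

definition ticks :: "ev list \<Rightarrow> nat" where "ticks t = length (filter ((=) Tick) t)"
definition emits :: "ev list \<Rightarrow> nat" where "emits t = length (filter ((=) Emit) t)"
definition ops :: "ev list \<Rightarrow> ev list" where "ops t = filter ((\<noteq>) Tick) t"

lemma ticks_simps [simp]: "ticks [] = 0" "ticks (x # t) = (if x = Tick then Suc (ticks t) else ticks t)"
    "ticks (t @ u) = ticks t + ticks u"
  and emits_simps [simp]: "emits [] = 0" "emits (x # t) = (if x = Emit then Suc (emits t) else emits t)"
    "emits (t @ u) = emits t + emits u"
  and ops_simps [simp]: "ops [] = []" "ops (x # t) = (if x = Tick then ops t else x # ops t)"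
    "ops (t @ u) = ops t @ ops u"
  by (auto simp: ticks_def emits_def ops_def)

fun stk :: "nat list \<Rightarrow> ev list \<Rightarrow> nat list" where
  "stk st [] = st"
| "stk st (Push v # t) = stk (st @ [v]) t"
| "stk st (Pop # t) = stk (butlast st) t"
| "stk st (x # t) = stk st t"

fun vis :: "nat list \<Rightarrow> ev list \<Rightarrow> nat set list" where
  "vis st [] = []"
| "vis st (Push v # t) = vis (st @ [v]) t"
| "vis st (Pop # t) = vis (butlast st) t"
| "vis st (Emit # t) = set st # vis st t"
| "vis st (Tick # t) = vis st t"

fun okst :: "nat \<Rightarrow> nat list \<Rightarrow> ev list \<Rightarrow> bool" where
  "okst n st [] = True"
| "okst n st (Push v # t) = (v < n \<and> v \<notin> set st \<and> okst n (st @ [v]) t)"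
| "okst n st (Pop # t) = (st \<noteq> [] \<and> okst n (butlast st) t)"
| "okst n st (x # t) = okst n st t"

text \<open>\<open>gp k t\<close> runs an automaton that counts the pushes and pops since the last \<open>Emit\<close> and fails
  on the fourth.\<close>

fun gp :: "nat \<Rightarrow> ev list \<Rightarrow> nat option" where
  "gp k [] = Some k"
| "gp k (Tick # t) = gp k t"
| "gp k (Emit # t) = gp 0 t"
| "gp k (_ # t) = (if k < 3 then gp (Suc k) t else None)"

lemma stk_append [simp]: "stk st (t @ u) = stk (stk st t) u"
  by (induction st t rule: stk.induct) auto

lemma vis_append [simp]: "vis st (t @ u) = vis st t @ vis (stk st t) u"
  by (induction st t rule: vis.induct) auto

lemma okst_append [simp]: "okst n st (t @ u) \<longleftrightarrow> okst n st t \<and> okst n (stk st t) u"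
  by (induction n st t rule: okst.induct) auto

lemma gp_append: "gp k (t @ u) = (case gp k t of None \<Rightarrow> None | Some j \<Rightarrow> gp j u)"
  by (induction k t rule: gp.induct) auto

lemma stk_ops [simp]: "stk st (ops t) = stk st t"
  by (induction st t rule: stk.induct) auto
lemma vis_ops [simp]: "vis st (ops t) = vis st t"
  by (induction st t rule: vis.induct) auto
lemma okst_ops [simp]: "okst n st (ops t) = okst n st t"
  by (induction n st t rule: okst.induct) auto
lemma gp_ops [simp]: "gp k (ops t) = gp k t"
  by (induction k t rule: gp.induct) auto
lemma emits_ops [simp]: "emits (ops t) = emits t"
  by (induction t) auto

lemma length_vis: "length (vis st t) = emits t"
  by (induction st t rule: vis.induct) auto

lemma okst_stk:
  "okst n st t \<Longrightarrow> distinct st \<Longrightarrow> set st \<subseteq> {..<n} \<Longrightarrow> distinct (stk st t) \<and> set (stk st t) \<subseteq> {..<n}"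
  by (induction n st t rule: okst.induct) (auto dest: in_set_butlastD simp: distinct_butlast)

lemma length_le_if_distinct: "distinct st \<Longrightarrow> set st \<subseteq> {..<n} \<Longrightarrow> length st \<le> n"
  by (metis card_lessThan card_mono distinct_card finite_lessThan)

text \<open>At most three operations precede each \<open>Emit\<close> and at most three trail. A
  bound on the pending visits thus becomes a bound on the queue length, for which
  \<open>4 * cap + 8\<close> cells suffice.\<close>

lemma gp_length: "Tick \<notin> set t \<Longrightarrow> k \<le> 3 \<Longrightarrow> gp k t \<noteq> None \<Longrightarrow> length t + k \<le> 4 * emits t + 3"
  by (induction k t rule: gp.induct) (auto split: if_splits)

text \<open>The reason why \<open>EMIT 4\<close> always reaches a visit.\<close>

lemma gp_first_Emit:
  assumes "gp k t \<noteq> None" "emits t \<noteq> 0" "Tick \<notin> set t" "k \<le> 3"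
  shows "\<exists>u v. t = u @ Emit # v \<and> Emit \<notin> set u \<and> length u + k \<le> 3"
  using assms
proof (induction k t rule: gp.induct)
  case (3 k t)
  then show ?case by (intro exI[of _ "[]"] exI[of _ t]) auto
next
  case ("4_1" k t)
  then obtain u v where "t = u @ Emit # v" "Emit \<notin> set u" "length u + Suc k \<le> 3"
    by (auto split: if_splits)
  then show ?case by (intro exI[of _ "Pop # u"] exI[of _ v]) auto
next
  case ("4_2" k w t)
  then obtain u v where "t = u @ Emit # v" "Emit \<notin> set u" "length u + Suc k \<le> 3"
    by (auto split: if_splits)
  then show ?case by (intro exI[of _ "Push w # u"] exI[of _ v]) auto
qed auto

text \<open>Registers of the queue: 40 and 41 delimit its memory, 42 and 43 point to its head and tail,
  44 counts the pending \<open>Emit\<close>s, 45 bounds their number, 46 tells whether output has started,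
  47 counts ticks since the last output, 48 is the address of the output set.\<close>

definition POP :: com where
  "POP = Asg 49 (Ld (V 42)) ;; Asg 42 (Plus (V 42) (N 1)) ;;
     If (Minus (V 41) (V 42)) Skip (Asg 42 (V 40))"

definition PUSHV :: com where
  "PUSHV = Sto (V 48) (Plus (Ld (V 48)) (N 1)) ;; Sto (Plus (V 48) (Ld (V 48))) (Minus (V 49) (N 2))"

definition POPV :: com where
  "POPV = Sto (V 48) (Minus (Ld (V 48)) (N 1))"

definition EMITV :: com where
  "EMITV = Out (V 48) ;; Asg 44 (Minus (V 44) (N 1))"

text \<open>Unrolled rather than a loop, so that its length bounds its time. The outer test singles
  out \<open>Pop\<close>, the word 0, and the inner one \<open>Emit\<close>, the word 1.\<close>

primrec EMIT :: "nat \<Rightarrow> com" where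
  "EMIT 0 = Skip"
| "EMIT (Suc k) = POP ;; If (V 49) (If (Minus (V 49) (N 1)) (PUSHV ;; EMIT k) EMITV) (POPV ;; EMIT k)"

text \<open>Ticks granted per visit. It has to exceed the amortized cost of a visit, at most 5 *
  1347 ticks, by a surplus that also covers the opening of a call and of its first kids.\<close>

definition cc :: nat where "cc = 100000"

definition TICK :: com where
  "TICK = If (V 46) (Asg 47 (Plus (V 47) (N 1)) ;;
     If (Minus (N cc) (V 47)) Skip (Asg 47 (N 0) ;; EMIT 4)) Skip"

definition PUT :: "exp \<Rightarrow> com" where
  "PUT e = Sto (V 43) e ;; Asg 49 (Ld (V 43)) ;; Asg 43 (Plus (V 43) (N 1)) ;;
     If (Minus (V 41) (V 43)) Skip (Asg 43 (V 40))"

text \<open>An \<open>Emit\<close> that exceeds the capacity forces a visit out at once. This starts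
  the output phase, and later on it keeps the number of pending visits at \<open>cap\<close> or
  below. Register 49 holds the word just stored.\<close>

definition ENQ :: "exp \<Rightarrow> com" where
  "ENQ e = PUT e ;; If (Minus (V 49) (N 1)) Skip (If (V 49) (Asg 44 (Plus (V 44) (N 1)) ;;
       If (Minus (V 44) (V 45)) (Asg 46 (N 1) ;; Asg 47 (N 0) ;; EMIT 4) Skip) Skip)"

primrec lower :: "com \<Rightarrow> com" where
  "lower Skip = Skip"
| "lower (Asg x e) = Asg x e"
| "lower (Sto a e) = Sto a e"
| "lower (Seq c d) = Seq (lower c) (lower d)"
| "lower (If e c d) = If e (lower c) (lower d)"
| "lower (While e c) = While e (TICK ;; lower c)"
| "lower (Out e) = Skip"
| "lower (Enq e) = ENQ e"

lemma loopfree_EMIT [simp]: "loopfree (EMIT k)"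
  by (induction k) (auto simp: POP_def PUSHV_def POPV_def EMITV_def)

lemma loopfree_TICK [simp]: "loopfree TICK" and loopfree_ENQ [simp]: "loopfree (ENQ e)"
  by (auto simp: TICK_def ENQ_def PUT_def)

section \<open>Weakest preconditions for the semantics with machine time\<close>

definition wp :: "nat \<Rightarrow> nat \<Rightarrow> com \<Rightarrow> (clock st \<Rightarrow> bool) \<Rightarrow> clock st \<Rightarrow> bool" where
  "wp S W c Q s \<longleftrightarrow> (\<exists>s'. big S W c s s' \<and> Q s')"

inductive_cases big_cases:
  "big S W Skip s s'" "big S W (Asg x e) s s'" "big S W (Sto a e) s s'" "big S W (Seq c d) s s'"
  "big S W (If e c d) s s'" "big S W (Out e) s s'"

lemma wp_simps:
  "wp S W Skip Q s = Q s"
  "wp S W (Asg x e) Q s = (ok S W e s \<and> Q (tick (elen e + 1) (upd_rg x (eval e s) s)))"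
  "wp S W (Sto a e) Q s = (ok S W a s \<and> ok S W e s \<and> eval a s < S \<and>
     Q (tick (clen (Sto a e)) (upd_mm (eval a s) (eval e s) s)))"
  "wp S W (Seq c d) Q s = wp S W c (wp S W d Q) s"
  "wp S W (If e c d) Q s = (ok S W e s \<and> (if eval e s \<noteq> 0 then
      wp S W c (\<lambda>s'. Q (tick 1 s')) (tick (elen e + 1) s) else wp S W d Q (tick (elen e + 1) s)))"
proof -
  show "wp S W (If e c d) Q s = (ok S W e s \<and> (if eval e s \<noteq> 0 then
      wp S W c (\<lambda>s'. Q (tick 1 s')) (tick (elen e + 1) s) else wp S W d Q (tick (elen e + 1) s)))"
  proof
    assume "wp S W (If e c d) Q s"
    then obtain s' where "big S W (If e c d) s s'" "Q s'" unfolding wp_def by blast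
    then show "ok S W e s \<and> (if eval e s \<noteq> 0 then
      wp S W c (\<lambda>s'. Q (tick 1 s')) (tick (elen e + 1) s) else wp S W d Q (tick (elen e + 1) s))"
      unfolding wp_def by (cases rule: big_cases(5)) auto
  next
    assume "ok S W e s \<and> (if eval e s \<noteq> 0 then
      wp S W c (\<lambda>s'. Q (tick 1 s')) (tick (elen e + 1) s) else wp S W d Q (tick (elen e + 1) s))"
    then show "wp S W (If e c d) Q s"
      unfolding wp_def by (metis big.IfF big.IfT)
  qed
qed (unfold wp_def, auto elim!: big_cases intro: big.intros)

lemma wp_Out: "ok S W e s \<Longrightarrow> represents (mm s) (eval e s) A \<Longrightarrow> eval e s + mm s (eval e s) < S \<Longrightarrow>
    Q (s\<lparr>gh := (fst (gh s) + elen e + 1, snd (gh s) @ [(fst (gh s) + elen e, A)])\<rparr>) \<Longrightarrow> wp S W (Out e) Q s"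
  unfolding wp_def by (blast intro: big.intros)

lemma wp_mono: "wp S W c P s \<Longrightarrow> (\<And>s'. P s' \<Longrightarrow> Q s') \<Longrightarrow> wp S W c Q s"
  unfolding wp_def by blast

lemma wp_clock:
  assumes "wp S W c Q s" "loopfree c"
  shows "wp S W c (\<lambda>s'. Q s' \<and> fst (gh s) \<le> fst (gh s') \<and> fst (gh s') \<le> fst (gh s) + clen c) s"
  using assms big_loopfree_clock big_clock_mono unfolding wp_def by meson

lemma tick_simps [simp]: "rg (tick k s) = rg s" "mm (tick k s) = mm s" "snd (gh (tick k s)) = snd (gh s)"
  "fst (gh (tick k s)) = fst (gh s) + k"
  by (auto simp: tick_def)

lemma eval_tick [simp]: "eval e (tick k s) = eval e s" "ok S W e (tick k s) = ok S W e s"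
  by (induction e) auto

section \<open>The circular queue and its timing invariant\<close>

text \<open>\<open>X\<close> bounds the memory of the simulated program, the queue starts at
  \<open>qb\<close>, \<open>c0\<close> is the time spent before the simulation, and
  \<open>Bd\<close> bounds the instructions per tick. The amortization hypothesis covers all factors
  of the trace, because the critical stretch begins wherever the queue last overflowed;
  \<open>t0 \<le> cc * cap\<close> makes a full queue last through any such stretch.\<close>

locale layer =
  fixes n X S W qb cap t0 c0 Bd :: nat and F :: "ev list"
  assumes X: "X \<le> qb" and S: "qb + (4 * cap + 8) + n + 1 < S" and SW: "S \<le> W" "cc \<le> W"
    and t0: "t0 \<le> cc * cap"
    and okF: "okst n [] F" and gpF: "gp 0 F \<noteq> None"
    and amortized: "F = xs @ ys @ zs \<Longrightarrow> ticks ys \<le> t0 + cc * emits ys"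
begin

definition qe where "qe = qb + (4 * cap + 8)"

definition qpos :: "nat \<Rightarrow> nat \<Rightarrow> nat" where
  "qpos h i = (if h + i < qe then h + i else h + i - (4 * cap + 8))"

text \<open>The strict bound on the length keeps the tail cell outside the stored part, so that a
  store at the tail overwrites nothing.\<close>

definition qrep :: "ev list \<Rightarrow> clock st \<Rightarrow> bool" where
  "qrep qu s \<longleftrightarrow> rg s 40 = qb \<and> rg s 41 = qe \<and> qb \<le> rg s 42 \<and> rg s 42 < qe \<and> length qu < 4 * cap + 8
     \<and> (\<forall>i<length qu. mm s (qpos (rg s 42) i) = code (qu ! i)) \<and> rg s 43 = qpos (rg s 42) (length qu)"

definition srep :: "nat list \<Rightarrow> clock st \<Rightarrow> bool" where
  "srep st s \<longleftrightarrow> rg s 48 = qe \<and> mm s qe = length st \<and> (\<forall>i<length st. mm s (qe + 1 + i) = st ! i)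
     \<and> distinct st \<and> length st \<le> n"

lemma qpos_bounds: "qb \<le> h \<Longrightarrow> h < qe \<Longrightarrow> i < 4 * cap + 8 \<Longrightarrow> qb \<le> qpos h i \<and> qpos h i < qe"
  by (auto simp: qpos_def qe_def)

lemma qpos_inj: "qb \<le> h \<Longrightarrow> h < qe \<Longrightarrow> i < 4 * cap + 8 \<Longrightarrow> j < 4 * cap + 8 \<Longrightarrow> qpos h i = qpos h j \<Longrightarrow> i = j"
  by (auto simp: qpos_def qe_def split: if_splits)

lemma wp_POP:
  assumes "qrep (x # qu) s"
  shows "wp S W POP (\<lambda>s'. qrep qu s' \<and> rg s' 49 = code x \<and> (\<forall>i. i \<noteq> 42 \<and> i \<noteq> 49 \<longrightarrow> rg s' i = rg s i)
     \<and> mm s' = mm s \<and> snd (gh s') = snd (gh s)) s"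
proof -
  define h where "h = rg s 42"
  have h: "qb \<le> h" "h < qe" "rg s 40 = qb" "rg s 41 = qe" "length qu + 1 < 4 * cap + 8"
    "\<And>i. i < length (x # qu) \<Longrightarrow> mm s (qpos h i) = code ((x # qu) ! i)" "rg s 43 = qpos h (length qu + 1)"
    using assms by (auto simp: qrep_def h_def)
  define h' where "h' = (if h + 1 = qe then qb else h + 1)"
  have h': "qb \<le> h'" "h' < qe" using h by (auto simp: h'_def qe_def)
  have eq: "qpos h' i = qpos h (Suc i)" if "i < 4 * cap + 8" for i
    using h that by (auto simp: qpos_def h'_def qe_def)
  have 1: "mm s h = code x" using h(6)[of 0] h by (auto simp: qpos_def)
  have 2: "mm s (qpos h' i) = code (qu ! i)" if "i < length qu" for i
    using h(5) h(6)[of "Suc i"] that by (simp add: eq)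
  have hS: "h < S" "h + 1 \<le> W" using h(2) S SW by (auto simp: qe_def)
  show ?thesis unfolding POP_def
    using hS h h' 1 2 eq SW S
    by (simp add: wp_simps h_def[symmetric] qrep_def) (auto simp: h'_def qe_def)
qed

lemma wp_PUSHV:
  assumes "srep st s" "rg s 49 = code (Push v)" "length st < n" "v \<notin> set st"
  shows "wp S W PUSHV (\<lambda>s'. srep (st @ [v]) s' \<and> rg s' = rg s \<and> (\<forall>a<qe. mm s' a = mm s a)
     \<and> snd (gh s') = snd (gh s)) s"
proof -
  have "qe + n + 1 < S" using S by (simp add: qe_def)
  then show ?thesis unfolding PUSHV_def using assms SW
    by (auto simp: wp_simps srep_def nth_append less_Suc_eq)
qed

lemma wp_POPV:
  assumes "srep st s" "st \<noteq> []"
  shows "wp S W POPV (\<lambda>s'. srep (butlast st) s' \<and> rg s' = rg s \<and> (\<forall>a<qe. mm s' a = mm s a)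
     \<and> snd (gh s') = snd (gh s)) s"
proof -
  have "qe + n + 1 < S" using S by (simp add: qe_def)
  then show ?thesis unfolding POPV_def using assms SW
    by (auto simp: wp_simps srep_def nth_butlast distinct_butlast)
qed

lemma wp_EMITV:
  assumes "srep st s"
  shows "wp S W EMITV (\<lambda>s'. srep st s' \<and> rg s' = (rg s)(44 := rg s 44 - 1) \<and> mm s' = mm s
     \<and> snd (gh s') = snd (gh s) @ [(fst (gh s) + 1, set st)] \<and> fst (gh s) + 1 \<le> fst (gh s')) s"
proof -
  have 1: "qe + n + 1 < S" using S by (simp add: qe_def)
  have m: "mm s qe = length st" "length st \<le> n" "rg s 48 = qe" using assms by (auto simp: srep_def)
  have "map (mm s) [Suc qe..<Suc qe + mm s qe] = st" unfolding m(1)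
    by (rule nth_equalityI) (use assms in \<open>auto simp: srep_def simp del: upt_Suc\<close>)
  then have "represents (mm s) qe (set st)"
    unfolding represents_def using assms by (simp only: srep_def simp_thms)
  then have "represents (mm s) (eval (V 48) s) (set st)" using m by simp
  then show ?thesis unfolding EMITV_def wp_simps
    by (rule wp_Out[rotated]) (use 1 m SW assms in \<open>auto simp: wp_simps srep_def\<close>)
qed

definition emitted :: "ev list \<Rightarrow> nat list \<Rightarrow> clock st \<Rightarrow> clock st \<Rightarrow> bool" where
  "emitted qu st s s' \<longleftrightarrow> qrep qu s' \<and> srep st s' \<and> (\<forall>i. i \<notin> {42, 44, 49} \<longrightarrow> rg s' i = rg s i)
     \<and> rg s' 44 = rg s 44 - 1 \<and> (\<forall>a<qb. mm s' a = mm s a)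
     \<and> (\<exists>t. snd (gh s') = snd (gh s) @ [(t, set st)] \<and> fst (gh s) \<le> t \<and> t \<le> fst (gh s'))"

lemma emitted_tick: "emitted qu st s s' \<Longrightarrow> emitted qu st s (tick k s')"
  unfolding emitted_def qrep_def srep_def by (auto intro: trans_le_add1)

lemma emitted_mono:
  assumes "emitted qu st s1 s'" "\<forall>i. i \<noteq> 42 \<and> i \<noteq> 49 \<longrightarrow> rg s1 i = rg s i" "\<forall>a<qe. mm s1 a = mm s a"
     "snd (gh s1) = snd (gh s)" "fst (gh s) \<le> fst (gh s1)"
  shows "emitted qu st s s'"
proof -
  have "qb < qe" by (simp add: qe_def)
  then show ?thesis using assms unfolding emitted_def by (auto intro: order_trans)
qed

lemma qrep_cong: "qrep q s \<Longrightarrow> (\<And>i. 40 \<le> i \<Longrightarrow> i \<le> 43 \<Longrightarrow> rg s' i = rg s i) \<Longrightarrow> \<forall>a<qe. mm s' a = mm s a \<Longrightarrow> qrep q s'"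
  using qpos_bounds by (auto simp: qrep_def)

text \<open>The operations before the first \<open>Emit\<close> are replayed one by one on the
  output set, one level of the unrolling for each; \<open>okst\<close> makes each of them legal
  there.\<close>

lemma wp_EMIT:
  assumes "qrep (u @ Emit # v) s" "Emit \<notin> set u" "Tick \<notin> set u" "length u < k" "srep st s"
    "okst n st u" "set st \<subseteq> {..<n}"
  shows "wp S W (EMIT k) (emitted v (stk st u) s) s"
  using assms
proof (induction k arbitrary: u s st)
  case (Suc k)
  have pop: "wp S W POP (\<lambda>s'. (qrep qu s' \<and> rg s' 49 = code x \<and> (\<forall>i. i \<noteq> 42 \<and> i \<noteq> 49 \<longrightarrow> rg s' i = rg s i)
     \<and> mm s' = mm s \<and> snd (gh s') = snd (gh s)) \<and> fst (gh s) \<le> fst (gh s') \<and> fst (gh s') \<le> fst (gh s) + clen POP) s"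
    if "qrep (x # qu) s" for x qu
    by (rule wp_clock[OF wp_POP[OF that]]) (simp add: POP_def)
  let ?s = "\<lambda>s1. tick (elen (Minus (V 49) (N 1)) + 1) (tick (elen (V 49) + 1) s1)"
  show ?case
  proof (cases u)
    case Nil
    have q: "qrep (Emit # v) s" using Suc.prems Nil by simp
    show ?thesis unfolding EMIT.simps wp_simps(4)
    proof (rule wp_mono[OF pop[OF q]], elim conjE)
      fix s1 assume a: "qrep v s1" "rg s1 49 = code Emit" "\<forall>i. i \<noteq> 42 \<and> i \<noteq> 49 \<longrightarrow> rg s1 i = rg s i"
         "mm s1 = mm s" "snd (gh s1) = snd (gh s)" "fst (gh s) \<le> fst (gh s1)"
      have "srep st (?s s1)" using Suc.prems(5) a by (auto simp: srep_def)
      from wp_EMITV[OF this]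
      have "wp S W EMITV (\<lambda>s'. emitted v (stk st u) s (tick 1 s')) (?s s1)"
      proof (rule wp_mono, intro emitted_tick)
        fix s' assume b: "srep st s' \<and> rg s' = (rg (?s s1))(44 := rg (?s s1) 44 - 1) \<and> mm s' = mm (?s s1) \<and>
          snd (gh s') = snd (gh (?s s1)) @ [(fst (gh (?s s1)) + 1, set st)] \<and> fst (gh (?s s1)) + 1 \<le> fst (gh s')"
        have "qrep v s'" by (rule qrep_cong[OF a(1)]) (use b in auto)
        then show "emitted v (stk st u) s s'" using b a Nil by (auto simp: emitted_def)
      qed
      then show "wp S W (If (V 49) (If (Minus (V 49) (N 1)) (PUSHV ;; EMIT k) EMITV) (POPV ;; EMIT k))
          (emitted v (stk st u) s) s1"
        using a SW by (simp add: wp_simps) (auto simp: cc_def)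
    qed
  next
    case (Cons x u')
    have q: "qrep (x # u' @ Emit # v) s" using Suc.prems Cons by simp
    show ?thesis unfolding EMIT.simps wp_simps(4)
    proof (rule wp_mono[OF pop[OF q]], elim conjE)
      fix s1 assume a: "qrep (u' @ Emit # v) s1" "rg s1 49 = code x" "\<forall>i. i \<noteq> 42 \<and> i \<noteq> 49 \<longrightarrow> rg s1 i = rg s i"
         "mm s1 = mm s" "snd (gh s1) = snd (gh s)" "fst (gh s) \<le> fst (gh s1)"
      have rec: "wp S W (EMIT k) (emitted v (stk st u) s) s2"
        if "srep (stk st [x]) s2" "rg s2 = rg s1" "\<forall>a<qe. mm s2 a = mm s1 a" "snd (gh s2) = snd (gh s1)"
           "fst (gh s1) \<le> fst (gh s2)" for s2
      proof -
        have q: "qrep (u' @ Emit # v) s2" by (rule qrep_cong[OF a(1)]) (use that in auto)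
        have ok: "okst n (stk st [x]) u'" "set (stk st [x]) \<subseteq> {..<n}"
          using Suc.prems(6,7) Cons okst_append[of n st "[x]" u'] by (cases x; auto dest: in_set_butlastD)+
        have "wp S W (EMIT k) (emitted v (stk (stk st [x]) u') s2) s2"
          by (rule Suc.IH[OF q _ _ _ that(1) ok]) (use Suc.prems Cons in auto)
        then have "wp S W (EMIT k) (emitted v (stk st u) s2) s2"
          using stk_append[of st "[x]" u'] Cons by simp
        then show ?thesis
          by (rule wp_mono) (erule emitted_mono, use that a in auto)
      qed
      have len: "length st \<le> n" using Suc.prems(5) by (simp add: srep_def)
      show "wp S W (If (V 49) (If (Minus (V 49) (N 1)) (PUSHV ;; EMIT k) EMITV) (POPV ;; EMIT k))
          (emitted v (stk st u) s) s1"
      proof (cases x)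
        case (Push w)
        then have w: "w < n" "w \<notin> set st" using Suc.prems(6) Cons by auto
        have "length (st @ [w]) \<le> n"
          by (rule length_le_if_distinct) (use w Suc.prems(5,7) in \<open>auto simp: srep_def\<close>)
        then have "length st < n" by simp
        have "srep st (?s s1)" using Suc.prems(5) a by (auto simp: srep_def)
        from wp_clock[OF wp_PUSHV[OF this _ \<open>length st < n\<close> w(2)]]
        have "wp S W PUSHV (wp S W (EMIT k) (\<lambda>s'. emitted v (stk st u) s (tick 1 (tick 1 s')))) (?s s1)"
          by (rule wp_mono) (auto simp: PUSHV_def a(2) Push intro!: wp_mono[OF rec] emitted_tick)
        then show ?thesis using a Push SW by (simp add: wp_simps) (auto simp: cc_def)
      next
        case Pop
        then have ne: "st \<noteq> []" using Suc.prems(6) Cons by auto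
        let ?s' = "tick (elen (V 49) + 1) s1"
        have "srep st ?s'" using Suc.prems(5) a by (auto simp: srep_def)
        from wp_clock[OF wp_POPV[OF this ne]]
        have "wp S W POPV (wp S W (EMIT k) (emitted v (stk st u) s)) ?s'"
          by (rule wp_mono) (auto simp: POPV_def a(2) Pop intro!: rec)
        then show ?thesis using a Pop SW by (simp add: wp_simps)
      qed (use Suc.prems Cons in auto)
    qed
  qed
qed simp

text \<open>Until the first output no more than \<open>cap + 1\<close> visits have been queued,
  hence at most \<open>t0 + cc * (cap + 1)\<close> ticks have passed. Later outputs are at most
  \<open>cc\<close> ticks apart. The further \<open>Bd\<close> in both bounds is for the code since
  the latest tick.\<close>

definition gaps_ok :: "nat list \<Rightarrow> bool" where
  "gaps_ok ts \<longleftrightarrow> (ts \<noteq> [] \<longrightarrow> ts ! 0 \<le> c0 + Bd * (t0 + cc * (cap + 1)) + Bd)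
     \<and> (\<forall>i. Suc i < length ts \<longrightarrow> ts ! Suc i \<le> ts ! i + Bd * (cc + 1))"

lemma gaps_ok_Nil [simp]: "gaps_ok []" by (simp add: gaps_ok_def)

lemma gaps_ok_single: "gaps_ok [t] \<longleftrightarrow> t \<le> c0 + Bd * (t0 + cc * (cap + 1)) + Bd"
  by (simp add: gaps_ok_def)

lemma gaps_ok_snoc: "gaps_ok ts \<Longrightarrow> ts \<noteq> [] \<Longrightarrow> t \<le> last ts + Bd * (cc + 1) \<Longrightarrow> gaps_ok (ts @ [t])"
  unfolding gaps_ok_def by (auto simp: nth_append last_conv_nth less_Suc_eq)
    (metis One_nat_def diff_Suc_1)

abbreviation times :: "clock st \<Rightarrow> nat list" where "times s \<equiv> map fst (snd (gh s))"

text \<open>The time since the last output (or since the start) is at most \<open>Bd\<close> per tick plus w.\<close>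

definition timing :: "ev list \<Rightarrow> nat \<Rightarrow> nat \<Rightarrow> clock st \<Rightarrow> bool" where
  "timing tr ne w s \<longleftrightarrow> gaps_ok (times s) \<and> (
     rg s 46 = 0 \<and> snd (gh s) = [] \<and> fst (gh s) \<le> c0 + Bd * ticks tr + w
   \<or> rg s 46 \<noteq> 0 \<and> snd (gh s) \<noteq> [] \<and> rg s 47 < cc
     \<and> (\<exists>pre suf. tr = pre @ suf \<and> cc * ne + ticks suf = cc * cap + cc * emits suf + rg s 47)
     \<and> fst (gh s) \<le> last (times s) + Bd * rg s 47 + w)"

definition linv :: "ev list \<Rightarrow> nat \<Rightarrow> clock st \<Rightarrow> bool" where
  "linv tr w s \<longleftrightarrow> (\<exists>dn qu. ops tr = dn @ qu \<and> gp 0 dn = Some 0 \<and> qrep qu s \<and> rg s 44 = emits qu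
     \<and> emits qu \<le> cap \<and> srep (stk [] dn) s \<and> map snd (snd (gh s)) = vis [] dn \<and> rg s 45 = cap
     \<and> timing tr (emits qu) w s)"

lemma linvI:
  assumes "ops tr = dn @ qu" "gp 0 dn = Some 0" "qrep qu s" "rg s 44 = emits qu" "emits qu \<le> cap"
    "srep (stk [] dn) s" "map snd (snd (gh s)) = vis [] dn" "rg s 45 = cap" "timing tr (emits qu) w s"
  shows "linv tr w s"
  using assms unfolding linv_def by blast

definition prefix_of_F :: "ev list \<Rightarrow> bool" where
  "prefix_of_F tr \<longleftrightarrow> (\<exists>zs. F = tr @ zs)"

lemma prefix_okst: "prefix_of_F tr \<Longrightarrow> okst n [] tr"
  using okF by (auto simp: prefix_of_F_def)

lemma prefix_gp: "prefix_of_F tr \<Longrightarrow> gp 0 tr \<noteq> None"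
  using gpF by (auto simp: prefix_of_F_def gp_append split: option.splits)

lemma prefix_amortized: "prefix_of_F (xs @ ys) \<Longrightarrow> ticks ys \<le> t0 + cc * emits ys"
  using amortized by (auto simp: prefix_of_F_def)

lemma ops_no_Tick: "ops tr = dn @ qu \<Longrightarrow> Tick \<notin> set dn \<and> Tick \<notin> set qu"
proof -
  assume "ops tr = dn @ qu"
  then have "set dn \<union> set qu = set (ops tr)" by simp
  then show ?thesis by (auto simp: ops_def)
qed

lemma wp_EMIT_pending:
  assumes tr: "prefix_of_F tr" "ops tr = dn @ qu" "gp 0 dn = Some 0"
    and q: "qrep qu s" "emits qu \<noteq> 0" "srep (stk [] dn) s" "map snd (snd (gh s)) = vis [] dn"
    and ne: "rg s 44 = emits qu"
  shows "wp S W (EMIT 4) (\<lambda>s'. \<exists>dn' qu' A t. ops tr = dn' @ qu' \<and> gp 0 dn' = Some 0 \<and> qrep qu' s'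
     \<and> srep (stk [] dn') s' \<and> map snd (snd (gh s')) = vis [] dn' \<and> emits qu' = emits qu - 1
     \<and> rg s' 44 = emits qu' \<and> (\<forall>i. i \<notin> {42, 44, 49} \<longrightarrow> rg s' i = rg s i) \<and> (\<forall>a<qb. mm s' a = mm s a)
     \<and> snd (gh s') = snd (gh s) @ [(t, A)] \<and> fst (gh s) \<le> t \<and> t \<le> fst (gh s')
     \<and> fst (gh s') \<le> fst (gh s) + clen (EMIT 4)) s"
proof -
  have g: "gp 0 qu \<noteq> None"
    using prefix_gp[OF tr(1)] tr(2,3) by (simp flip: gp_ops[of 0 tr] add: gp_append)
  have nt: "Tick \<notin> set dn" "Tick \<notin> set qu" using ops_no_Tick[OF tr(2)] by auto
  obtain u v where uv: "qu = u @ Emit # v" "Emit \<notin> set u" "length u \<le> 3"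
    using gp_first_Emit[OF g q(2) nt(2)] by auto
  have ok: "okst n [] dn" "okst n (stk [] dn) u"
    using prefix_okst[OF tr(1)] tr(2) uv(1) by (simp_all flip: okst_ops[of n _ tr])
  have st: "set (stk [] dn) \<subseteq> {..<n}" using okst_stk[OF ok(1)] by simp
  have e0: "emits u = 0" using uv(2) by (auto simp: emits_def filter_empty_conv)
  have v0: "vis st u = []" for st using e0 length_vis[of st u] by simp
  have "wp S W (EMIT 4) (emitted v (stk (stk [] dn) u) s) s"
    by (rule wp_EMIT) (use q uv nt ok st in auto)
  from wp_clock[OF this loopfree_EMIT] show ?thesis
  proof (rule wp_mono, elim conjE)
    fix s' assume em: "emitted v (stk (stk [] dn) u) s s'" and cl: "fst (gh s') \<le> fst (gh s) + clen (EMIT 4)"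
    from em obtain t where t: "snd (gh s') = snd (gh s) @ [(t, set (stk (stk [] dn) u))]"
       "fst (gh s) \<le> t" "t \<le> fst (gh s')" unfolding emitted_def by blast
    have gp': "gp 0 (dn @ u @ [Emit]) = Some 0"
      using g tr(3) uv(1) by (auto simp: gp_append split: option.splits)
    show "\<exists>dn' qu' A t. ops tr = dn' @ qu' \<and> gp 0 dn' = Some 0 \<and> qrep qu' s'
     \<and> srep (stk [] dn') s' \<and> map snd (snd (gh s')) = vis [] dn' \<and> emits qu' = emits qu - 1
     \<and> rg s' 44 = emits qu' \<and> (\<forall>i. i \<notin> {42, 44, 49} \<longrightarrow> rg s' i = rg s i) \<and> (\<forall>a<qb. mm s' a = mm s a)
     \<and> snd (gh s') = snd (gh s) @ [(t, A)] \<and> fst (gh s) \<le> t \<and> t \<le> fst (gh s')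
     \<and> fst (gh s') \<le> fst (gh s) + clen (EMIT 4)"
      by (rule exI[of _ "dn @ u @ [Emit]"], rule exI[of _ v], rule exI[of _ "set (stk (stk [] dn) u)"], rule exI[of _ t])
        (use em t tr gp' uv ne e0 cl q(4) v0 in \<open>auto simp: emitted_def\<close>)
  qed
qed

lemma qrep_length:
  assumes "prefix_of_F tr" "ops tr = dn @ qu" "gp 0 dn = Some 0" "emits qu \<le> cap + 1"
  shows "length qu < 4 * cap + 8"
proof -
  have "gp 0 qu \<noteq> None"
    using prefix_gp[OF assms(1)] assms(2,3) by (simp flip: gp_ops[of 0 tr] add: gp_append)
  then have "length qu + 0 \<le> 4 * emits qu + 3"
    by (rule gp_length[rotated 2]) (use ops_no_Tick[OF assms(2)] in auto)
  then show ?thesis using assms(4) by simp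
qed

lemma srep_tick [simp]: "srep st (tick k s) = srep st s" and qrep_tick [simp]: "qrep qu (tick k s) = qrep qu s"
  by (auto simp: srep_def qrep_def)

lemma srep_upd [simp]: "i \<noteq> 48 \<Longrightarrow> srep st (upd_rg i v s) = srep st s"
  by (auto simp: srep_def)
lemma qrep_upd [simp]: "i \<notin> {40, 41, 42, 43} \<Longrightarrow> qrep st (upd_rg i v s) = qrep st s"
  by (auto simp: qrep_def)

text \<open>The equation in \<open>timing\<close> counts from the last overflow: pending visits are
  \<open>cap\<close>, plus those queued since, minus those output since, where one is output per
  \<open>cc\<close> ticks and register 47 holds the remainder. If nothing were pending when an
  output falls due, the stretch since the overflow would contain more than \<open>t0\<close> ticks
  beyond \<open>cc\<close> per visit, against the amortization hypothesis.\<close>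

lemma wp_TICK:
  assumes inv: "linv tr w s" and pr: "prefix_of_F (tr @ [Tick])" and w: "w + clen TICK \<le> Bd"
  shows "wp S W TICK (\<lambda>s'. linv (tr @ [Tick]) (clen TICK) s' \<and> (\<forall>i<40. rg s' i = rg s i) \<and> (\<forall>a<qb. mm s' a = mm s a)) s"
proof -
  from inv obtain dn qu where i: "ops tr = dn @ qu" "gp 0 dn = Some 0" "qrep qu s" "rg s 44 = emits qu"
    "emits qu \<le> cap" "srep (stk [] dn) s" "map snd (snd (gh s)) = vis [] dn" "rg s 45 = cap"
    "timing tr (emits qu) w s" unfolding linv_def by blast
  have pr': "prefix_of_F tr" using pr by (auto simp: prefix_of_F_def)
  show ?thesis
  proof (cases "rg s 46 = 0")
    case True
    then have t: "snd (gh s) = []" "fst (gh s) \<le> c0 + Bd * ticks tr + w"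
      using i(9) by (auto simp: timing_def)
    have "elen (V 46) + 1 \<le> clen TICK" by (simp add: TICK_def)
    then have t2: "fst (gh s) + (elen (V 46) + 1) \<le> c0 + Bd * Suc (ticks tr) + clen TICK"
      using t(2) w unfolding mult_Suc_right by linarith
    have "linv (tr @ [Tick]) (clen TICK) (tick (elen (V 46) + 1) s)"
      by (rule linvI[of _ dn qu]) (use i t t2 True in \<open>simp_all add: timing_def\<close>)
    then show ?thesis unfolding TICK_def wp_simps using True by simp
  next
    case False
    then obtain pre suf where t: "gaps_ok (times s)" "snd (gh s) \<noteq> []" "rg s 47 < cc" "tr = pre @ suf"
      "cc * emits qu + ticks suf = cc * cap + cc * emits suf + rg s 47"
      "fst (gh s) \<le> last (times s) + Bd * rg s 47 + w"
      using i(9) by (auto simp: timing_def)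
    let ?c1 = "Asg 47 (Plus (V 47) (N 1))"
    let ?c2 = "If (Minus (N cc) (V 47)) Skip (Asg 47 (N 0) ;; EMIT 4)"
    define s1 where "s1 = tick (elen (Plus (V 47) (N 1)) + 1) (upd_rg 47 (rg s 47 + 1) (tick (elen (V 46) + 1) s))"
    have s1: "rg s1 = (rg s)(47 := rg s 47 + 1)" "mm s1 = mm s" "snd (gh s1) = snd (gh s)"
      "qrep qu s1" "srep (stk [] dn) s1"
      using i(3,6) by (auto simp: s1_def qrep_def srep_def)
    have cl1: "fst (gh s1) = fst (gh s) + (elen (V 46) + 1 + (elen (Plus (V 47) (N 1)) + 1))"
      by (simp add: s1_def)
    have cl: "clen TICK = (elen (V 46) + 1 + (elen (Plus (V 47) (N 1)) + 1))
       + (elen (Minus (N cc) (V 47)) + 1) + (elen (N 0) + 1) + clen (EMIT 4) + 2"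
      by (simp add: TICK_def)
    have W1: "rg s 47 + 1 \<le> W" "cc \<le> W" using t(3) SW by auto
    have mults: "Bd * Suc (rg s 47) = Bd * rg s 47 + Bd" by simp
    have "wp S W ?c2 (\<lambda>s'. linv (tr @ [Tick]) (clen TICK) (tick 1 s') \<and> (\<forall>i<40. rg (tick 1 s') i = rg s i)
        \<and> (\<forall>a<qb. mm (tick 1 s') a = mm s a)) s1"
    proof (cases "rg s 47 + 1 < cc")
      case True
      have "timing (tr @ [Tick]) (emits qu) (clen TICK) (tick 1 (tick 1 (tick (elen (Minus (N cc) (V 47)) + 1) s1)))"
        unfolding timing_def
      proof (intro conjI disjI2)
        show "\<exists>pre suf. tr @ [Tick] = pre @ suf \<and> cc * emits qu + ticks suf = cc * cap + cc * emits suf +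
           rg (tick 1 (tick 1 (tick (elen (Minus (N cc) (V 47)) + 1) s1))) 47"
          by (rule exI[of _ pre], rule exI[of _ "suf @ [Tick]"]) (use t s1 in simp)
        show "fst (gh (tick 1 (tick 1 (tick (elen (Minus (N cc) (V 47)) + 1) s1)))) \<le>
          last (times (tick 1 (tick 1 (tick (elen (Minus (N cc) (V 47)) + 1) s1)))) +
          Bd * rg (tick 1 (tick 1 (tick (elen (Minus (N cc) (V 47)) + 1) s1))) 47 + clen TICK"
          using t(6) w s1 cl1 cl mults by simp
      qed (use t s1 False True in auto)
      then have "linv (tr @ [Tick]) (clen TICK) (tick 1 (tick 1 (tick (elen (Minus (N cc) (V 47)) + 1) s1)))"
        by (intro linvI[of _ dn qu]) (use i s1 in auto)
      then show ?thesis using True W1 s1 by (simp add: wp_simps)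
    next
      case False': False
      then have c47: "rg s 47 + 1 = cc" using t(3) by simp
      have "cc * cap + ticks (suf @ [Tick]) \<le> cc * cap + (t0 + cc * emits (suf @ [Tick]))"
        using prefix_amortized[of pre "suf @ [Tick]"] pr t(4) by simp
      then have "emits qu \<noteq> 0" using t(5) c47 t0 by (intro notI) simp
      define s2 where "s2 = tick (elen (N 0) + 1) (upd_rg 47 0 (tick (elen (Minus (N cc) (V 47)) + 1) s1))"
      have s2: "rg s2 = (rg s)(47 := 0)" "mm s2 = mm s" "snd (gh s2) = snd (gh s)"
        "qrep qu s2" "srep (stk [] dn) s2"
        using s1 by (auto simp: s2_def qrep_def srep_def)
      have cl2: "fst (gh s2) = fst (gh s1) + (elen (Minus (N cc) (V 47)) + 1) + (elen (N 0) + 1)"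
        by (simp add: s2_def)
      have "wp S W (EMIT 4) (\<lambda>s'. linv (tr @ [Tick]) (clen TICK) (tick 1 s') \<and> (\<forall>i<40. rg (tick 1 s') i = rg s i)
        \<and> (\<forall>a<qb. mm (tick 1 s') a = mm s a)) s2"
      proof (rule wp_mono[OF wp_EMIT_pending[OF pr' i(1,2) s2(4) \<open>emits qu \<noteq> 0\<close> s2(5)]], goal_cases)
        case 1 then show ?case using s2 i by simp
      next
        case 2 then show ?case using s2 i by simp
      next
        case (3 s')
        then obtain dn' qu' A t' where e: "ops tr = dn' @ qu'" "gp 0 dn' = Some 0" "qrep qu' s'"
           "srep (stk [] dn') s'" "map snd (snd (gh s')) = vis [] dn'" "emits qu' = emits qu - 1"
           "rg s' 44 = emits qu'" "\<forall>i. i \<notin> {42, 44, 49} \<longrightarrow> rg s' i = rg s2 i" "\<forall>a<qb. mm s' a = mm s2 a"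
           "snd (gh s') = snd (gh s2) @ [(t', A)]" "fst (gh s2) \<le> t'" "t' \<le> fst (gh s')"
           "fst (gh s') \<le> fst (gh s2) + clen (EMIT 4)" by blast
        have r46: "rg s' 46 \<noteq> 0" "rg s' 47 = 0" "rg s' 45 = cap" using e(8) s2(1) False i(8) by auto
        \<comment> \<open>The earlier ticks account for \<open>Bd * rg s 47\<close>, and the code
          since the latest one, including \<open>TICK\<close>, for at most one more
          \<open>Bd\<close>.\<close>
        have gap: "t' \<le> last (times s) + Bd * (cc + 1)"
        proof -
          have "Bd * cc = Bd * rg s 47 + Bd" using c47 mults by simp
          then show ?thesis using e(12,13) cl2 cl1 t(6) w cl by simp
        qed
        have "timing (tr @ [Tick]) (emits qu') (clen TICK) (tick 1 s')"
          unfolding timing_def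
        proof (intro conjI disjI2)
          show "gaps_ok (times (tick 1 s'))"
            using gaps_ok_snoc[OF t(1) _ gap] t(2) e(10) s2(3) by simp
          have "cc * emits qu' + cc = cc * emits qu"
            using e(6) \<open>emits qu \<noteq> 0\<close> by (cases "emits qu") simp_all
          then show "\<exists>pre suf. tr @ [Tick] = pre @ suf \<and> cc * emits qu' + ticks suf = cc * cap + cc * emits suf + rg (tick 1 s') 47"
            using t(4,5) c47 r46 by (intro exI[of _ pre] exI[of _ "suf @ [Tick]"]) simp
          show "fst (gh (tick 1 s')) \<le> last (times (tick 1 s')) + Bd * rg (tick 1 s') 47 + clen TICK"
            using e(10-13) r46 cl by simp
          show "rg (tick 1 s') 47 < cc" using r46 c47 by simp
        qed (use r46 e in auto)
        then have "linv (tr @ [Tick]) (clen TICK) (tick 1 s')"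
          by (intro linvI[of _ dn' qu']) (use e r46 i(5) s2 in auto)
        then show ?case using e(8,9) s2 by auto
      qed
      then show ?thesis using c47 W1 s1 by (simp add: wp_simps s2_def)
    qed
    then show ?thesis unfolding TICK_def using False W1 by (simp add: wp_simps s1_def)
  qed
qed

lemma wp_PUT:
  assumes q: "qrep qu s" and len: "Suc (length qu) < 4 * cap + 8" and e: "ok S W e s"
  shows "wp S W (PUT e) (\<lambda>s'. qrep (qu @ [decode (eval e s)]) s' \<and> rg s' 49 = eval e s
     \<and> (\<forall>i. i \<noteq> 43 \<and> i \<noteq> 49 \<longrightarrow> rg s' i = rg s i)
     \<and> (\<forall>a. a < qb \<or> qe \<le> a \<longrightarrow> mm s' a = mm s a) \<and> snd (gh s') = snd (gh s)) s"
proof -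
  define h where "h = rg s 42"
  define v where "v = eval e s"
  have h: "qb \<le> h" "h < qe" "rg s 40 = qb" "rg s 41 = qe"
    "\<And>i. i < length qu \<Longrightarrow> mm s (qpos h i) = code (qu ! i)" "rg s 43 = qpos h (length qu)"
    using q by (auto simp: qrep_def h_def)
  have p: "qb \<le> qpos h (length qu)" "qpos h (length qu) < qe" using qpos_bounds h(1,2) len by auto
  have hS: "qpos h (length qu) < S" "qpos h (length qu) + 1 \<le> W" using p(2) S SW by (auto simp: qe_def)
  have nxt: "qpos h (Suc (length qu)) = (if qpos h (length qu) + 1 < qe then qpos h (length qu) + 1 else qb)"
    using h(1,2) len by (auto simp: qpos_def qe_def)
  have ne: "qpos h i \<noteq> qpos h (length qu)" if "i < length qu" for i
    using qpos_inj[OF h(1,2), of i "length qu"] that len by auto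
  show ?thesis unfolding PUT_def
    using e hS h p len nxt ne
    by (simp add: wp_simps v_def[symmetric] h_def[symmetric] qrep_def)
      (auto simp: nth_append less_Suc_eq)
qed

text \<open>Only an \<open>Emit\<close> that arrives at \<open>cap\<close> pending visits causes an
  output. Afterwards exactly \<open>cap\<close> visits are pending again, so the equation of
  \<open>timing\<close> restarts with an empty stretch.\<close>

lemma wp_ENQ:
  assumes inv: "linv tr w s" and pr: "prefix_of_F (tr @ [decode (eval e s)])"
    and w: "w + clen (ENQ e) \<le> Bd" and e: "ok S W e s"
  shows "wp S W (ENQ e) (\<lambda>s'. linv (tr @ [decode (eval e s)]) (w + clen (ENQ e)) s'
     \<and> (\<forall>i<40. rg s' i = rg s i) \<and> (\<forall>a<qb. mm s' a = mm s a)) s"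
proof -
  define x where "x = decode (eval e s)"
  have cx: "code x = eval e s" "x \<noteq> Tick" by (simp_all add: x_def)
  from inv obtain dn qu where i: "ops tr = dn @ qu" "gp 0 dn = Some 0" "qrep qu s" "rg s 44 = emits qu"
    "emits qu \<le> cap" "srep (stk [] dn) s" "map snd (snd (gh s)) = vis [] dn" "rg s 45 = cap"
    "timing tr (emits qu) w s" unfolding linv_def by blast
  have pr': "prefix_of_F tr" using pr by (auto simp: prefix_of_F_def)
  have ops': "ops (tr @ [x]) = dn @ (qu @ [x])" using i(1) cx by simp
  \<comment> \<open>For a moment \<open>cap + 1\<close> visits may be queued; the buffer has room
    for them.\<close>
  have "length (qu @ [x]) < 4 * cap + 8"
    by (rule qrep_length[OF pr[folded x_def] ops' i(2)]) (use i(5) in auto)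
  then have len: "Suc (length qu) < 4 * cap + 8" by simp
  let ?ch = "If (Minus (V 49) (N 1)) Skip (If (V 49) (Asg 44 (Plus (V 44) (N 1)) ;;
       If (Minus (V 44) (V 45)) (Asg 46 (N 1) ;; Asg 47 (N 0) ;; EMIT 4) Skip) Skip)"
  let ?Q = "\<lambda>s'. linv (tr @ [x]) (w + clen (ENQ e)) s' \<and> (\<forall>i<40. rg s' i = rg s i) \<and> (\<forall>a<qb. mm s' a = mm s a)"
  have cl: "clen (ENQ e) = clen (PUT e) + clen ?ch" by (simp add: ENQ_def)
  have "wp S W (PUT e ;; ?ch) ?Q s"
    unfolding wp_simps(4)
  proof (rule wp_mono[OF wp_clock[OF wp_PUT[OF i(3) len e]]], goal_cases)
    case 1 show ?case by (simp add: PUT_def)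
  next
    case (2 s1)
    then have a: "qrep (qu @ [x]) s1" "rg s1 49 = code x" "\<And>i. i \<noteq> 43 \<Longrightarrow> i \<noteq> 49 \<Longrightarrow> rg s1 i = rg s i"
      "\<And>a. a < qb \<or> qe \<le> a \<Longrightarrow> mm s1 a = mm s a" "snd (gh s1) = snd (gh s)"
      "fst (gh s) \<le> fst (gh s1)" "fst (gh s1) \<le> fst (gh s) + clen (PUT e)"
      unfolding cx(1) by (auto simp: x_def)
    have sr: "srep (stk [] dn) s1" using i(6) a(3,4) by (auto simp: srep_def)
    show ?case
    proof (cases "x = Emit")
      case False
      have timing: "timing (tr @ [x]) (emits qu) (w + clen (ENQ e)) s'"
        if "rg s' 46 = rg s 46" "rg s' 47 = rg s 47" "snd (gh s') = snd (gh s)" "fst (gh s') \<le> fst (gh s) + clen (ENQ e)" for s'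
        using i(9) that unfolding timing_def
      proof (elim conjE disjE exE, intro conjI disjI1, goal_cases)
        case (5 pre suf)
        show ?case
        proof (intro conjI disjI2)
          show "\<exists>pre suf. tr @ [x] = pre @ suf \<and> cc * emits qu + ticks suf = cc * cap + cc * emits suf + rg s' 47"
            by (rule exI[of _ pre], rule exI[of _ "suf @ [x]"]) (use 5 cx False in simp)
        qed (use 5 in simp_all)
      qed (use cx in auto)
      define f where "f = (\<lambda>s1. tick 1 (tick (elen (Minus (V 49) (N 1)) + 1) s1) :: clock st)"
      define g where "g = (\<lambda>s1. tick (elen (V 49) + 1) (tick (elen (Minus (V 49) (N 1)) + 1) s1) :: clock st)"
      have Q: "?Q s'" if "s' = f s1 \<or> s' = g s1" for s'
      proof -
        have s': "rg s' = rg s1" "mm s' = mm s1" "snd (gh s') = snd (gh s1)" "fst (gh s') \<le> fst (gh s1) + clen ?ch"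
          using that by (auto simp: f_def g_def)
        have "timing (tr @ [x]) (emits qu) (w + clen (ENQ e)) s'"
          by (rule timing) (use s' a cl in auto)
        then have "linv (tr @ [x]) (w + clen (ENQ e)) s'"
          by (intro linvI[of _ dn "qu @ [x]"])
            (use i(2,4,5,7,8) a(1,3,5) sr s' ops' False in \<open>auto simp: qrep_def srep_def\<close>)
        then show ?thesis using a(3,4) s' by auto
      qed
      show ?thesis
      proof (cases x)
        case Pop
        then show ?thesis using a(2) Q[of "g s1"] SW by (simp add: wp_simps g_def cc_def)
      next
        case (Push k)
        then show ?thesis using a(2) Q[of "f s1"] SW by (simp add: wp_simps f_def cc_def)
      qed (use cx False in auto)
    next
      case True
      define s2 where "s2 = tick (elen (Plus (V 44) (N 1)) + 1) (upd_rg 44 (rg s 44 + 1)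
         (tick (elen (V 49) + 1) (tick (elen (Minus (V 49) (N 1)) + 1) s1)))"
      have s2: "rg s2 = (rg s1)(44 := rg s 44 + 1)" "mm s2 = mm s1" "snd (gh s2) = snd (gh s)"
        using a by (simp_all add: s2_def)
      have q2: "qrep (qu @ [x]) s2" "srep (stk [] dn) s2" using a(1) sr by (auto simp: s2_def qrep_def srep_def)
      have cl2: "fst (gh s2) = fst (gh s1) + (elen (Minus (V 49) (N 1)) + 1) + (elen (V 49) + 1) + (elen (Plus (V 44) (N 1)) + 1)"
        by (simp add: s2_def)
      have clc: "clen ?ch = (elen (Minus (V 49) (N 1)) + 1) + (elen (V 49) + 1) + (elen (Plus (V 44) (N 1)) + 1)
         + (elen (Minus (V 44) (V 45)) + 1) + (elen (N 1) + 1) + (elen (N 0) + 1) + clen (EMIT 4) + 3"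
        by simp
      have W1: "emits qu + 1 \<le> W" using i(5) S SW by linarith
      have c1: "rg s1 49 = 1" using a(2) True by simp
      have "wp S W (If (Minus (V 44) (V 45)) (Asg 46 (N 1) ;; Asg 47 (N 0) ;; EMIT 4) Skip) (\<lambda>s'. ?Q (tick 1 s')) s2"
      proof (cases "emits qu < cap")
        case lt: True
        define s3 where "s3 = tick 1 (tick (elen (Minus (V 44) (V 45)) + 1) s2)"
        have s3: "rg s3 = rg s2" "mm s3 = mm s2" "snd (gh s3) = snd (gh s)"
          "fst (gh s3) \<le> fst (gh s) + clen (ENQ e)"
          using s2 cl2 cl clc a(7) by (auto simp: s3_def)
        have "timing (tr @ [x]) (emits (qu @ [x])) (w + clen (ENQ e)) s3"
          using i(9) s3 unfolding timing_def
        proof (elim conjE disjE exE, intro conjI disjI1, goal_cases)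
          case (5 pre suf)
          show ?case
          proof (intro conjI disjI2)
            show "\<exists>pre suf. tr @ [x] = pre @ suf \<and> cc * emits (qu @ [x]) + ticks suf = cc * cap + cc * emits suf + rg s3 47"
              by (rule exI[of _ pre], rule exI[of _ "suf @ [x]"]) (use 5 True a(3) s2 in simp)
          qed (use 5 a(3) s2 in simp_all)
        qed (use True a(3) s2 in auto)
        then have "linv (tr @ [x]) (w + clen (ENQ e)) s3"
          by (intro linvI[of _ dn "qu @ [x]"])
            (use i(2,4,5,7,8) a(1,3,5) q2 s2 s3 ops' lt True in \<open>auto simp: qrep_def srep_def\<close>)
        then have "?Q s3" using a(3,4) s2 s3 by auto
        then show ?thesis using lt a(3) i(4,8) s2 by (simp add: wp_simps s3_def)
      next
        case False
        then have ec: "emits qu = cap" using i(5) by simp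
        define s3 where "s3 = tick (elen (N 0) + 1) (upd_rg 47 0 (tick (elen (N 1) + 1) (upd_rg 46 1 (tick (elen (Minus (V 44) (V 45)) + 1) s2))))"
        have s3: "rg s3 = (rg s2)(46 := 1, 47 := 0)" "mm s3 = mm s1" "snd (gh s3) = snd (gh s)"
          using s2 by (simp_all add: s3_def)
        have q3: "qrep (qu @ [x]) s3" "srep (stk [] dn) s3" using q2 by (auto simp: s3_def qrep_def srep_def)
        have cl3: "fst (gh s3) \<le> fst (gh s) + clen (ENQ e) - clen (EMIT 4) - 3"
          using cl2 cl clc a(7) by (simp add: s3_def)
        have n0: "emits (qu @ [x]) \<noteq> 0" using True by simp
        have "wp S W (EMIT 4) (\<lambda>s'. ?Q (tick 1 (tick 1 s'))) s3"
        proof (rule wp_mono[OF wp_EMIT_pending[OF pr[folded x_def] ops' i(2) q3(1) n0 q3(2)]], goal_cases)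
          case 1 then show ?case using s3 i by simp
        next
          case 2 then show ?case using s3 s2 i True by simp
        next
          case (3 s')
          then obtain dn' qu' A t' where f: "ops (tr @ [x]) = dn' @ qu'" "gp 0 dn' = Some 0" "qrep qu' s'"
             "srep (stk [] dn') s'" "map snd (snd (gh s')) = vis [] dn'" "emits qu' = emits (qu @ [x]) - 1"
             "rg s' 44 = emits qu'" "\<forall>i. i \<notin> {42, 44, 49} \<longrightarrow> rg s' i = rg s3 i" "\<forall>a<qb. mm s' a = mm s3 a"
             "snd (gh s') = snd (gh s3) @ [(t', A)]" "fst (gh s3) \<le> t'" "t' \<le> fst (gh s')"
             "fst (gh s') \<le> fst (gh s3) + clen (EMIT 4)" by blast
          have r46: "rg s' 46 \<noteq> 0" "rg s' 47 = 0" "rg s' 45 = cap" using f(8) s3 s2 a(3) i(8) by auto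
          have eq: "emits qu' = cap" using f(6) True ec by simp
          have t'le: "t' \<le> fst (gh s) + clen (ENQ e)" using f(12,13) cl3 cl clc by simp
          have gp: "gaps_ok (times s @ [t'])"
          proof (cases "snd (gh s) = []")
            case True': True
            then have c: "fst (gh s) \<le> c0 + Bd * ticks tr + w" using i(9) by (auto simp: timing_def)
            \<comment> \<open>Nothing has been output yet, so all visits of the trace are still
              queued and there are \<open>cap\<close> of them.\<close>
            have "emits dn = 0" using i(7) True' length_vis[of "[]" dn] by simp
            then have "emits tr = cap" using ec emits_ops[of tr] i(1) by simp
            then have "ticks tr \<le> t0 + cc * (cap + 1)" using prefix_amortized[of "[]" tr] pr' by simp
            then have "Bd * ticks tr \<le> Bd * (t0 + cc * (cap + 1))" by (rule mult_le_mono2)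
            then have "t' \<le> c0 + Bd * (t0 + cc * (cap + 1)) + Bd" using c t'le w by linarith
            then show ?thesis using True' by (simp add: gaps_ok_single)
          next
            case False
            then have c: "fst (gh s) \<le> last (times s) + Bd * rg s 47 + w" "rg s 47 < cc" "gaps_ok (times s)"
              using i(9) by (auto simp: timing_def)
            have "Bd * rg s 47 \<le> Bd * cc" using c(2) by simp
            then have "t' \<le> last (times s) + Bd * (cc + 1)" using c(1) t'le w unfolding distrib_left by linarith
            then show ?thesis using gaps_ok_snoc[OF c(3)] False by simp
          qed
          have "timing (tr @ [x]) (emits qu') (w + clen (ENQ e)) (tick 1 (tick 1 s'))"
            unfolding timing_def
          proof (intro conjI disjI2)
            show "\<exists>pre suf. tr @ [x] = pre @ suf \<and> cc * emits qu' + ticks suf = cc * cap + cc * emits suf + rg (tick 1 (tick 1 s')) 47"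
              by (rule exI[of _ "tr @ [x]"], rule exI[of _ "[]"]) (use r46 eq in simp)
            show "fst (gh (tick 1 (tick 1 s'))) \<le> last (times (tick 1 (tick 1 s')))
                + Bd * rg (tick 1 (tick 1 s')) 47 + (w + clen (ENQ e))"
              using f(10-13) r46 cl clc by simp
            show "rg (tick 1 (tick 1 s')) 47 < cc" using r46 by (simp add: cc_def)
          qed (use r46 f s3 gp in auto)
          then have "linv (tr @ [x]) (w + clen (ENQ e)) (tick 1 (tick 1 s'))"
            by (intro linvI[OF f(1,2)]) (use f(3,4,5,7) r46(3) eq in simp_all)
          then show ?case using f(8,9) s3 s2 a(3,4) by auto
        qed
        then show ?thesis using ec a(3) i(4,8) s2 SW by (simp add: wp_simps s3_def cc_def)
      qed
      then show ?thesis using c1 a(3) i(4) W1 SW by (simp add: wp_simps s2_def cc_def)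
    qed
  qed
  then show ?thesis by (simp add: ENQ_def x_def)
qed

lemma linv_user:
  assumes "linv tr w s" "\<And>i. 40 \<le> i \<Longrightarrow> rg s' i = rg s i" "\<And>a. qb \<le> a \<Longrightarrow> mm s' a = mm s a"
    "snd (gh s') = snd (gh s)" "fst (gh s') \<le> fst (gh s) + k" "w + k \<le> w'"
  shows "linv tr w' s'"
proof -
  from assms(1) obtain dn qu where i: "ops tr = dn @ qu" "gp 0 dn = Some 0" "qrep qu s" "rg s 44 = emits qu"
    "emits qu \<le> cap" "srep (stk [] dn) s" "map snd (snd (gh s)) = vis [] dn" "rg s 45 = cap"
    "timing tr (emits qu) w s" unfolding linv_def by blast
  have qe: "qb \<le> qe" by (simp add: qe_def)
  have q: "qrep qu s'" using i(3) assms(2,3) qpos_bounds unfolding qrep_def by auto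
  have sr: "srep (stk [] dn) s'" using i(6) assms(2,3) qe unfolding srep_def by auto
  have "timing tr (emits qu) w' s'"
    using i(9) assms(2,4,5,6) unfolding timing_def by fastforce
  then show ?thesis by (intro linvI[OF i(1,2) q _ i(5) sr]) (use i assms in auto)
qed

section \<open>Simulation of trace programs on top of the queue\<close>

definition agree :: "clock st \<Rightarrow> ev list st \<Rightarrow> bool" where
  "agree s0 s1 \<longleftrightarrow> (\<forall>i<40. rg s0 i = rg s1 i) \<and> (\<forall>a<X. mm s0 a = mm s1 a)"

lemma agree_eval:
  assumes "agree s0 s1" "ok X W e s1" "vars e \<subseteq> {..<40}"
  shows "eval e s0 = eval e s1 \<and> ok S W e s0"
  using assms X S by (induction e) (auto simp: agree_def)

lemma lbig_gh: "lbig S' W' c s s' \<Longrightarrow> \<exists>t. gh s' = gh s @ t"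
  by (induction rule: lbig.induct) auto

lemma prefix_of_F_lbig: "lbig S' W' c s s' \<Longrightarrow> prefix_of_F (gh s') \<Longrightarrow> prefix_of_F (gh s)"
  by (drule lbig_gh) (auto simp: prefix_of_F_def)

text \<open>The instructions executed after the last tick of a command.\<close>

fun straight :: "com \<Rightarrow> nat" where
  "straight (While e c) = elen e + 1"
| "straight (Seq c d) = straight c + straight d"
| "straight (If e c d) = elen e + straight c + straight d + 2"
| "straight c = clen (lower c)"

lemma straight_le: "straight c \<le> clen (lower c)"
  by (induction c) auto

text \<open>\<open>w\<close> bounds the instructions since the latest tick. If the command ticks,
  whatever follows its last tick fits into \<open>clen (lower c)\<close>; if it does not, it adds at
  most \<open>straight c\<close>; hence the maximum. Both stay within the program text, so one
  constant \<open>Bd\<close> serves the whole program.\<close>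

theorem lower_sim:
  assumes "lbig X W c s1 s1'" "cvars c \<subseteq> {..<40}" "agree s0 s1" "linv (gh s1) w s0" "prefix_of_F (gh s1')"
    "w + clen (lower c) \<le> Bd" "2 * clen (lower c) \<le> Bd"
  shows "\<exists>s0'. big S W (lower c) s0 s0' \<and> agree s0' s1' \<and> linv (gh s1') (max (w + straight c) (clen (lower c))) s0'"
  using assms
proof (induction arbitrary: s0 w rule: lbig.induct)
  case (Skip s)
  have "linv (gh s) (max (w + straight Skip) (clen (lower Skip))) s0"
    by (rule linv_user[OF Skip(3), of _ 0]) auto
  moreover have "big S W (lower Skip) s0 s0" by (simp add: big.Skip)
  ultimately show ?case using Skip(2) by blast
next
  case (Asg e s x)
  have e: "eval e s0 = eval e s" "ok S W e s0" using agree_eval[OF Asg.prems(2) Asg.hyps] Asg.prems(1) by auto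
  show ?case unfolding lower.simps
  proof (rule exI, intro conjI)
    show "big S W (Asg x e) s0 (tick (elen e + 1) (upd_rg x (eval e s0) s0))" using e by (intro big.Asg)
    show "agree (tick (elen e + 1) (upd_rg x (eval e s0) s0)) (upd_rg x (eval e s) s)"
      using Asg.prems e by (auto simp: agree_def)
    show "linv (gh (upd_rg x (eval e s) s)) (max (w + straight (Asg x e)) (clen (Asg x e))) (tick (elen e + 1) (upd_rg x (eval e s0) s0))"
      by (rule linv_user[where s = s0 and k = "elen e + 1" and w = w]) (use Asg.prems in auto)
  qed
next
  case (Sto a s e)
  have e: "eval e s0 = eval e s" "ok S W e s0" "eval a s0 = eval a s" "ok S W a s0" "eval a s < S"
    using agree_eval[OF Sto.prems(2) Sto.hyps(1)] agree_eval[OF Sto.prems(2) Sto.hyps(2)] Sto X S by auto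
  let ?s = "tick (clen (Sto a e)) (upd_mm (eval a s0) (eval e s0) s0)"
  show ?case unfolding lower.simps
  proof (rule exI, intro conjI)
    show "big S W (Sto a e) s0 ?s" using e by (intro big.Sto) auto
    show "agree ?s (upd_mm (eval a s) (eval e s) s)"
      using Sto.prems e by (auto simp: agree_def)
    show "linv (gh (upd_mm (eval a s) (eval e s) s)) (max (w + straight (Sto a e)) (clen (Sto a e))) ?s"
      by (rule linv_user[where s = s0 and k = "clen (Sto a e)" and w = w]) (use Sto.prems Sto.hyps(3) e X in auto)
  qed
next
  case (Seq c s s' d s'')
  have pr: "prefix_of_F (gh s')" using prefix_of_F_lbig[OF Seq.hyps(2)] Seq.prems by auto
  obtain t where t: "big S W (lower c) s0 t" "agree t s'" "linv (gh s') (max (w + straight c) (clen (lower c))) t"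
    using Seq.IH(1)[OF _ Seq.prems(2,3) pr] Seq.prems by auto
  have "max (w + straight c) (clen (lower c)) + clen (lower d) \<le> Bd"
    using Seq.prems(5,6) straight_le[of c] by auto
  then obtain t' where t': "big S W (lower d) t t'" "agree t' s''"
    "linv (gh s'') (max (max (w + straight c) (clen (lower c)) + straight d) (clen (lower d))) t'"
    using Seq.IH(2)[OF _ t(2,3) Seq.prems(4)] Seq.prems by auto
  have "linv (gh s'') (max (w + straight (c ;; d)) (clen (lower (c ;; d)))) t'"
    by (rule linv_user[OF t'(3), of _ 0]) (use straight_le[of d] in auto)
  moreover have "big S W (lower (c ;; d)) s0 t'" using big.Seq[OF t(1) t'(1)] by simp
  ultimately show ?case using t'(2) by blast
next
  case (IfT e s c s' d)
  have e: "eval e s0 = eval e s" "ok S W e s0" using agree_eval[OF IfT.prems(2) IfT.hyps(1)] IfT.prems(1) by auto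
  let ?s0 = "tick (elen e + 1) s0"
  have ag: "agree ?s0 s" using IfT.prems(2) by (auto simp: agree_def)
  have li: "linv (gh s) (w + (elen e + 1)) ?s0" by (rule linv_user[OF IfT.prems(3), of _ "elen e + 1"]) auto
  obtain t where t: "big S W (lower c) ?s0 t" "agree t s'" "linv (gh s') (max (w + (elen e + 1) + straight c) (clen (lower c))) t"
    using IfT.IH[OF _ ag li IfT.prems(4)] IfT.prems by auto
  have "big S W (lower (If e c d)) s0 (tick 1 t)" unfolding lower.simps
    by (rule big.IfT[OF e(2) _ t(1) refl]) (use e IfT in auto)
  moreover have "linv (gh s') (max (w + straight (If e c d)) (clen (lower (If e c d)))) (tick 1 t)"
    by (rule linv_user[OF t(3), of _ 1]) auto
  moreover have "agree (tick 1 t) s'" using t(2) by (auto simp: agree_def)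
  ultimately show ?case by blast
next
  case (IfF e s d s' c)
  have e: "eval e s0 = eval e s" "ok S W e s0" using agree_eval[OF IfF.prems(2) IfF.hyps(1)] IfF.prems(1) by auto
  let ?s0 = "tick (elen e + 1) s0"
  have ag: "agree ?s0 s" using IfF.prems(2) by (auto simp: agree_def)
  have li: "linv (gh s) (w + (elen e + 1)) ?s0" by (rule linv_user[OF IfF.prems(3), of _ "elen e + 1"]) auto
  obtain t where t: "big S W (lower d) ?s0 t" "agree t s'" "linv (gh s') (max (w + (elen e + 1) + straight d) (clen (lower d))) t"
    using IfF.IH[OF _ ag li IfF.prems(4)] IfF.prems by auto
  have "big S W (lower (If e c d)) s0 t" unfolding lower.simps
    by (rule big.IfF[OF e(2) _ t(1)]) (use e IfF in auto)
  moreover have "linv (gh s') (max (w + straight (If e c d)) (clen (lower (If e c d)))) t"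
    by (rule linv_user[OF t(3), of _ 0]) auto
  ultimately show ?case using t(2) by blast
next
  case (WhileF e s c)
  have e: "eval e s0 = eval e s" "ok S W e s0" using agree_eval[OF WhileF.prems(2) WhileF.hyps(1)] WhileF.prems(1) by auto
  have "big S W (lower (While e c)) s0 (tick (elen e + 1) s0)" unfolding lower.simps
    by (rule big.WhileF) (use e WhileF in auto)
  moreover have "linv (gh s) (max (w + straight (While e c)) (clen (lower (While e c)))) (tick (elen e + 1) s0)"
    by (rule linv_user[OF WhileF.prems(3), of _ "elen e + 1"]) auto
  moreover have "agree (tick (elen e + 1) s0) s" using WhileF.prems(2) by (auto simp: agree_def)
  ultimately show ?case by blast
next
  case (WhileT e s c s' s'')
  have e: "eval e s0 = eval e s" "ok S W e s0" using agree_eval[OF WhileT.prems(2) WhileT.hyps(1)] WhileT.prems(1) by auto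
  have pr1: "prefix_of_F (gh s')" using prefix_of_F_lbig[OF WhileT.hyps(4)] WhileT.prems by auto
  have pr0: "prefix_of_F (gh s @ [Tick])" using prefix_of_F_lbig[OF WhileT.hyps(3)] pr1 by auto
  let ?s0 = "tick (elen e + 1) s0"
  have li: "linv (gh s) (w + (elen e + 1)) ?s0" by (rule linv_user[OF WhileT.prems(3), of _ "elen e + 1"]) auto
  obtain t where t: "big S W TICK ?s0 t" "linv (gh s @ [Tick]) (clen TICK) t"
    "\<forall>i<40. rg t i = rg ?s0 i" "\<forall>a<qb. mm t a = mm ?s0 a"
    using wp_TICK[OF li pr0] WhileT.prems unfolding wp_def by auto
  have ag: "agree t (logev Tick s)" using t(3,4) WhileT.prems(2) X by (auto simp: agree_def)
  obtain u where u: "big S W (lower c) t u" "agree u s'" "linv (gh s') (max (clen TICK + straight c) (clen (lower c))) u"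
    using WhileT.IH(1)[OF _ ag _ pr1, of "clen TICK"] t(2) WhileT.prems by auto
  have ag': "agree (tick 1 u) s'" using u(2) by (auto simp: agree_def)
  \<comment> \<open>Each iteration starts with a tick, which discards the time before it; so this
    value does not grow from one iteration to the next.\<close>
  define w' where "w' = max (clen TICK + straight c) (clen (lower c)) + 1"
  have li': "linv (gh s') w' (tick 1 u)" by (rule linv_user[OF u(3), of _ 1]) (auto simp: w'_def)
  have w': "w' + elen e + 1 \<le> clen (lower (While e c))" using straight_le[of c] by (auto simp: w'_def)
  obtain v where v: "big S W (lower (While e c)) (tick 1 u) v" "agree v s''"
    "linv (gh s'') (max (w' + straight (While e c)) (clen (lower (While e c)))) v"
    using WhileT.IH(2)[OF _ ag' li' WhileT.prems(4)] WhileT.prems w' by auto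
  have "big S W (lower (While e c)) s0 v" unfolding lower.simps
    by (rule big.WhileT[OF e(2) _ big.Seq[OF t(1) u(1)] v(1)[unfolded lower.simps]]) (use e WhileT in auto)
  moreover have "linv (gh s'') (max (w + straight (While e c)) (clen (lower (While e c)))) v"
    by (rule linv_user[OF v(3), of _ 0]) (use w' in auto)
  ultimately show ?case using v(2) by blast
next
  case (Enq e s)
  have e: "eval e s0 = eval e s" "ok S W e s0" using agree_eval[OF Enq.prems(2) Enq.hyps(1)] Enq.prems(1) by auto
  obtain t where t: "big S W (ENQ e) s0 t" "linv (gh s @ [decode (eval e s)]) (w + clen (ENQ e)) t"
    "\<forall>i<40. rg t i = rg s0 i" "\<forall>a<qb. mm t a = mm s0 a"
    using wp_ENQ[OF Enq.prems(3) _ _ e(2)] Enq.prems e unfolding wp_def by auto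
  have "agree t (logev (decode (eval e s)) s)" using t(3,4) Enq.prems(2) X by (auto simp: agree_def)
  moreover have "linv (gh s @ [decode (eval e s)]) (max (w + straight (Enq e)) (clen (lower (Enq e)))) t"
    by (rule linv_user[OF t(2), of _ 0]) auto
  ultimately show ?case using t(1) by auto
qed

section \<open>Emptying the queue at the end\<close>

text \<open>When the enumeration is complete, pending visits are released without waiting for ticks.
  The length added to the clock reserves time for one more round of the flushing loop.\<close>

definition finv :: "clock st \<Rightarrow> bool" where
  "finv s \<longleftrightarrow> (\<exists>dn qu. ops F = dn @ qu \<and> gp 0 dn = Some 0 \<and> qrep qu s \<and> rg s 44 = emits qu
     \<and> srep (stk [] dn) s \<and> map snd (snd (gh s)) = vis [] dn \<and> gaps_ok (times s) \<and>
     (if snd (gh s) = [] then fst (gh s) + clen (While (V 44) (EMIT 4)) \<le> c0 + Bd * (t0 + cc * (cap + 1)) + Bd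
      else fst (gh s) + clen (While (V 44) (EMIT 4)) \<le> last (times s) + Bd * (cc + 1)))"

lemma linv_finv:
  assumes inv: "linv F w s" and w: "w + clen (While (V 44) (EMIT 4)) \<le> Bd"
  shows "finv s"
proof -
  from inv obtain dn qu where i: "ops F = dn @ qu" "gp 0 dn = Some 0" "qrep qu s" "rg s 44 = emits qu"
    "emits qu \<le> cap" "srep (stk [] dn) s" "map snd (snd (gh s)) = vis [] dn" "rg s 45 = cap"
    "timing F (emits qu) w s" unfolding linv_def by blast
  have "if snd (gh s) = [] then fst (gh s) + clen (While (V 44) (EMIT 4)) \<le> c0 + Bd * (t0 + cc * (cap + 1)) + Bd
      else fst (gh s) + clen (While (V 44) (EMIT 4)) \<le> last (times s) + Bd * (cc + 1)"
  proof (cases "snd (gh s) = []")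
    case True
    then have c: "fst (gh s) \<le> c0 + Bd * ticks F + w" using i(9) by (auto simp: timing_def)
    have "emits dn = 0" using i(7) True length_vis[of "[]" dn] by simp
    then have "emits F \<le> cap" using i(5) emits_ops[of F] i(1) by simp
    then have "cc * emits F \<le> cc * (cap + 1)" by (intro mult_le_mono2) simp
    moreover have "ticks F \<le> t0 + cc * emits F" using amortized[of "[]" F "[]"] by simp
    ultimately have "Bd * ticks F \<le> Bd * (t0 + cc * (cap + 1))" by (intro mult_le_mono2) linarith
    then show ?thesis using True c w unfolding if_P[OF True] by linarith
  next
    case False
    then have c: "fst (gh s) \<le> last (times s) + Bd * rg s 47 + w" "rg s 47 < cc"
      using i(9) by (auto simp: timing_def)
    have "Bd * rg s 47 \<le> Bd * cc" using c(2) by simp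
    then have "fst (gh s) + clen (While (V 44) (EMIT 4)) \<le> last (times s) + (Bd * cc + Bd * 1)"
      using c(1) w by linarith
    then show ?thesis by (simp only: False if_False distrib_left)
  qed
  then show ?thesis using i unfolding finv_def timing_def by blast
qed

lemma prefix_F [simp]: "prefix_of_F F"
  by (simp add: prefix_of_F_def)

lemma wp_flush:
  assumes "finv s" "rg s 44 = m" and B: "2 * clen (While (V 44) (EMIT 4)) \<le> Bd"
  shows "\<exists>s'. big S W (While (V 44) (EMIT 4)) s s' \<and> map snd (snd (gh s')) = vis [] F \<and> gaps_ok (times s')
     \<and> (snd (gh s') \<noteq> [] \<longrightarrow> fst (gh s') \<le> last (times s') + Bd * (cc + 1))"
  using assms(1,2)
proof (induction m arbitrary: s)
  case 0
  from 0(1) obtain dn qu where i: "ops F = dn @ qu" "rg s 44 = emits qu"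
    "map snd (snd (gh s)) = vis [] dn" "gaps_ok (times s)"
    "snd (gh s) \<noteq> [] \<Longrightarrow> fst (gh s) + clen (While (V 44) (EMIT 4)) \<le> last (times s) + Bd * (cc + 1)"
    unfolding finv_def by (auto split: if_splits)
  have "vis (stk [] dn) qu = []" using i(2) 0(2) length_vis[of "stk [] dn" qu] by simp
  then have "vis [] F = vis [] dn" using vis_ops[of "[]" F] i(1) by simp
  moreover have "big S W (While (V 44) (EMIT 4)) s (tick (elen (V 44) + 1) s)"
    by (rule big.WhileF) (use 0 in auto)
  ultimately show ?case using i by (intro exI[of _ "tick (elen (V 44) + 1) s"]) auto
next
  case (Suc m)
  from Suc.prems(1) obtain dn qu where i: "ops F = dn @ qu" "gp 0 dn = Some 0" "qrep qu s" "rg s 44 = emits qu"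
    "srep (stk [] dn) s" "map snd (snd (gh s)) = vis [] dn" "gaps_ok (times s)"
    "if snd (gh s) = [] then fst (gh s) + clen (While (V 44) (EMIT 4)) \<le> c0 + Bd * (t0 + cc * (cap + 1)) + Bd
      else fst (gh s) + clen (While (V 44) (EMIT 4)) \<le> last (times s) + Bd * (cc + 1)"
    unfolding finv_def by blast
  define s1 where "s1 = tick (elen (V 44) + 1) s"
  have s1: "rg s1 = rg s" "snd (gh s1) = snd (gh s)" "qrep qu s1" "srep (stk [] dn) s1"
    "fst (gh s1) = fst (gh s) + (elen (V 44) + 1)" using i by (simp_all add: s1_def)
  have ne: "emits qu \<noteq> 0" using i(4) Suc.prems(2) by simp
  have "wp S W (EMIT 4) (\<lambda>s'. finv (tick 1 s') \<and> rg (tick 1 s') 44 = m) s1"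
  proof (rule wp_mono[OF wp_EMIT_pending[OF prefix_F i(1,2) s1(3) ne s1(4)]], goal_cases)
    case (3 s')
    then obtain dn' qu' A t' where f: "ops F = dn' @ qu'" "gp 0 dn' = Some 0" "qrep qu' s'"
       "srep (stk [] dn') s'" "map snd (snd (gh s')) = vis [] dn'" "emits qu' = emits qu - 1"
       "rg s' 44 = emits qu'" "snd (gh s') = snd (gh s1) @ [(t', A)]" "fst (gh s1) \<le> t'" "t' \<le> fst (gh s')"
       "fst (gh s') \<le> fst (gh s1) + clen (EMIT 4)" by blast
    have t'le: "t' \<le> fst (gh s) + clen (While (V 44) (EMIT 4))" using f(10,11) s1(5) by simp
    have g: "gaps_ok (times s')"
    proof (cases "snd (gh s) = []")
      case True
      then have "t' \<le> c0 + Bd * (t0 + cc * (cap + 1)) + Bd" using i(8) t'le by auto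
      then show ?thesis using f(8) s1(2) True by (simp add: gaps_ok_single)
    next
      case False
      then have "t' \<le> last (times s) + Bd * (cc + 1)" using i(8) t'le by auto
      then show ?thesis using gaps_ok_snoc[OF i(7)] False f(8) s1(2) by simp
    qed
    have l: "snd (gh s') \<noteq> []" "last (times s') = t'" using f(8) by auto
    have "fst (gh s') + 1 + clen (While (V 44) (EMIT 4)) \<le> t' + Bd * (cc + 1)"
      using f(9,11) B by simp
    note c = this
    have "finv (tick 1 s')" unfolding finv_def
      by (rule exI[of _ dn'], rule exI[of _ qu']) (use c f l g in simp)
    then show ?case using f(6,7) i(4) Suc.prems(2) by simp
  qed (use s1 i in auto)
  then obtain s' where s': "big S W (EMIT 4) s1 s'" "finv (tick 1 s')" "rg (tick 1 s') 44 = m"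
    unfolding wp_def by blast
  from Suc.IH[OF s'(2,3)] obtain s'' where s'': "big S W (While (V 44) (EMIT 4)) (tick 1 s') s''"
    "map snd (snd (gh s'')) = vis [] F" "gaps_ok (times s'')"
    "snd (gh s'') \<noteq> [] \<longrightarrow> fst (gh s'') \<le> last (times s'') + Bd * (cc + 1)" by blast
  have "big S W (While (V 44) (EMIT 4)) s s''"
    by (rule big.WhileT[OF _ _ s'(1)[unfolded s1_def] s''(1)]) (use Suc.prems in auto)
  then show ?case using s'' by blast
qed

end

section \<open>Traces of the recursive enumeration\<close>

text \<open>The \<open>Tick\<close> belongs to the loop iteration that enters the kid. The iteration
  that leaves it contributes the closing \<open>Tick\<close> of the kid's own trace, and the
  \<open>Pop\<close>.\<close>

fun blk :: "nat \<times> nat list \<times> ev list \<Rightarrow> ev list" where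
  "blk (c, P, u) = Tick # Push c # u @ [Pop]"

abbreviation kid :: "nat \<times> nat list \<times> ev list \<Rightarrow> nat \<times> nat list" where
  "kid z \<equiv> (fst z, fst (snd z))"

locale poset =
  fixes n :: nat and r :: "nat rel"
  assumes po: "partial_order_on {..<n} r"
begin

fun inc :: "nat list \<Rightarrow> nat" where
  "inc [] = 0"
| "inc (v # xs) = length (filter (incomparable r v) xs) + inc xs"

definition wf :: "nat list \<Rightarrow> bool" where
  "wf Q \<longleftrightarrow> distinct Q \<and> set Q \<subseteq> {..<n}"

text \<open>\<open>spine Q chs x\<close>: repeatedly removing longest chains from Q yields the recursive calls \<open>chs\<close>
  (the element added to the antichain, and the remaining candidates), those of the last chain
  first, in x steps.  Lists are reversed at each removal because the machine builds them back to
  front.\<close>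

inductive spine :: "nat list \<Rightarrow> (nat \<times> nat list) list \<Rightarrow> nat \<Rightarrow> bool" where
  Nil: "spine [] [] 0"
| chain: "Q \<noteq> [] \<Longrightarrow> longest_chain r (set Q) cs \<Longrightarrow> mset ds = mset cs \<Longrightarrow>
    spine (rev (filter (\<lambda>v. v \<notin> set ds) Q)) chs x \<Longrightarrow> y \<le> x + 6 * (1 + length Q + inc Q) \<Longrightarrow>
    spine Q (chs @ map (\<lambda>c. (c, rev (filter (incomparable r c) Q))) ds) y"

text \<open>\<open>node b Q t\<close>: t is the trace of a call with candidates Q that visits its antichain first
  (b true) or last (b false); b alternates along the recursion.\<close>

inductive node :: "bool \<Rightarrow> nat list \<Rightarrow> ev list \<Rightarrow> bool" where
  first: "spine Q (map kid zs) x \<Longrightarrow> (\<And>z. z \<in> set zs \<Longrightarrow> node False (fst (snd z)) (snd (snd z))) \<Longrightarrow>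
    node True Q (Emit # replicate x Tick @ concat (map blk zs) @ [Tick])"
| last: "spine Q (rev (map kid zs)) x \<Longrightarrow> (\<And>z. z \<in> set zs \<Longrightarrow> node True (fst (snd z)) (snd (snd z))) \<Longrightarrow>
    y \<le> x + length Q \<Longrightarrow> node False Q (replicate y Tick @ concat (map blk zs) @ [Tick, Emit])"

lemma refl_r: "v < n \<Longrightarrow> (v, v) \<in> r"
  using partial_order_onD(1)[OF po] by (auto simp: refl_on_def)

lemma longest_nonempty:
  assumes "longest_chain r (set Q) cs" "Q \<noteq> []"
  shows "cs \<noteq> []" "set cs \<subseteq> set Q"
proof -
  obtain v where "v \<in> set Q" using assms(2) by (cases Q) auto
  then have "chain_list r (set Q) [v]" by (simp add: chain_list_def)
  then have "length [v] \<le> length cs" using assms(1) unfolding longest_chain_def by blast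
  then show "cs \<noteq> []" by auto
  show "set cs \<subseteq> set Q" using assms(1) by (simp add: longest_chain_def chain_list_def)
qed

lemma longest_locale: "longest_chain r (set Q) cs \<Longrightarrow> wf Q \<Longrightarrow> longest {..<n} r (set Q) cs"
  using po by unfold_locales (auto simp: wf_def)

lemma wf_filter [simp]: "wf Q \<Longrightarrow> wf (rev (filter p Q))"
  by (auto simp: wf_def)

text \<open>Every candidate lies in exactly one of the removed chains and gives one kid.\<close>

lemma length_spine: "spine Q chs x \<Longrightarrow> wf Q \<Longrightarrow> length chs = length Q"
proof (induction rule: spine.induct)
  case (chain Q cs ds chs x y)
  interpret L: longest "{..<n}" r "set Q" cs by (rule longest_locale) fact+
  have d: "set ds = set cs" using chain.hyps(3) by (rule mset_eq_setD)
  have "length (filter (\<lambda>v. v \<in> set cs) Q) = card (set cs)"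
    using chain.prems L.csQ by (subst distinct_card[symmetric]) (auto simp: wf_def intro!: arg_cong[of _ _ card])
  then have "length (filter (\<lambda>v. v \<in> set cs) Q) = length ds"
    using L.dist chain.hyps(3) by (simp add: distinct_card flip: size_mset)
  then show ?case
    using chain sum_length_filter_compl[of "\<lambda>v. v \<in> set cs" Q] by (simp add: d)
qed simp

lemma spine_kid:
  "spine Q chs x \<Longrightarrow> wf Q \<Longrightarrow> (c, P) \<in> set chs \<Longrightarrow>
    wf P \<and> c \<in> set Q \<and> c \<notin> set P \<and> set P \<subseteq> set Q"
proof (induction rule: spine.induct)
  case (chain Q cs ds chs x y)
  have d: "set ds = set cs" using chain.hyps(3) by (rule mset_eq_setD)
  have cs: "set cs \<subseteq> set Q" using longest_nonempty chain.hyps by auto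
  have ne: "v < n \<Longrightarrow> \<not> incomparable r v v" for v using refl_r by (auto simp: incomparable_def)
  show ?case
  proof (cases "(c, P) \<in> set chs")
    case True then show ?thesis using chain.IH chain.prems by auto
  next
    case False
    then have "c \<in> set cs" "P = rev (filter (incomparable r c) Q)" using chain.prems d by auto
    then show ?thesis using chain.prems cs ne[of c] by (auto simp: wf_def)
  qed
qed simp

subsection \<open>Visited antichains\<close>

text \<open>The calls on \<open>P - set cs\<close> keep the antichain unchanged, and a spine is this
  recursion unrolled. If every unrolled invocation makes that call first, the visit of
  \<open>A\<close> by the innermost call on the empty set comes at the front; if every one makes it
  last, the visit comes at the end.\<close>

lemma spine_enumerate:
  assumes "spine Q chs x"
  shows "list_all2 (\<lambda>(c, P) Bs. enumerate_order r (set P) (insert c A) Bs) chs Ass \<Longrightarrow>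
      enumerate_order r (set Q) A (A # concat Ass)"
    and "list_all2 (\<lambda>(c, P) Bs. enumerate_order r (set P) (insert c A) Bs) (rev chs) Ass \<Longrightarrow>
      enumerate_order r (set Q) A (concat Ass @ [A])"
  using assms
proof (induction arbitrary: Ass rule: spine.induct)
  case Nil
  { case 1 then show ?case by (auto intro: enumerate_order.visit) }
  { case 2 then show ?case by (auto intro: enumerate_order.visit) }
next
  case (chain Q cs ds chs x y)
  let ?E = "\<lambda>(c, P) Bs. enumerate_order r (set P) (insert c A) Bs"
  let ?ks = "map (\<lambda>c. (c, rev (filter (incomparable r c) Q))) ds"
  let ?call = "\<lambda>(c, P). (set P, insert c A)"
  have d: "set ds = set cs" using chain.hyps(3) by (rule mset_eq_setD)
  have R: "set (rev (filter (\<lambda>v. v \<notin> set ds) Q)) = set Q - set cs" using d by auto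
  have calls: "map ?call ?ks = map (\<lambda>c. ({x \<in> set Q. incomparable r x c}, insert c A)) ds"
    by (auto simp: incomparable_commute)
  have ms: "mset (map ?call ?ks) = mset (map (\<lambda>c. ({x \<in> set Q. incomparable r x c}, insert c A)) cs)"
    unfolding calls mset_map chain.hyps(3) ..
  have l2: "list_all2 (\<lambda>call Bs. enumerate_order r (fst call) (snd call) Bs) (map ?call ks) Bss"
    if "list_all2 ?E ks Bss" for ks Bss
    using that by (auto simp: list_all2_map1 split_def)
  have ne: "set Q \<noteq> {}" using chain.hyps(1) by simp
  { case 1
    then obtain A1 A2 where a: "Ass = A1 @ A2" "list_all2 ?E chs A1" "list_all2 ?E ?ks A2"
      by (auto simp: list_all2_append1)
    have "enumerate_order r (set Q) A (concat ((A # concat A1) # A2))"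
    proof (rule enumerate_order.branch[OF ne chain.hyps(2)])
      show "mset ((set Q - set cs, A) # map ?call ?ks) = mset (map (\<lambda>c. ({x \<in> set Q. incomparable r x c}, insert c A)) cs
                        @ [(set Q - set cs, A)])" using ms by simp
      show "list_all2 (\<lambda>call Bs. enumerate_order r (fst call) (snd call) Bs)
          ((set Q - set cs, A) # map ?call ?ks) ((A # concat A1) # A2)"
        using l2[OF a(3)] chain.IH(1)[OF a(2)] unfolding R by simp
    qed
    then show ?case using a(1) by simp }
  { case 2
    then obtain A1 A2 where a: "Ass = A2 @ A1" "list_all2 ?E (rev chs) A1" "list_all2 ?E (rev ?ks) A2"
      by (auto simp: list_all2_append1)
    have "enumerate_order r (set Q) A (concat (A2 @ [concat A1 @ [A]]))"
    proof (rule enumerate_order.branch[OF ne chain.hyps(2)])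
      show "mset (map ?call (rev ?ks) @ [(set Q - set cs, A)]) = mset (map (\<lambda>c. ({x \<in> set Q. incomparable r x c}, insert c A)) cs
                        @ [(set Q - set cs, A)])" using ms by (simp add: rev_map[symmetric])
      show "list_all2 (\<lambda>call Bs. enumerate_order r (fst call) (snd call) Bs)
          (map ?call (rev ?ks) @ [(set Q - set cs, A)]) (A2 @ [concat A1 @ [A]])"
        using l2[OF a(3)] chain.IH(2)[OF a(2)] unfolding R by (intro list_all2_appendI) auto
    qed
    then show ?case using a(1) by simp }
qed

lemma stk_Ticks [simp]: "stk A (replicate x Tick) = A" and vis_Ticks [simp]: "vis A (replicate x Tick) = []"
  by (induction x) auto

lemma vis_blocks:
  assumes "\<And>z A. z \<in> set zs \<Longrightarrow> stk A (snd (snd z)) = A \<and>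
      enumerate_order r (set (fst (snd z))) (set A) (vis A (snd (snd z)))"
  shows "stk A (concat (map blk zs)) = A \<and> (\<exists>Ass. vis A (concat (map blk zs)) = concat Ass \<and>
     list_all2 (\<lambda>(c, P) Bs. enumerate_order r (set P) (insert c (set A)) Bs) (map kid zs) Ass)"
  using assms
proof (induction zs)
  case (Cons z zs)
  obtain c P u where z: "z = (c, P, u)" by (cases z) auto
  have u: "stk B u = B" "enumerate_order r (set P) (set B) (vis B u)" for B
    using Cons.prems[of z B] z by auto
  obtain Ass where "stk A (concat (map blk zs)) = A" "vis A (concat (map blk zs)) = concat Ass"
     "list_all2 (\<lambda>(c, P) Bs. enumerate_order r (set P) (insert c (set A)) Bs) (map kid zs) Ass"
    using Cons by auto
  then show ?case using u[of "A @ [c]"] z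
    by (auto intro!: exI[of _ "vis (A @ [c]) u # Ass"])
qed auto

theorem node_enumerate:
  assumes "node b Q t"
  shows "stk A t = A \<and> enumerate_order r (set Q) (set A) (vis A t)"
  using assms
proof (induction arbitrary: A rule: node.induct)
  case (first Q zs x)
  obtain Ass where "stk A (concat (map blk zs)) = A" "vis A (concat (map blk zs)) = concat Ass"
     "list_all2 (\<lambda>(c, P) Bs. enumerate_order r (set P) (insert c (set A)) Bs) (map kid zs) Ass"
    using vis_blocks[of zs A] first.IH by blast
  then show ?case using spine_enumerate(1)[OF first.hyps(1)] by auto
next
  case (last Q zs x y)
  obtain Ass where "stk A (concat (map blk zs)) = A" "vis A (concat (map blk zs)) = concat Ass"
     "list_all2 (\<lambda>(c, P) Bs. enumerate_order r (set P) (insert c (set A)) Bs) (map kid zs) Ass"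
    using vis_blocks[of zs A] last.IH by blast
  then show ?case using spine_enumerate(2)[OF last.hyps(1), of "set A" Ass] by auto
qed

lemma gp_Ticks [simp]: "gp k (replicate x Tick @ t) = gp k t" "gp k (replicate x Tick) = Some k"
  by (induction x) auto

text \<open>A call that visits first accepts every state and returns with at most one pending
  operation, the \<open>Pop\<close> of its last kid. A call that visits last returns with none, but
  needs room for one push on entry. The extreme cases between two visits are a pop followed by two
  pushes, and two pops followed by a push.\<close>

lemma node_gp:
  assumes "node b Q t"
  shows "if b then (\<forall>k. \<exists>j\<le>1. gp k t = Some j) else (\<forall>k\<le>2. gp k t = Some 0)"
  using assms
proof (induction rule: node.induct)
  case (first Q zs x)
  have "k \<le> 1 \<Longrightarrow> \<exists>j\<le>1. gp k (concat (map blk zs)) = Some j" for k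
    using first.IH
  proof (induction zs arbitrary: k)
    case (Cons z zs)
    obtain c P u where z: "z = (c, P, u)" by (cases z) auto
    have "gp (Suc k) u = Some 0" using Cons.prems(1) Cons.prems(2)[of z] z by auto
    then show ?case using Cons.prems Cons.IH[of 1] by (auto simp: z gp_append)
  qed auto
  from this[of 0] show ?case by (auto simp: gp_append)
next
  case (last Q zs x y)
  have "k \<le> 2 \<Longrightarrow> \<exists>j\<le>2. gp k (concat (map blk zs)) = Some j" for k
    using last.IH
  proof (induction zs arbitrary: k)
    case (Cons z zs)
    obtain c P u where z: "z = (c, P, u)" by (cases z) auto
    obtain j where "j \<le> 1" "gp (Suc k) u = Some j" using Cons.prems(2)[of z] z by auto
    then show ?case using Cons.prems Cons.IH[of "Suc j"] by (auto simp: z gp_append)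
  qed auto
  then show ?case by (fastforce simp: gp_append)
qed

lemma okst_Ticks [simp]: "okst m A (replicate x Tick)"
  by (induction x) auto

lemma node_okst:
  assumes "node b Q t" "wf Q" "set A \<inter> set Q = {}"
  shows "okst n A t"
proof -
  have blocks: "okst n A (concat (map blk zs))"
    if "\<And>z A. z \<in> set zs \<Longrightarrow> wf (fst (snd z)) \<Longrightarrow> set A \<inter> set (fst (snd z)) = {} \<Longrightarrow> okst n A (snd (snd z))"
      "\<And>z. z \<in> set zs \<Longrightarrow> node b' (fst (snd z)) (snd (snd z))"
      "spine Q chs x" "set (map kid zs) \<subseteq> set chs" "wf Q" "set A \<inter> set Q = {}" for zs A Q chs x b'
    using that(1,2,4)
  proof (induction zs)
    case (Cons z zs)
    obtain c P u where z: "z = (c, P, u)" by (cases z) auto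
    have k: "wf P" "c \<in> set Q" "c \<notin> set P" "set P \<subseteq> set Q"
      using spine_kid[OF that(3,5), of c P] Cons.prems(3) z by auto
    have "okst n (A @ [c]) u" using Cons.prems(1)[of z "A @ [c]"] z k that(6) by auto
    moreover have "stk (A @ [c]) u = A @ [c]" using node_enumerate Cons.prems(2)[of z] z by auto
    moreover have "c < n" "c \<notin> set A" using k(2) that(5,6) by (auto simp: wf_def)
    ultimately show ?case using Cons z by auto
  qed auto
  show ?thesis using assms
  proof (induction arbitrary: A rule: node.induct)
    case (first Q zs x)
    have "okst n A (concat (map blk zs))"
      by (rule blocks[of zs False Q "map kid zs" x]) (use first in auto)
    then show ?case by auto
  next
    case (last Q zs x y)
    have "okst n A (concat (map blk zs))"
      by (rule blocks[of zs True Q "rev (map kid zs)" x]) (use last in auto)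
    then show ?case by auto
  qed
qed

text \<open>An antichain avoids the chain or contains some element \<open>c\<close> of it, and then
  its other elements form an antichain among those incomparable to \<open>c\<close>.\<close>

lemma enumerate_order_set:
  assumes "enumerate_order r P A As"
  shows "set As = (\<lambda>B. A \<union> B) ` antichains P r"
  using assms
proof (induction rule: enumerate_order.induct)
  case (visit A)
  then show ?case by (auto simp: antichains_def)
next
  case (branch P cs calls A Ass)
  have "set (concat Ass) = (\<Union>call\<in>set calls. (\<lambda>B. snd call \<union> B) ` antichains (fst call) r)"
    using branch.IH by (induction calls Ass rule: list_all2_induct) auto
  also have "set calls = set (map (\<lambda>c. ({x \<in> P. incomparable r x c}, insert c A)) cs @ [(P - set cs, A)])"
    using branch.hyps(3) by (rule mset_eq_setD)
  also have "(\<Union>call\<in>\<dots>. (\<lambda>B. snd call \<union> B) ` antichains (fst call) r) = (\<lambda>B. A \<union> B) ` antichains P r"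
    (is "?L = ?R")
  proof
    have csP: "set cs \<subseteq> P" using branch.hyps(2) by (simp add: longest_chain_def chain_list_def)
    show "?L \<subseteq> ?R"
    proof
      fix X assume "X \<in> ?L"
      then consider c B where "c \<in> set cs" "B \<in> antichains {x \<in> P. incomparable r x c} r" "X = insert c A \<union> B"
        | B where "B \<in> antichains (P - set cs) r" "X = A \<union> B" by auto
      then show "X \<in> ?R"
      proof cases
        case 1
        then have "insert c B \<in> antichains P r" using csP
          by (auto simp: antichains_def incomparable_def)
        then show ?thesis using 1(3) by (auto intro!: image_eqI[of _ _ "insert c B"])
      next
        case 2
        then show ?thesis by (auto simp: antichains_def)
      qed
    qed
    show "?R \<subseteq> ?L"
    proof
      fix X assume "X \<in> ?R"
      then obtain B where B: "B \<in> antichains P r" "X = A \<union> B" by auto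
      show "X \<in> ?L"
      proof (cases "B \<inter> set cs = {}")
        case True
        then have "B \<in> antichains (P - set cs) r" using B by (auto simp: antichains_def)
        then show ?thesis using B by auto
      next
        case False
        then obtain c where c: "c \<in> B" "c \<in> set cs" by auto
        then have "B - {c} \<in> antichains {x \<in> P. incomparable r x c} r" using B by (auto simp: antichains_def)
        moreover have "X = insert c A \<union> (B - {c})" using B c by auto
        ultimately show ?thesis using c by auto
      qed
    qed
  qed
  finally show ?case .
qed

subsection \<open>Counting\<close>

abbreviation ac :: "nat list \<Rightarrow> nat set set" where "ac Q \<equiv> antichains (set Q) r"

definition cnt :: "nat list \<Rightarrow> nat" where "cnt Q = card (ac Q)"
definition small :: "nat list \<Rightarrow> nat" where "small Q = card {B \<in> ac Q. card B \<le> 4}"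
text \<open>In the tree of calls an antichain is reached through one call for each prefix of its
  insertion order. Those from which at most four of its elements are still missing count it in their
  \<open>small\<close>, and there are at most five of them. So this is the sum of
  \<open>small\<close> over all calls below, as \<open>prefixes_spine\<close> confirms level by
  level.\<close>

definition prefixes :: "nat list \<Rightarrow> nat" where "prefixes Q = (\<Sum>B\<in>ac Q. min 5 (Suc (card B)))"

lemma finite_ac [simp]: "finite (ac Q)"
  by (rule finite_subset[of _ "Pow (set Q)"]) (auto simp: antichains_def)

lemma ac_finite: "B \<in> ac Q \<Longrightarrow> finite B"
  by (auto simp: antichains_def intro: finite_subset)

lemma ac_mono: "set P \<subseteq> set Q \<Longrightarrow> ac P \<subseteq> ac Q"
  by (auto simp: antichains_def)

lemma empty_ac [simp]: "{} \<in> ac Q"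
  by (auto simp: antichains_def)

lemma cnt_mono: "set P \<subseteq> set Q \<Longrightarrow> cnt P \<le> cnt Q"
  unfolding cnt_def by (intro card_mono ac_mono) auto

lemma small_le_cnt: "small Q \<le> cnt Q"
  unfolding small_def cnt_def by (intro card_mono) auto

lemma prefixes_le: "prefixes Q \<le> 5 * cnt Q"
  unfolding prefixes_def cnt_def
  by (rule order_trans[OF sum_mono[of _ _ "\<lambda>_. 5"]]) auto

lemma small_sum: "small Q = (\<Sum>B\<in>ac Q. if card B \<le> 4 then 1 else 0)"
proof -
  have "{B \<in> ac Q. card B \<le> 4} = ac Q \<inter> {B. card B \<le> 4}" by auto
  then show ?thesis unfolding small_def by (simp add: sum.If_cases)
qed

text \<open>A nonempty antichain belongs to exactly one kid: its element on the first removed chain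
  that it meets.\<close>

lemma spine_sum:
  fixes h :: "nat set \<Rightarrow> nat"
  assumes "spine Q chs x" "wf Q"
  shows "(\<Sum>B\<in>ac Q. h B) = h {} + (\<Sum>(c, P)\<leftarrow>chs. \<Sum>B\<in>ac P. h (insert c B))"
  using assms
proof (induction rule: spine.induct)
  case Nil
  have "antichains {} r = {{}}" by (auto simp: antichains_def)
  then show ?case by simp
next
  case (chain Q cs ds chs x y)
  interpret L: longest "{..<n}" r "set Q" cs by (rule longest_locale) fact+
  define R where "R = rev (filter (\<lambda>v. v \<notin> set ds) Q)"
  define K where "K = (\<lambda>c. rev (filter (incomparable r c) Q))"
  have d: "set ds = set cs" using chain.hyps(3) by (rule mset_eq_setD)
  have dd: "distinct ds" using L.dist chain.hyps(3) by (metis mset_eq_imp_distinct_iff)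
  have Rs: "set R = set Q - set cs" using d by (auto simp: R_def)
  have nK: "c \<notin> set (K c)" if "c \<in> set cs" for c
    using L.refl_r[of c] L.csQ that by (auto simp: K_def incomparable_def)
  have split: "ac Q = ac R \<union> (\<Union>c\<in>set cs. insert c ` ac (K c))"
  proof
    show "ac Q \<subseteq> ac R \<union> (\<Union>c\<in>set cs. insert c ` ac (K c))"
    proof
      fix B assume B: "B \<in> ac Q"
      show "B \<in> ac R \<union> (\<Union>c\<in>set cs. insert c ` ac (K c))"
      proof (cases "B \<inter> set cs = {}")
        case True then show ?thesis using B Rs by (auto simp: antichains_def)
      next
        case False
        then obtain c where c: "c \<in> B" "c \<in> set cs" by auto
        then have "B - {c} \<in> ac (K c)" using B by (auto simp: antichains_def K_def)
        moreover have "B = insert c (B - {c})" using c by auto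
        ultimately show ?thesis using c by blast
      qed
    qed
    have "ac R \<subseteq> ac Q" using Rs by (intro ac_mono) auto
    moreover have "insert c ` ac (K c) \<subseteq> ac Q" if "c \<in> set cs" for c
      using that L.csQ by (auto simp: antichains_def K_def incomparable_def)
    ultimately show "ac R \<union> (\<Union>c\<in>set cs. insert c ` ac (K c)) \<subseteq> ac Q" by auto
  qed
  have "(\<Sum>B\<in>ac Q. h B) = (\<Sum>B\<in>ac R. h B) + (\<Sum>B\<in>(\<Union>c\<in>set cs. insert c ` ac (K c)). h B)"
    unfolding split
  proof (rule sum.union_disjoint)
    show "ac R \<inter> (\<Union>c\<in>set cs. insert c ` ac (K c)) = {}" using Rs by (auto simp: antichains_def)
  qed auto
  also have "(\<Sum>B\<in>(\<Union>c\<in>set cs. insert c ` ac (K c)). h B) = (\<Sum>c\<in>set cs. \<Sum>B\<in>insert c ` ac (K c). h B)"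
  proof (rule sum.UNION_disjoint)
    show "\<forall>c\<in>set cs. \<forall>d\<in>set cs. c \<noteq> d \<longrightarrow> insert c ` ac (K c) \<inter> insert d ` ac (K d) = {}"
    proof (intro ballI impI)
      fix c c' assume c: "c \<in> set cs" "c' \<in> set cs" "c \<noteq> c'"
      have "insert c B \<noteq> insert c' B'" if "B \<in> ac (K c)" "B' \<in> ac (K c')" for B B'
      proof
        assume "insert c B = insert c' B'"
        then have "c' \<in> B" using c(3) by auto
        moreover have "insert c B \<in> ac Q" using split c(1) that(1) by blast
        ultimately show False using L.chain_inter[of "insert c B" c c'] c by auto
      qed
      then show "insert c ` ac (K c) \<inter> insert c' ` ac (K c') = {}" by blast
    qed
  qed auto
  also have "\<dots> = (\<Sum>c\<in>set cs. \<Sum>B\<in>ac (K c). h (insert c B))"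
  proof (rule sum.cong[OF refl])
    fix c assume c: "c \<in> set cs"
    have "inj_on (insert c) (ac (K c))"
    proof (rule inj_onI)
      fix B B' assume b: "B \<in> ac (K c)" "B' \<in> ac (K c)" "insert c B = insert c B'"
      then have "c \<notin> B" "c \<notin> B'" using nK[OF c] by (auto simp: antichains_def)
      then show "B = B'" using b(3) by auto
    qed
    then show "(\<Sum>B\<in>insert c ` ac (K c). h B) = (\<Sum>B\<in>ac (K c). h (insert c B))" by (simp add: sum.reindex)
  qed
  also have "\<dots> = (\<Sum>c\<leftarrow>ds. \<Sum>B\<in>ac (K c). h (insert c B))"
    unfolding d[symmetric] by (rule sum.distinct_set_conv_list[OF dd])
  finally have eq: "(\<Sum>B\<in>ac Q. h B) = (\<Sum>B\<in>ac R. h B) + (\<Sum>c\<leftarrow>ds. \<Sum>B\<in>ac (K c). h (insert c B))" .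
  have "(\<Sum>B\<in>ac R. h B) = h {} + (\<Sum>(c, P)\<leftarrow>chs. \<Sum>B\<in>ac P. h (insert c B))"
    using chain.IH chain.prems by (simp add: R_def)
  then show ?case using eq by (simp add: K_def comp_def)
qed

lemma cnt_spine: "spine Q chs x \<Longrightarrow> wf Q \<Longrightarrow> cnt Q = 1 + (\<Sum>(c, P)\<leftarrow>chs. cnt P)"
  using spine_sum[of Q chs x "\<lambda>_. 1"] by (simp add: cnt_def)

lemma prefixes_spine:
  assumes "spine Q chs x" "wf Q"
  shows "prefixes Q = small Q + (\<Sum>(c, P)\<leftarrow>chs. prefixes P)"
proof -
  have c: "card (insert c B) = Suc (card B)" if "(c, P) \<in> set chs" "B \<in> ac P" for c P B
  proof -
    have "c \<notin> B" using spine_kid[OF assms that(1)] that(2) by (auto simp: antichains_def)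
    then show ?thesis using ac_finite[OF that(2)] by simp
  qed
  have "prefixes Q = 1 + (\<Sum>(c, P)\<leftarrow>chs. \<Sum>B\<in>ac P. min 5 (Suc (card (insert c B))))"
    unfolding prefixes_def using spine_sum[OF assms, of "\<lambda>B. min 5 (Suc (card B))"] by simp
  also have "(\<Sum>(c, P)\<leftarrow>chs. \<Sum>B\<in>ac P. min 5 (Suc (card (insert c B))))
     = (\<Sum>(c, P)\<leftarrow>chs. (\<Sum>B\<in>ac P. if card (insert c B) \<le> 4 then 1 else 0) + prefixes P)"
  proof (rule arg_cong[of _ _ sum_list], rule map_cong[OF refl], clarify)
    fix c P assume a: "(c, P) \<in> set chs"
    show "(\<Sum>B\<in>ac P. min 5 (Suc (card (insert c B)))) =
      (\<Sum>B\<in>ac P. if card (insert c B) \<le> 4 then 1 else 0) + prefixes P"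
      unfolding prefixes_def sum.distrib[symmetric] by (rule sum.cong) (auto simp: c[OF a])
  qed
  also have "\<dots> = (\<Sum>(c, P)\<leftarrow>chs. (\<Sum>B\<in>ac P. if card (insert c B) \<le> 4 then 1 else 0)) + (\<Sum>(c, P)\<leftarrow>chs. prefixes P)"
    by (simp add: sum_list_addf split_def)
  also have "1 + \<dots> = small Q + (\<Sum>(c, P)\<leftarrow>chs. prefixes P)"
    unfolding small_sum using spine_sum[OF assms, of "\<lambda>B. if card B \<le> 4 then 1 else 0"] by simp
  finally show ?thesis .
qed

lemma inc_pairs: "wf Q \<Longrightarrow> 2 * inc Q = card {(u, v). u \<in> set Q \<and> v \<in> set Q \<and> incomparable r u v}"
proof (induction Q)
  case (Cons v xs)
  define I where "I = set (filter (incomparable r v) xs)"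
  define D where "D = {(u, w). u \<in> set xs \<and> w \<in> set xs \<and> incomparable r u w}"
  have v: "v \<notin> set xs" "v < n" "distinct xs" "wf xs" using Cons.prems by (auto simp: wf_def)
  have "\<not> incomparable r v v" using refl_r[OF v(2)] by (simp add: incomparable_def)
  then have "{(u, w). u \<in> set (v # xs) \<and> w \<in> set (v # xs) \<and> incomparable r u w}
      = D \<union> ({v} \<times> I \<union> I \<times> {v})"
    by (auto simp: D_def I_def incomparable_commute)
  moreover have "card (D \<union> ({v} \<times> I \<union> I \<times> {v})) = card D + (card I + card I)"
  proof -
    have fD: "finite D" by (rule finite_subset[of _ "set xs \<times> set xs"]) (auto simp: D_def)
    have "card ({v} \<times> I \<union> I \<times> {v}) = card I + card I"
      by (subst card_Un_disjoint) (use v in \<open>auto simp: I_def card_cartesian_product\<close>)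
    moreover have "card (D \<union> ({v} \<times> I \<union> I \<times> {v})) = card D + card ({v} \<times> I \<union> I \<times> {v})"
      by (rule card_Un_disjoint) (use v fD in \<open>auto simp: I_def D_def\<close>)
    ultimately show ?thesis by simp
  qed
  moreover have "card I = length (filter (incomparable r v) xs)"
    unfolding I_def by (rule distinct_card) (use v in simp)
  ultimately show ?case using Cons.IH[OF v(4)] by (simp add: D_def)
qed simp

lemma inc_two: "wf Q \<Longrightarrow> inc Q = card {B \<in> ac Q. card B = 2}"
proof (induction Q)
  case Nil
  have "antichains {} r = {{}}" by (auto simp: antichains_def)
  then show ?case by (auto intro!: card_eq_0_iff[THEN iffD2, symmetric])
next
  case (Cons v xs)
  define I where "I = set (filter (incomparable r v) xs)"
  have v: "v \<notin> set xs" "distinct xs" "wf xs" using Cons.prems by (auto simp: wf_def)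
  have eq: "{B \<in> ac (v # xs). card B = 2} = {B \<in> ac xs. card B = 2} \<union> (\<lambda>u. {v, u}) ` I"
  proof
    show "{B \<in> ac (v # xs). card B = 2} \<subseteq> {B \<in> ac xs. card B = 2} \<union> (\<lambda>u. {v, u}) ` I"
    proof
      fix B assume B: "B \<in> {B \<in> ac (v # xs). card B = 2}"
      then obtain a b where ab: "B = {a, b}" "a \<noteq> b" by (auto simp: card_2_iff)
      show "B \<in> {B \<in> ac xs. card B = 2} \<union> (\<lambda>u. {v, u}) ` I"
        using B ab by (auto simp: antichains_def I_def)
    qed
    have "card {v, u} = 2" if "u \<in> set xs" for u using that v(1) by (cases "u = v") auto
    then show "{B \<in> ac xs. card B = 2} \<union> (\<lambda>u. {v, u}) ` I \<subseteq> {B \<in> ac (v # xs). card B = 2}"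
      by (auto simp: antichains_def I_def incomparable_def)
  qed
  have "card ({B \<in> ac xs. card B = 2} \<union> (\<lambda>u. {v, u}) ` I) = card {B \<in> ac xs. card B = 2} + card ((\<lambda>u. {v, u}) ` I)"
    by (rule card_Un_disjoint) (use v in \<open>auto simp: antichains_def I_def\<close>)
  moreover have "card ((\<lambda>u. {v, u}) ` I) = card I"
    by (rule card_image) (use v in \<open>auto simp: inj_on_def doubleton_eq_iff I_def\<close>)
  moreover have "card I = length (filter (incomparable r v) xs)"
    unfolding I_def by (rule distinct_card) (use v in simp)
  ultimately show ?case using Cons.IH[OF v(3)] eq by simp
qed

text \<open>The empty set, the singletons and the incomparable pairs are small antichains.\<close>

lemma size_le_small:
  assumes "wf Q"
  shows "1 + length Q + inc Q \<le> small Q"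
proof -
  have 1: "card ((\<lambda>v. {v}) ` set Q) = length Q"
    using assms by (subst card_image) (auto simp: wf_def distinct_card)
  let ?A = "{{}} :: nat set set" and ?B = "(\<lambda>v. {v}) ` set Q" and ?C = "{B \<in> ac Q. card B = 2}"
  have "card (?A \<union> ?B \<union> ?C) = card (?A \<union> ?B) + card ?C"
    by (rule card_Un_disjoint) auto
  moreover have "card (?A \<union> ?B) = card ?A + card ?B"
    by (rule card_Un_disjoint) auto
  ultimately have "1 + length Q + inc Q = card (?A \<union> ?B \<union> ?C)"
    using 1 inc_two[OF assms] by simp
  moreover have "card (?A \<union> ?B \<union> ?C) \<le> small Q" unfolding small_def
    by (rule card_mono) (auto simp: antichains_def)
  ultimately show ?thesis by simp
qed

text \<open>All of \<open>small_meeting\<close> is lost with the chain. For the constant, the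
  elements and the incomparable pairs, each lost antichain pays at most 6 + 6 + 3 * 441 = 1335 ticks
  of the next extraction. The constant is covered because a nonempty rest implies that some
  antichain is lost.\<close>

lemma small_remove:
  assumes "wf Q" "longest_chain r (set Q) cs" "set R = set Q - set cs" "wf R" "R \<noteq> []"
  shows "6 * (1 + length R + inc R) + 1338 * small R \<le> 1338 * small Q"
proof -
  interpret L: longest "{..<n}" r "set Q" cs by (rule longest_locale) fact+
  define F where "F = small_meeting r (set Q) (set cs)"
  have lR: "length R = card (set R)" using assms(4) by (simp add: wf_def distinct_card)
  have 1: "length R \<le> card F" using L.card_R_le lR assms(3) by (simp add: F_def)
  have "2 * inc R = card {(u, v). u \<in> set Q - set cs \<and> v \<in> set Q - set cs \<and> incomparable r u v}"
    using inc_pairs[OF assms(4)] assms(3) by simp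
  then have 2: "2 * inc R \<le> 441 * card F" using L.card_incomparable_le by (simp add: F_def)
  have 3: "1 \<le> card F" using 1 assms(5) by (cases R) auto
  have "small R + card F = card ({B \<in> ac R. card B \<le> 4} \<union> F)"
    unfolding small_def
    by (rule card_Un_disjoint[symmetric]) (use L.finF assms(3) in \<open>auto simp: F_def small_meeting_def antichains_def\<close>)
  also have "\<dots> \<le> small Q" unfolding small_def
    by (rule card_mono) (use assms(3) in \<open>auto simp: F_def small_meeting_def antichains_def\<close>)
  finally have 4: "small R + card F \<le> small Q" .
  have "6 * (1 + length R + inc R) \<le> 1338 * card F" using 1 2 3 by simp
  then show ?thesis using 4 by simp
qed

text \<open>A potential argument: the extraction on the rest is paid by the drop of
  \<open>small\<close>, and only the first extraction remains unpaid. The 1338 on the left is the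
  share of the empty antichain, which is never lost.\<close>

lemma spine_cost:
  assumes "spine Q chs x" "wf Q"
  shows "x + 1338 \<le> 6 * (1 + length Q + inc Q) + 1338 * small Q"
  using assms
proof (induction rule: spine.induct)
  case Nil
  have "1 \<le> small []" using size_le_small[of "[]"] by (simp add: wf_def)
  then show ?case by simp
next
  case (chain Q cs ds chs x y)
  let ?R = "rev (filter (\<lambda>v. v \<notin> set ds) Q)"
  have d: "set ds = set cs" using chain.hyps(3) by (rule mset_eq_setD)
  have s1: "1 \<le> small Q" using size_le_small[OF chain.prems] by simp
  show ?case
  proof (cases "?R = []")
    case True
    then have "x = 0" using chain.hyps(4) by (auto elim: spine.cases)
    then show ?thesis using chain.hyps(5) s1 by linarith
  next
    case False
    have "6 * (1 + length ?R + inc ?R) + 1338 * small ?R \<le> 1338 * small Q"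
      by (rule small_remove[OF chain.prems chain.hyps(2) _ _ False]) (use d chain.prems in auto)
    moreover have "x + 1338 \<le> 6 * (1 + length ?R + inc ?R) + 1338 * small ?R"
      using chain.IH chain.prems by simp
    ultimately show ?thesis using chain.hyps(5) by linarith
  qed
qed

definition q where "q = card (incomparable_pairs {..<n} r)"

lemma inc_le_q:
  assumes "wf Q" shows "inc Q \<le> q"
proof -
  have "finite (antichains {..<n} r)"
    by (rule finite_subset[of _ "Pow {..<n}"]) (auto simp: antichains_def)
  then show ?thesis unfolding inc_two[OF assms] q_def incomparable_pairs_def
    by (intro card_mono) (use assms in \<open>auto simp: wf_def antichains_def\<close>)
qed

lemma length_le_n: "wf Q \<Longrightarrow> length Q \<le> n"
  using length_le_if_distinct by (auto simp: wf_def)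

text \<open>Each removal takes at least one element. Unlike the previous bound this one does not
  involve the number of antichains; it limits the additive terms, and through them the size of the
  queue.\<close>

lemma spine_cost_max:
  assumes "spine Q chs x" "wf Q"
  shows "x \<le> length Q * (6 * (1 + n + q))"
  using assms
proof (induction rule: spine.induct)
  case (chain Q cs ds chs x y)
  let ?R = "rev (filter (\<lambda>v. v \<notin> set ds) Q)"
  have d: "set ds = set cs" using chain.hyps(3) by (rule mset_eq_setD)
  obtain c where c: "c \<in> set cs" "c \<in> set Q"
    using longest_nonempty[OF chain.hyps(2,1)] by (cases cs) auto
  have "length (filter (\<lambda>v. v \<notin> set ds) Q) < length Q"
    using c d by (intro length_filter_less) auto
  then have "length ?R + 1 \<le> length Q" by simp
  then have "(length ?R + 1) * (6 * (1 + n + q)) \<le> length Q * (6 * (1 + n + q))" by (rule mult_le_mono1)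
  moreover have "x \<le> length ?R * (6 * (1 + n + q))" using chain.IH chain.prems by simp
  moreover have "6 * (1 + length Q + inc Q) \<le> 6 * (1 + n + q)"
    using length_le_n[OF chain.prems] inc_le_q[OF chain.prems] by simp
  ultimately show ?case using chain.hyps(5) by (simp add: algebra_simps)
qed simp

subsection \<open>Amortization\<close>

text \<open>The balance of a piece of trace: ticks spent minus ticks granted by its visits.\<close>

definition wt :: "ev list \<Rightarrow> int" where
  "wt t = int (ticks t) - int (cc * emits t)"

text \<open>Bounds on prefixes, suffixes and factors compose under concatenation, as in the
  divide-and-conquer solution of the maximum segment sum problem; bounds on factors alone would
  not.\<close>

definition pre_le :: "ev list \<Rightarrow> int \<Rightarrow> bool" where
  "pre_le t b \<longleftrightarrow> (\<forall>x y. t = x @ y \<longrightarrow> wt x \<le> b)"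
definition suf_le :: "ev list \<Rightarrow> int \<Rightarrow> bool" where
  "suf_le t b \<longleftrightarrow> (\<forall>x y. t = x @ y \<longrightarrow> wt y \<le> b)"
definition inf_le :: "ev list \<Rightarrow> int \<Rightarrow> bool" where
  "inf_le t b \<longleftrightarrow> (\<forall>x y z. t = x @ y @ z \<longrightarrow> wt y \<le> b)"

lemma wt_simps [simp]: "wt [] = 0" "wt (x @ y) = wt x + wt y" "wt (Tick # t) = 1 + wt t"
  "wt (Emit # t) = wt t - int cc" "wt (Push v # t) = wt t" "wt (Pop # t) = wt t" "wt (replicate k Tick) = int k"
proof -
  have "ticks (replicate k Tick) = k" "emits (replicate k Tick) = 0" by (induction k) auto
  then show "wt (replicate k Tick) = int k" by (simp add: wt_def)
qed (auto simp: wt_def algebra_simps)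

lemma pre_le_append:
  assumes "pre_le a m" "pre_le b k" "wt a + k \<le> m" shows "pre_le (a @ b) m"
  using assms unfolding pre_le_def by (fastforce simp: append_eq_append_conv2)

lemma suf_le_append:
  assumes "suf_le b m" "suf_le a k" "k + wt b \<le> m" shows "suf_le (a @ b) m"
  using assms unfolding suf_le_def by (fastforce simp: append_eq_append_conv2)

lemma inf_le_append:
  assumes a: "inf_le a m" and b: "inf_le b m" and s: "suf_le a k" and p: "pre_le b l" and kl: "k + l \<le> m"
  shows "inf_le (a @ b) m"
  unfolding inf_le_def
proof (intro allI impI)
  fix x y z assume "a @ b = x @ y @ z"
  then consider u where "a = x @ u" "u @ b = y @ z" | u where "x = a @ u" "b = u @ y @ z"
    by (auto simp: append_eq_append_conv2)
  then show "wt y \<le> m"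
  proof cases
    case 1
    from 1(2) consider v where "u = y @ v" "z = v @ b" | v where "y = u @ v" "b = v @ z"
      by (auto simp: append_eq_append_conv2)
    then show ?thesis
    proof cases
      case v: 1
      then show ?thesis using 1(1) a by (auto simp: inf_le_def)
    next
      case v: 2
      then have "wt u \<le> k" "wt v \<le> l" using 1(1) s p by (auto simp: suf_le_def pre_le_def)
      then show ?thesis using v kl by simp
    qed
  next
    case 2
    then show ?thesis using b by (auto simp: inf_le_def)
  qed
qed

lemma le_mono: "pre_le t a \<Longrightarrow> a \<le> b \<Longrightarrow> pre_le t b" "suf_le t a \<Longrightarrow> a \<le> b \<Longrightarrow> suf_le t b"
    "inf_le t a \<Longrightarrow> a \<le> b \<Longrightarrow> inf_le t b"
  by (metis pre_le_def order_trans, metis suf_le_def order_trans, metis inf_le_def order_trans)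

lemma le_Nil [simp]: "pre_le [] a \<longleftrightarrow> 0 \<le> a" "suf_le [] a \<longleftrightarrow> 0 \<le> a" "inf_le [] a \<longleftrightarrow> 0 \<le> a"
  unfolding pre_le_def suf_le_def inf_le_def by auto

lemma le_single: "pre_le [x] a \<longleftrightarrow> 0 \<le> a \<and> wt [x] \<le> a" "suf_le [x] a \<longleftrightarrow> 0 \<le> a \<and> wt [x] \<le> a"
    "inf_le [x] a \<longleftrightarrow> 0 \<le> a \<and> wt [x] \<le> a"
  unfolding pre_le_def suf_le_def inf_le_def by (auto simp: Cons_eq_append_conv append_eq_Cons_conv)

lemma le_Ticks: "pre_le (replicate x Tick) (int x)" "suf_le (replicate x Tick) (int x)"
    "inf_le (replicate x Tick) (int x)"
proof -
  have "wt y \<le> int x" if "replicate x Tick = a @ y @ z" for a y z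
  proof -
    have "set y \<subseteq> {Tick}" "length y \<le> x"
      using arg_cong[OF that, of set] arg_cong[OF that, of length] by (auto split: if_splits)
    then have "y = replicate (length y) Tick" by (metis replicate_length_same subset_code(1) singletonD)
    then have "wt y = int (length y)" by (metis wt_simps(7))
    then show ?thesis using \<open>length y \<le> x\<close> by simp
  qed
  then show "pre_le (replicate x Tick) (int x)" "suf_le (replicate x Tick) (int x)"
    "inf_le (replicate x Tick) (int x)"
    unfolding pre_le_def suf_le_def inf_le_def by (metis append_Nil append_Nil2)+
qed

lemma blk_le:
  assumes "wt u \<le> -1" "0 \<le> p" "0 \<le> s" "pre_le u p" "suf_le u s" "inf_le u m" "1 + p \<le> m" "s \<le> m"
  shows "pre_le (blk (c, P, u)) (1 + p)" "suf_le (blk (c, P, u)) s" "inf_le (blk (c, P, u)) m" "wt (blk (c, P, u)) \<le> 0"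
proof -
  have eq: "blk (c, P, u) = ([Tick] @ [Push c]) @ u @ [Pop]" by simp
  have 1: "pre_le (u @ [Pop]) p" "suf_le (u @ [Pop]) s" "inf_le (u @ [Pop]) m"
    using pre_le_append[OF assms(4), of "[Pop]" 0] suf_le_append[OF _ assms(5), of "[Pop]"]
      inf_le_append[OF assms(6) _ assms(5), of "[Pop]" 0] assms by (auto simp: le_single)
  have 2: "pre_le ([Tick] @ [Push c]) (1 + p)" "suf_le ([Tick] @ [Push c]) 1" "inf_le ([Tick] @ [Push c]) m"
    using assms pre_le_append[of "[Tick]" "1 + p" "[Push c]" 0] suf_le_append[of "[Push c]" 1 "[Tick]" 1]
      inf_le_append[of "[Tick]" m "[Push c]" 1 0] by (auto simp: le_single)
  show "pre_le (blk (c, P, u)) (1 + p)" unfolding eq by (rule pre_le_append[OF 2(1) 1(1)]) simp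
  show "suf_le (blk (c, P, u)) s" unfolding eq by (rule suf_le_append[OF 1(2) 2(2)]) (use assms in simp)
  show "inf_le (blk (c, P, u)) m" unfolding eq by (rule inf_le_append[OF 2(3) 1(3) 2(2) 1(1)]) (use assms in simp)
  show "wt (blk (c, P, u)) \<le> 0" using assms by simp
qed

lemma concat_le:
  assumes "\<And>b. b \<in> set bs \<Longrightarrow> wt b \<le> 0 \<and> pre_le b p \<and> suf_le b s \<and> inf_le b m" "0 \<le> p" "0 \<le> s" "p + s \<le> m"
  shows "wt (concat bs) \<le> 0 \<and> pre_le (concat bs) p \<and> suf_le (concat bs) s \<and> inf_le (concat bs) m"
  using assms(1)
proof (induction bs)
  case (Cons b bs)
  have b: "wt b \<le> 0" "pre_le b p" "suf_le b s" "inf_le b m" using Cons.prems by auto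
  have c: "wt (concat bs) \<le> 0" "pre_le (concat bs) p" "suf_le (concat bs) s" "inf_le (concat bs) m"
    using Cons by auto
  show ?case
    using b(1) c(1) pre_le_append[OF b(2) c(2)] suf_le_append[OF c(3) b(3)] inf_le_append[OF b(4) c(4) b(3) c(2)] assms
    by auto
qed (use assms in auto)

text \<open>Bound for the work of one call outside its kids: at most n removals with
  \<open>6 * (1 + n + q)\<close> ticks each, and the reversal of the list of kids.\<close>

definition own :: int where "own = 7 * int n * (1 + int n + int q)"

text \<open>Bounds that pass through the recursion without growing with the depth. Suffixes grow in
  calls that visit first and are cut back by the final visit of the other kind; prefixes grow in
  calls that visit last and are cut back by the initial visit of the other kind. The prefix bound is
  also stated relative to \<open>cnt Q\<close>, so that antichains visited earlier can pay for the
  opening of a kid.\<close>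

definition am :: "bool \<Rightarrow> nat list \<Rightarrow> ev list \<Rightarrow> bool" where
  "am b Q t \<longleftrightarrow> emits t = cnt Q \<and> ticks t \<le> 1347 * prefixes Q \<and> wt t \<le> - 93000 * int (cnt Q)
     \<and> (\<exists>x. pre_le t x \<and> 0 \<le> x \<and> (if b then x \<le> own \<and> x \<le> 1346 * int (cnt Q) else x \<le> 2 * own + 2 \<and> x \<le> 2700 * int (cnt Q)))
     \<and> suf_le t (own + (if b then 2 else 1)) \<and> inf_le t (4 * own + 10)"

lemma cnt_pos: "1 \<le> cnt Q"
  unfolding cnt_def by (simp add: Suc_le_eq card_gt_0_iff) (use empty_ac in blast)

lemma own_bound:
  assumes "spine Q chs x" "wf Q"
  shows "int (x + length Q) \<le> own" "int (x + length Q) \<le> 1345 * int (cnt Q)"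
proof -
  have "x + length Q \<le> length Q * (6 * (1 + n + q)) + length Q * (1 + n + q)"
    using spine_cost_max[OF assms] by (rule add_mono) simp
  also have "\<dots> = length Q * (7 * (1 + n + q))" by algebra
  also have "\<dots> \<le> n * (7 * (1 + n + q))" by (rule mult_le_mono1[OF length_le_n[OF assms(2)]])
  finally have "int (x + length Q) \<le> int (n * (7 * (1 + n + q)))" by (simp only: of_nat_le_iff)
  then show "int (x + length Q) \<le> own" by (simp add: own_def algebra_simps)
  have "x + length Q \<le> 1345 * small Q"
    using spine_cost[OF assms] size_le_small[OF assms(2)] by simp
  then show "int (x + length Q) \<le> 1345 * int (cnt Q)" using small_le_cnt[of Q] by linarith
qed

text \<open>Here the size of \<open>cc\<close> matters: 100000 - 5 * 1347 exceeds 93000.\<close>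

lemma am_wt:
  assumes "emits t = cnt Q" "ticks t \<le> 1347 * prefixes Q"
  shows "wt t \<le> - 93000 * int (cnt Q)"
  using assms prefixes_le[of Q] unfolding wt_def by (simp add: cc_def)

lemma int_sum_kids: "int (\<Sum>(c, P)\<leftarrow>ks. f P) = (\<Sum>(c, P)\<leftarrow>ks. int (f P))"
  by (induction ks) auto

lemma sum_list_kids:
  assumes "\<And>z. z \<in> set zs \<Longrightarrow> am b (fst (snd z)) (snd (snd z))"
  shows "emits (concat (map blk zs)) = (\<Sum>(c, P)\<leftarrow>map kid zs. cnt P)"
    "ticks (concat (map blk zs)) \<le> length zs + 1347 * (\<Sum>(c, P)\<leftarrow>map kid zs. prefixes P)"
proof -
  show "emits (concat (map blk zs)) = (\<Sum>(c, P)\<leftarrow>map kid zs. cnt P)"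
    using assms
  proof (induction zs)
    case (Cons z zs)
    obtain c P u where z: "z = (c, P, u)" by (cases z rule: prod_cases3)
    have "emits u = cnt P" using Cons.prems[of z] z by (simp add: am_def)
    then show ?case using Cons by (simp add: z)
  qed simp
  show "ticks (concat (map blk zs)) \<le> length zs + 1347 * (\<Sum>(c, P)\<leftarrow>map kid zs. prefixes P)"
    using assms
  proof (induction zs)
    case (Cons z zs)
    obtain c P u where z: "z = (c, P, u)" by (cases z rule: prod_cases3)
    have "ticks u \<le> 1347 * prefixes P" using Cons.prems[of z] z by (simp add: am_def)
    moreover have "ticks (concat (map blk zs)) \<le> length zs + 1347 * (\<Sum>(c, P)\<leftarrow>map kid zs. prefixes P)"
      using Cons by simp
    ultimately show ?case by (simp add: z)
  qed simp
qed

text \<open>In a call that visits its antichain first, the kids of the last chains come first; all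
  antichains of the candidates remaining after the chain of a kid have been visited before that kid,
  and they outnumber the cost of its first two levels.\<close>

lemma pre_le_first:
  assumes "spine Q chs x" "wf Q" "map kid zs = chs" "\<And>z. z \<in> set zs \<Longrightarrow> am False (fst (snd z)) (snd (snd z))"
  shows "pre_le (concat (map blk zs)) 90000 \<and> wt (concat (map blk zs)) \<le> - 90000 * (int (cnt Q) - 1)"
  using assms
proof (induction arbitrary: zs rule: spine.induct)
  case (chain Q cs ds chs x y)
  let ?R = "rev (filter (\<lambda>v. v \<notin> set ds) Q)"
  obtain z1 z2 where z: "zs = z1 @ z2" "map kid z1 = chs" "map kid z2 = map (\<lambda>c. (c, rev (filter (incomparable r c) Q))) ds"
    using chain.prems(2) by (auto simp: map_eq_append_conv)
  have R: "wf ?R" using chain.prems(1) by simp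
  have I: "pre_le (concat (map blk z1)) 90000" "wt (concat (map blk z1)) \<le> - 90000 * (int (cnt ?R) - 1)"
    using chain.IH[OF R z(2)] chain.prems(3) z(1) by auto
  \<comment> \<open>A kid may be \<open>2700 * cnt P\<close> ticks behind before its visits catch
    up, and one tick enters it. Its candidates lie in the rest, because no member of the chain is
    incomparable to \<open>c\<close>.\<close>
  define M where "M = 2701 * int (cnt ?R)"
  have d: "set ds = set cs" using chain.hyps(3) by (rule mset_eq_setD)
  have am: "am False P u" "set P \<subseteq> set ?R" if "(c, P, u) \<in> set z2" for c P u
  proof -
    show "am False P u" using chain.prems(3)[of "(c, P, u)"] that z(1) by auto
    have "(c, P) \<in> set (map kid z2)" using that by force
    then have P: "c \<in> set cs" "P = rev (filter (incomparable r c) Q)" unfolding z(3) using d by auto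
    interpret L: longest "{..<n}" r "set Q" cs by (rule longest_locale) fact+
    have "v \<notin> set cs" if "v \<in> set P" for v
    proof
      assume v: "v \<in> set cs"
      have "incomparable r c v" using that P(2) by auto
      then have "{c, v} \<in> antichains (set Q) r" using P(1) v L.csQ
        by (auto simp: antichains_def incomparable_def)
      then have "c = v" using L.chain_inter[of "{c, v}" c v] P(1) v by auto
      then show False using \<open>incomparable r c v\<close> P(1) L.csQ L.refl_r by (auto simp: incomparable_def)
    qed
    then show "set P \<subseteq> set ?R" using P(2) d by auto
  qed
  have blocks: "wt b \<le> 0 \<and> pre_le b M" if "b \<in> set (map blk z2)" for b
  proof -
    from that obtain z' where "z' \<in> set z2" "b = blk z'" by auto
    moreover obtain c P u where "z' = (c, P, u)" by (cases z' rule: prod_cases3)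
    ultimately have b: "(c, P, u) \<in> set z2" "b = blk (c, P, u)" by simp_all
    obtain p where p: "pre_le u p" "0 \<le> p" "p \<le> 2700 * int (cnt P)" using am(1)[OF b(1)] by (auto simp: am_def)
    have c1: "cnt P \<le> cnt ?R" using am(2)[OF b(1)] by (rule cnt_mono)
    have w: "wt u \<le> -1" "suf_le u (own + 1)" "inf_le u (4 * own + 10)"
      using am(1)[OF b(1)] cnt_pos[of P] by (auto simp: am_def)
    have own: "own \<ge> 0" by (simp add: own_def)
    have "pre_le b (1 + p)" "wt b \<le> 0" unfolding b(2)
      using blk_le[OF w(1) p(2) _ p(1) w(2) _, of "max (4 * own + 10) (1 + p)"] w own le_mono(3)[OF w(3)]
      by auto
    moreover have "1 + p \<le> M" using p c1 cnt_pos[of ?R] by (simp add: M_def)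
    ultimately show ?thesis using le_mono(1) by blast
  qed
  have "pre_le (concat bs) M" if "\<And>b. b \<in> set bs \<Longrightarrow> wt b \<le> 0 \<and> pre_le b M" for bs
    using that
  proof (induction bs)
    case (Cons b bs)
    then show ?case using pre_le_append[of b M "concat bs" M] by auto
  qed (simp add: M_def)
  then have "pre_le (concat (map blk z2)) M" using blocks by blast
  \<comment> \<open>The earlier kids visit all nonempty antichains of the rest and contribute
    \<open>- 90000 * (cnt ?R - 1)\<close>, which outweighs \<open>M\<close> as soon as there is one.
    Otherwise \<open>cnt ?R\<close> is 1 and \<open>M\<close> is only 2701.\<close>
  then have "pre_le (concat (map blk z1) @ concat (map blk z2)) 90000"
    by (rule pre_le_append[OF I(1)]) (use I(2) cnt_pos[of ?R] in \<open>simp add: M_def\<close>)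
  moreover have "wt (concat (map blk zs)) \<le> - 90000 * (int (cnt Q) - 1)"
  proof -
    have sp: "spine Q (map kid zs) y" unfolding chain.prems(2) by (rule spine.chain) fact+
    have len: "wt (concat (map blk ys)) \<le> - 90000 * (\<Sum>(c, P)\<leftarrow>map kid ys. int (cnt P))"
      if "set ys \<subseteq> set zs" for ys
      using that
    proof (induction ys)
      case (Cons a ys)
      obtain c P u where a: "a = (c, P, u)" by (cases a) auto
      have "am False P u" using chain.prems(3)[of a] Cons.prems a by auto
      then have "wt u \<le> - 93000 * int (cnt P)" by (simp add: am_def)
      then show ?case using Cons a cnt_pos[of P] by auto
    qed simp
    have "int (cnt Q) - 1 = (\<Sum>(c, P)\<leftarrow>map kid zs. int (cnt P))"
      using cnt_spine[OF sp chain.prems(1)] int_sum_kids[of cnt "map kid zs"] by simp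
    then show ?thesis using len[of zs] by simp
  qed
  ultimately show ?case using z(1) by simp
next
  case Nil
  have "antichains {} r = {{}}" by (auto simp: antichains_def)
  then show ?case using Nil by (simp add: cnt_def)
qed

theorem node_am: "node b Q t \<Longrightarrow> wf Q \<Longrightarrow> am b Q t"
proof (induction rule: node.induct)
  case (first Q zs x)
  have o0: "own \<ge> 0" by (simp add: own_def)
  have kids: "am False (fst (snd z)) (snd (snd z))" if "z \<in> set zs" for z
    using first.IH[OF that] spine_kid[OF first.hyps(1) first.prems, of "fst z" "fst (snd z)"] that by force
  have em: "emits (Emit # replicate x Tick @ concat (map blk zs) @ [Tick]) = cnt Q"
    using sum_list_kids(1)[of zs, OF kids] cnt_spine[OF first.hyps(1) first.prems] by (simp add: emits_def)
  have len: "length zs = length Q" using length_spine[OF first.hyps(1) first.prems] by simp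
  have tr: "ticks (replicate x Tick) = x" by (simp add: ticks_def)
  \<comment> \<open>The spine takes at most \<open>1344 * small Q\<close> ticks, by
    \<open>spine_cost\<close> and \<open>size_le_small\<close>; in addition there are one tick per
    kid and the closing tick.\<close>
  have ti: "ticks (Emit # replicate x Tick @ concat (map blk zs) @ [Tick]) \<le> 1347 * prefixes Q"
    using sum_list_kids(2)[of zs, OF kids] prefixes_spine[OF first.hyps(1) first.prems] spine_cost[OF first.hyps(1) first.prems]
      size_le_small[OF first.prems] len by (simp add: tr)
  have bl: "wt b \<le> 0 \<and> pre_le b (2 * own + 3) \<and> suf_le b (own + 1) \<and> inf_le b (4 * own + 10)"
    if b: "b \<in> set (map blk zs)" for b
  proof -
    from b obtain z' where "z' \<in> set zs" "b = blk z'" by auto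
    moreover obtain c P u where "z' = (c, P, u)" by (cases z' rule: prod_cases3)
    ultimately have z: "(c, P, u) \<in> set zs" "b = blk (c, P, u)" by simp_all
    have a: "am False P u" using kids[OF z(1)] by simp
    obtain p where p: "pre_le u p" "0 \<le> p" "p \<le> 2 * own + 2" using a by (auto simp: am_def)
    have w: "wt u \<le> -1" "suf_le u (own + 1)" "inf_le u (4 * own + 10)"
      using a cnt_pos[of P] by (auto simp: am_def)
    show ?thesis using blk_le[OF w(1) p(2) _ p(1) w(2,3)] p o0 z(2) le_mono(1)[of b "1 + p" "2 * own + 3"] by auto
  qed
  have K: "wt (concat (map blk zs)) \<le> 0" "pre_le (concat (map blk zs)) (2 * own + 3)"
    "suf_le (concat (map blk zs)) (own + 1)" "inf_le (concat (map blk zs)) (4 * own + 10)"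
    using concat_le[of "map blk zs", OF bl] o0 by auto
  \<comment> \<open>A bound free of n and q. The opening visit, worth \<open>cc\<close>, covers it
    together with the closing tick, and only the ticks of the spine remain as prefix bound.\<close>
  have K2: "pre_le (concat (map blk zs)) 90000"
    using pre_le_first[OF first.hyps(1) first.prems refl] kids by blast
  have x: "int x \<le> own" "int x \<le> 1345 * int (cnt Q)" using own_bound[OF first.hyps(1) first.prems] by auto
  let ?k = "concat (map blk zs) @ [Tick]"
  have k1: "pre_le ?k 90001" "suf_le ?k (own + 2)" "inf_le ?k (4 * own + 10)" "pre_le ?k (2 * own + 4)"
    using pre_le_append[OF le_mono(1)[OF K2], of 90001 "[Tick]" 1] K suf_le_append[OF _ K(3), of "[Tick]" "own + 2"]
      inf_le_append[OF K(4) _ K(3), of "[Tick]" 1] o0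
      pre_le_append[OF le_mono(1)[OF K(2)], of "2 * own + 4" "[Tick]" 1] by (auto simp: le_single)
  have k2: "pre_le (replicate x Tick @ ?k) (int x + 90001)" "suf_le (replicate x Tick @ ?k) (own + 2)"
    "inf_le (replicate x Tick @ ?k) (4 * own + 10)" "pre_le (replicate x Tick @ ?k) (4 * own + 10)"
    using pre_le_append[OF le_mono(1)[OF le_Ticks(1)] k1(1), of x "int x + 90001"]
      suf_le_append[OF k1(2) le_Ticks(2), of x] inf_le_append[OF le_mono(3)[OF le_Ticks(3)] k1(3) le_Ticks(2) k1(4), of x]
      pre_le_append[OF le_mono(1)[OF le_Ticks(1)] k1(4), of x "4 * own + 10"] K(1) x o0 by auto
  have wk: "wt (replicate x Tick @ ?k) \<le> own + 1" using K(1) x by simp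
  have "pre_le ([Emit] @ replicate x Tick @ ?k) (int x)"
    by (rule pre_le_append[OF _ k2(1)]) (auto simp: le_single cc_def)
  moreover have "suf_le ([Emit] @ replicate x Tick @ ?k) (own + 2)"
    by (rule suf_le_append[OF k2(2), of _ 0]) (use wk o0 in \<open>auto simp: le_single\<close>)
  moreover have "inf_le ([Emit] @ replicate x Tick @ ?k) (4 * own + 10)"
    by (rule inf_le_append[OF _ k2(3) _ k2(4), of _ 0]) (use o0 in \<open>auto simp: le_single\<close>)
  ultimately show ?case unfolding am_def using em ti am_wt[OF em ti] x
    by (auto intro!: exI[of _ "int x"])
next
  case (last Q zs x y)
  have o0: "own \<ge> 0" by (simp add: own_def)
  have kd: "(fst z, fst (snd z)) \<in> set (rev (map kid zs))" if "z \<in> set zs" for z using that by auto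
  have kids: "am True (fst (snd z)) (snd (snd z))" "set (fst (snd z)) \<subseteq> set Q" if "z \<in> set zs" for z
    using last.IH[OF that] spine_kid[OF last.hyps(1) last.prems kd[OF that]] by auto
  have rv: "(\<Sum>(c, P)\<leftarrow>rev (map kid zs). f P) = (\<Sum>(c, P)\<leftarrow>map kid zs. f P :: nat)" for f
    by (induction zs) (auto simp: add.commute)
  have em: "emits (replicate y Tick @ concat (map blk zs) @ [Tick, Emit]) = cnt Q"
    using sum_list_kids(1)[of zs, OF kids(1)] cnt_spine[OF last.hyps(1) last.prems] unfolding rv by (simp add: emits_def)
  have len: "length zs = length Q" using length_spine[OF last.hyps(1) last.prems] by simp
  have tr: "ticks (replicate y Tick) = y" by (simp add: ticks_def)
  have ti: "ticks (replicate y Tick @ concat (map blk zs) @ [Tick, Emit]) \<le> 1347 * prefixes Q"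
    using sum_list_kids(2)[of zs, OF kids(1)] prefixes_spine[OF last.hyps(1) last.prems, unfolded rv]
      spine_cost[OF last.hyps(1) last.prems] last.hyps(3)
      size_le_small[OF last.prems] len by (simp add: tr)
  \<comment> \<open>A prefix bound common to all kids: \<open>cnt\<close> is monotone in the
    candidates, so each kid's bounds are at most those taken with \<open>Q\<close>.\<close>
  define X where "X = min own (1346 * int (cnt Q))"
  have X0: "0 \<le> X" using o0 by (simp add: X_def)
  have bl: "wt b \<le> 0 \<and> pre_le b (1 + X) \<and> suf_le b (own + 2) \<and> inf_le b (4 * own + 10)"
    if b: "b \<in> set (map blk zs)" for b
  proof -
    from b obtain z' where "z' \<in> set zs" "b = blk z'" by auto
    moreover obtain c P u where "z' = (c, P, u)" by (cases z' rule: prod_cases3)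
    ultimately have z: "(c, P, u) \<in> set zs" "b = blk (c, P, u)" by simp_all
    have a: "am True P u" "set P \<subseteq> set Q" using kids[OF z(1)] by auto
    have "cnt P \<le> cnt Q" using a(2) by (rule cnt_mono)
    then obtain p where p: "pre_le u p" "0 \<le> p" "p \<le> X" using a(1) by (auto simp: am_def X_def)
    have w: "wt u \<le> -1" "suf_le u (own + 2)" "inf_le u (4 * own + 10)"
      using a(1) cnt_pos[of P] by (auto simp: am_def)
    have "p \<le> own" using p(3) by (simp add: X_def)
    then show ?thesis using blk_le[OF w(1) p(2) _ p(1) w(2,3)] p o0 z(2) le_mono(1)[of b "1 + p" "1 + X"] by auto
  qed
  have K: "wt (concat (map blk zs)) \<le> 0" "pre_le (concat (map blk zs)) (1 + X)"
    "suf_le (concat (map blk zs)) (own + 2)" "inf_le (concat (map blk zs)) (4 * own + 10)"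
    using concat_le[of "map blk zs", OF bl] o0 X0 by (auto simp: X_def)
  have y: "int y \<le> own" "int y \<le> 1345 * int (cnt Q)" "int y \<le> X"
    using own_bound[OF last.hyps(1) last.prems] last.hyps(3) by (auto simp: X_def)
  have e: "pre_le [Tick, Emit] 1" "suf_le [Tick, Emit] 0" "inf_le [Tick, Emit] 1"
    using pre_le_append[of "[Tick]" 1 "[Emit]" 0] suf_le_append[of "[Emit]" 0 "[Tick]" 1]
      inf_le_append[of "[Tick]" 1 "[Emit]" 1 0] by (auto simp: le_single cc_def)
  let ?k = "concat (map blk zs) @ [Tick, Emit]"
  have k1: "pre_le ?k (2 + X)" "suf_le ?k (own + 1)" "inf_le ?k (4 * own + 10)"
    using pre_le_append[OF le_mono(1)[OF K(2)] e(1), of "2 + X"] K X0 suf_le_append[OF le_mono(2)[OF e(2)] K(3), of "own + 1"]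
      inf_le_append[OF K(4) le_mono(3)[OF e(3)] K(3) e(1)] o0 by (auto simp: cc_def)
  have "pre_le (replicate y Tick @ ?k) (int y + (2 + X))"
    by (rule pre_le_append[OF le_mono(1)[OF le_Ticks(1)] k1(1)]) (use X0 in auto)
  moreover have "suf_le (replicate y Tick @ ?k) (own + 1)"
    by (rule suf_le_append[OF k1(2) le_Ticks(2)]) (use y K(1) in \<open>auto simp: cc_def\<close>)
  moreover have "inf_le (replicate y Tick @ ?k) (4 * own + 10)"
    by (rule inf_le_append[OF le_mono(3)[OF le_Ticks(3)] k1(3) le_Ticks(2) k1(1)]) (use y o0 in \<open>auto simp: X_def\<close>)
  moreover have "int y + (2 + X) \<le> 2 * own + 2" "int y + (2 + X) \<le> 2700 * int (cnt Q)"
    using y cnt_pos[of Q] by (auto simp: X_def)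
  ultimately show ?case unfolding am_def using em ti am_wt[OF em ti] X0
    by (auto intro!: exI[of _ "int y + (2 + X)"])
qed

subsection \<open>The complete trace\<close>

text \<open>Each operation changes one element, so the state of the automaton bounds the distance of
  the current set from the set \<open>L\<close> visited last.\<close>

lemma vis_gray:
  assumes "gp k t \<noteq> None" "card (sym_diff L (set st)) \<le> k" "k \<le> 3" "finite L"
  shows "successively (\<lambda>A B. card (sym_diff A B) \<le> 3) (L # vis st t)"
  using assms
proof (induction st t arbitrary: k L rule: vis.induct)
  case (2 st v t)
  have "sym_diff L (set (st @ [v])) \<subseteq> insert v (sym_diff L (set st))" by auto
  then have "card (sym_diff L (set (st @ [v]))) \<le> card (insert v (sym_diff L (set st)))"
    using 2(5) by (intro card_mono) auto
  also have "\<dots> \<le> Suc (card (sym_diff L (set st)))" by (rule card_insert_le_m1) auto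
  finally show ?case using 2 by (auto split: if_splits)
next
  case (3 st t)
  have "set st \<subseteq> insert (last st) (set (butlast st))"
    by (cases st rule: rev_cases) auto
  then have "sym_diff L (set (butlast st)) \<subseteq> insert (last st) (sym_diff L (set st))"
    by (auto dest: in_set_butlastD)
  then have "card (sym_diff L (set (butlast st))) \<le> card (insert (last st) (sym_diff L (set st)))"
    using 3(5) by (intro card_mono) auto
  also have "\<dots> \<le> Suc (card (sym_diff L (set st)))" by (rule card_insert_le_m1) auto
  finally show ?case using 3 by (auto split: if_splits)
qed auto

context
  fixes F t :: "ev list" and Q :: "nat list" and x :: nat
  assumes F: "F = replicate x Tick @ t" and t: "node True Q t" and Q: "distinct Q" "set Q = {..<n}"
begin

lemma wfQ: "wf Q" using Q by (simp add: wf_def)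

lemma F_okst: "okst n [] F"
  using node_okst[OF t wfQ, of "[]"] by (simp add: F)

lemma F_gp: "gp 0 F \<noteq> None"
  using node_gp[OF t] by (auto simp: F)

text \<open>Visits are distinct by counting: there are as many of them as antichains, and every
  antichain is among them.\<close>

lemma F_vis: "enumerate_order r {..<n} {} (vis [] F)" "set (vis [] F) = antichains {..<n} r" "distinct (vis [] F)"
  "emits F \<noteq> 0"
proof -
  show e: "enumerate_order r {..<n} {} (vis [] F)"
    using node_enumerate[OF t, of "[]"] Q by (simp add: F)
  show s: "set (vis [] F) = antichains {..<n} r"
    using enumerate_order_set[OF e] by simp
  have em: "emits F = cnt Q" using node_am[OF t wfQ] by (simp add: F am_def emits_def)
  then show "emits F \<noteq> 0" using cnt_pos[of Q] by simp
  have "length (vis [] F) = card (set (vis [] F))"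
    unfolding s length_vis em cnt_def Q(2) ..
  then show "distinct (vis [] F)" by (simp add: card_distinct)
qed

lemma F_gray: "Suc i < length (vis [] F) \<Longrightarrow> card (sym_diff (vis [] F ! i) (vis [] F ! Suc i)) \<le> 3"
proof -
  assume i: "Suc i < length (vis [] F)"
  have "successively (\<lambda>A B. card (sym_diff A B) \<le> 3) ({} # vis [] F)"
    by (rule vis_gray[OF F_gp]) auto
  then have "successively (\<lambda>A B. card (sym_diff A B) \<le> 3) (vis [] F)"
    by (cases "vis [] F") auto
  then show ?thesis using i by (simp add: successively_conv_nth)
qed

text \<open>28 is four times the 7 in \<open>own\<close>, and the leading ticks of the sorting phase
  only add to the bound.\<close>

lemma F_amortized:
  assumes "F = xs @ ys @ zs"
  shows "ticks ys \<le> (x + 28 * n * (1 + n + q) + 10) + cc * emits ys"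
proof -
  have am: "am True Q t" by (rule node_am[OF t wfQ])
  have o0: "own \<ge> 0" by (simp add: own_def)
  obtain p where p: "pre_le t p" "p \<le> own" using am by (auto simp: am_def)
  have "inf_le t (4 * own + 10)" using am by (simp add: am_def)
  then have "inf_le F (int x + (4 * own + 10))" unfolding F
    by (intro inf_le_append[OF le_mono(3)[OF le_Ticks(3)] le_mono(3) le_Ticks(2) le_mono(1)[OF p(1) p(2)]])
      (use o0 in auto)
  then have "wt ys \<le> int x + (4 * own + 10)" using assms unfolding inf_le_def by blast
  then have "int (ticks ys) \<le> int ((x + 28 * n * (1 + n + q) + 10) + cc * emits ys)"
    by (simp add: wt_def own_def algebra_simps)
  then show ?thesis by (simp only: of_nat_le_iff)
qed

end

end

section \<open>The enumeration program\<close>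

definition lwp :: "nat \<Rightarrow> nat \<Rightarrow> com \<Rightarrow> (ev list st \<Rightarrow> bool) \<Rightarrow> ev list st \<Rightarrow> bool" where
  "lwp X W c Q s \<longleftrightarrow> (\<exists>s'. lbig X W c s s' \<and> Q s')"

inductive_cases lbig_cases:
  "lbig X W Skip s s'" "lbig X W (Asg x e) s s'" "lbig X W (Sto a e) s s'" "lbig X W (Seq c d) s s'"
  "lbig X W (If e c d) s s'" "lbig X W (Enq e) s s'"

inductive_cases lbig_While: "lbig X W (While e c) s s'"

lemma lwp_simps:
  "lwp X W Skip Q s = Q s"
  "lwp X W (Asg x e) Q s = (ok X W e s \<and> Q (upd_rg x (eval e s) s))"
  "lwp X W (Sto a e) Q s = (ok X W a s \<and> ok X W e s \<and> eval a s < X \<and> Q (upd_mm (eval a s) (eval e s) s))"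
  "lwp X W (Seq c d) Q s = lwp X W c (lwp X W d Q) s"
  "lwp X W (Enq e) Q s = (ok X W e s \<and> Q (logev (decode (eval e s)) s))"
proof -
  show "lwp X W (Seq c d) Q s = lwp X W c (lwp X W d Q) s"
    unfolding lwp_def by (metis lbig_cases(4) lbig.Seq)
qed (unfold lwp_def, auto elim!: lbig_cases intro: lbig.Skip lbig.Asg lbig.Sto lbig.Enq)

lemma lwp_If: "lwp X W (If e c d) Q s = (ok X W e s \<and> (if eval e s \<noteq> 0 then lwp X W c Q s else lwp X W d Q s))"
proof
  assume "lwp X W (If e c d) Q s"
  then obtain s' where "lbig X W (If e c d) s s'" "Q s'" unfolding lwp_def by blast
  then show "ok X W e s \<and> (if eval e s \<noteq> 0 then lwp X W c Q s else lwp X W d Q s)"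
    unfolding lwp_def by (cases rule: lbig_cases(5)) auto
next
  assume "ok X W e s \<and> (if eval e s \<noteq> 0 then lwp X W c Q s else lwp X W d Q s)"
  then show "lwp X W (If e c d) Q s"
    unfolding lwp_def by (cases "eval e s = 0") (auto intro: lbig.IfT lbig.IfF)
qed

lemma lwp_While: "lwp X W (While e c) Q s =
  (ok X W e s \<and> (if eval e s = 0 then Q s else lwp X W c (lwp X W (While e c) Q) (logev Tick s)))"
proof
  assume "lwp X W (While e c) Q s"
  then obtain s' where "lbig X W (While e c) s s'" "Q s'" unfolding lwp_def by blast
  then show "ok X W e s \<and> (if eval e s = 0 then Q s else lwp X W c (lwp X W (While e c) Q) (logev Tick s))"
    unfolding lwp_def by (cases rule: lbig_While) auto
next
  assume a: "ok X W e s \<and> (if eval e s = 0 then Q s else lwp X W c (lwp X W (While e c) Q) (logev Tick s))"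
  show "lwp X W (While e c) Q s"
  proof (cases "eval e s = 0")
    case True
    then show ?thesis using a unfolding lwp_def by (intro exI[of _ s] conjI lbig.WhileF) auto
  next
    case False
    then obtain s' s'' where "lbig X W c (logev Tick s) s'" "lbig X W (While e c) s' s''" "Q s''"
      using a unfolding lwp_def by auto
    then show ?thesis using a False lbig.WhileT unfolding lwp_def by blast
  qed
qed

lemma lwp_mono: "lwp X W c P s \<Longrightarrow> (\<And>s'. P s' \<Longrightarrow> Q s') \<Longrightarrow> lwp X W c Q s"
  unfolding lwp_def by blast

text \<open>Comparability of two elements is read off the input matrix, whose row length is in register 1.\<close>

definition INCMP :: "exp \<Rightarrow> exp \<Rightarrow> exp" where
  "INCMP x y = Minus (N 1) (Plus (Ld (Plus (N 1) (Plus (Times x (V 1)) y)))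
     (Ld (Plus (N 1) (Plus (Times y (V 1)) x))))"

abbreviation ADR :: "nat \<Rightarrow> exp \<Rightarrow> exp" where "ADR b e \<equiv> Plus (V b) e"
abbreviation ARR :: "nat \<Rightarrow> exp \<Rightarrow> exp" where "ARR b e \<equiv> Ld (Plus (V b) e)"

text \<open>Registers 2 to 7 hold the base addresses of arrays: heights, predecessors, elements sorted by
  height, current chain, heads of the candidate lists, stack frames.  Register 8 is the heap
  pointer.  Index 0 of the sorted array and both ends of the chain array are sentinels.\<close>

definition DOWN :: "nat \<Rightarrow> com" where
  "DOWN b = While (INCMP (ARR b (V 12)) (V 11)) (Asg 12 (Minus (V 12) (N 1)))"

text \<open>The added 1 turns truncated subtraction into the test that a height is at least register
  15.\<close>

definition SHIFT :: com where
  "SHIFT = While (Minus (Plus (ARR 2 (ARR 4 (V 12))) (N 1)) (V 15))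
     (Sto (Plus (ADR 4 (V 12)) (N 1)) (ARR 4 (V 12)) ;; Asg 12 (Minus (V 12) (N 1)))"

text \<open>The new element is the sentinel of both scans: it is comparable to itself, and its
  provisional height 0 is below every new height. If it has no comparable predecessor, the first
  scan ends at it and its height becomes 1.\<close>

definition INSERT :: com where
  "INSERT = Sto (ADR 2 (V 11)) (N 0) ;; Sto (V 4) (V 11) ;; Asg 12 (V 14) ;; DOWN 4 ;;
     Asg 13 (ARR 4 (V 12)) ;; Asg 15 (Plus (ARR 2 (V 13)) (N 1)) ;; Sto (ADR 3 (V 11)) (V 13) ;;
     Asg 12 (V 14) ;; SHIFT ;;
     Sto (Plus (ADR 4 (V 12)) (N 1)) (V 11) ;; Sto (ADR 2 (V 11)) (V 15) ;; Asg 14 (Plus (V 14) (N 1))"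

definition NEXT :: com where
  "NEXT = Asg 11 (Ld (V 10)) ;; Asg 10 (Ld (Plus (V 10) (N 1)))"

definition HEIGHTS :: com where
  "HEIGHTS = Asg 14 (N 0) ;; Asg 10 (V 9) ;; While (V 10) (NEXT ;; INSERT)"

abbreviation CHAIN_LOOP :: com where
  "CHAIN_LOOP \<equiv> While (V 12) (Sto (ADR 5 (V 12)) (V 13) ;; Sto (ADR 6 (V 13)) (N 0) ;;
       Asg 13 (ARR 3 (V 13)) ;; Asg 12 (Minus (V 12) (N 1)))"

definition CHAIN :: com where
  "CHAIN = Asg 13 (ARR 4 (V 14)) ;; Asg 14 (ARR 2 (V 13)) ;; Asg 12 (V 14) ;;
     CHAIN_LOOP"

definition UP :: com where
  "UP = While (INCMP (ARR 5 (V 12)) (V 11))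
     (Asg 13 (ARR 5 (V 12)) ;; Sto (V 8) (V 11) ;; Sto (Plus (V 8) (N 1)) (ARR 6 (V 13)) ;;
      Sto (ADR 6 (V 13)) (V 8) ;; Asg 8 (Plus (V 8) (N 2)) ;; Asg 12 (Plus (V 12) (N 1)))"

definition OTHER :: com where
  "OTHER = Sto (V 8) (V 11) ;; Sto (Plus (V 8) (N 1)) (V 16) ;; Asg 16 (V 8) ;; Asg 8 (Plus (V 8) (N 2)) ;;
     Sto (V 5) (V 11) ;; Sto (Plus (ADR 5 (V 14)) (N 1)) (V 11) ;;
     DOWN 5 ;; Asg 12 (Plus (V 12) (N 1)) ;; UP"

text \<open>The sum of the two truncated differences is nonzero exactly for different numbers. It
  compares an element with the chain element of the same height, which tells whether it lies on the
  chain.\<close>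

abbreviation DIST_LOOP :: com where
  "DIST_LOOP \<equiv> While (V 10) (NEXT ;; Asg 12 (ARR 2 (V 11)) ;; Asg 13 (ARR 5 (V 12)) ;;
       If (Plus (Minus (V 11) (V 13)) (Minus (V 13) (V 11))) OTHER Skip)"

definition DIST :: com where
  "DIST = Asg 16 (N 0) ;; Asg 10 (V 9) ;;
     DIST_LOOP"

abbreviation KIDS_LOOP :: com where
  "KIDS_LOOP \<equiv> While (V 12) (Asg 13 (ARR 5 (V 12)) ;; Sto (V 8) (V 13) ;;
     Sto (Plus (V 8) (N 1)) (ARR 6 (V 13)) ;; Sto (Plus (V 8) (N 2)) (V 17) ;; Asg 17 (V 8) ;;
     Asg 8 (Plus (V 8) (N 3)) ;; Asg 12 (Minus (V 12) (N 1)))"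

definition KIDS :: com where
  "KIDS = Asg 12 (V 14) ;; KIDS_LOOP"

abbreviation SPINE_LOOP :: com where
  "SPINE_LOOP \<equiv> While (V 9) (HEIGHTS ;; CHAIN ;; DIST ;; KIDS ;; Asg 9 (V 16))"

definition SPINE :: com where
  "SPINE = Asg 17 (N 0) ;; SPINE_LOOP"

locale program = poset +
  fixes X W HT PR LL CA HD ST HP0 :: nat
  assumes layout: "n * n < HT" "HT + n \<le> PR" "PR + n \<le> LL" "LL + n + 1 \<le> CA" "CA + n + 2 \<le> HD"
    "HD + n \<le> ST" "ST + 2 * n + 6 \<le> HP0" "HP0 \<le> X" "X \<le> W"
begin

definition base_on :: "(nat \<Rightarrow> nat) \<Rightarrow> (nat \<Rightarrow> nat) \<Rightarrow> bool" where
  "base_on g m \<longleftrightarrow> g 1 = n \<and> g 2 = HT \<and> g 3 = PR \<and> g 4 = LL \<and> g 5 = CA \<and> g 6 = HD \<and> g 7 = ST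
     \<and> (\<forall>u<n. \<forall>v<n. m (1 + (u * n + v)) = (if (u, v) \<in> r then 1 else 0))"

abbreviation base :: "ev list st \<Rightarrow> bool" where
  "base s \<equiv> base_on (rg s) (mm s)"

lemma matrix_address: "u < n \<Longrightarrow> v < n \<Longrightarrow> Suc (u * n + v) \<le> n * n"
proof -
  assume "u < n" "v < n"
  then have "u * n + v < u * n + n" by simp
  also have "\<dots> = Suc u * n" by simp
  also have "\<dots> \<le> n * n" using \<open>u < n\<close> by (intro mult_le_mono1) simp
  finally show ?thesis by simp
qed

lemma baseD: "base s \<Longrightarrow> rg s 1 = n" "base s \<Longrightarrow> rg s (Suc 0) = n" "base s \<Longrightarrow> rg s 2 = HT" "base s \<Longrightarrow> rg s 3 = PR" "base s \<Longrightarrow> rg s 4 = LL"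
   "base s \<Longrightarrow> rg s 5 = CA" "base s \<Longrightarrow> rg s 6 = HD" "base s \<Longrightarrow> rg s 7 = ST"
  by (auto simp: base_on_def)

lemma base_cong:
  assumes "base s" "\<And>i. i < 8 \<Longrightarrow> rg s' i = rg s i" "\<And>a. a < HT \<Longrightarrow> mm s' a = mm s a"
  shows "base s'"
proof -
  have "mm s' (1 + (u * n + v)) = mm s (1 + (u * n + v))" if "u < n" "v < n" for u v
    using assms(3) matrix_address[OF that] layout(1) by simp
  then show ?thesis using assms(1,2) by (simp add: base_on_def)
qed

lemma base_rg [simp]: "8 \<le> i \<Longrightarrow> base_on (g(i := v)) m = base_on g m"
  and base_mm [simp]: "HT \<le> a \<Longrightarrow> base_on g (m(a := v)) = base_on g m"
proof -
  show "base_on (g(i := v)) m = base_on g m" if "8 \<le> i" using that by (auto simp: base_on_def)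
  show "base_on g (m(a := v)) = base_on g m" if a: "HT \<le> a"
  proof -
    have "1 + (u * n + w) \<noteq> a" if "u < n" "w < n" for u w
      using matrix_address[OF that] layout(1) a by simp
    then show ?thesis by (auto simp: base_on_def)
  qed
qed

text \<open>Equal elements count as comparable: both matrix entries are 1, and truncated subtraction
  gives 0.\<close>

lemma INCMP:
  assumes "base s" "eval x s < n" "eval y s < n" "ok X W x s" "ok X W y s"
  shows "ok X W (INCMP x y) s"
    "eval (INCMP x y) s = (if incomparable r (eval x s) (eval y s) then 1 else 0)"
proof -
  note a = matrix_address[OF assms(2,3)] matrix_address[OF assms(3,2)]
  have b: "mm s (Suc (eval x s * n + eval y s)) = (if (eval x s, eval y s) \<in> r then 1 else 0)"
    "mm s (Suc (eval y s * n + eval x s)) = (if (eval y s, eval x s) \<in> r then 1 else 0)"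
    using assms(1-3) by (auto simp: base_on_def)
  have W: "eval x s * n \<le> W" "eval y s * n \<le> W" "eval x s * n + eval y s \<le> W" "eval y s * n + eval x s \<le> W"
    "Suc (eval x s * n + eval y s) \<le> W" "Suc (eval y s * n + eval x s) \<le> W"
    "Suc (eval x s * n + eval y s) < X" "Suc (eval y s * n + eval x s) < X" "2 \<le> W"
    using a layout by linarith+
  show "ok X W (INCMP x y) s" unfolding INCMP_def
    using assms W b by (simp add: baseD)
  show "eval (INCMP x y) s = (if incomparable r (eval x s) (eval y s) then 1 else 0)"
    unfolding INCMP_def using b by (simp add: baseD[OF assms(1)] incomparable_def)
qed

text \<open>Index 0 holds the element itself, which is comparable to itself and ends the scan. Every
  cell passed holds an incomparable element, and these pay for the ticks.\<close>

lemma lwp_DOWN: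
  assumes "base s" "b \<in> {4, 5}" "rg s 11 < n" "rg s 12 \<le> n + 1" "\<And>j. j \<le> rg s 12 \<Longrightarrow> mm s (rg s b + j) < n"
    "rg s 12 + rg s b < X" "mm s (rg s b) = rg s 11"
    "\<And>i. i \<le> rg s 12 \<Longrightarrow> \<not> incomparable r (mm s (rg s b + i)) (rg s 11) \<Longrightarrow>
      (\<And>j. i < j \<Longrightarrow> j \<le> rg s 12 \<Longrightarrow> incomparable r (mm s (rg s b + j)) (rg s 11)) \<Longrightarrow>
      Q (s\<lparr>rg := (rg s)(12 := i), gh := gh s @ replicate (rg s 12 - i) Tick\<rparr>)"
  shows "lwp X W (DOWN b) Q s"
  using assms
proof (induction "rg s 12" arbitrary: s)
  case 0
  have ok: "ok X W (ARR b (V 12)) s" "eval (ARR b (V 12)) s = rg s 11"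
    using 0(1,2,3,7,8) 0(6)[of 0] layout by auto
  have e: "ok X W (INCMP (ARR b (V 12)) (V 11)) s" "eval (INCMP (ARR b (V 12)) (V 11)) s = 0"
    using INCMP[of s "ARR b (V 12)" "V 11"] 0(2,4) ok refl_r[of "rg s 11"] by (auto simp: incomparable_def)
  have "Q (s\<lparr>rg := (rg s)(12 := 0), gh := gh s @ replicate (rg s 12 - 0) Tick\<rparr>)"
    by (rule "0.prems"(8)) (use 0 e(2) refl_r[of "rg s 11"] in \<open>auto simp: incomparable_def\<close>)
  moreover have "(rg s)(12 := 0) = rg s" using 0(1) by auto
  ultimately have "Q s" using 0(1)[symmetric] by simp
  then show ?case unfolding DOWN_def by (subst lwp_While) (use e in auto)
next
  case (Suc k)
  have ok: "ok X W (ARR b (V 12)) s" "eval (ARR b (V 12)) s = mm s (rg s b + rg s 12)" "mm s (rg s b + rg s 12) < n"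
    using Suc(2,5,8) Suc(7)[of "rg s 12"] layout by auto
  have e: "ok X W (INCMP (ARR b (V 12)) (V 11)) s"
    "eval (INCMP (ARR b (V 12)) (V 11)) s = (if incomparable r (mm s (rg s b + rg s 12)) (rg s 11) then 1 else 0)"
    using INCMP[of s "ARR b (V 12)" "V 11"] Suc(3,5) ok by auto
  show ?case
  proof (cases "incomparable r (mm s (rg s b + rg s 12)) (rg s 11)")
    case False
    have "Q (s\<lparr>rg := (rg s)(12 := rg s 12), gh := gh s @ replicate (rg s 12 - rg s 12) Tick\<rparr>)"
      by (rule Suc.prems(8)) (use False in auto)
    then have "Q s" by simp
    then show ?thesis unfolding DOWN_def by (subst lwp_While) (use e False in auto)
  next
    case True
    let ?s = "s\<lparr>gh := gh s @ [Tick], rg := (rg s)(12 := k)\<rparr>"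
    have b: "b \<noteq> 12" using Suc.prems(2) by auto
    have k: "rg s 12 = Suc k" using Suc(2) by simp
    have "lwp X W (DOWN b) Q ?s"
    proof (rule Suc.hyps(1))
      fix i assume i: "i \<le> rg ?s 12" "\<not> incomparable r (mm ?s (rg ?s b + i)) (rg ?s 11)"
        "\<And>j. i < j \<Longrightarrow> j \<le> rg ?s 12 \<Longrightarrow> incomparable r (mm ?s (rg ?s b + j)) (rg ?s 11)"
      have "Q (s\<lparr>rg := (rg s)(12 := i), gh := gh s @ replicate (rg s 12 - i) Tick\<rparr>)"
        by (rule Suc.prems(8)) (use i b k True le_Suc_eq in \<open>auto split: if_splits\<close>)
      moreover have "replicate (rg s 12 - i) Tick = Tick # replicate (k - i) Tick"
        using i(1) k by (simp add: Suc_diff_le)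
      ultimately show "Q (?s\<lparr>rg := (rg ?s)(12 := i), gh := gh ?s @ replicate (rg ?s 12 - i) Tick\<rparr>)" by simp
    qed (use Suc.prems b k in auto)
    then show ?thesis unfolding DOWN_def
      by (subst lwp_While) (use e True k layout in \<open>auto simp: lwp_simps\<close>)
  qed
qed

lemma lwp_SHIFT:
  assumes "base s" "rg s 12 \<le> n" "rg s 12 + LL + 1 < CA" "\<And>j. j \<le> rg s 12 \<Longrightarrow> mm s (LL + j) < n"
    "mm s (HT + mm s LL) < rg s 15" "\<And>j. j \<le> rg s 12 \<Longrightarrow> mm s (HT + mm s (LL + j)) \<le> n"
    "\<And>i. i \<le> rg s 12 \<Longrightarrow> mm s (HT + mm s (LL + i)) < rg s 15 \<Longrightarrow>
      (\<And>j. i < j \<Longrightarrow> j \<le> rg s 12 \<Longrightarrow> rg s 15 \<le> mm s (HT + mm s (LL + j))) \<Longrightarrow>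
      Q (s\<lparr>rg := (rg s)(12 := i), mm := (\<lambda>a. if LL + i + 1 < a \<and> a \<le> LL + rg s 12 + 1 then mm s (a - 1) else mm s a),
         gh := gh s @ replicate (rg s 12 - i) Tick\<rparr>)"
  shows "lwp X W SHIFT Q s"
  using assms
proof (induction "rg s 12" arbitrary: s)
  case 0
  have "Q (s\<lparr>rg := (rg s)(12 := 0), mm := (\<lambda>a. if LL + 0 + 1 < a \<and> a \<le> LL + rg s 12 + 1 then mm s (a - 1) else mm s a),
         gh := gh s @ replicate (rg s 12 - 0) Tick\<rparr>)"
    by (rule "0.prems"(7)) (use 0 in auto)
  moreover have "(rg s)(12 := 0) = rg s" using 0(1) by auto
  moreover have "(\<lambda>a. if LL + 0 + 1 < a \<and> a \<le> LL + rg s 12 + 1 then mm s (a - 1) else mm s a) = mm s"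
    using 0(1) by auto
  ultimately have "Q s" using 0(1)[symmetric] by simp
  moreover have "mm s LL < n" "mm s (HT + mm s LL) \<le> n" using 0(5)[of 0] 0(7)[of 0] by auto
  ultimately show ?case unfolding SHIFT_def
    by (subst lwp_While) (use 0(1)[symmetric] 0(2,6) layout in \<open>auto simp: baseD\<close>)
next
  case (Suc k)
  have m: "mm s (LL + rg s 12) < n" "mm s (HT + mm s (LL + rg s 12)) \<le> n"
    using Suc(6)[of "rg s 12"] Suc(8)[of "rg s 12"] by auto
  let ?e = "Minus (Plus (ARR 2 (ARR 4 (V 12))) (N 1)) (V 15)"
  have e: "ok X W ?e s" "eval ?e s = mm s (HT + mm s (LL + rg s 12)) + 1 - rg s 15"
    using m Suc(3,4) layout by (auto simp: baseD)
  show ?case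
  proof (cases "mm s (HT + mm s (LL + rg s 12)) < rg s 15")
    case True
    have "Q (s\<lparr>rg := (rg s)(12 := rg s 12), mm := (\<lambda>a. if LL + rg s 12 + 1 < a \<and> a \<le> LL + rg s 12 + 1 then mm s (a - 1) else mm s a),
         gh := gh s @ replicate (rg s 12 - rg s 12) Tick\<rparr>)"
      by (rule Suc.prems(7)) (use True in auto)
    moreover have "(\<lambda>a. if LL + rg s 12 + 1 < a \<and> a \<le> LL + rg s 12 + 1 then mm s (a - 1) else mm s a) = mm s"
      by auto
    ultimately have "Q s" by simp
    then show ?thesis unfolding SHIFT_def by (subst lwp_While) (use e True in auto)
  next
    case False
    have k: "rg s 12 = Suc k" using Suc(2) by simp
    define m where "m = (mm s)(LL + Suc k + 1 := mm s (LL + Suc k))"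
    let ?s = "s\<lparr>gh := gh s @ [Tick], mm := m, rg := (rg s)(12 := k)\<rparr>"
    have HL: "HT + i < LL" if "i < n" for i using that layout by linarith
    have same: "m (LL + j) = mm s (LL + j)" "m (HT + mm s (LL + j)) = mm s (HT + mm s (LL + j))" if "j \<le> Suc k" for j
      using that HL[OF Suc.prems(4)[of j]] k by (auto simp: m_def)
    have "lwp X W SHIFT Q ?s"
    proof (rule Suc.hyps(1))
      show "base ?s" by (rule base_cong[OF Suc.prems(1)]) (use layout in \<open>auto simp: m_def\<close>)
      show "mm ?s (HT + mm ?s LL) < rg ?s 15" using same[of 0] Suc.prems(5) by simp
      show "mm ?s (LL + j) < n" "mm ?s (HT + mm ?s (LL + j)) \<le> n" if "j \<le> rg ?s 12" for j
        using that same[of j] Suc.prems(4,6)[of j] k by simp_all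
      fix i assume i: "i \<le> rg ?s 12" "mm ?s (HT + mm ?s (LL + i)) < rg ?s 15"
        "\<And>j. i < j \<Longrightarrow> j \<le> rg ?s 12 \<Longrightarrow> rg ?s 15 \<le> mm ?s (HT + mm ?s (LL + j))"
      have "Q (s\<lparr>rg := (rg s)(12 := i), mm := (\<lambda>a. if LL + i + 1 < a \<and> a \<le> LL + rg s 12 + 1 then mm s (a - 1) else mm s a),
         gh := gh s @ replicate (rg s 12 - i) Tick\<rparr>)"
      proof (rule Suc.prems(7))
        show "i \<le> rg s 12" using i(1) k by simp
        show "mm s (HT + mm s (LL + i)) < rg s 15" using i(1,2) same[of i] by simp
        fix j assume j: "i < j" "j \<le> rg s 12"
        show "rg s 15 \<le> mm s (HT + mm s (LL + j))"
          using i(3)[of j] j same[of j] False k by (cases "j = Suc k") auto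
      qed
      moreover have "replicate (rg s 12 - i) Tick = Tick # replicate (k - i) Tick"
        using i(1) k by (simp add: Suc_diff_le)
      moreover have "(\<lambda>a. if LL + i + 1 < a \<and> a \<le> LL + rg ?s 12 + 1 then mm ?s (a - 1) else mm ?s a)
        = (\<lambda>a. if LL + i + 1 < a \<and> a \<le> LL + rg s 12 + 1 then mm s (a - 1) else mm s a)"
        using i(1) k by (auto simp: fun_eq_iff m_def)
      ultimately show "Q (?s\<lparr>rg := (rg ?s)(12 := i), mm := (\<lambda>a. if LL + i + 1 < a \<and> a \<le> LL + rg ?s 12 + 1 then mm ?s (a - 1) else mm ?s a),
         gh := gh ?s @ replicate (rg ?s 12 - i) Tick\<rparr>)" by simp
    qed (use Suc.prems k in auto)
    then show ?thesis unfolding SHIFT_def m_def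
      by (subst lwp_While) (use e False k Suc.prems(1,2,3) layout in \<open>auto simp: lwp_simps baseD\<close>)
  qed
qed

subsection \<open>Heights\<close>

text \<open>\<open>HG h p xs\<close>: h and p are the heights and predecessors computed from the list xs, in which every
  element comes after the smaller ones (or every element before them).\<close>

definition HG :: "(nat \<Rightarrow> nat) \<Rightarrow> (nat \<Rightarrow> nat) \<Rightarrow> nat list \<Rightarrow> bool" where
  "HG h p xs \<longleftrightarrow> (\<forall>j<length xs. 1 \<le> h (xs ! j)
     \<and> (h (xs ! j) = 1 \<or> (\<exists>i<j. p (xs ! j) = xs ! i \<and> \<not> incomparable r (xs ! i) (xs ! j) \<and> h (xs ! j) = h (xs ! i) + 1))
     \<and> (\<forall>i<j. \<not> incomparable r (xs ! i) (xs ! j) \<longrightarrow> h (xs ! i) < h (xs ! j)))"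

lemma HG_Nil [simp]: "HG h p []"
  by (simp add: HG_def)

lemma HG_cong:
  assumes "HG h p xs" "\<And>v. v \<in> set xs \<Longrightarrow> h' v = h v \<and> p' v = p v"
  shows "HG h' p' xs"
proof -
  have "h' (xs ! j) = h (xs ! j)" "p' (xs ! j) = p (xs ! j)" if "j < length xs" for j
    using assms(2) that by auto
  then show ?thesis using assms(1) unfolding HG_def by (smt (verit) order.strict_trans)
qed

lemma HG_snoc:
  assumes HG: "HG h p xs"
    and v: "1 \<le> h v" "h v = 1 \<or> (\<exists>u\<in>set xs. p v = u \<and> \<not> incomparable r u v \<and> h v = h u + 1)"
      "\<And>u. u \<in> set xs \<Longrightarrow> \<not> incomparable r u v \<Longrightarrow> h u < h v"
  shows "HG h p (xs @ [v])"
  unfolding HG_def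
proof (intro allI impI)
  fix j assume j: "j < length (xs @ [v])"
  let ?P = "\<lambda>ys j. 1 \<le> h (ys ! j)
     \<and> (h (ys ! j) = 1 \<or> (\<exists>i<j. p (ys ! j) = ys ! i \<and> \<not> incomparable r (ys ! i) (ys ! j) \<and> h (ys ! j) = h (ys ! i) + 1))
     \<and> (\<forall>i<j. \<not> incomparable r (ys ! i) (ys ! j) \<longrightarrow> h (ys ! i) < h (ys ! j))"
  show "?P (xs @ [v]) j"
  proof (cases "j < length xs")
    case True
    have eq: "(xs @ [v]) ! i = xs ! i" if "i \<le> j" for i using that True by (simp add: nth_append)
    have "?P xs j" using HG True unfolding HG_def by blast
    then show ?thesis using eq by (metis less_imp_le order_refl)
  next
    case False
    then have j': "j = length xs" using j by simp
    have eq: "(xs @ [v]) ! j = v" "\<And>i. i < j \<Longrightarrow> (xs @ [v]) ! i = xs ! i" by (auto simp: j' nth_append)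
    have "h v = 1 \<or> (\<exists>i<j. p v = xs ! i \<and> \<not> incomparable r (xs ! i) v \<and> h v = h (xs ! i) + 1)"
      using v(2) unfolding j' by (metis in_set_conv_nth)
    moreover have "\<forall>i<j. \<not> incomparable r (xs ! i) v \<longrightarrow> h (xs ! i) < h v" using v(3) by (auto simp: j')
    ultimately show ?thesis using v(1) eq by auto
  qed
qed

lemma HG_bound: "HG h p xs \<Longrightarrow> j < length xs \<Longrightarrow> h (xs ! j) \<le> Suc j"
proof (induction j rule: less_induct)
  case (less j)
  then consider "h (xs ! j) = 1" | i where "i < j" "h (xs ! j) = h (xs ! i) + 1" unfolding HG_def by blast
  then show ?case
  proof cases
    case 2
    then show ?thesis using less.IH[OF 2(1)] less.prems by simp
  qed simp
qed

abbreviation ht :: "(nat \<Rightarrow> nat) \<Rightarrow> nat \<Rightarrow> nat" where "ht m v \<equiv> m (HT + v)"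
abbreviation pr :: "(nat \<Rightarrow> nat) \<Rightarrow> nat \<Rightarrow> nat" where "pr m v \<equiv> m (PR + v)"

definition hinv :: "nat list \<Rightarrow> nat list \<Rightarrow> ev list st \<Rightarrow> bool" where
  "hinv xs L s \<longleftrightarrow> base s \<and> rg s 14 = length xs \<and> wf xs \<and> HG (ht (mm s)) (pr (mm s)) xs
     \<and> set L = set xs \<and> distinct L \<and> (\<forall>j<length L. mm s (LL + 1 + j) = L ! j)
     \<and> sorted (map (ht (mm s)) L)"

lemma hinv_length: "hinv xs L s \<Longrightarrow> length L = length xs"
  unfolding hinv_def wf_def by (metis distinct_card)

lemma hinv_ht_le: "hinv xs L s \<Longrightarrow> v \<in> set xs \<Longrightarrow> ht (mm s) v \<le> length xs \<and> v < n"
  using HG_bound[of "ht (mm s)" "pr (mm s)" xs] unfolding hinv_def wf_def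
  by (metis Suc_leI in_set_conv_nth lessThan_iff order_trans subsetD)

text \<open>In a list sorted by height, the first comparable entry met from the top is the tallest
  one, so the new height is one more than its height. Both scans pass only entries that are
  incomparable to the new element.\<close>

lemma lwp_INSERT:
  assumes inv: "hinv xs L s" and v: "rg s 11 = v" "v \<notin> set xs" "v < n"
  shows "lwp X W INSERT (\<lambda>s'. (\<exists>L'. hinv (xs @ [v]) L' s') \<and> (\<forall>i. i \<notin> {12, 13, 14, 15} \<longrightarrow> rg s' i = rg s i)
     \<and> (\<forall>a. a < HT \<or> CA \<le> a \<longrightarrow> mm s' a = mm s a)
     \<and> (\<exists>t. gh s' = gh s @ replicate t Tick \<and> t \<le> 2 * length (filter (incomparable r v) xs))) s"
proof -
  define k where "k = length xs"
  have b: "base s" and k: "rg s 14 = k" and wf: "wf xs" and HG: "HG (ht (mm s)) (pr (mm s)) xs"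
    and L: "set L = set xs" "distinct L" "\<And>j. j < k \<Longrightarrow> mm s (LL + 1 + j) = L ! j" "sorted (map (ht (mm s)) L)"
    and lenL: "length L = k"
    using inv hinv_length[OF inv] by (auto simp: hinv_def k_def)
  have "wf (xs @ [v])" using wf v by (auto simp: wf_def)
  then have kn: "k < n" using length_le_n[of "xs @ [v]"] by (simp add: k_def)
  have Ln: "L ! j < n" "ht (mm s) (L ! j) \<le> k" "L ! j \<noteq> v" "L ! j \<in> set xs" if "j < k" for j
    using hinv_ht_le[OF inv, of "L ! j"] that L(1) lenL nth_mem[of j L] v(2) by (auto simp: k_def)
  define s1 where "s1 = s\<lparr>mm := (mm s)(HT + v := 0, LL := v), rg := (rg s)(12 := k)\<rparr>"
  have m1: "mm s1 LL = v" "mm s1 (HT + v) = 0" "\<And>j. j < k \<Longrightarrow> mm s1 (LL + 1 + j) = L ! j"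
    "\<And>u. u \<noteq> v \<Longrightarrow> u < n \<Longrightarrow> mm s1 (HT + u) = mm s (HT + u)"
    "\<And>u. u < n \<Longrightarrow> mm s1 (PR + u) = mm s (PR + u)"
    using L(3) v(3) layout by (auto simp: s1_def)
  have m1': "mm s1 (LL + j) = (if j = 0 then v else L ! (j - 1))" if "j \<le> k" for j
    using m1(1) m1(3)[of "j - 1"] that by (cases j) auto
  have b1: "base s1" using b layout by (simp add: s1_def)
  have r1: "rg s1 12 = k" "rg s1 11 = v" "rg s1 14 = k" "rg s1 4 = LL" using k v b by (auto simp: s1_def baseD)
  have lay: "LL + k + 1 < CA" "HT + v < PR" "PR + v < LL" "CA < X" "X \<le> W" "LL < X" "HT < X"
    using kn v(3) layout by linarith+
  have main: "lwp X W (DOWN 4 ;; Asg 13 (ARR 4 (V 12)) ;; Asg 15 (Plus (ARR 2 (V 13)) (N 1)) ;; Sto (ADR 3 (V 11)) (V 13) ;;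
     Asg 12 (V 14) ;; SHIFT ;;
     Sto (Plus (ADR 4 (V 12)) (N 1)) (V 11) ;; Sto (ADR 2 (V 11)) (V 15) ;; Asg 14 (Plus (V 14) (N 1)))
     (\<lambda>s'. (\<exists>L'. hinv (xs @ [v]) L' s') \<and> (\<forall>i. i \<notin> {12, 13, 14, 15} \<longrightarrow> rg s' i = rg s i)
     \<and> (\<forall>a. a < HT \<or> CA \<le> a \<longrightarrow> mm s' a = mm s a)
     \<and> (\<exists>t. gh s' = gh s @ replicate t Tick \<and> t \<le> 2 * length (filter (incomparable r v) xs))) s1"
    (is "lwp X W (DOWN 4 ;; ?rest) ?Q s1")
    unfolding lwp_simps(4)[of X W "DOWN 4"]
  proof (rule lwp_DOWN[OF b1])
    show "mm s1 (rg s1 4 + j) < n" if "j \<le> rg s1 12" for j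
      using m1'[of j] Ln(1)[of "j - 1"] that r1 v(3) by (cases j) auto
    fix i assume i0: "i \<le> rg s1 12" "\<not> incomparable r (mm s1 (rg s1 4 + i)) (rg s1 11)"
      "\<And>j. i < j \<Longrightarrow> j \<le> rg s1 12 \<Longrightarrow> incomparable r (mm s1 (rg s1 4 + j)) (rg s1 11)"
    then have i: "i \<le> k" "i = 0 \<or> \<not> incomparable r (L ! (i - 1)) v"
      using m1'[of i] r1 by (auto split: if_splits)
    have i3: "incomparable r (L ! j) v" if "i \<le> j" "j < k" for j
      using i0(3)[of "Suc j"] m1'[of "Suc j"] r1 that by simp
    note i = i i3
    define x where "x = (if i = 0 then v else L ! (i - 1))"
    define h where "h = (if i = 0 then 0 else ht (mm s) x) + 1"
    have x: "x < n" "ht (mm s1) x + 1 = h" "mm s1 (LL + i) = x" "i \<noteq> 0 \<Longrightarrow> x \<in> set xs" "h \<le> k + 1"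
      using m1'[OF i(1)] i(1) Ln[of "i - 1"] v(3) m1(2) m1(4)[of x] by (auto simp: x_def h_def)
    define s2 where "s2 = s1\<lparr>gh := gh s1 @ replicate (k - i) Tick, mm := (mm s1)(PR + v := x), rg := (rg s1)(13 := x, 15 := h, 12 := k)\<rparr>"
    have m2: "mm s2 (PR + v) = x" "\<And>a. a \<noteq> PR + v \<Longrightarrow> mm s2 a = mm s1 a" by (auto simp: s2_def)
    have m2': "mm s2 (LL + j) = (if j = 0 then v else L ! (j - 1))" if "j \<le> k" for j
      using m1'[OF that] m2(2)[of "LL + j"] lay by auto
    have m2h: "mm s2 (HT + u) = (if u = v then 0 else ht (mm s) u)" if "u < n" for u
      using m2(2)[of "HT + u"] m1(2) m1(4)[of u] that layout by auto
    have b2: "base s2" using b1 layout by (simp add: s2_def)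
    have r2: "rg s2 12 = k" "rg s2 15 = h" "rg s2 11 = v" "rg s2 14 = k" using r1 by (auto simp: s2_def)
    have h2: "mm s2 (HT + mm s2 (LL + j)) \<le> n" if "j \<le> k" for j
    proof (cases j)
      case 0 then show ?thesis using m2'[OF that] m2h[OF v(3)] by simp
    next
      case (Suc j')
      then show ?thesis using m2'[OF that] m2h[of "L ! j'"] Ln[of j'] kn that by auto
    qed
    have "lwp X W (SHIFT ;; Sto (Plus (ADR 4 (V 12)) (N 1)) (V 11) ;; Sto (ADR 2 (V 11)) (V 15) ;; Asg 14 (Plus (V 14) (N 1))) ?Q s2"
      unfolding lwp_simps(4)[of X W SHIFT]
    proof (rule lwp_SHIFT[OF b2])
      show "mm s2 (LL + j) < n" if "j \<le> rg s2 12" for j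
        using m2'[of j] Ln(1)[of "j - 1"] that r2 v(3) by (cases j) auto
      show "mm s2 (HT + mm s2 LL) < rg s2 15" using m2'[of 0] m2h[OF v(3)] r2 by (simp add: h_def)
      show "mm s2 (HT + mm s2 (LL + j)) \<le> n" if "j \<le> rg s2 12" for j using h2 that r2 by simp
      show "rg s2 12 \<le> n" "rg s2 12 + LL + 1 < CA" using kn lay r2 by auto
      fix l assume l0: "l \<le> rg s2 12" "mm s2 (HT + mm s2 (LL + l)) < rg s2 15"
        "\<And>j. l < j \<Longrightarrow> j \<le> rg s2 12 \<Longrightarrow> rg s2 15 \<le> mm s2 (HT + mm s2 (LL + j))"
      have hL: "mm s2 (HT + mm s2 (LL + Suc j)) = ht (mm s) (L ! j)" if "j < k" for j
        using m2'[of "Suc j"] m2h[of "L ! j"] Ln[OF that] that by auto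
      have l1: "l \<le> k" using l0(1) r2 by simp
      have l2: "l = 0 \<or> ht (mm s) (L ! (l - 1)) < h"
        using l0(2) l1 r2 hL[of "l - 1"] by (cases l) auto
      have l3: "h \<le> ht (mm s) (L ! j)" if "l \<le> j" "j < k" for j
        using l0(3)[of "Suc j"] r2 hL[of j] that by simp
      note l = l1 l2 l3
      \<comment> \<open>The entry that ended the first scan has height \<open>h - 1\<close>, so the
        second scan stops there at the latest.\<close>
      have il: "i \<le> l"
      proof (rule ccontr)
        assume "\<not> i \<le> l"
        then have "h \<le> ht (mm s) (L ! (i - 1))" using l(3)[of "i - 1"] i(1) by auto
        then show False using \<open>\<not> i \<le> l\<close> by (auto simp: h_def x_def)
      qed
      define L' where "L' = take l L @ v # drop l L"
      define m3 where "m3 = (\<lambda>a. if LL + l + 1 < a \<and> a \<le> LL + rg s2 12 + 1 then mm s2 (a - 1) else mm s2 a)"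
      define s4 where "s4 = s2\<lparr>rg := (rg s2)(12 := l, 14 := k + 1), mm := m3(LL + l + 1 := v, HT + v := h),
         gh := gh s2 @ replicate (rg s2 12 - l) Tick\<rparr>"
      have m4: "mm s4 (LL + 1 + j) = L' ! j" if j: "j < Suc k" for j
      proof -
        have ne: "LL + 1 + j \<noteq> HT + v" using lay by auto
        consider "j < l" | "j = l" | "l < j" by linarith
        then show ?thesis
        proof cases
          case 1 then show ?thesis using m2'[of "Suc j"] l(1) ne lenL
            by (auto simp: s4_def m3_def L'_def nth_append)
        next
          case 2 then show ?thesis using ne lenL l(1) by (auto simp: s4_def L'_def nth_append)
        next
          case 3
          then have "L' ! j = L ! (j - 1)" using lenL l(1) j by (auto simp: L'_def nth_append nth_Cons')
          then show ?thesis using 3 m2'[of j] j ne r2 by (auto simp: s4_def m3_def)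
        qed
      qed
      have m4h: "ht (mm s4) u = (if u = v then h else ht (mm s) u)" if "u < n" for u
        using m2h[OF that] that layout by (auto simp: s4_def m3_def)
      have m4p: "pr (mm s4) u = (if u = v then x else pr (mm s) u)" if "u < n" for u
        using m2(1) m2(2)[of "PR + u"] m1(5)[OF that] that v(3) layout by (auto simp: s4_def m3_def)
      have m4o: "mm s4 a = mm s a" if "a < HT \<or> CA \<le> a" for a
        using that m2(2)[of a] lay l(1) r2 by (auto simp: s4_def m3_def s1_def)
      have b4: "base s4"
      proof (rule base_cong[OF b])
        show "rg s4 i = rg s i" if "i < 8" for i using that by (simp add: s4_def s2_def s1_def)
      qed (use m4o in blast)
      have nv: "u < n \<and> u \<noteq> v" if "u \<in> set xs" for u using wf v(2) that by (auto simp: wf_def)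
      have HG4: "HG (ht (mm s4)) (pr (mm s4)) xs"
        by (rule HG_cong[OF HG]) (use m4h m4p nv in auto)
      have cmp: "ht (mm s) u < h" if u: "u \<in> set xs" "\<not> incomparable r u v" for u
      proof -
        obtain j where j: "j < k" "u = L ! j" using u(1) L(1) lenL by (metis in_set_conv_nth)
        then have ji: "j < i" using i(3)[of j] u(2) by (cases "i \<le> j") auto
        have "ht (mm s) (L ! j) \<le> ht (mm s) (L ! (i - 1))"
          using sorted_nth_mono[OF L(4), of j "i - 1"] ji i(1) lenL by simp
        then show ?thesis using ji j(2) by (simp add: h_def x_def)
      qed
      have HG': "HG (ht (mm s4)) (pr (mm s4)) (xs @ [v])"
      proof (rule HG_snoc[OF HG4])
        show "1 \<le> ht (mm s4) v" using m4h[OF v(3)] by (simp add: h_def)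
        show "ht (mm s4) v = 1 \<or> (\<exists>u\<in>set xs. pr (mm s4) v = u \<and> \<not> incomparable r u v \<and> ht (mm s4) v = ht (mm s4) u + 1)"
        proof (cases "i = 0")
          case True then show ?thesis using m4h[OF v(3)] by (simp add: h_def)
        next
          case False
          have "\<not> incomparable r x v" using i(2) False by (simp add: x_def)
          then show ?thesis using m4h[OF v(3)] m4p[OF v(3)] m4h[OF x(1)] x(4)[OF False] False nv
            by (auto simp: h_def)
        qed
        show "ht (mm s4) u < ht (mm s4) v" if "u \<in> set xs" "\<not> incomparable r u v" for u
          using cmp[OF that] m4h[OF v(3)] m4h[of u] nv[OF that(1)] by simp
      qed
      have setL': "set L' = set (xs @ [v])" "distinct L'" "length L' = Suc k"
      proof -
        have "set L' = insert v (set (take l L) \<union> set (drop l L))" by (auto simp: L'_def)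
        also have "set (take l L) \<union> set (drop l L) = set L" by (metis append_take_drop_id set_append)
        finally show "set L' = set (xs @ [v])" using L(1) by simp
        show "distinct L'" using L(1,2) v(2) set_take_disj_set_drop_if_distinct[OF L(2), of l l]
          by (auto simp: L'_def dest: in_set_takeD in_set_dropD)
        show "length L' = Suc k" using lenL l(1) by (simp add: L'_def)
      qed
      have srt: "sorted (map (ht (mm s4)) L')"
      proof -
        have eq: "map (ht (mm s4)) (take l L) = take l (map (ht (mm s)) L)"
          "map (ht (mm s4)) (drop l L) = drop l (map (ht (mm s)) L)"
          unfolding take_map drop_map using nv L(1) m4h
          by (auto dest!: in_set_takeD in_set_dropD)
        have "y \<le> h" if "y \<in> set (take l (map (ht (mm s)) L))" for y
        proof -
          obtain j where j: "j < l" "j < k" "y = ht (mm s) (L ! j)"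
            using \<open>y \<in> set (take l (map (ht (mm s)) L))\<close> lenL l(1) by (auto simp: in_set_conv_nth)
          have "y \<le> ht (mm s) (L ! (l - 1))" unfolding j(3)
            using sorted_nth_mono[OF L(4), of j "l - 1"] j l(1) lenL by simp
          then show ?thesis using l(2) j(1) by auto
        qed
        moreover have "h \<le> y" if "y \<in> set (drop l (map (ht (mm s)) L))" for y
          using that l(3) lenL by (auto simp: in_set_conv_nth)
        moreover have "sorted (take l (map (ht (mm s)) L))" "sorted (drop l (map (ht (mm s)) L))"
          using L(4) by (auto intro: sorted_wrt_take sorted_wrt_drop)
        ultimately have "sorted (take l (map (ht (mm s)) L) @ h # drop l (map (ht (mm s)) L))"
          by (fastforce simp: sorted_append)
        then show ?thesis unfolding L'_def map_append list.map eq using m4h[OF v(3)] by simp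
      qed
      have "hinv (xs @ [v]) L' s4" unfolding hinv_def
        using b4 HG' setL' srt m4 \<open>wf (xs @ [v])\<close> by (auto simp: s4_def k_def)
      moreover have "\<exists>t. gh s4 = gh s @ replicate t Tick \<and> t \<le> 2 * length (filter (incomparable r v) xs)"
      proof (intro exI conjI)
        show "gh s4 = gh s @ replicate ((k - i) + (k - l)) Tick"
          using r2 by (simp add: s4_def s2_def s1_def replicate_add)
        have "set (drop i L) \<subseteq> set (filter (incomparable r v) xs)"
          using i(3) lenL L(1) nth_mem[of "i + _" L] by (auto simp: in_set_conv_nth incomparable_commute)
        then have "card (set (drop i L)) \<le> card (set (filter (incomparable r v) xs))" by (intro card_mono) auto
        moreover have "card (set (drop i L)) = k - i" using L(2) lenL by (simp add: distinct_card)
        moreover have "card (set (filter (incomparable r v) xs)) = length (filter (incomparable r v) xs)"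
          using wf by (intro distinct_card) (simp add: wf_def)
        ultimately show "(k - i) + (k - l) \<le> 2 * length (filter (incomparable r v) xs)" using il by simp
      qed
      moreover have "\<forall>i. i \<notin> {12, 13, 14, 15} \<longrightarrow> rg s4 i = rg s i" by (simp add: s4_def s2_def s1_def)
      ultimately have "?Q s4" using m4o by blast
      moreover have "s4 = s2\<lparr>rg := (rg s2)(12 := l), mm := m3, gh := gh s2 @ replicate (rg s2 12 - l) Tick,
         mm := m3(LL + l + 1 := v, HT + v := h), rg := (rg s2)(12 := l, 14 := k + 1)\<rparr>"
        by (simp add: s4_def)
      ultimately show "lwp X W (Sto (Plus (ADR 4 (V 12)) (N 1)) (V 11) ;; Sto (ADR 2 (V 11)) (V 15) ;; Asg 14 (Plus (V 14) (N 1))) ?Q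
         (s2\<lparr>rg := (rg s2)(12 := l), mm := \<lambda>a. if LL + l + 1 < a \<and> a \<le> LL + rg s2 12 + 1 then mm s2 (a - 1) else mm s2 a,
         gh := gh s2 @ replicate (rg s2 12 - l) Tick\<rparr>)"
        unfolding m3_def[symmetric] using r2 b2 lay l(1) kn layout
        by (auto simp: lwp_simps baseD)
    qed
    then show "lwp X W ?rest ?Q (s1\<lparr>rg := (rg s1)(12 := i), gh := gh s1 @ replicate (rg s1 12 - i) Tick\<rparr>)"
      using r1 b1 x lay layout i(1) kn v
      by (simp add: lwp_simps baseD s2_def)
  qed (use r1 lay kn m1 v in auto)
  show ?thesis unfolding INSERT_def
    using main b v k lay layout by (simp add: lwp_simps baseD s1_def)
qed

end

context program
begin

section \<open>Linked lists, and the heights of a list of candidates\<close>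

text \<open>Address 0 marks the end of a list, which is safe because the heap starts at the positive
  address \<open>HP0\<close>.\<close>

fun lst :: "nat \<Rightarrow> (nat \<Rightarrow> nat) \<Rightarrow> nat \<Rightarrow> nat list \<Rightarrow> bool" where
  "lst h m p [] \<longleftrightarrow> p = 0"
| "lst h m p (x # xs) \<longleftrightarrow> HP0 \<le> p \<and> p + 1 < h \<and> m p = x \<and> lst h m (m (p + 1)) xs"

lemma lst_cong:
  "lst h m p xs \<Longrightarrow> h \<le> h' \<Longrightarrow> (\<And>a. HP0 \<le> a \<Longrightarrow> a < h \<Longrightarrow> m' a = m a) \<Longrightarrow> lst h' m' p xs"
  by (induction xs arbitrary: p) auto

lemma HP0_pos: "0 < HP0" "2 < X" "2 < W" "X \<le> W" "HP0 \<le> X"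
  using layout by linarith+

lemma inc_append: "inc (xs @ [v]) = inc xs + length (filter (incomparable r v) xs)"
  by (induction xs) (auto simp: incomparable_commute)

lemma lwp_NEXT:
  assumes "lst h (mm s) (rg s 10) (v # ys)" "h \<le> X"
    "Q (s\<lparr>rg := (rg s)(11 := v, 10 := mm s (rg s 10 + 1))\<rparr>)"
  shows "lwp X W NEXT Q s"
  unfolding NEXT_def using assms HP0_pos by (auto simp: lwp_simps)

text \<open>An insertion costs at most twice the increase of \<open>inc\<close>, so the costs
  telescope.\<close>

lemma heights_loop:
  assumes "hinv xs L s" "lst h (mm s) (rg s 10) ys" "wf (xs @ ys)" "h \<le> X"
  shows "lwp X W (While (V 10) (NEXT ;; INSERT)) (\<lambda>s'. (\<exists>L'. hinv (xs @ ys) L' s')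
     \<and> (\<forall>i. i \<notin> {10, 11, 12, 13, 14, 15} \<longrightarrow> rg s' i = rg s i)
     \<and> (\<forall>a. a < HT \<or> CA \<le> a \<longrightarrow> mm s' a = mm s a)
     \<and> (\<exists>t. gh s' = gh s @ replicate t Tick \<and> t + 2 * inc xs \<le> length ys + 2 * inc (xs @ ys))) s"
  using assms
proof (induction ys arbitrary: xs L s)
  case Nil
  then show ?case by (subst lwp_While) (auto intro!: exI[of _ 0])
next
  case (Cons v ys)
  define s1 where "s1 = (logev Tick s)\<lparr>rg := (rg s)(11 := v, 10 := mm s (rg s 10 + 1))\<rparr>"
  have h1: "hinv xs L s1" using Cons.prems(1) by (simp add: hinv_def s1_def)
  have v: "v \<notin> set xs" "v < n" "rg s1 11 = v" using Cons.prems(3) by (auto simp: wf_def s1_def)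
  have "lwp X W INSERT (lwp X W (While (V 10) (NEXT ;; INSERT)) (\<lambda>s'. (\<exists>L'. hinv (xs @ v # ys) L' s')
     \<and> (\<forall>i. i \<notin> {10, 11, 12, 13, 14, 15} \<longrightarrow> rg s' i = rg s i)
     \<and> (\<forall>a. a < HT \<or> CA \<le> a \<longrightarrow> mm s' a = mm s a)
     \<and> (\<exists>t. gh s' = gh s @ replicate t Tick \<and> t + 2 * inc xs \<le> length (v # ys) + 2 * inc (xs @ v # ys)))) s1"
  proof (rule lwp_mono[OF lwp_INSERT[OF h1 v(3,1,2)]], elim conjE exE)
    fix s2 L2 t2
    assume a: "hinv (xs @ [v]) L2 s2" "\<forall>i. i \<notin> {12, 13, 14, 15} \<longrightarrow> rg s2 i = rg s1 i"
      "\<forall>a. a < HT \<or> CA \<le> a \<longrightarrow> mm s2 a = mm s1 a"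
      "gh s2 = gh s1 @ replicate t2 Tick" "t2 \<le> 2 * length (filter (incomparable r v) xs)"
    have "CA \<le> HP0" using layout by linarith
    then have l2: "lst h (mm s2) (rg s2 10) ys"
      using a Cons.prems(2) by (auto simp: s1_def intro: lst_cong)
    have w: "wf ((xs @ [v]) @ ys)" using Cons.prems(3) by simp
    show "lwp X W (While (V 10) (NEXT ;; INSERT)) (\<lambda>s'. (\<exists>L'. hinv (xs @ v # ys) L' s')
     \<and> (\<forall>i. i \<notin> {10, 11, 12, 13, 14, 15} \<longrightarrow> rg s' i = rg s i)
     \<and> (\<forall>a. a < HT \<or> CA \<le> a \<longrightarrow> mm s' a = mm s a)
     \<and> (\<exists>t. gh s' = gh s @ replicate t Tick \<and> t + 2 * inc xs \<le> length (v # ys) + 2 * inc (xs @ v # ys))) s2"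
    proof (rule lwp_mono[OF Cons.IH[OF a(1) l2 w Cons.prems(4)]], elim conjE exE)
      fix s3 L3 t3
      assume b: "hinv ((xs @ [v]) @ ys) L3 s3" "\<forall>i. i \<notin> {10, 11, 12, 13, 14, 15} \<longrightarrow> rg s3 i = rg s2 i"
      "\<forall>a. a < HT \<or> CA \<le> a \<longrightarrow> mm s3 a = mm s2 a"
      "gh s3 = gh s2 @ replicate t3 Tick" "t3 + 2 * inc (xs @ [v]) \<le> length ys + 2 * inc ((xs @ [v]) @ ys)"
      have "gh s3 = gh s @ replicate (1 + t2 + t3) Tick"
        using a(4) b(4) by (simp add: s1_def replicate_add)
      moreover have "1 + t2 + t3 + 2 * inc xs \<le> length (v # ys) + 2 * inc (xs @ v # ys)"
        using a(5) b(5) by (simp add: inc_append)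
      ultimately have ex: "\<exists>t. gh s3 = gh s @ replicate t Tick \<and> t + 2 * inc xs \<le> length (v # ys) + 2 * inc (xs @ v # ys)"
        by blast
      show "(\<exists>L'. hinv (xs @ v # ys) L' s3) \<and> (\<forall>i. i \<notin> {10, 11, 12, 13, 14, 15} \<longrightarrow> rg s3 i = rg s i)
     \<and> (\<forall>a. a < HT \<or> CA \<le> a \<longrightarrow> mm s3 a = mm s a)
     \<and> (\<exists>t. gh s3 = gh s @ replicate t Tick \<and> t + 2 * inc xs \<le> length (v # ys) + 2 * inc (xs @ v # ys))"
      proof (intro conjI)
        show "\<exists>t. gh s3 = gh s @ replicate t Tick \<and> t + 2 * inc xs \<le> length (v # ys) + 2 * inc (xs @ v # ys)"
          by (rule ex)
      qed (use a b in \<open>auto simp: s1_def\<close>)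
    qed
  qed
  moreover have "rg s 10 \<noteq> 0" using Cons.prems(2) HP0_pos by auto
  moreover have "lst h (mm s) (rg s 10) (v # ys)" by fact
  ultimately show ?case
    by (subst lwp_While) (auto simp: lwp_simps s1_def simp del: lst.simps intro!: lwp_NEXT[where s = "logev Tick s"] Cons.prems(4))
qed

lemma lwp_HEIGHTS:
  assumes "base s" "lst h (mm s) (rg s 9) qs" "wf qs" "h \<le> X"
  shows "lwp X W HEIGHTS (\<lambda>s'. (\<exists>L'. hinv qs L' s')
     \<and> (\<forall>i. i \<notin> {10, 11, 12, 13, 14, 15} \<longrightarrow> rg s' i = rg s i)
     \<and> (\<forall>a. a < HT \<or> CA \<le> a \<longrightarrow> mm s' a = mm s a)
     \<and> (\<exists>t. gh s' = gh s @ replicate t Tick \<and> t \<le> length qs + 2 * inc qs)) s"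
proof -
  let ?s = "s\<lparr>rg := (rg s)(14 := 0, 10 := rg s 9)\<rparr>"
  have "hinv [] [] ?s" using assms(1) by (simp add: hinv_def wf_def)
  from heights_loop[OF this _ _ assms(4), of qs] assms
  have "lwp X W (While (V 10) (NEXT ;; INSERT)) (\<lambda>s'. (\<exists>L'. hinv qs L' s')
     \<and> (\<forall>i. i \<notin> {10, 11, 12, 13, 14, 15} \<longrightarrow> rg s' i = rg ?s i)
     \<and> (\<forall>a. a < HT \<or> CA \<le> a \<longrightarrow> mm s' a = mm ?s a)
     \<and> (\<exists>t. gh s' = gh ?s @ replicate t Tick \<and> t + 2 * 0 \<le> length qs + 2 * inc qs)) ?s"
    by simp
  then show ?thesis unfolding HEIGHTS_def lwp_simps
    using HP0_pos by (auto elim!: lwp_mono)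
qed

subsection \<open>The longest chain\<close>

text \<open>Consecutive members are only known to be comparable and to occur in list order: the
  candidate list may be sorted in either direction, so the chain may run upwards or
  downwards.\<close>

definition cinv :: "nat list \<Rightarrow> nat list \<Rightarrow> ev list st \<Rightarrow> bool" where
  "cinv qs cs s \<longleftrightarrow> base s \<and> wf qs \<and> rg s 14 = length cs \<and> HG (ht (mm s)) (pr (mm s)) qs \<and> set cs \<subseteq> set qs
     \<and> (\<forall>j<length cs. mm s (CA + 1 + j) = cs ! j \<and> ht (mm s) (cs ! j) = Suc j)
     \<and> (\<forall>j. Suc j < length cs \<longrightarrow> (\<exists>a b. a < b \<and> b < length qs \<and> qs ! a = cs ! j \<and> qs ! b = cs ! Suc j
          \<and> \<not> incomparable r (cs ! j) (cs ! Suc j)))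
     \<and> (\<forall>v\<in>set qs. ht (mm s) v \<le> length cs)"

text \<open>Along predecessors the height drops by one each time down to 1, so the height serves as
  index and the array is filled from the back. The heads of the members' candidate lists are cleared
  on the way.\<close>

lemma chain_loop:
  assumes "base s" "wf qs" "HG (ht (mm s)) (pr (mm s)) qs" "rg s 12 \<noteq> 0 \<Longrightarrow> rg s 13 \<in> set qs \<and> ht (mm s) (rg s 13) = rg s 12"
    "rg s 12 \<le> n"
  shows "lwp X W (CHAIN_LOOP)
     (\<lambda>s'. (\<forall>i. i \<notin> {12, 13} \<longrightarrow> rg s' i = rg s i) \<and> gh s' = gh s @ replicate (rg s 12) Tick
       \<and> (\<exists>cs. length cs = rg s 12 \<and> set cs \<subseteq> set qs
          \<and> (\<forall>j<length cs. mm s' (CA + 1 + j) = cs ! j \<and> ht (mm s) (cs ! j) = Suc j)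
          \<and> (\<forall>j. Suc j < length cs \<longrightarrow> pr (mm s) (cs ! Suc j) = cs ! j)
          \<and> (cs \<noteq> [] \<longrightarrow> last cs = rg s 13) \<and> (\<forall>c\<in>set cs. mm s' (HD + c) = 0)
          \<and> (\<forall>a. \<not> (CA < a \<and> a \<le> CA + rg s 12) \<longrightarrow> (\<forall>c\<in>set cs. a \<noteq> HD + c) \<longrightarrow> mm s' a = mm s a))) s"
  using assms
proof (induction "rg s 12" arbitrary: s)
  case 0
  then show ?case by (subst lwp_While) auto
next
  case (Suc m)
  define x where "x = rg s 13"
  have m: "rg s 12 = Suc m" using Suc(2) by simp
  have x: "x \<in> set qs" "ht (mm s) x = Suc m" using Suc.prems(4) m by (auto simp: x_def)
  then have xn: "x < n" using Suc.prems(2) by (auto simp: wf_def)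
  have adr: "CA + Suc m < HD" "HD + x < ST" "ST < X" "PR + x < CA" "HT + x < CA" "CA < HD" "HD < X"
    "PR < X" "CA < X"
    using m Suc.prems(5) xn layout by linarith+
  define s1 where "s1 = s\<lparr>gh := gh s @ [Tick], mm := (mm s)(CA + Suc m := x, HD + x := 0), rg := (rg s)(13 := pr (mm s) x, 12 := m)\<rparr>"
  have low: "mm s1 a = mm s a" if "a < CA" for a using that adr by (auto simp: s1_def)
  have b1: "base s1" using Suc.prems(1) adr layout by (simp add: s1_def)
  have qn: "HT + u < CA" "PR + u < CA" if "u \<in> set qs" for u
    using that Suc.prems(2) layout by (auto simp: wf_def)
  have HG1: "HG (ht (mm s1)) (pr (mm s1)) qs"
    by (rule HG_cong[OF Suc.prems(3)]) (use low qn in auto)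
  have nxt: "rg s1 13 \<in> set qs \<and> ht (mm s1) (rg s1 13) = rg s1 12" if "rg s1 12 \<noteq> 0"
  proof -
    have m0: "m \<noteq> 0" using that by (simp add: s1_def)
    obtain j where j: "j < length qs" "qs ! j = x" using x(1) by (metis in_set_conv_nth)
    then have "ht (mm s) x \<noteq> 1" using x(2) m0 by simp
    then obtain i where "i < j" "pr (mm s) x = qs ! i" "ht (mm s) x = ht (mm s) (qs ! i) + 1"
      using Suc.prems(3) j unfolding HG_def by blast
    then have "pr (mm s) x \<in> set qs" "ht (mm s) (pr (mm s) x) = m" using j x(2) by auto
    then show ?thesis using low qn by (simp add: s1_def)
  qed
  have "m = rg s1 12" by (simp add: s1_def)
  moreover have "rg s1 12 \<le> n" using Suc.prems(5) m by (simp add: s1_def)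
  ultimately have IH: "lwp X W (CHAIN_LOOP)
     (\<lambda>s'. (\<forall>i. i \<notin> {12, 13} \<longrightarrow> rg s' i = rg s1 i) \<and> gh s' = gh s1 @ replicate (rg s1 12) Tick
       \<and> (\<exists>cs. length cs = rg s1 12 \<and> set cs \<subseteq> set qs
          \<and> (\<forall>j<length cs. mm s' (CA + 1 + j) = cs ! j \<and> ht (mm s1) (cs ! j) = Suc j)
          \<and> (\<forall>j. Suc j < length cs \<longrightarrow> pr (mm s1) (cs ! Suc j) = cs ! j)
          \<and> (cs \<noteq> [] \<longrightarrow> last cs = rg s1 13) \<and> (\<forall>c\<in>set cs. mm s' (HD + c) = 0)
          \<and> (\<forall>a. \<not> (CA < a \<and> a \<le> CA + rg s1 12) \<longrightarrow> (\<forall>c\<in>set cs. a \<noteq> HD + c) \<longrightarrow> mm s' a = mm s1 a))) s1"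
    using Suc.hyps(1)[of s1] b1 Suc.prems(2) HG1 nxt by blast
  have "lwp X W (CHAIN_LOOP)
     (\<lambda>s'. (\<forall>i. i \<notin> {12, 13} \<longrightarrow> rg s' i = rg s i) \<and> gh s' = gh s @ replicate (rg s 12) Tick
       \<and> (\<exists>cs. length cs = rg s 12 \<and> set cs \<subseteq> set qs
          \<and> (\<forall>j<length cs. mm s' (CA + 1 + j) = cs ! j \<and> ht (mm s) (cs ! j) = Suc j)
          \<and> (\<forall>j. Suc j < length cs \<longrightarrow> pr (mm s) (cs ! Suc j) = cs ! j)
          \<and> (cs \<noteq> [] \<longrightarrow> last cs = rg s 13) \<and> (\<forall>c\<in>set cs. mm s' (HD + c) = 0)
          \<and> (\<forall>a. \<not> (CA < a \<and> a \<le> CA + rg s 12) \<longrightarrow> (\<forall>c\<in>set cs. a \<noteq> HD + c) \<longrightarrow> mm s' a = mm s a))) s1"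
  proof (rule lwp_mono[OF IH], elim conjE exE, goal_cases)
    case (1 s' cs)
    note c = this
    have len: "length cs = m" using c(3) by (simp add: s1_def)
    have ne: "HD + c' \<noteq> CA + Suc m" for c' using adr(1) by simp
    have hx: "mm s' (HD + x) = 0"
    proof (cases "x \<in> set cs")
      case False
      have "mm s' (HD + x) = mm s1 (HD + x)"
        by (rule c(9)[rule_format]) (use False adr len m layout in \<open>auto simp: s1_def\<close>)
      then show ?thesis by (simp add: s1_def)
    qed (use c(8) in auto)
    have cx: "mm s' (CA + Suc m) = x"
    proof -
      have "mm s' (CA + Suc m) = mm s1 (CA + Suc m)"
      proof (rule c(9)[rule_format])
        show "\<not> (CA < CA + Suc m \<and> CA + Suc m \<le> CA + rg s1 12)" by (simp add: s1_def)
        show "CA + Suc m \<noteq> HD + c" for c using ne[of c] by simp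
      qed
      then show ?thesis using ne[of x] by (simp add: s1_def)
    qed
    have hts: "ht (mm s1) u = ht (mm s) u" "pr (mm s1) u = pr (mm s) u" if "u \<in> set qs" for u
      using low qn that by auto
    have csq: "cs ! j \<in> set qs" if "j < m" for j using c(4) len that nth_mem by blast
    show ?case
    proof (intro conjI exI[of _ "cs @ [x]"])
      show "\<forall>i. i \<notin> {12, 13} \<longrightarrow> rg s' i = rg s i" using c(1) by (simp add: s1_def)
      show "gh s' = gh s @ replicate (rg s 12) Tick" using c(2) m by (simp add: s1_def)
      show "length (cs @ [x]) = rg s 12" using len m by simp
      show "set (cs @ [x]) \<subseteq> set qs" using c(4) x(1) by simp
      show "\<forall>j<length (cs @ [x]). mm s' (CA + 1 + j) = (cs @ [x]) ! j \<and> ht (mm s) ((cs @ [x]) ! j) = Suc j"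
      proof (intro allI impI)
        fix j assume "j < length (cs @ [x])"
        then consider "j < m" | "j = m" using len by fastforce
        then show "mm s' (CA + 1 + j) = (cs @ [x]) ! j \<and> ht (mm s) ((cs @ [x]) ! j) = Suc j"
        proof cases
          case 1
          then show ?thesis using c(5)[rule_format, of j] len hts(1)[OF csq[OF 1]] by (simp add: nth_append)
        next
          case 2
          then show ?thesis using len cx x(2) by (simp add: nth_append)
        qed
      qed
      show "\<forall>j. Suc j < length (cs @ [x]) \<longrightarrow> pr (mm s) ((cs @ [x]) ! Suc j) = (cs @ [x]) ! j"
      proof (intro allI impI)
        fix j assume j: "Suc j < length (cs @ [x])"
        show "pr (mm s) ((cs @ [x]) ! Suc j) = (cs @ [x]) ! j"
        proof (cases "Suc j < m")
          case True
          then show ?thesis using c(6)[rule_format, of j] len hts(2)[OF csq[of "Suc j"]] by (simp add: nth_append)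
        next
          case False
          then have "m = Suc j" using j len by simp
          then show ?thesis using c(7) len by (cases cs rule: rev_cases) (auto simp: nth_append s1_def)
        qed
      qed
      show "cs @ [x] \<noteq> [] \<longrightarrow> last (cs @ [x]) = rg s 13" by (simp add: x_def)
      show "\<forall>c\<in>set (cs @ [x]). mm s' (HD + c) = 0" using c(8) hx by simp
      show "\<forall>a. \<not> (CA < a \<and> a \<le> CA + rg s 12) \<longrightarrow> (\<forall>c\<in>set (cs @ [x]). a \<noteq> HD + c) \<longrightarrow> mm s' a = mm s a"
      proof (intro allI impI)
        fix a assume a: "\<not> (CA < a \<and> a \<le> CA + rg s 12)" "\<forall>c\<in>set (cs @ [x]). a \<noteq> HD + c"
        have "mm s' a = mm s1 a" by (rule c(9)[rule_format]) (use a m in \<open>auto simp: s1_def\<close>)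
        then show "mm s' a = mm s a" using a m by (auto simp: s1_def)
      qed
    qed
  qed
  then show ?case
    by (subst lwp_While)
      (use m adr Suc.prems(1,5) layout xn in \<open>simp add: lwp_simps baseD s1_def x_def[symmetric]\<close>)
qed

lemma lwp_CHAIN:
  assumes inv: "hinv qs L s" and ne: "qs \<noteq> []"
  shows "lwp X W CHAIN (\<lambda>s'. (\<exists>cs. cs \<noteq> [] \<and> cinv qs cs s' \<and> (\<forall>c\<in>set cs. mm s' (HD + c) = 0)
       \<and> gh s' = gh s @ replicate (length cs) Tick)
     \<and> (\<forall>i. i \<notin> {12, 13, 14} \<longrightarrow> rg s' i = rg s i) \<and> (\<forall>a. a < CA \<or> ST \<le> a \<longrightarrow> mm s' a = mm s a)) s"
proof -
  define x where "x = L ! (length qs - 1)"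
  have b: "base s" and wf: "wf qs" and HG: "HG (ht (mm s)) (pr (mm s)) qs" and k: "rg s 14 = length qs"
    and L: "set L = set qs" "\<And>j. j < length L \<Longrightarrow> mm s (LL + 1 + j) = L ! j" "sorted (map (ht (mm s)) L)"
    using inv by (auto simp: hinv_def)
  have len: "length L = length qs" using hinv_length[OF inv] .
  have k0: "length qs > 0" using ne by simp
  have kn: "length qs \<le> n" using length_le_n[OF wf] .
  have "x \<in> set L" unfolding x_def by (rule nth_mem) (use len k0 in simp)
  moreover have "mm s (LL + 1 + (length qs - 1)) = x" unfolding x_def by (rule L(2)) (use len k0 in simp)
  ultimately have x: "x \<in> set qs" "mm s (LL + length qs) = x" using L(1) k0 by simp_all
  have xn: "x < n" "ht (mm s) x \<le> n" using hinv_ht_le[OF inv x(1)] kn by auto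
  have mx: "ht (mm s) v \<le> ht (mm s) x" if v: "v \<in> set qs" for v
  proof -
    obtain j where "j < length L" "L ! j = v" using v L(1) by (metis in_set_conv_nth)
    then show ?thesis using sorted_nth_mono[OF L(3), of j "length qs - 1"] len k0 by (auto simp: x_def)
  qed
  have x1: "1 \<le> ht (mm s) x" using HG x(1) unfolding HG_def by (metis in_set_conv_nth)
  let ?s = "s\<lparr>rg := (rg s)(13 := x, 14 := ht (mm s) x, 12 := ht (mm s) x)\<rparr>"
  have adr: "LL + length qs < X" "HT + x < X" "LL + length qs \<le> W" using kn xn layout by linarith+
  have "lwp X W (CHAIN_LOOP) (\<lambda>s'. (\<exists>cs. cs \<noteq> [] \<and> cinv qs cs s' \<and> (\<forall>c\<in>set cs. mm s' (HD + c) = 0)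
       \<and> gh s' = gh s @ replicate (length cs) Tick)
     \<and> (\<forall>i. i \<notin> {12, 13, 14} \<longrightarrow> rg s' i = rg s i) \<and> (\<forall>a. a < CA \<or> ST \<le> a \<longrightarrow> mm s' a = mm s a)) ?s"
  proof (rule lwp_mono[OF chain_loop[of ?s qs]], goal_cases)
    case (6 s')
    then obtain cs where c: "\<forall>i. i \<notin> {12, 13} \<longrightarrow> rg s' i = rg ?s i" "gh s' = gh s @ replicate (ht (mm s) x) Tick"
      "length cs = ht (mm s) x" "set cs \<subseteq> set qs"
      "\<forall>j<length cs. mm s' (CA + 1 + j) = cs ! j \<and> ht (mm s) (cs ! j) = Suc j"
      "\<forall>j. Suc j < length cs \<longrightarrow> pr (mm s) (cs ! Suc j) = cs ! j"
      "\<forall>c\<in>set cs. mm s' (HD + c) = 0"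
      "\<forall>a. \<not> (CA < a \<and> a \<le> CA + ht (mm s) x) \<longrightarrow> (\<forall>c\<in>set cs. a \<noteq> HD + c) \<longrightarrow> mm s' a = mm s a"
      by auto
    have cn: "c < n" if "c \<in> set cs" for c using that c(4) wf by (auto simp: wf_def)
    have same: "mm s' a = mm s a" if "a < CA \<or> ST \<le> a" for a
    proof (rule c(8)[rule_format])
      show "\<not> (CA < a \<and> a \<le> CA + ht (mm s) x)" using that xn(2) layout by linarith
      show "a \<noteq> HD + c" if "c \<in> set cs" for c using \<open>a < CA \<or> ST \<le> a\<close> cn[OF that] layout by linarith
    qed
    have hts: "ht (mm s') u = ht (mm s) u" "pr (mm s') u = pr (mm s) u" if "u \<in> set qs" for u
      using that wf layout by (auto simp: wf_def intro!: same)
    have b': "base s'"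
    proof (rule base_cong[OF b])
      show "mm s' a = mm s a" if "a < HT" for a using that layout by (intro same) linarith
    qed (use c(1) in auto)
    have csq: "cs ! j \<in> set qs" if "j < length cs" for j using c(4) that nth_mem by blast
    have "cinv qs cs s'" unfolding cinv_def
    proof (intro conjI)
      show "rg s' 14 = length cs" using c(1,3) by simp
      show "HG (ht (mm s')) (pr (mm s')) qs" by (rule HG_cong[OF HG]) (use hts in auto)
      show "\<forall>j<length cs. mm s' (CA + 1 + j) = cs ! j \<and> ht (mm s') (cs ! j) = Suc j"
        using c(5) hts csq by auto
      show "\<forall>v\<in>set qs. ht (mm s') v \<le> length cs" using mx hts c(3) by auto
      show "\<forall>j. Suc j < length cs \<longrightarrow> (\<exists>a b. a < b \<and> b < length qs \<and> qs ! a = cs ! j \<and> qs ! b = cs ! Suc j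
          \<and> \<not> incomparable r (cs ! j) (cs ! Suc j))"
      proof (intro allI impI)
        fix j assume j: "Suc j < length cs"
        obtain d where d: "d < length qs" "qs ! d = cs ! Suc j" using csq[OF j] by (metis in_set_conv_nth)
        have "ht (mm s) (qs ! d) \<noteq> 1" using c(5) j d by auto
        then obtain i where "i < d" "pr (mm s) (qs ! d) = qs ! i" "\<not> incomparable r (qs ! i) (qs ! d)"
          using HG d(1) unfolding HG_def by blast
        then show "\<exists>a b. a < b \<and> b < length qs \<and> qs ! a = cs ! j \<and> qs ! b = cs ! Suc j
          \<and> \<not> incomparable r (cs ! j) (cs ! Suc j)"
          using d c(6) j by (intro exI[of _ i] exI[of _ d]) auto
      qed
    qed (use b' wf c(4) in auto)
    moreover have "cs \<noteq> []" using c(3) x1 by auto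
    ultimately show ?case using c(1,2,3,7) same by auto
  qed (use b wf HG x xn in auto)
  then show ?thesis unfolding CHAIN_def
    using b adr k x layout by (simp add: lwp_simps baseD)
qed

text \<open>Lists are built by prepending and come out reversed at each removal. A reversed linear
  extension is one of the converse order, for which heights and longest chains serve equally
  well.\<close>

definition sdir :: "nat list \<Rightarrow> bool" where
  "sdir qs \<longleftrightarrow> sorted_wrt (\<lambda>u v. (v, u) \<notin> r) qs \<or> sorted_wrt (\<lambda>u v. (u, v) \<notin> r) qs"

lemma sdir_rev: "sdir (rev qs) = sdir qs"
  by (auto simp: sdir_def sorted_wrt_rev)

lemma sdir_filter: "sdir qs \<Longrightarrow> sdir (filter p qs)"
  by (auto simp: sdir_def sorted_wrt_filter)

text \<open>Mirsky's argument: heights increase strictly along every chain of \<open>r'\<close> and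
  never exceed \<open>length cs\<close>. The relation \<open>r'\<close> stands for \<open>r\<close>
  or its converse, according to the direction of the list.\<close>

lemma cinv_longest_aux:
  assumes c: "cinv qs cs s" and tr: "trans r'" and inc': "\<And>u v. incomparable r u v \<longleftrightarrow> (u, v) \<notin> r' \<and> (v, u) \<notin> r'"
    and dir: "sorted_wrt (\<lambda>u v. (v, u) \<notin> r') qs"
  shows "longest_chain r' (set qs) cs"
  unfolding longest_chain_def
proof (intro conjI allI impI)
  have d: "distinct qs" using c by (simp add: cinv_def wf_def)
  have HG: "HG (ht (mm s)) (pr (mm s)) qs" using c by (simp add: cinv_def)
  have step: "(cs ! j, cs ! Suc j) \<in> r'" if "Suc j < length cs" for j
  proof -
    obtain a b where ab: "a < b" "b < length qs" "qs ! a = cs ! j" "qs ! b = cs ! Suc j"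
          "\<not> incomparable r (cs ! j) (cs ! Suc j)" using c \<open>Suc j < length cs\<close> unfolding cinv_def by blast
    have "(qs ! b, qs ! a) \<notin> r'" using dir ab(1,2) by (auto simp: sorted_wrt_iff_nth_less)
    then show ?thesis using ab inc' by auto
  qed
  have le: "(cs ! i, cs ! j) \<in> r'" if "i < j" "j < length cs" for i j
    using that
  proof (induction j)
    case (Suc j)
    then show ?case using step[of j] tr by (cases "i = j") (auto dest: transD)
  qed simp
  have hts: "ht (mm s) (cs ! j) = Suc j" if "j < length cs" for j using c that by (auto simp: cinv_def)
  have "cs ! i \<noteq> cs ! j" if "i < j" "j < length cs" for i j
    using hts[of i] hts[of j] that by auto
  then show "chain_list r' (set qs) cs"
    using le c by (auto simp: chain_list_def sorted_wrt_iff_nth_less cinv_def)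
  fix ds assume ds: "chain_list r' (set qs) ds"
  have lt: "ht (mm s) u < ht (mm s) v" if uv: "u \<in> set qs" "v \<in> set qs" "(u, v) \<in> r'" "u \<noteq> v" for u v
  proof -
    obtain a b where ab: "a < length qs" "b < length qs" "u = qs ! a" "v = qs ! b" using uv by (auto simp: in_set_conv_nth)
    have "a \<noteq> b" using uv(4) ab by auto
    moreover have "\<not> b < a" using dir ab uv(3) by (auto simp: sorted_wrt_iff_nth_less)
    ultimately have "a < b" by simp
    then show ?thesis using HG ab uv(3) inc' unfolding HG_def by blast
  qed
  have "sorted_wrt (\<lambda>a b. ht (mm s) a < ht (mm s) b) ds"
    using ds lt by (auto simp: chain_list_def intro: sorted_wrt_mono_rel[rotated])
  then have "sorted_wrt (<) (map (ht (mm s)) ds)" by (simp add: sorted_wrt_map)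
  then have "distinct (map (ht (mm s)) ds)" by (simp add: strict_sorted_iff)
  moreover have "set (map (ht (mm s)) ds) \<subseteq> {1..length cs}"
  proof
    fix y assume "y \<in> set (map (ht (mm s)) ds)"
    then obtain v where v: "v \<in> set qs" "y = ht (mm s) v" using ds by (auto simp: chain_list_def)
    have "1 \<le> ht (mm s) v" using HG v(1) unfolding HG_def by (metis in_set_conv_nth)
    then show "y \<in> {1..length cs}" using v c by (auto simp: cinv_def)
  qed
  ultimately show "length ds \<le> length cs"
    using card_mono[of "{1..length cs}" "set (map (ht (mm s)) ds)"] distinct_card[of "map (ht (mm s)) ds"]
    by simp
qed

lemma cinv_longest:
  assumes "cinv qs cs s" "sdir qs"
  obtains cs' where "longest_chain r (set qs) cs'" "cs' = cs \<or> cs' = rev cs"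
proof -
  have tr: "trans r" using partial_order_onD(2)[OF po] .
  from assms(2) consider "sorted_wrt (\<lambda>u v. (v, u) \<notin> r) qs" | "sorted_wrt (\<lambda>u v. (u, v) \<notin> r) qs"
    by (auto simp: sdir_def)
  then show thesis
  proof cases
    case 1
    have "longest_chain r (set qs) cs"
      by (rule cinv_longest_aux[OF assms(1) tr _ 1]) (auto simp: incomparable_def)
    then show thesis using that by blast
  next
    case 2
    have "longest_chain (r\<inverse>) (set qs) cs"
      by (rule cinv_longest_aux[OF assms(1)]) (use 2 tr in \<open>auto simp: incomparable_def\<close>)
    then show thesis using that by (simp add: longest_chain_converse)
  qed
qed

text \<open>The interval property given by \<open>lo\<close> and \<open>hi\<close>, transferred to a
  chain stored in either direction.\<close>

lemma chain_convex:
  assumes lc: "longest_chain r (set qs) cs'" "cs' = cs \<or> cs' = rev cs" and "wf qs"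
    and ij: "i < j" "j < l" "l < length cs" "incomparable r (cs ! i) v" "incomparable r (cs ! l) v"
  shows "incomparable r (cs ! j) v"
proof -
  interpret L: longest "{..<n}" r "set qs" cs' by (rule longest_locale) fact+
  show ?thesis
  proof (cases "cs' = cs")
    case True
    then show ?thesis using ij L.incomparable_iff[of i v] L.incomparable_iff[of j v] L.incomparable_iff[of l v] by auto
  next
    case False
    then have c: "cs' = rev cs" using lc(2) by simp
    let ?f = "\<lambda>i. length cs - Suc i"
    have eq: "cs' ! ?f i = cs ! i" if "i < length cs" for i
      using that by (simp add: c rev_nth Suc_diff_Suc)
    have f: "?f l < ?f j" "?f j < ?f i" "?f i < length cs'" using ij c by auto
    have "L.lo v \<le> ?f l" "?f i < L.hi v"
      using L.incomparable_iff[of "?f i" v] L.incomparable_iff[of "?f l" v] f ij eq[of i] eq[of l] by auto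
    then have "L.lo v \<le> ?f j \<and> ?f j < L.hi v" using f by linarith
    then show ?thesis using L.incomparable_iff[of "?f j" v] f eq[of j] ij by auto
  qed
qed

lemma chain_comparable:
  assumes lc: "longest_chain r (set qs) cs'" "cs' = cs \<or> cs' = rev cs" and "wf qs" "c \<in> set cs" "d \<in> set cs"
  shows "\<not> incomparable r c d"
proof
  assume i: "incomparable r c d"
  interpret L: longest "{..<n}" r "set qs" cs' by (rule longest_locale) fact+
  have s: "set cs' = set cs" using lc(2) by auto
  have "{c, d} \<in> antichains (set qs) r" using i s L.csQ assms(4,5)
    by (auto simp: antichains_def incomparable_def)
  then have "c = d" using L.chain_inter[of "{c, d}" c d] assms(4,5) s by auto
  then show False using i L.refl_r[of c] L.csQ s assms(4) by (auto simp: incomparable_def)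
qed

end

context program
begin

fun klst :: "nat \<Rightarrow> (nat \<Rightarrow> nat) \<Rightarrow> nat \<Rightarrow> (nat \<times> nat list) list \<Rightarrow> bool" where
  "klst h m p [] \<longleftrightarrow> p = 0"
| "klst h m p ((c, P) # ks) \<longleftrightarrow> HP0 \<le> p \<and> p + 2 < h \<and> m p = c \<and> lst h m (m (p + 1)) P \<and> klst h m (m (p + 2)) ks"

lemma klst_cong:
  "klst h m p ks \<Longrightarrow> h \<le> h' \<Longrightarrow> (\<And>a. HP0 \<le> a \<Longrightarrow> a < h \<Longrightarrow> m' a = m a) \<Longrightarrow> klst h' m' p ks"
proof (induction ks arbitrary: p)
  case (Cons k ks)
  obtain c P where k: "k = (c, P)" by (cases k)
  have a: "HP0 \<le> p" "p + 2 < h" "m p = c" "lst h m (m (p + 1)) P" "klst h m (m (p + 2)) ks"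
    using Cons.prems(1) k by auto
  have m: "m' p = m p" "m' (p + 1) = m (p + 1)" "m' (p + 2) = m (p + 2)" using Cons.prems(3) a(1,2) by auto
  have "lst h' m' (m (p + 1)) P" using lst_cong[OF a(4) Cons.prems(2,3)] .
  moreover have "klst h' m' (m (p + 2)) ks" using Cons.IH[OF a(5) Cons.prems(2,3)] .
  ultimately show ?case using a m Cons.prems(2) k by simp
qed simp

text \<open>Heap space is demanded only for index ranges of incomparable elements, since the caller
  knows its space in terms of incomparable pairs. The cell after the chain holds \<open>v\<close>
  itself and ends the scan.\<close>

lemma lwp_UP:
  assumes "base s" "rg s 11 = v" "v < n" "rg s 12 = Suc i" "i \<le> length cs" "length cs \<le> n"
    "\<And>j. j < length cs \<Longrightarrow> mm s (CA + 1 + j) = cs ! j" "mm s (CA + 1 + length cs) = v" "distinct cs" "set cs \<subseteq> {..<n}"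
    "rg s 8 = hp" "HP0 \<le> hp"
    "\<And>l. i \<le> l \<Longrightarrow> l \<le> length cs \<Longrightarrow> (\<And>j. i \<le> j \<Longrightarrow> j < l \<Longrightarrow> incomparable r (cs ! j) v) \<Longrightarrow> hp + 2 * (l - i) \<le> X"
    "\<And>c. c \<in> set cs \<Longrightarrow> lst hp (mm s) (mm s (HD + c)) (P c)"
  shows "lwp X W UP (\<lambda>s'. \<exists>l. i \<le> l \<and> l \<le> length cs \<and> (\<forall>j. i \<le> j \<longrightarrow> j < l \<longrightarrow> incomparable r (cs ! j) v)
     \<and> (l = length cs \<or> \<not> incomparable r (cs ! l) v) \<and> rg s' 8 = hp + 2 * (l - i)
     \<and> (\<forall>c\<in>set cs. lst (rg s' 8) (mm s') (mm s' (HD + c)) (if \<exists>j. i \<le> j \<and> j < l \<and> c = cs ! j then v # P c else P c))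
     \<and> (\<forall>x. x \<notin> {8, 12, 13} \<longrightarrow> rg s' x = rg s x) \<and> (\<forall>a<hp. \<not> (HD \<le> a \<and> a < ST) \<longrightarrow> mm s' a = mm s a)
     \<and> gh s' = gh s @ replicate (l - i) Tick) s"
  using assms
proof (induction "length cs - i" arbitrary: s i hp P)
  case 0
  then have i: "i = length cs" by simp
  have a: "CA + Suc i < X" "CA + Suc i \<le> W" using 0(6,7) layout by linarith+
  have "ok X W (ARR 5 (V 12)) s" "eval (ARR 5 (V 12)) s = v" using 0(2,5,9) a i by (simp_all add: baseD)
  then have "ok X W (INCMP (ARR 5 (V 12)) (V 11)) s" "eval (INCMP (ARR 5 (V 12)) (V 11)) s = 0"
    using INCMP[OF 0(2), of "ARR 5 (V 12)" "V 11"] 0(3,4) refl_r[of v] by (auto simp: incomparable_def)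
  then show ?case unfolding UP_def
    by (subst lwp_While) (use 0 i in \<open>auto intro!: exI[of _ i]\<close>)
next
  case (Suc d)
  have il: "i < length cs" using Suc(2) by simp
  define x where "x = cs ! i"
  have x: "x \<in> set cs" "x < n" "mm s (CA + Suc i) = x" using Suc.prems(7)[OF il] subsetD[OF Suc.prems(10) nth_mem[OF il]] nth_mem[OF il] by (simp_all add: x_def)
  have a: "CA + Suc i < HD" "CA + Suc i < X" "CA + Suc i \<le> W" "HD + x < ST" "HD + x < X" "ST < HP0" "HD + x \<le> W"
    "HD + x < hp" "CA < HD"
    using il Suc.prems(6,12) x(2) layout by linarith+
  have e0: "ok X W (ARR 5 (V 12)) s" "eval (ARR 5 (V 12)) s = x" using Suc.prems(1,4) a x by (simp_all add: baseD)
  then have e: "ok X W (INCMP (ARR 5 (V 12)) (V 11)) s"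
    "eval (INCMP (ARR 5 (V 12)) (V 11)) s = (if incomparable r x v then 1 else 0)"
    using INCMP[OF Suc.prems(1), of "ARR 5 (V 12)" "V 11"] Suc.prems(2,3) x(2) by auto
  show ?case
  proof (cases "incomparable r x v")
    case False
    then show ?thesis unfolding UP_def
      by (subst lwp_While) (use e Suc.prems il in \<open>auto simp: x_def intro!: exI[of _ i]\<close>)
  next
    case True
    have hp: "hp + 2 \<le> X"
      using Suc.prems(13)[of "Suc i"] il True by (auto simp: x_def less_Suc_eq)
    define s1 where "s1 = s\<lparr>gh := gh s @ [Tick], mm := (mm s)(hp := v, Suc hp := mm s (HD + x), HD + x := hp),
      rg := (rg s)(13 := x, 8 := hp + 2, 12 := Suc (Suc i))\<rparr>"
    define P' where "P' = P(x := v # P x)"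
    have low: "mm s1 b = mm s b" if "b < hp" "b \<noteq> HD + x" for b using that by (simp add: s1_def)
    have l1: "lst (hp + 2) (mm s1) (mm s1 (HD + c)) (P' c)" if c: "c \<in> set cs" for c
    proof -
      have cn: "c < n" using c Suc.prems(10) by auto
      have l: "lst (hp + 2) (mm s1) (mm s (HD + c)) (P c)"
        by (rule lst_cong[OF Suc.prems(14)[OF c]]) (use low a in auto)
      show ?thesis
      proof (cases "c = x")
        case True
        have "mm s1 (HD + x) = hp" "mm s1 hp = v" "mm s1 (hp + 1) = mm s (HD + x)" using a by (auto simp: s1_def)
        then show ?thesis using l True Suc.prems(12) by (simp add: P'_def)
      next
        case False
        have "HD + c < ST" using cn layout by linarith
        then have "mm s1 (HD + c) = mm s (HD + c)" using False a Suc.prems(12) by (intro low) auto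
        then show ?thesis using l False by (simp add: P'_def)
      qed
    qed
    have "lwp X W UP (\<lambda>s'. \<exists>l. Suc i \<le> l \<and> l \<le> length cs \<and> (\<forall>j. Suc i \<le> j \<longrightarrow> j < l \<longrightarrow> incomparable r (cs ! j) v)
     \<and> (l = length cs \<or> \<not> incomparable r (cs ! l) v) \<and> rg s' 8 = (hp + 2) + 2 * (l - Suc i)
     \<and> (\<forall>c\<in>set cs. lst (rg s' 8) (mm s') (mm s' (HD + c)) (if \<exists>j. Suc i \<le> j \<and> j < l \<and> c = cs ! j then v # P' c else P' c))
     \<and> (\<forall>x. x \<notin> {8, 12, 13} \<longrightarrow> rg s' x = rg s1 x) \<and> (\<forall>a<hp + 2. \<not> (HD \<le> a \<and> a < ST) \<longrightarrow> mm s' a = mm s1 a)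
     \<and> gh s' = gh s1 @ replicate (l - Suc i) Tick) s1"
    proof (rule Suc.hyps(1))
      show "d = length cs - Suc i" using Suc(2) by simp
      show "base s1" using Suc.prems(1,12) a layout by (simp add: s1_def)
      show "mm s1 (CA + 1 + j) = cs ! j" if "j < length cs" for j
      proof -
        have "CA + 1 + j < HD" using that Suc.prems(6) layout by linarith
        then show ?thesis using low[of "CA + 1 + j"] Suc.prems(7)[OF that] a by simp
      qed
      have "CA + 1 + length cs < HD" using Suc.prems(6) layout by linarith
      then show "mm s1 (CA + 1 + length cs) = v" using low[of "CA + 1 + length cs"] Suc.prems(8) a by simp
      fix l assume l: "Suc i \<le> l" "l \<le> length cs" "\<And>j. Suc i \<le> j \<Longrightarrow> j < l \<Longrightarrow> incomparable r (cs ! j) v"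
      have "hp + 2 * (l - i) \<le> X"
      proof (rule Suc.prems(13))
        show "incomparable r (cs ! j) v" if "i \<le> j" "j < l" for j
          using l(3)[of j] that True by (cases "j = i") (auto simp: x_def)
      qed (use l in auto)
      then show "hp + 2 + 2 * (l - Suc i) \<le> X" using l(1) by simp
    qed (use Suc.prems l1 il in \<open>auto simp: s1_def\<close>)
    then have "lwp X W UP (\<lambda>s'. \<exists>l. i \<le> l \<and> l \<le> length cs \<and> (\<forall>j. i \<le> j \<longrightarrow> j < l \<longrightarrow> incomparable r (cs ! j) v)
     \<and> (l = length cs \<or> \<not> incomparable r (cs ! l) v) \<and> rg s' 8 = hp + 2 * (l - i)
     \<and> (\<forall>c\<in>set cs. lst (rg s' 8) (mm s') (mm s' (HD + c)) (if \<exists>j. i \<le> j \<and> j < l \<and> c = cs ! j then v # P c else P c))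
     \<and> (\<forall>x. x \<notin> {8, 12, 13} \<longrightarrow> rg s' x = rg s x) \<and> (\<forall>a<hp. \<not> (HD \<le> a \<and> a < ST) \<longrightarrow> mm s' a = mm s a)
     \<and> gh s' = gh s @ replicate (l - i) Tick) s1"
    proof (rule lwp_mono, elim exE conjE)
      fix s' l
      assume b: "Suc i \<le> l" "l \<le> length cs" "\<forall>j. Suc i \<le> j \<longrightarrow> j < l \<longrightarrow> incomparable r (cs ! j) v"
        "l = length cs \<or> \<not> incomparable r (cs ! l) v" "rg s' 8 = (hp + 2) + 2 * (l - Suc i)"
        "\<forall>c\<in>set cs. lst (rg s' 8) (mm s') (mm s' (HD + c)) (if \<exists>j. Suc i \<le> j \<and> j < l \<and> c = cs ! j then v # P' c else P' c)"
        "\<forall>x. x \<notin> {8, 12, 13} \<longrightarrow> rg s' x = rg s1 x" "\<forall>a<hp + 2. \<not> (HD \<le> a \<and> a < ST) \<longrightarrow> mm s' a = mm s1 a"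
        "gh s' = gh s1 @ replicate (l - Suc i) Tick"
      have rep: "[Tick] @ replicate (l - Suc i) Tick = replicate (l - i) Tick"
        using b(1) by (simp add: Suc_diff_Suc flip: replicate_Suc)
      show "\<exists>l. i \<le> l \<and> l \<le> length cs \<and> (\<forall>j. i \<le> j \<longrightarrow> j < l \<longrightarrow> incomparable r (cs ! j) v)
     \<and> (l = length cs \<or> \<not> incomparable r (cs ! l) v) \<and> rg s' 8 = hp + 2 * (l - i)
     \<and> (\<forall>c\<in>set cs. lst (rg s' 8) (mm s') (mm s' (HD + c)) (if \<exists>j. i \<le> j \<and> j < l \<and> c = cs ! j then v # P c else P c))
     \<and> (\<forall>x. x \<notin> {8, 12, 13} \<longrightarrow> rg s' x = rg s x) \<and> (\<forall>a<hp. \<not> (HD \<le> a \<and> a < ST) \<longrightarrow> mm s' a = mm s a)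
     \<and> gh s' = gh s @ replicate (l - i) Tick"
      proof (intro exI[of _ l] conjI allI impI ballI)
        fix j assume "i \<le> j" "j < l"
        then show "incomparable r (cs ! j) v" using b(3) True by (cases "j = i") (auto simp: x_def)
      next
        fix c assume c: "c \<in> set cs"
        have xi: "\<not> (\<exists>j. Suc i \<le> j \<and> j < l \<and> x = cs ! j)"
          using Suc.prems(9) il b(2) by (auto simp: x_def nth_eq_iff_index_eq)
        have eq: "(if \<exists>j. Suc i \<le> j \<and> j < l \<and> c = cs ! j then v # P' c else P' c)
          = (if \<exists>j. i \<le> j \<and> j < l \<and> c = cs ! j then v # P c else P c)"
        proof (cases "c = x")
          case True
          moreover have "\<exists>j. i \<le> j \<and> j < l \<and> c = cs ! j"
            using True b(1) by (intro exI[of _ i]) (simp add: x_def)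
          ultimately show ?thesis using xi by (simp add: P'_def)
        next
          case False
          then have "Suc i \<le> j \<longleftrightarrow> i \<le> j" if "c = cs ! j" for j
            using that by (cases "j = i") (auto simp: x_def)
          then have "Suc i \<le> j \<and> j < l \<and> c = cs ! j \<longleftrightarrow> i \<le> j \<and> j < l \<and> c = cs ! j" for j
            by (cases "c = cs ! j") simp_all
          then have e: "(\<exists>j. Suc i \<le> j \<and> j < l \<and> c = cs ! j) \<longleftrightarrow> (\<exists>j. i \<le> j \<and> j < l \<and> c = cs ! j)"
            by (simp only:)
          show ?thesis unfolding e P'_def fun_upd_other[OF False] ..
        qed
        show "lst (rg s' 8) (mm s') (mm s' (HD + c)) (if \<exists>j. i \<le> j \<and> j < l \<and> c = cs ! j then v # P c else P c)"
          using bspec[OF b(6) c] unfolding eq .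
      next
        fix a assume "a < hp" "\<not> (HD \<le> a \<and> a < ST)"
        then show "mm s' a = mm s a" using b(8) low[of a] \<open>HD + x < ST\<close> by auto
      next
        show "gh s' = gh s @ replicate (l - i) Tick" using b(9) rep by (simp add: s1_def)
      qed (use b in \<open>auto simp: s1_def\<close>)
    qed
    then show ?thesis unfolding UP_def
      by (subst lwp_While)
        (use e e0 True x a hp Suc.prems(1,2,4,11,12) layout il in \<open>simp add: lwp_simps baseD s1_def\<close>)
  qed
qed

subsection \<open>Candidates of the kids\<close>

text \<open>What the later loops use about the chain, free of machine state and direction. Equal
  heights force incomparability, which provides for every element a first incomparable member of the
  chain.\<close>

definition chainok :: "nat list \<Rightarrow> nat list \<Rightarrow> (nat \<Rightarrow> nat) \<Rightarrow> bool" where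
  "chainok qs cs H \<longleftrightarrow> wf qs \<and> distinct cs \<and> set cs \<subseteq> set qs \<and> (\<forall>j<length cs. H (cs ! j) = Suc j)
     \<and> (\<forall>u\<in>set qs. 1 \<le> H u \<and> H u \<le> length cs) \<and> (\<forall>u\<in>set qs. \<forall>w\<in>set qs. u \<noteq> w \<longrightarrow> H u = H w \<longrightarrow> incomparable r u w)
     \<and> (\<forall>c\<in>set cs. \<forall>d\<in>set cs. \<not> incomparable r c d)
     \<and> (\<forall>i j l v. i < j \<longrightarrow> j < l \<longrightarrow> l < length cs \<longrightarrow> incomparable r (cs ! i) v \<longrightarrow> incomparable r (cs ! l) v
          \<longrightarrow> incomparable r (cs ! j) v)"

lemma cinv_chainok:
  assumes c: "cinv qs cs s" and d: "sdir qs"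
  shows "chainok qs cs (ht (mm s))"
proof -
  obtain cs' where lc: "longest_chain r (set qs) cs'" "cs' = cs \<or> cs' = rev cs" using cinv_longest[OF c d] .
  have wf: "wf qs" using c by (simp add: cinv_def)
  have HG: "HG (ht (mm s)) (pr (mm s)) qs" using c by (simp add: cinv_def)
  interpret L: longest "{..<n}" r "set qs" cs' by (rule longest_locale[OF lc(1) wf])
  have eq: "incomparable r u w" if uw: "u \<in> set qs" "w \<in> set qs" "u \<noteq> w" "ht (mm s) u = ht (mm s) w" for u w
  proof -
    obtain a b where ab: "a < length qs" "b < length qs" "u = qs ! a" "w = qs ! b"
      using uw(1,2) by (metis in_set_conv_nth)
    have "a \<noteq> b" using uw(3) ab by auto
    then show ?thesis using HG ab uw(4) unfolding HG_def
      by (metis incomparable_commute less_irrefl linorder_neqE_nat)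
  qed
  have "1 \<le> ht (mm s) u" if "u \<in> set qs" for u using HG that unfolding HG_def by (metis in_set_conv_nth)
  moreover have "distinct cs" using L.dist lc(2) by auto
  ultimately show ?thesis unfolding chainok_def
    using c eq wf chain_convex[OF lc wf] chain_comparable[OF lc wf] by (auto simp: cinv_def)
qed

text \<open>Each list cell takes two words: one cell per element off the chain, for the list of the
  rest, and one per incomparable pair of a chain element and a candidate, for the lists of the
  kids.\<close>

definition dinv :: "nat list \<Rightarrow> nat list \<Rightarrow> (nat \<Rightarrow> nat) \<Rightarrow> nat \<Rightarrow> nat list \<Rightarrow> ev list st \<Rightarrow> bool" where
  "dinv qs cs H h0 xs s \<longleftrightarrow> base s \<and> rg s 14 = length cs \<and> (\<forall>j<length cs. mm s (CA + 1 + j) = cs ! j)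
     \<and> (\<forall>u\<in>set qs. ht (mm s) u = H u) \<and> HP0 \<le> h0 \<and> h0 \<le> rg s 8
     \<and> rg s 8 \<le> h0 + 2 * length (filter (\<lambda>v. v \<notin> set cs) xs) + 2 * (\<Sum>c\<leftarrow>cs. length (filter (incomparable r c) xs))
     \<and> lst (rg s 8) (mm s) (rg s 16) (rev (filter (\<lambda>v. v \<notin> set cs) xs))
     \<and> (\<forall>c\<in>set cs. lst (rg s 8) (mm s) (mm s (HD + c)) (rev (filter (incomparable r c) xs)))"

lemma segment_le:
  assumes "l \<le> length cs" "\<And>j. i \<le> j \<Longrightarrow> j < l \<Longrightarrow> p (cs ! j)"
  shows "l - i \<le> length (filter p cs)"
proof -
  have "card {i..<l} \<le> card {j. j < length cs \<and> p (cs ! j)}"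
    using assms by (intro card_mono) auto
  then show ?thesis by (simp add: length_filter_conv_card)
qed

lemma sum_filter_snoc:
  "(\<Sum>c\<leftarrow>cs. length (filter (incomparable r c) (xs @ [v]))) =
   (\<Sum>c\<leftarrow>cs. length (filter (incomparable r c) xs)) + length (filter (\<lambda>c. incomparable r c v) cs)"
  by (induction cs) auto

text \<open>The chain element of the same height as \<open>v\<close> is incomparable to
  \<open>v\<close>, so the scans start inside the interval of \<open>v\<close>: down to its lower
  end, then up through all of it. This makes the cost proportional to the length of an interval
  whose ends are not known beforehand.\<close>

lemma lwp_OTHER:
  assumes ok: "chainok qs cs H" and inv: "dinv qs cs H h0 xs s"
    and v: "rg s 11 = v" "v \<in> set qs" "v \<notin> set cs" "rg s 12 = H v" and ne: "cs \<noteq> []"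
    and heap: "h0 + 2 * length (filter (\<lambda>v. v \<notin> set cs) (xs @ [v])) + 2 * (\<Sum>c\<leftarrow>cs. length (filter (incomparable r c) (xs @ [v]))) \<le> X"
  shows "lwp X W OTHER (\<lambda>s'. dinv qs cs H h0 (xs @ [v]) s'
     \<and> (\<forall>i. i \<notin> {8, 12, 13, 16} \<longrightarrow> rg s' i = rg s i)
     \<and> (\<forall>a. a < CA \<or> ST \<le> a \<and> a < h0 \<longrightarrow> mm s' a = mm s a)
     \<and> (\<exists>t. gh s' = gh s @ replicate t Tick \<and> t \<le> 2 * length (filter (\<lambda>c. incomparable r c v) cs))) s"
proof -
  define hp where "hp = rg s 8"
  define k where "k = length cs"
  define D where "D = length (filter (\<lambda>c. incomparable r c v) cs)"
  have b: "base s" and arr: "\<And>j. j < k \<Longrightarrow> mm s (CA + 1 + j) = cs ! j" and hts: "\<And>u. u \<in> set qs \<Longrightarrow> ht (mm s) u = H u"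
    and h0: "HP0 \<le> h0" "h0 \<le> hp" and hp_le: "hp \<le> h0 + 2 * length (filter (\<lambda>v. v \<notin> set cs) xs) + 2 * (\<Sum>c\<leftarrow>cs. length (filter (incomparable r c) xs))"
    and lR: "lst hp (mm s) (rg s 16) (rev (filter (\<lambda>v. v \<notin> set cs) xs))"
    and lP: "\<And>c. c \<in> set cs \<Longrightarrow> lst hp (mm s) (mm s (HD + c)) (rev (filter (incomparable r c) xs))" and r14: "rg s 14 = k"
    using inv by (auto simp: dinv_def hp_def k_def)
  have wf: "wf qs" and dc: "distinct cs" and cq: "set cs \<subseteq> set qs" and Hc: "\<And>j. j < k \<Longrightarrow> H (cs ! j) = Suc j"
    and Hb: "\<And>u. u \<in> set qs \<Longrightarrow> 1 \<le> H u \<and> H u \<le> k"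
    and Heq: "\<And>u w. u \<in> set qs \<Longrightarrow> w \<in> set qs \<Longrightarrow> u \<noteq> w \<Longrightarrow> H u = H w \<Longrightarrow> incomparable r u w"
    and conv: "\<And>i j l. i < j \<Longrightarrow> j < l \<Longrightarrow> l < k \<Longrightarrow> incomparable r (cs ! i) v \<Longrightarrow> incomparable r (cs ! l) v
          \<Longrightarrow> incomparable r (cs ! j) v"
    using ok unfolding chainok_def k_def by blast+
  have vn: "v < n" using v(2) wf by (auto simp: wf_def)
  have csn: "set cs \<subseteq> {..<n}" using cq wf by (auto simp: wf_def)
  have kn: "k \<le> n" unfolding k_def using length_le_if_distinct[OF dc csn] .
  have cn: "cs ! j < n" if "j < k" for j using subsetD[OF csn nth_mem[of j cs]] that by (simp add: k_def)
  have heap': "hp + 2 + 2 * D \<le> X" using heap hp_le v(3) unfolding sum_filter_snoc by (simp add: D_def)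
  define s1 where "s1 = s\<lparr>rg := (rg s)(16 := hp, 8 := hp + 2), mm := (mm s)(hp := v, Suc hp := rg s 16, CA := v, CA + Suc k := v)\<rparr>"
  have lay: "CA + Suc k < HD" "CA < HD" "HD \<le> ST" "ST < HP0" "HP0 \<le> hp" "hp + 2 \<le> X" "CA < X" "X \<le> W"
    "CA + Suc k < X"
    using kn h0 heap' layout by linarith+
  have low: "mm s1 a = mm s a" if "a < hp" "a \<noteq> CA" "a \<noteq> CA + Suc k" for a using that by (simp add: s1_def)
  have b1: "base s1" using b lay layout by (simp add: s1_def)
  have arr1: "mm s1 (CA + 1 + j) = cs ! j" if "j < k" for j
    using arr[OF that] low[of "CA + 1 + j"] that lay by simp
  have sent: "mm s1 CA = v" "mm s1 (CA + 1 + k) = v" using lay by (auto simp: s1_def)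
  have r1: "rg s1 5 = CA" "rg s1 11 = v" "rg s1 12 = H v" "rg s1 14 = k" "rg s1 8 = hp + 2"
    using b v r14 by (simp_all add: s1_def baseD)
  have Hv: "1 \<le> H v" "H v \<le> k" using Hb[OF v(2)] by auto
  have inc0: "incomparable r (cs ! (H v - 1)) v"
  proof (rule Heq)
    have c: "cs ! (H v - 1) \<in> set cs" by (rule nth_mem) (use Hv in \<open>simp add: k_def\<close>)
    show "cs ! (H v - 1) \<in> set qs" using cq c by blast
    show "cs ! (H v - 1) \<noteq> v" using v(3) c by metis
    show "H (cs ! (H v - 1)) = H v" using Hc[of "H v - 1"] Hv by simp
  qed (rule v(2))
  have m1': "mm s1 (CA + j) = (if j = 0 then v else cs ! (j - 1))" if "j \<le> k" for j
    using sent(1) arr1[of "j - 1"] that by (cases j) auto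
  let ?Q = "\<lambda>s'. dinv qs cs H h0 (xs @ [v]) s'
     \<and> (\<forall>i. i \<notin> {8, 12, 13, 16} \<longrightarrow> rg s' i = rg s i)
     \<and> (\<forall>a. a < CA \<or> ST \<le> a \<and> a < h0 \<longrightarrow> mm s' a = mm s a)
     \<and> (\<exists>t. gh s' = gh s @ replicate t Tick \<and> t \<le> 2 * length (filter (\<lambda>c. incomparable r c v) cs))"
  have "lwp X W (DOWN 5) (lwp X W (Asg 12 (Plus (V 12) (N 1)) ;; UP) ?Q) s1"
  proof (rule lwp_DOWN[OF b1])
    show "mm s1 (rg s1 5 + j) < n" if "j \<le> rg s1 12" for j
      using m1'[of j] cn[of "j - 1"] that r1 vn Hv by (cases j) auto
    show "rg s1 12 \<le> n + 1" "rg s1 12 + rg s1 5 < X" using r1 Hv kn lay by auto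
    show "mm s1 (rg s1 5) = rg s1 11" "rg s1 11 < n" using sent r1 vn by auto
    fix i assume i0: "i \<le> rg s1 12" "\<not> incomparable r (mm s1 (rg s1 5 + i)) (rg s1 11)"
      "\<And>j. i < j \<Longrightarrow> j \<le> rg s1 12 \<Longrightarrow> incomparable r (mm s1 (rg s1 5 + j)) (rg s1 11)"
    have ik: "i \<le> H v" "i \<le> k" using i0(1) r1 Hv by auto
    have i1: "i = 0 \<or> \<not> incomparable r (cs ! (i - 1)) v"
      using i0(2) m1'[OF ik(2)] r1 by (auto split: if_splits)
    have i2: "incomparable r (cs ! j) v" if "i \<le> j" "j < H v" for j
      using i0(3)[of "Suc j"] m1'[of "Suc j"] r1 Hv that by simp
    have iH: "i < H v" using i1 inc0 ik(1) by (cases "i = H v") (use Hv in auto)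
    define s2 where "s2 = s1\<lparr>gh := gh s1 @ replicate (H v - i) Tick, rg := (rg s1)(12 := Suc i)\<rparr>"
    have "lwp X W UP ?Q s2"
    proof (rule lwp_mono[OF lwp_UP[of s2 v i cs "hp + 2" "\<lambda>c. rev (filter (incomparable r c) xs)"]], goal_cases)
      case (13 l)
      then have "l - i \<le> D" unfolding D_def by (intro segment_le) auto
      then show ?case using heap' by simp
    next
      case (14 c)
      have c: "HD + c < ST" "HD \<le> HD + c" using 14 csn layout by auto
      have "mm s1 (HD + c) = mm s (HD + c)" using c lay by (intro low) auto
      moreover have "lst (hp + 2) (mm s1) (mm s (HD + c)) (rev (filter (incomparable r c) xs))"
        by (rule lst_cong[OF lP[OF 14]]) (use low lay in auto)
      ultimately show ?case by (simp add: s2_def)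
    next
      case (15 s')
      then obtain l where l: "i \<le> l" "l \<le> length cs" "\<forall>j. i \<le> j \<longrightarrow> j < l \<longrightarrow> incomparable r (cs ! j) v"
        "l = length cs \<or> \<not> incomparable r (cs ! l) v" "rg s' 8 = (hp + 2) + 2 * (l - i)"
        "\<forall>c\<in>set cs. lst (rg s' 8) (mm s') (mm s' (HD + c)) (if \<exists>j. i \<le> j \<and> j < l \<and> c = cs ! j
            then v # rev (filter (incomparable r c) xs) else rev (filter (incomparable r c) xs))"
        "\<forall>x. x \<notin> {8, 12, 13} \<longrightarrow> rg s' x = rg s2 x" "\<forall>a<hp + 2. \<not> (HD \<le> a \<and> a < ST) \<longrightarrow> mm s' a = mm s2 a"
        "gh s' = gh s2 @ replicate (l - i) Tick" by blast
      have lD: "l - i \<le> D" unfolding D_def using l(2,3) by (intro segment_le) auto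
      have Hl: "H v \<le> l"
      proof (rule ccontr)
        assume "\<not> H v \<le> l"
        then have "incomparable r (cs ! l) v" "l \<noteq> length cs" using i2[OF l(1)] Hv by (auto simp: k_def)
        then show False using l(4) by auto
      qed
      \<comment> \<open>By convexity, and because index \<open>H v - 1\<close> lies in the interval,
        the two scans have found exactly its ends.\<close>
      have all: "(\<exists>j. i \<le> j \<and> j < l \<and> c = cs ! j) \<longleftrightarrow> incomparable r c v" if c: "c \<in> set cs" for c
      proof
        assume "incomparable r c v"
        obtain j where j: "j < k" "c = cs ! j" using c by (auto simp: in_set_conv_nth k_def)
        have "i \<le> j"
        proof (rule ccontr)
          assume ji: "\<not> i \<le> j"
          then have n1: "\<not> incomparable r (cs ! (i - 1)) v" using i1 by auto
          then have "j \<noteq> i - 1" using j \<open>incomparable r c v\<close> by auto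
          then have "incomparable r (cs ! (i - 1)) v"
            using conv[of j "i - 1" "H v - 1"] ji iH Hv j \<open>incomparable r c v\<close> inc0 by auto
          then show False using n1 by simp
        qed
        moreover have "j < l"
        proof (rule ccontr)
          assume jl: "\<not> j < l"
          then have n1: "\<not> incomparable r (cs ! l) v" "l < k" using l(4) j(1) by (auto simp: k_def)
          then have "j \<noteq> l" using j \<open>incomparable r c v\<close> by auto
          then have "incomparable r (cs ! l) v"
            using conv[of "H v - 1" l j] jl Hl Hv j \<open>incomparable r c v\<close> inc0 by auto
          then show False using n1 by simp
        qed
        ultimately show "\<exists>j. i \<le> j \<and> j < l \<and> c = cs ! j" using j by blast
      qed (use l(3) in auto)
      have same: "mm s' a = mm s a" if "a < hp" "\<not> (CA \<le> a \<and> a < ST)" for a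
        using l(8)[rule_format, of a] low[of a] that lay by (auto simp: s2_def)
      have "dinv qs cs H h0 (xs @ [v]) s'"
        unfolding dinv_def
      proof (intro conjI)
        show "base s'"
        proof (rule base_cong[OF b])
          show "rg s' i = rg s i" if "i < 8" for i using l(7) that by (simp add: s2_def s1_def)
          show "mm s' a = mm s a" if "a < HT" for a using that layout lay by (intro same) linarith+
        qed
        show "rg s' 14 = length cs" using l(7) r1 by (simp add: s2_def k_def)
        show "\<forall>j<length cs. mm s' (CA + 1 + j) = cs ! j"
        proof (intro allI impI)
          fix j assume j: "j < length cs"
          have "mm s' (CA + 1 + j) = mm s2 (CA + 1 + j)"
            by (rule l(8)[rule_format]) (use j lay in \<open>auto simp: k_def\<close>)
          then show "mm s' (CA + 1 + j) = cs ! j" using arr1[of j] j by (simp add: s2_def k_def)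
        qed
        show "\<forall>u\<in>set qs. ht (mm s') u = H u"
        proof
          fix u assume u: "u \<in> set qs"
          have "HT + u < CA" using u wf layout by (auto simp: wf_def)
          then have "ht (mm s') u = ht (mm s) u" using lay by (intro same) auto
          then show "ht (mm s') u = H u" using hts[OF u] by simp
        qed
        show "h0 \<le> rg s' 8" using l(5) h0 by simp
        show "rg s' 8 \<le> h0 + 2 * length (filter (\<lambda>v. v \<notin> set cs) (xs @ [v])) + 2 * (\<Sum>c\<leftarrow>cs. length (filter (incomparable r c) (xs @ [v])))"
          using l(5) hp_le lD v(3) unfolding sum_filter_snoc by (simp add: D_def)
        have R: "rg s' 16 = hp" using l(7) by (simp add: s2_def s1_def)
        have "mm s' hp = v" "mm s' (hp + 1) = rg s 16"
          using l(8)[rule_format, of hp] l(8)[rule_format, of "hp + 1"] lay by (auto simp: s2_def s1_def)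
        moreover have "lst (rg s' 8) (mm s') (rg s 16) (rev (filter (\<lambda>v. v \<notin> set cs) xs))"
          by (rule lst_cong[OF lR]) (use same lay l(5) in auto)
        ultimately show "lst (rg s' 8) (mm s') (rg s' 16) (rev (filter (\<lambda>v. v \<notin> set cs) (xs @ [v])))"
          using R v(3) lay l(5) by simp
        show "\<forall>c\<in>set cs. lst (rg s' 8) (mm s') (mm s' (HD + c)) (rev (filter (incomparable r c) (xs @ [v])))"
          using l(6) all by auto
      qed (use h0 in auto)
      moreover have "\<exists>t. gh s' = gh s @ replicate t Tick \<and> t \<le> 2 * length (filter (\<lambda>c. incomparable r c v) cs)"
      proof (intro exI conjI)
        show "gh s' = gh s @ replicate ((H v - i) + (l - i)) Tick"
          using l(9) by (simp add: s2_def s1_def replicate_add)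
        show "(H v - i) + (l - i) \<le> 2 * length (filter (\<lambda>c. incomparable r c v) cs)"
          using lD Hl unfolding D_def by linarith
      qed
      ultimately show ?case using l(7) same h0 lay by (auto simp: s2_def s1_def)
    qed (use b1 r1 vn ik kn arr1 sent dc csn lay in \<open>auto simp: s2_def k_def\<close>)
    then show "lwp X W (Asg 12 (Plus (V 12) (N 1)) ;; UP) ?Q (s1\<lparr>rg := (rg s1)(12 := i), gh := gh s1 @ replicate (rg s1 12 - i) Tick\<rparr>)"
      using r1 ik kn layout by (simp add: lwp_simps s2_def)
  qed (use r1 in auto)
  then show ?thesis unfolding OTHER_def
    using b r14 v(1) lay layout by (simp add: lwp_simps baseD s1_def hp_def[symmetric])
qed

lemma chain_member:
  assumes "chainok qs cs H" "v \<in> set qs"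
  shows "cs ! (H v - 1) = v \<longleftrightarrow> v \<in> set cs" "H v - 1 < length cs"
proof -
  have b: "1 \<le> H v" "H v \<le> length cs" and h: "\<And>j. j < length cs \<Longrightarrow> H (cs ! j) = Suc j"
    using assms unfolding chainok_def by blast+
  then show l: "H v - 1 < length cs" by simp
  show "cs ! (H v - 1) = v \<longleftrightarrow> v \<in> set cs"
  proof
    assume "v \<in> set cs"
    then obtain j where j: "j < length cs" "v = cs ! j" by (auto simp: in_set_conv_nth)
    then show "cs ! (H v - 1) = v" using h[of j] by simp
  next
    assume "cs ! (H v - 1) = v"
    then show "v \<in> set cs" using nth_mem[OF l] by simp
  qed
qed

lemma dist_loop:
  assumes ok: "chainok qs cs H" and ne: "cs \<noteq> []"
    and heap: "h0 + 2 * length (filter (\<lambda>v. v \<notin> set cs) qs) + 2 * (\<Sum>c\<leftarrow>cs. length (filter (incomparable r c) qs)) \<le> X"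
    and inv: "dinv qs cs H h0 xs s" and qs: "qs = xs @ ys" and l: "lst h0 (mm s) (rg s 10) ys"
  shows "lwp X W (DIST_LOOP) (\<lambda>s'. dinv qs cs H h0 qs s'
     \<and> (\<forall>i. i \<notin> {8, 10, 11, 12, 13, 16} \<longrightarrow> rg s' i = rg s i)
     \<and> (\<forall>a. a < CA \<or> ST \<le> a \<and> a < h0 \<longrightarrow> mm s' a = mm s a)
     \<and> (\<exists>t. gh s' = gh s @ replicate t Tick \<and> t + 2 * (\<Sum>c\<leftarrow>cs. length (filter (incomparable r c) xs))
         \<le> length ys + 2 * (\<Sum>c\<leftarrow>cs. length (filter (incomparable r c) qs)))) s"
  using inv qs l
proof (induction ys arbitrary: xs s)
  case Nil
  then show ?case by (subst lwp_While) (auto intro!: exI[of _ 0])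
next
  case (Cons v ys)
  let ?body = "If (Plus (Minus (V 11) (V 13)) (Minus (V 13) (V 11))) OTHER Skip"
  let ?W = "While (V 10) (NEXT ;; Asg 12 (ARR 2 (V 11)) ;; Asg 13 (ARR 5 (V 12)) ;; ?body)"
  let ?pc = "\<lambda>xs. \<Sum>c\<leftarrow>cs. length (filter (incomparable r c) xs)"
  let ?P = "\<lambda>s'. dinv qs cs H h0 qs s' \<and> (\<forall>i. i \<notin> {8, 10, 11, 12, 13, 16} \<longrightarrow> rg s' i = rg s i)
     \<and> (\<forall>a. a < CA \<or> ST \<le> a \<and> a < h0 \<longrightarrow> mm s' a = mm s a)
     \<and> (\<exists>t. gh s' = gh s @ replicate t Tick \<and> t + 2 * ?pc xs \<le> length (v # ys) + 2 * ?pc qs)"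
  have qs': "qs = (xs @ [v]) @ ys" using Cons.prems(2) by simp
  have vq: "v \<in> set qs" using qs' by simp
  have wf: "wf qs" and Hb: "1 \<le> H v" "H v \<le> length cs" using ok vq unfolding chainok_def by blast+
  have dc: "distinct cs" "set cs \<subseteq> set qs" using ok unfolding chainok_def by blast+
  have csn: "set cs \<subseteq> {..<n}" using dc wf by (auto simp: wf_def)
  have kn: "length cs \<le> n" using length_le_if_distinct[OF dc(1) csn] .
  have vn: "v < n" using vq wf by (auto simp: wf_def)
  note mem = chain_member[OF ok vq]
  have b: "base s" and ht: "ht (mm s) v = H v" and arr: "mm s (CA + H v) = cs ! (H v - 1)"
    using Cons.prems(1) vq mem(2) Hb(1) unfolding dinv_def by (auto dest: spec[of _ "H v - 1"])
  define s1 where "s1 = (logev Tick s)\<lparr>rg := (rg s)(11 := v, 10 := mm s (rg s 10 + 1), 12 := H v, 13 := cs ! (H v - 1))\<rparr>"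
  have d1: "dinv qs cs H h0 xs s1" using Cons.prems(1) by (simp add: dinv_def s1_def)
  have h0: "h0 \<le> X" "HP0 \<le> h0" using heap Cons.prems(1) by (auto simp: dinv_def)
  have l1: "lst h0 (mm s) (mm s (rg s 10 + 1)) ys" using Cons.prems(3) by simp
  have next_iter: "lwp X W ?W ?P s2"
    if d2: "dinv qs cs H h0 (xs @ [v]) s2" and r2: "\<forall>i. i \<notin> {8, 12, 13, 16} \<longrightarrow> rg s2 i = rg s1 i"
      and m2: "\<forall>a. a < CA \<or> ST \<le> a \<and> a < h0 \<longrightarrow> mm s2 a = mm s1 a"
      and g2: "gh s2 = gh s1 @ replicate t2 Tick" "t2 \<le> 2 * length (filter (\<lambda>c. incomparable r c v) cs)" for s2 t2
  proof -
    have "ST \<le> HP0" using layout by linarith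
    then have "lst h0 (mm s2) (mm s (rg s 10 + 1)) ys"
      by (intro lst_cong[OF l1]) (use m2 in \<open>auto simp: s1_def\<close>)
    moreover have "rg s2 10 = mm s (rg s 10 + 1)" using r2 by (simp add: s1_def)
    ultimately have l2: "lst h0 (mm s2) (rg s2 10) ys" by simp
    show ?thesis
    proof (rule lwp_mono[OF Cons.IH[OF d2 qs' l2]], elim conjE exE)
      fix s3 t3
      assume a: "dinv qs cs H h0 qs s3" "\<forall>i. i \<notin> {8, 10, 11, 12, 13, 16} \<longrightarrow> rg s3 i = rg s2 i"
        "\<forall>a. a < CA \<or> ST \<le> a \<and> a < h0 \<longrightarrow> mm s3 a = mm s2 a" "gh s3 = gh s2 @ replicate t3 Tick"
        "t3 + 2 * ?pc (xs @ [v]) \<le> length ys + 2 * ?pc qs"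
      show "?P s3"
      proof (intro conjI exI)
        show "gh s3 = gh s @ replicate (1 + t2 + t3) Tick" using a(4) g2(1) by (simp add: s1_def replicate_add)
        show "1 + t2 + t3 + 2 * ?pc xs \<le> length (v # ys) + 2 * ?pc qs"
          using a(5) g2(2) unfolding sum_filter_snoc by simp
      qed (use a r2 m2 in \<open>auto simp: s1_def\<close>)
    qed
  qed
  have main: "lwp X W ?body (lwp X W ?W ?P) s1"
  proof (cases "v \<in> set cs")
    case True
    have ne: "\<not> incomparable r c v" if "c \<in> set cs" for c using ok True that unfolding chainok_def by blast
    then have f: "(\<Sum>c\<leftarrow>cs. length (filter (incomparable r c) (xs @ [v]))) = ?pc xs"
      unfolding sum_filter_snoc by simp
    have d2: "dinv qs cs H h0 (xs @ [v]) s1" using d1 True f ne by (auto simp: dinv_def)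
    have "lwp X W ?W ?P s1" by (rule next_iter[OF d2, of 0]) auto
    then show ?thesis using True mem(1) h0 layout by (simp add: lwp_If lwp_simps s1_def)
  next
    case False
    have "h0 + 2 * length (filter (\<lambda>v. v \<notin> set cs) (xs @ [v])) + 2 * (\<Sum>c\<leftarrow>cs. length (filter (incomparable r c) (xs @ [v]))) \<le> X"
    proof -
      have "length (filter (\<lambda>v. v \<notin> set cs) (xs @ [v])) \<le> length (filter (\<lambda>v. v \<notin> set cs) qs)" using qs' by simp
      moreover have "(\<Sum>c\<leftarrow>cs. length (filter (incomparable r c) (xs @ [v]))) \<le> ?pc qs"
        unfolding qs' by (intro sum_list_mono) simp
      ultimately show ?thesis using heap by linarith
    qed
    note heap1 = this
    have r1: "rg s1 11 = v" "rg s1 12 = H v" by (simp_all add: s1_def)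
    have "lwp X W OTHER (lwp X W ?W ?P) s1"
    proof (rule lwp_mono[OF lwp_OTHER[OF ok d1 r1(1) vq False r1(2) ne heap1]], elim conjE exE)
      fix s2 t
      assume "dinv qs cs H h0 (xs @ [v]) s2" "\<forall>i. i \<notin> {8, 12, 13, 16} \<longrightarrow> rg s2 i = rg s1 i"
        "\<forall>a. a < CA \<or> ST \<le> a \<and> a < h0 \<longrightarrow> mm s2 a = mm s1 a" "gh s2 = gh s1 @ replicate t Tick"
        "t \<le> 2 * length (filter (\<lambda>c. incomparable r c v) cs)"
      then show "lwp X W ?W ?P s2" by (rule next_iter)
    qed
    moreover have "v \<noteq> cs ! (H v - 1)" using False mem(1) by metis
    moreover have "v \<le> W" "cs ! (H v - 1) \<le> W" "v + cs ! (H v - 1) \<le> W"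
    proof -
      have "cs ! (H v - 1) < n" using subsetD[OF csn nth_mem[OF mem(2)]] by simp
      then show "v \<le> W" "cs ! (H v - 1) \<le> W" "v + cs ! (H v - 1) \<le> W" using vn layout by linarith+
    qed
    ultimately show ?thesis by (auto simp: lwp_If lwp_simps s1_def)
  qed
  have adr: "HT + v < X" "CA + H v < X" "HT + v \<le> W" "CA + H v \<le> W" using vn kn Hb layout by linarith+
  have p: "rg s 10 \<noteq> 0" "rg s 10 + 1 < X" "mm s (rg s 10) = v" using Cons.prems(3) HP0_pos h0 by auto
  show ?case
    by (subst lwp_While)
      (use main p adr b ht arr layout in \<open>simp add: lwp_simps NEXT_def baseD s1_def\<close>)
qed

lemma lwp_DIST:
  assumes c: "cinv qs cs s" "sdir qs" "cs \<noteq> []" and l: "lst h0 (mm s) (rg s 9) qs" "rg s 8 = h0" "HP0 \<le> h0"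
    and hd: "\<forall>c\<in>set cs. mm s (HD + c) = 0"
    and heap: "h0 + 2 * length (filter (\<lambda>v. v \<notin> set cs) qs) + 2 * (\<Sum>c\<leftarrow>cs. length (filter (incomparable r c) qs)) \<le> X"
  shows "lwp X W DIST (\<lambda>s'. dinv qs cs (ht (mm s)) h0 qs s'
     \<and> (\<forall>i. i \<notin> {8, 10, 11, 12, 13, 16} \<longrightarrow> rg s' i = rg s i)
     \<and> (\<forall>a. a < CA \<or> ST \<le> a \<and> a < h0 \<longrightarrow> mm s' a = mm s a)
     \<and> (\<exists>t. gh s' = gh s @ replicate t Tick \<and> t \<le> length qs + 2 * (\<Sum>c\<leftarrow>cs. length (filter (incomparable r c) qs)))) s"
proof -
  let ?s = "s\<lparr>rg := (rg s)(16 := 0, 10 := rg s 9)\<rparr>"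
  have ok: "chainok qs cs (ht (mm s))" by (rule cinv_chainok[OF c(1,2)])
  have d: "dinv qs cs (ht (mm s)) h0 [] ?s" using c(1) l hd by (auto simp: dinv_def cinv_def)
  have "lwp X W (DIST_LOOP) (\<lambda>s'. dinv qs cs (ht (mm s)) h0 qs s'
     \<and> (\<forall>i. i \<notin> {8, 10, 11, 12, 13, 16} \<longrightarrow> rg s' i = rg s i)
     \<and> (\<forall>a. a < CA \<or> ST \<le> a \<and> a < h0 \<longrightarrow> mm s' a = mm s a)
     \<and> (\<exists>t. gh s' = gh s @ replicate t Tick \<and> t \<le> length qs + 2 * (\<Sum>c\<leftarrow>cs. length (filter (incomparable r c) qs)))) ?s"
    by (rule lwp_mono[OF dist_loop[OF ok c(3) heap d, of qs]]) (use l in auto)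
  then show ?thesis unfolding DIST_def by (simp add: lwp_simps)
qed

text \<open>Prepending from the last chain element down puts the kids of this chain, in chain order,
  in front of those of the earlier chains, as the order in \<open>spine\<close> demands.\<close>

lemma kids_loop:
  assumes "base s" "rg s 12 = i" "i \<le> length cs" "length cs \<le> n" "\<And>j. j < length cs \<Longrightarrow> mm s (CA + 1 + j) = cs ! j"
    "set cs \<subseteq> {..<n}" "rg s 8 = hp" "HP0 \<le> hp" "hp + 3 * i \<le> X"
    "\<And>c. c \<in> set cs \<Longrightarrow> lst hp (mm s) (mm s (HD + c)) (P c)" "klst hp (mm s) (rg s 17) ks"
  shows "lwp X W (KIDS_LOOP)
     (\<lambda>s'. base s' \<and> rg s' 8 = hp + 3 * i \<and> klst (rg s' 8) (mm s') (rg s' 17) (map (\<lambda>c. (c, P c)) (take i cs) @ ks)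
     \<and> (\<forall>i. i \<notin> {8, 12, 13, 17} \<longrightarrow> rg s' i = rg s i) \<and> (\<forall>a<hp. mm s' a = mm s a)
     \<and> gh s' = gh s @ replicate i Tick) s"
  using assms
proof (induction i arbitrary: s hp ks)
  case 0
  then show ?case by (subst lwp_While) auto
next
  case (Suc i)
  define x where "x = cs ! i"
  have x: "x \<in> set cs" "mm s (CA + Suc i) = x" using Suc.prems(3,5) by (auto simp: x_def)
  then have xn: "x < n" using Suc.prems(6) by auto
  have "hp + 3 \<le> X" using Suc.prems(9) by simp
  then have adr: "CA + Suc i < HD" "HD + x < ST" "ST < hp" "hp + 3 \<le> X" "HD \<le> HD + x" "CA + Suc i < X" "HD + x < X" "CA < X"
    using Suc.prems(3,4,8) xn layout by linarith+
  define s1 where "s1 = s\<lparr>gh := gh s @ [Tick], mm := (mm s)(hp := x, Suc hp := mm s (HD + x), Suc (Suc hp) := rg s 17),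
     rg := (rg s)(13 := x, 17 := hp, 8 := hp + 3, 12 := i)\<rparr>"
  have low: "mm s1 a = mm s a" if "a < hp" for a using that by (simp add: s1_def)
  have b1: "base s1" using Suc.prems(1) adr layout by (simp add: s1_def)
  have "lwp X W (KIDS_LOOP)
     (\<lambda>s'. base s' \<and> rg s' 8 = (hp + 3) + 3 * i \<and> klst (rg s' 8) (mm s') (rg s' 17) (map (\<lambda>c. (c, P c)) (take i cs) @ ((x, P x) # ks))
     \<and> (\<forall>i. i \<notin> {8, 12, 13, 17} \<longrightarrow> rg s' i = rg s1 i) \<and> (\<forall>a<hp + 3. mm s' a = mm s1 a)
     \<and> gh s' = gh s1 @ replicate i Tick) s1"
  proof (rule Suc.IH[OF b1])
    show "mm s1 (CA + 1 + j) = cs ! j" if "j < length cs" for j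
    proof -
      have "CA + 1 + j < hp" using that Suc.prems(4) adr layout by linarith
      then show ?thesis using low Suc.prems(5)[OF that] by simp
    qed
    show "lst (hp + 3) (mm s1) (mm s1 (HD + c)) (P c)" if c: "c \<in> set cs" for c
    proof -
      have "c < n" using c Suc.prems(6) by auto
      then have "HD + c < hp" using adr layout by linarith
      then show ?thesis using low by (auto intro: lst_cong[OF Suc.prems(10)[OF c]])
    qed
    have "lst (hp + 3) (mm s1) (mm s (HD + x)) (P x)"
      by (rule lst_cong[OF Suc.prems(10)[OF x(1)]]) (use low in auto)
    moreover have "klst (hp + 3) (mm s1) (rg s 17) ks"
      by (rule klst_cong[OF Suc.prems(11)]) (use low in auto)
    moreover have "mm s1 hp = x" "mm s1 (hp + 1) = mm s (HD + x)" "mm s1 (hp + 2) = rg s 17" by (auto simp: s1_def)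
    ultimately show "klst (hp + 3) (mm s1) (rg s1 17) ((x, P x) # ks)"
      using Suc.prems(8) by (simp add: s1_def)
  qed (use Suc.prems adr in \<open>auto simp: s1_def\<close>)
  then have "lwp X W (KIDS_LOOP)
     (\<lambda>s'. base s' \<and> rg s' 8 = hp + 3 * Suc i \<and> klst (rg s' 8) (mm s') (rg s' 17) (map (\<lambda>c. (c, P c)) (take (Suc i) cs) @ ks)
     \<and> (\<forall>i. i \<notin> {8, 12, 13, 17} \<longrightarrow> rg s' i = rg s i) \<and> (\<forall>a<hp. mm s' a = mm s a)
     \<and> gh s' = gh s @ replicate (Suc i) Tick) s1"
  proof (rule lwp_mono, elim conjE, intro conjI)
    fix s' assume k: "klst (rg s' 8) (mm s') (rg s' 17) (map (\<lambda>c. (c, P c)) (take i cs) @ ((x, P x) # ks))"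
    have "take (Suc i) cs = take i cs @ [x]" using Suc.prems(3) by (simp add: take_Suc_conv_app_nth x_def)
    then show "klst (rg s' 8) (mm s') (rg s' 17) (map (\<lambda>c. (c, P c)) (take (Suc i) cs) @ ks)" using k by simp
  qed (auto simp: s1_def)
  then show ?case
    by (subst lwp_While)
      (use Suc.prems(1,2,7) x adr layout in \<open>simp add: lwp_simps baseD s1_def\<close>)
qed

end

context program
begin

section \<open>Extraction of all chains: time and space\<close>

lemma lwp_Seq: "lwp X W (c ;; d) Q = lwp X W c (lwp X W d Q)"
  using lwp_simps(4) by blast

text \<open>Incomparable pairs between chain and rest and those within the rest are different pairs
  of \<open>qs\<close>, so costs per pair add up along the spine to \<open>inc qs\<close>. Each
  element of the rest occurs in a pair of the first sort, with the chain element of its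
  height.\<close>

lemma chainok_budget:
  fixes qs cs
  defines "R \<equiv> rev (filter (\<lambda>v. v \<notin> set cs) qs)" and "pn \<equiv> \<Sum>c\<leftarrow>cs. length (filter (incomparable r c) qs)"
  assumes ok: "chainok qs cs H"
  shows "pn + inc R \<le> inc qs" "length R \<le> pn" "length R + length cs = length qs"
proof -
  have wf: "wf qs" and dc: "distinct cs" and cq: "set cs \<subseteq> set qs"
    and cmp: "\<And>c d. c \<in> set cs \<Longrightarrow> d \<in> set cs \<Longrightarrow> \<not> incomparable r c d"
    and Hb: "\<And>u. u \<in> set qs \<Longrightarrow> 1 \<le> H u \<and> H u \<le> length cs"
    and Hc: "\<And>j. j < length cs \<Longrightarrow> H (cs ! j) = Suc j"
    and Heq: "\<And>u w. u \<in> set qs \<Longrightarrow> w \<in> set qs \<Longrightarrow> u \<noteq> w \<Longrightarrow> H u = H w \<Longrightarrow> incomparable r u w"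
    using ok unfolding chainok_def by blast+
  have dq: "distinct qs" using wf by (simp add: wf_def)
  have wR: "wf R" using wf by (auto simp: wf_def R_def)
  have sR: "set R = set qs - set cs" by (auto simp: R_def)
  let ?A = "SIGMA c:set cs. {v \<in> set qs. incomparable r c v}"
  have "pn = (\<Sum>c\<in>set cs. length (filter (incomparable r c) qs))"
    unfolding pn_def using dc by (simp add: sum_list_distinct_conv_sum_set)
  also have "\<dots> = (\<Sum>c\<in>set cs. card {v \<in> set qs. incomparable r c v})"
    using dq by (intro sum.cong refl) (simp add: distinct_length_filter Int_def conj_commute)
  also have "\<dots> = card ?A" by (simp add: card_SigmaI)
  finally have pnA: "pn = card ?A" .
  let ?P = "\<lambda>S. {(u, v). u \<in> S \<and> v \<in> S \<and> incomparable r u v}"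
  have fin: "finite ?A" "finite (?P (set R))" "finite (?P (set qs))"
    by (auto intro: finite_subset[of _ "set R \<times> set R"] finite_subset[of _ "set qs \<times> set qs"])
  \<comment> \<open>\<open>inc_pairs\<close> counts ordered pairs, so the mixed pairs are needed in
    both orders.\<close>
  let ?B = "{(v, c). c \<in> set cs \<and> v \<in> set qs \<and> incomparable r v c}"
  have B: "prod.swap ` ?A = ?B"
    by (auto simp: image_iff dest: incomparable_commute[THEN iffD1])
  have finB: "finite ?B" unfolding B[symmetric] using fin(1) by simp
  have "card (?A \<union> ?B) = card ?A + card ?B"
    by (rule card_Un_disjoint[OF fin(1) finB]) (use cmp in auto)
  moreover have "card ?B = card ?A" unfolding B[symmetric] by (intro card_image) (auto intro: inj_onI)
  moreover have "card ((?A \<union> ?B) \<union> ?P (set R)) = card (?A \<union> ?B) + card (?P (set R))"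
    by (rule card_Un_disjoint) (use fin finB sR in auto)
  moreover have "card ((?A \<union> ?B) \<union> ?P (set R)) \<le> card (?P (set qs))"
  proof (rule card_mono[OF fin(3)])
    show "(?A \<union> ?B) \<union> ?P (set R) \<subseteq> ?P (set qs)" unfolding sR using cq by blast
  qed
  ultimately show "pn + inc R \<le> inc qs"
    using inc_pairs[OF wf] inc_pairs[OF wR] pnA by linarith
  have "card (set R) \<le> card ((\<lambda>(c, v). v) ` ?A)"
  proof (rule card_mono)
    show "set R \<subseteq> (\<lambda>(c, v). v) ` ?A"
    proof
      fix v assume "v \<in> set R"
      then have v: "v \<in> set qs" "v \<notin> set cs" using sR by auto
      define c where "c = cs ! (H v - 1)"
      have l: "H v - 1 < length cs" using Hb[OF v(1)] by linarith
      then have c: "c \<in> set cs" by (simp add: c_def)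
      have "H c = H v" using Hc[OF l] Hb[OF v(1)] by (simp add: c_def)
      then have "incomparable r c v" using c v cq by (intro Heq) auto
      then have "(c, v) \<in> ?A" using c v by auto
      then show "v \<in> (\<lambda>(c, v). v) ` ?A" by force
    qed
  qed (use fin in auto)
  also have "\<dots> \<le> card ?A" using fin by (intro card_image_le)
  finally show "length R \<le> pn" using wR pnA by (simp add: wf_def distinct_card)
  have "card (set R) = card (set qs) - card (set cs)" unfolding sR using cq by (intro card_Diff_subset) auto
  moreover have "card (set cs) \<le> card (set qs)" using cq by (intro card_mono) auto
  ultimately show "length R + length cs = length qs" using wR dc dq by (simp add: wf_def distinct_card)
qed

text \<open>A round uses \<open>2 * length R + 2 * pn \<le> 4 * pn\<close> words for lists and three
  words per kid, which telescopes by \<open>pn + inc R \<le> inc qs\<close>. It takes at most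
  \<open>1 + 4 * length qs + 4 * inc qs\<close> ticks, within the allowance of
  \<open>spine\<close>.\<close>

lemma spine_loop:
  assumes "base s" "rg s 8 = hp" "HP0 \<le> hp" "lst hp (mm s) (rg s 9) qs" "klst hp (mm s) (rg s 17) old"
    "wf qs" "sdir qs" "hp + 4 * inc qs + 3 * length qs \<le> X"
  shows "lwp X W (SPINE_LOOP)
    (\<lambda>s'. \<exists>chs x. spine qs chs x \<and> (\<forall>c\<in>set chs. sdir (snd c)) \<and> klst (rg s' 8) (mm s') (rg s' 17) (chs @ old)
      \<and> gh s' = gh s @ replicate x Tick \<and> hp \<le> rg s' 8 \<and> rg s' 8 \<le> hp + 4 * inc qs + 3 * length qs
      \<and> (\<forall>i. i \<notin> {8..17} \<longrightarrow> rg s' i = rg s i) \<and> (\<forall>a. a < HT \<or> ST \<le> a \<and> a < hp \<longrightarrow> mm s' a = mm s a)) s"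
  using assms
proof (induction "length qs" arbitrary: s hp qs old rule: less_induct)
  case less
  let ?W = "SPINE_LOOP"
  let ?P = "\<lambda>s'. \<exists>chs x. spine qs chs x \<and> (\<forall>c\<in>set chs. sdir (snd c)) \<and> klst (rg s' 8) (mm s') (rg s' 17) (chs @ old)
      \<and> gh s' = gh s @ replicate x Tick \<and> hp \<le> rg s' 8 \<and> rg s' 8 \<le> hp + 4 * inc qs + 3 * length qs
      \<and> (\<forall>i. i \<notin> {8..17} \<longrightarrow> rg s' i = rg s i) \<and> (\<forall>a. a < HT \<or> ST \<le> a \<and> a < hp \<longrightarrow> mm s' a = mm s a)"
  show ?case
  proof (cases qs)
    case Nil
    then have z: "rg s 9 = 0" using less.prems by simp
    have "?P s"
      by (rule exI[of _ "[]"], rule exI[of _ 0]) (use Nil less.prems in \<open>auto intro: spine.Nil\<close>)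
    then show ?thesis by (subst lwp_While) (use z in auto)
  next
    case (Cons q0 qs0)
    then have ne: "qs \<noteq> []" by simp
    have nz: "rg s 9 \<noteq> 0" using less.prems(4) Cons HP0_pos by auto
    have hpX: "hp \<le> X" using less.prems(8) by linarith
    have lay: "HT < CA" "CA \<le> ST" "ST < HP0" using layout by linarith+
    let ?s = "logev Tick s"
    have "lwp X W HEIGHTS (lwp X W CHAIN (lwp X W DIST (lwp X W KIDS (lwp X W (Asg 9 (V 16)) (lwp X W ?W ?P))))) ?s"
    proof (rule lwp_mono[OF lwp_HEIGHTS[of ?s hp qs]], goal_cases)
      case (5 s1)
      then obtain L t1 where h1: "hinv qs L s1" and r1: "\<And>i. i \<notin> {10, 11, 12, 13, 14, 15} \<Longrightarrow> rg s1 i = rg s i"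
        and m1: "\<And>a. a < HT \<or> CA \<le> a \<Longrightarrow> mm s1 a = mm s a"
        and g1: "gh s1 = gh s @ Tick # replicate t1 Tick" "t1 \<le> length qs + 2 * inc qs" by auto
      show ?case
      proof (rule lwp_mono[OF lwp_CHAIN[OF h1 ne]], elim conjE exE)
        fix s2 cs
        assume cs: "cs \<noteq> []" "cinv qs cs s2" "\<forall>c\<in>set cs. mm s2 (HD + c) = 0" "gh s2 = gh s1 @ replicate (length cs) Tick"
          and r2: "\<forall>i. i \<notin> {12, 13, 14} \<longrightarrow> rg s2 i = rg s1 i" and m2: "\<forall>a. a < CA \<or> ST \<le> a \<longrightarrow> mm s2 a = mm s1 a"
        define H where "H = ht (mm s2)"
        define R where "R = rev (filter (\<lambda>v. v \<notin> set cs) qs)"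
        define pn where "pn = (\<Sum>c\<leftarrow>cs. length (filter (incomparable r c) qs))"
        have ok: "chainok qs cs H" unfolding H_def by (rule cinv_chainok[OF cs(2) less.prems(7)])
        note bud = chainok_budget[OF ok, folded R_def pn_def]
        have lR: "length (filter (\<lambda>v. v \<notin> set cs) qs) = length R" by (simp add: R_def)
        have b2: "rg s2 9 = rg s 9" "rg s2 8 = hp" "rg s2 17 = rg s 17" "rg s2 14 = length cs"
          using r1 r2 less.prems(2) cs(2) by (auto simp: cinv_def)
        have l2: "lst hp (mm s2) (rg s2 9) qs" unfolding b2
          by (rule lst_cong[OF less.prems(4)]) (use m1 m2 lay in auto)
        have hp2: "hp + 2 * length R + 2 * pn + 3 * length cs \<le> hp + 4 * inc qs + 3 * length qs"
          "hp + 2 * length R + 2 * pn + 3 * length cs + 4 * inc R + 3 * length R \<le> hp + 4 * inc qs + 3 * length qs"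
          using bud by linarith+
        show "lwp X W DIST (lwp X W KIDS (lwp X W (Asg 9 (V 16)) (lwp X W ?W ?P))) s2"
        proof (rule lwp_mono[OF lwp_DIST[OF cs(2) less.prems(7) cs(1) l2 b2(2) less.prems(3) cs(3)]], goal_cases)
          case 1
          show ?case unfolding lR pn_def[symmetric] using hp2(1) less.prems(8) by linarith
        next
          case (2 s3)
          then obtain t3 where d3: "dinv qs cs H hp qs s3" and r3: "\<And>i. i \<notin> {8, 10, 11, 12, 13, 16} \<Longrightarrow> rg s3 i = rg s2 i"
            and m3: "\<And>a. a < CA \<or> ST \<le> a \<and> a < hp \<Longrightarrow> mm s3 a = mm s2 a"
            and g3: "gh s3 = gh s2 @ replicate t3 Tick" "t3 \<le> length qs + 2 * pn" unfolding H_def pn_def by blast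
          define h3 where "h3 = rg s3 8"
          have b3: "base s3" and r3': "rg s3 14 = length cs" and a3: "\<And>j. j < length cs \<Longrightarrow> mm s3 (CA + 1 + j) = cs ! j"
            and h3: "hp \<le> h3" "h3 \<le> hp + 2 * length R + 2 * pn" "HP0 \<le> h3"
            and lR3: "lst h3 (mm s3) (rg s3 16) R"
            and lP3: "\<And>c. c \<in> set cs \<Longrightarrow> lst h3 (mm s3) (mm s3 (HD + c)) (rev (filter (incomparable r c) qs))"
            using d3 less.prems(3) unfolding dinv_def h3_def lR pn_def[symmetric] R_def[symmetric] by auto
          have dc: "distinct cs" "set cs \<subseteq> set qs" using ok unfolding chainok_def by blast+
          have csn: "set cs \<subseteq> {..<n}" using dc(2) less.prems(6) by (auto simp: wf_def)
          have kn: "length cs \<le> n" using length_le_if_distinct[OF dc(1) csn] .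
          define s4 where "s4 = s3\<lparr>rg := (rg s3)(12 := length cs)\<rparr>"
          have same: "mm s3 a = mm s a" if "a < HT \<or> ST \<le> a \<and> a < hp" for a
            using that m3 m1 m2 lay by auto
          have k4: "klst h3 (mm s4) (rg s4 17) old"
            by (rule klst_cong[of hp "mm s"]) (use less.prems(5) h3 same lay r3 b2 in \<open>auto simp: s4_def\<close>)
          have "lwp X W (KIDS_LOOP) (lwp X W (Asg 9 (V 16)) (lwp X W ?W ?P)) s4"
          proof (rule lwp_mono[OF kids_loop[of s4 "length cs" cs h3 "\<lambda>c. rev (filter (incomparable r c) qs)" old]], goal_cases)
            case (12 s5)
            note 1 = 12
            let ?ks = "map (\<lambda>c. (c, rev (filter (incomparable r c) qs))) cs"
            have g5: "gh s5 = gh s @ replicate (1 + t1 + length cs + t3 + length cs) Tick" using 1 g1(1) g3(1) cs(4)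
              by (simp add: s4_def replicate_add)
            define s6 where "s6 = s5\<lparr>rg := (rg s5)(9 := rg s5 16)\<rparr>"
            have r5: "\<And>i. i \<notin> {8, 12, 13, 17} \<Longrightarrow> rg s5 i = rg s4 i" and m5: "\<And>a. a < h3 \<Longrightarrow> mm s5 a = mm s3 a"
              and k5: "klst (h3 + 3 * length cs) (mm s5) (rg s5 17) (?ks @ old)" and r5': "rg s5 8 = h3 + 3 * length cs" and b5: "base s5"
              using 1 by (auto simp: s4_def)
            have "lst (h3 + 3 * length cs) (mm s5) (rg s3 16) R"
              by (rule lst_cong[OF lR3]) (use m5 in auto)
            then have l6: "lst (h3 + 3 * length cs) (mm s6) (rg s6 9) R" using r5 by (simp add: s6_def s4_def)
            have len: "length R < length qs" using bud(3) cs(1) by (cases cs) auto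
            have wR: "wf R" using less.prems(6) by (auto simp: wf_def R_def)
            have sR: "sdir R" using less.prems(7) by (simp add: R_def sdir_rev sdir_filter)
            have "lwp X W ?W (\<lambda>s'. \<exists>chs x. spine R chs x \<and> (\<forall>c\<in>set chs. sdir (snd c)) \<and> klst (rg s' 8) (mm s') (rg s' 17) (chs @ ?ks @ old)
               \<and> gh s' = gh s6 @ replicate x Tick \<and> h3 + 3 * length cs \<le> rg s' 8 \<and> rg s' 8 \<le> h3 + 3 * length cs + 4 * inc R + 3 * length R
               \<and> (\<forall>i. i \<notin> {8..17} \<longrightarrow> rg s' i = rg s6 i) \<and> (\<forall>a. a < HT \<or> ST \<le> a \<and> a < h3 + 3 * length cs \<longrightarrow> mm s' a = mm s6 a)) s6"
              by (rule less.hyps[OF len _ _ _ l6 _ wR sR])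
                (use b5 r5' h3 k5 hp2 less.prems(8) in \<open>auto simp: s6_def\<close>)
            then have "lwp X W ?W ?P s6"
            proof (rule lwp_mono, elim exE conjE)
              fix s' chs x
              assume a: "spine R chs x" "\<forall>c\<in>set chs. sdir (snd c)" "klst (rg s' 8) (mm s') (rg s' 17) (chs @ ?ks @ old)"
                "gh s' = gh s6 @ replicate x Tick" "h3 + 3 * length cs \<le> rg s' 8" "rg s' 8 \<le> h3 + 3 * length cs + 4 * inc R + 3 * length R"
                "\<forall>i. i \<notin> {8..17} \<longrightarrow> rg s' i = rg s6 i" "\<forall>a. a < HT \<or> ST \<le> a \<and> a < h3 + 3 * length cs \<longrightarrow> mm s' a = mm s6 a"
              obtain cs' where lc: "longest_chain r (set qs) cs'" "cs' = cs \<or> cs' = rev cs"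
                using cinv_longest[OF cs(2) less.prems(7)] .
              have ms: "mset cs = mset cs'" using lc(2) by auto
              have sp: "spine qs (chs @ ?ks) (x + (1 + t1 + length cs + t3 + length cs))"
                by (rule spine.chain[OF ne lc(1) ms]) (use a(1) g1(2) g3(2) bud in \<open>auto simp: R_def\<close>)
              show "?P s'"
              proof (rule exI[of _ "chs @ ?ks"], rule exI[of _ "x + (1 + t1 + length cs + t3 + length cs)"], intro conjI)
                show "spine qs (chs @ ?ks) (x + (1 + t1 + length cs + t3 + length cs))" by (rule sp)
                show "\<forall>c\<in>set (chs @ ?ks). sdir (snd c)" using a(2) less.prems(7) by (auto simp: sdir_rev sdir_filter)
                show "klst (rg s' 8) (mm s') (rg s' 17) ((chs @ ?ks) @ old)" using a(3) by simp
                have "gh s' = gh s @ replicate (1 + t1 + length cs + t3 + length cs + x) Tick"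
                  unfolding replicate_add[of _ x] using a(4) g5 by (simp add: s6_def)
                then show "gh s' = gh s @ replicate (x + (1 + t1 + length cs + t3 + length cs)) Tick" by (simp add: add.commute)
                show "hp \<le> rg s' 8" using a(5) h3 by linarith
                show "rg s' 8 \<le> hp + 4 * inc qs + 3 * length qs" using a(6) h3(2) hp2(2) by linarith
                show "\<forall>i. i \<notin> {8..17} \<longrightarrow> rg s' i = rg s i" using a(7) r5 r3 r2 r1 by (auto simp: s6_def s4_def)
                show "\<forall>a. a < HT \<or> ST \<le> a \<and> a < hp \<longrightarrow> mm s' a = mm s a"
                proof (intro allI impI)
                  fix b assume b: "b < HT \<or> ST \<le> b \<and> b < hp"
                  then have "b < h3" using h3 lay by auto
                  then have "mm s' b = mm s6 b" using a(8) b by auto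
                  also have "\<dots> = mm s b" using m5[OF \<open>b < h3\<close>] same[OF b] by (simp add: s6_def)
                  finally show "mm s' b = mm s b" .
                qed
              qed
            qed
            then show ?case by (simp add: lwp_simps s6_def)
          qed (use b3 kn a3 csn h3 lP3 k4 hp2 less.prems(8) in \<open>auto simp: s4_def h3_def[symmetric]\<close>)
          then show ?case unfolding KIDS_def using r3' by (simp add: lwp_simps s4_def)
        qed
      qed
    qed (use less.prems hpX in auto)
    then show ?thesis by (subst lwp_While) (use nz in \<open>simp only: lwp_Seq ok.simps eval.simps if_False simp_thms\<close>)
  qed
qed

lemma lwp_SPINE:
  assumes "base s" "rg s 8 = hp" "HP0 \<le> hp" "lst hp (mm s) (rg s 9) qs"
    "wf qs" "sdir qs" "hp + 4 * inc qs + 3 * length qs \<le> X"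
  shows "lwp X W SPINE
    (\<lambda>s'. \<exists>chs x. spine qs chs x \<and> (\<forall>c\<in>set chs. sdir (snd c)) \<and> klst (rg s' 8) (mm s') (rg s' 17) chs
      \<and> gh s' = gh s @ replicate x Tick \<and> hp \<le> rg s' 8 \<and> rg s' 8 \<le> hp + 4 * inc qs + 3 * length qs
      \<and> (\<forall>i. i \<notin> {8..17} \<longrightarrow> rg s' i = rg s i) \<and> (\<forall>a. a < HT \<or> ST \<le> a \<and> a < hp \<longrightarrow> mm s' a = mm s a)) s"
proof -
  have "lwp X W (SPINE_LOOP)
    (\<lambda>s'. \<exists>chs x. spine qs chs x \<and> (\<forall>c\<in>set chs. sdir (snd c)) \<and> klst (rg s' 8) (mm s') (rg s' 17) (chs @ [])
      \<and> gh s' = gh (upd_rg 17 0 s) @ replicate x Tick \<and> hp \<le> rg s' 8 \<and> rg s' 8 \<le> hp + 4 * inc qs + 3 * length qs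
      \<and> (\<forall>i. i \<notin> {8..17} \<longrightarrow> rg s' i = rg (upd_rg 17 0 s) i) \<and> (\<forall>a. a < HT \<or> ST \<le> a \<and> a < hp \<longrightarrow> mm s' a = mm (upd_rg 17 0 s) a)) (upd_rg 17 0 s)"
    by (rule spine_loop) (use assms in auto)
  then show ?thesis unfolding SPINE_def lwp_simps eval.simps
    by (intro conjI) (simp, rule lwp_mono, assumption, elim exE conjE, intro exI conjI, auto)
qed

end

section \<open>The recursion with an explicit stack of frames\<close>

abbreviation REV_LOOP :: com where
  "REV_LOOP \<equiv> While (V 17) (Sto (V 8) (Ld (V 17)) ;; Sto (Plus (V 8) (N 1)) (Ld (Plus (V 17) (N 1))) ;;
     Sto (Plus (V 8) (N 2)) (V 12) ;; Asg 12 (V 8) ;; Asg 8 (Plus (V 8) (N 3)) ;; Asg 17 (Ld (Plus (V 17) (N 2))))"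

text \<open>Serves the calls that visit last: they run through their kids in the opposite order,
  those of the first chain first. The kid cells are copied, while the candidate lists are
  shared.\<close>

definition REV :: com where
  "REV = Asg 12 (N 0) ;; REV_LOOP ;;
     Asg 17 (V 12)"

text \<open>Register 19 is the depth of the recursion, and register 20 tells whether the current call visits
  its antichain first.  The frame of depth d holds the remaining kids and the heap pointer to be
  restored.\<close>

definition DESC :: com where
  "DESC = Asg 13 (Ld (V 18)) ;; Sto (V 18) (Ld (Plus (V 13) (N 2))) ;; Enq (Plus (Ld (V 13)) (N 2)) ;;
     Asg 9 (Ld (Plus (V 13) (N 1))) ;; Sto (Plus (V 18) (N 3)) (V 8) ;; Asg 20 (Minus (N 1) (V 20)) ;;
     If (V 20) (Enq (N 1)) Skip ;; SPINE ;; If (V 20) Skip REV ;; Asg 19 (Plus (V 19) (N 1)) ;;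
     Sto (Plus (V 18) (N 2)) (V 17)"

definition ASC :: com where
  "ASC = Asg 8 (Ld (Plus (V 18) (N 1))) ;; If (V 20) Skip (Enq (N 1)) ;; Asg 20 (Minus (N 1) (V 20)) ;;
     Asg 19 (Minus (V 19) (N 1)) ;; If (V 19) (Enq (N 0)) Skip"

definition LOOP :: com where
  "LOOP = While (V 19) (Asg 18 (Plus (V 7) (Plus (V 19) (V 19))) ;; If (Ld (V 18)) DESC ASC)"

context program
begin

lemma rev_loop:
  assumes "base s" "rg s 8 = h" "HP0 \<le> h" "h + 3 * length ks \<le> X" "klst h (mm s) (rg s 17) ks" "klst h (mm s) (rg s 12) acc"
  shows "lwp X W (REV_LOOP)
    (\<lambda>s'. klst (rg s' 8) (mm s') (rg s' 12) (rev ks @ acc) \<and> rg s' 8 = h + 3 * length ks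
      \<and> (\<forall>a<h. mm s' a = mm s a) \<and> (\<forall>i. i \<notin> {8, 12, 17} \<longrightarrow> rg s' i = rg s i)
      \<and> gh s' = gh s @ replicate (length ks) Tick) s"
  using assms
proof (induction ks arbitrary: s h acc)
  case Nil
  then show ?case by (subst lwp_While) auto
next
  case (Cons k ks)
  obtain c P where k: "k = (c, P)" by (cases k)
  define p where "p = rg s 17"
  have kl: "HP0 \<le> p" "p + 2 < h" "mm s p = c" "lst h (mm s) (mm s (p + 1)) P" "klst h (mm s) (mm s (p + 2)) ks"
    using Cons.prems(5) k by (auto simp: p_def)
  have hX: "h + 3 \<le> X" using Cons.prems(4) by simp
  define s1 where "s1 = s\<lparr>gh := gh s @ [Tick], mm := (mm s)(h := c, Suc h := mm s (p + 1), Suc (Suc h) := rg s 12),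
    rg := (rg s)(12 := h, 8 := h + 3, 17 := mm s (p + 2))\<rparr>"
  have low: "mm s1 a = mm s a" if "a < h" for a using that by (simp add: s1_def)
  have "lwp X W (REV_LOOP)
    (\<lambda>s'. klst (rg s' 8) (mm s') (rg s' 12) (rev ks @ ((c, P) # acc)) \<and> rg s' 8 = (h + 3) + 3 * length ks
      \<and> (\<forall>a<h + 3. mm s' a = mm s1 a) \<and> (\<forall>i. i \<notin> {8, 12, 17} \<longrightarrow> rg s' i = rg s1 i)
      \<and> gh s' = gh s1 @ replicate (length ks) Tick) s1"
  proof (rule Cons.IH)
    show "base s1" using Cons.prems(1,3) layout by (simp add: s1_def)
    have "klst (h + 3) (mm s1) (mm s (p + 2)) ks" by (rule klst_cong[OF kl(5)]) (use low in auto)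
    then show "klst (h + 3) (mm s1) (rg s1 17) ks" by (simp add: s1_def)
    have "klst (h + 3) (mm s1) (rg s 12) acc" by (rule klst_cong[OF Cons.prems(6)]) (use low in auto)
    moreover have "lst (h + 3) (mm s1) (mm s (p + 1)) P" by (rule lst_cong[OF kl(4)]) (use low in auto)
    moreover have "mm s1 h = c" "mm s1 (h + 1) = mm s (p + 1)" "mm s1 (h + 2) = rg s 12" by (auto simp: s1_def)
    ultimately show "klst (h + 3) (mm s1) (rg s1 12) ((c, P) # acc)" using Cons.prems(3) by (simp add: s1_def)
  qed (use Cons.prems in \<open>auto simp: s1_def\<close>)
  then have main: "lwp X W (REV_LOOP)
    (\<lambda>s'. klst (rg s' 8) (mm s') (rg s' 12) (rev (k # ks) @ acc) \<and> rg s' 8 = h + 3 * length (k # ks)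
      \<and> (\<forall>a<h. mm s' a = mm s a) \<and> (\<forall>i. i \<notin> {8, 12, 17} \<longrightarrow> rg s' i = rg s i)
      \<and> gh s' = gh s @ replicate (length (k # ks)) Tick) s1"
    by (rule lwp_mono) (auto simp: s1_def k)
  have "0 < p" "p + 2 < X" "h + 3 \<le> W" using kl(1,2) hX HP0_pos by linarith+
  then show ?case
    by (subst lwp_While) (use main Cons.prems(2) hX kl(1-3) p_def[symmetric] layout in \<open>simp add: lwp_simps s1_def\<close>)
qed

lemma lwp_REV:
  assumes "base s" "rg s 8 = h" "HP0 \<le> h" "h + 3 * length ks \<le> X" "klst h (mm s) (rg s 17) ks"
  shows "lwp X W REV
    (\<lambda>s'. klst (rg s' 8) (mm s') (rg s' 17) (rev ks) \<and> rg s' 8 = h + 3 * length ks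
      \<and> (\<forall>a<h. mm s' a = mm s a) \<and> (\<forall>i. i \<notin> {8, 12, 17} \<longrightarrow> rg s' i = rg s i)
      \<and> gh s' = gh s @ replicate (length ks) Tick) s"
proof -
  have "klst h (mm (upd_rg 12 0 s)) (rg (upd_rg 12 0 s) 12) []" by simp
  from rev_loop[OF _ _ assms(3,4) _ this] assms
  have "lwp X W (REV_LOOP)
    (\<lambda>s'. klst (rg s' 8) (mm s') (rg s' 12) (rev ks @ []) \<and> rg s' 8 = h + 3 * length ks
      \<and> (\<forall>a<h. mm s' a = mm (upd_rg 12 0 s) a) \<and> (\<forall>i. i \<notin> {8, 12, 17} \<longrightarrow> rg s' i = rg (upd_rg 12 0 s) i)
      \<and> gh s' = gh (upd_rg 12 0 s) @ replicate (length ks) Tick) (upd_rg 12 0 s)" by simp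
  then show ?thesis unfolding REV_def lwp_simps eval.simps
    by (intro conjI) (simp, rule lwp_mono, assumption, auto)
qed

lemma st_swap:
  fixes s :: "'g st"
  shows "s\<lparr>gh := a, rg := b\<rparr> = s\<lparr>rg := b, gh := a\<rparr>" "s\<lparr>gh := a, mm := c\<rparr> = s\<lparr>mm := c, gh := a\<rparr>"
    "s\<lparr>rg := b, mm := c\<rparr> = s\<lparr>mm := c, rg := b\<rparr>"
  by simp_all

lemma lwp_LOOP: "lwp X W LOOP Q s = (if rg s 19 = 0 then Q s
    else lwp X W (Asg 18 (Plus (V 7) (Plus (V 19) (V 19))) ;; If (Ld (V 18)) DESC ASC) (lwp X W LOOP Q) (logev Tick s))"
  unfolding LOOP_def by (subst lwp_While) simp

text \<open>Continuation style: the last hypothesis says that the loop ends well from every state in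
  which the current frame is completed, so the loop need not be cut at the end of a call. The outer
  induction is on a bound \<open>k\<close> for the number of candidates of the kids, which drops
  with the depth; the inner one is on the remaining kids. The heap below \<open>hp\<close> and the
  lower frames survive, so a call gives back its memory by resetting the heap pointer.\<close>

lemma run_frame:
  assumes "base s" "rg s 19 = d" "1 \<le> d" "rg s 20 = (if b then 1 else 0)" "rg s 8 = h"
    "klst h (mm s) (mm s (ST + 2 * d)) ks" "mm s (ST + 2 * d + 1) = hp" "HP0 \<le> hp" "hp \<le> h"
    "\<And>c P. (c, P) \<in> set ks \<Longrightarrow> c < n \<and> wf P \<and> sdir P \<and> length P < k" "d + k \<le> n + 1" "h + k * (6 * n + 4 * q) \<le> X"
    "\<And>zs s'. map kid zs = ks \<Longrightarrow> (\<And>z. z \<in> set zs \<Longrightarrow> node (\<not> b) (fst (snd z)) (snd (snd z))) \<Longrightarrow>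
      gh s' = gh s @ concat (map blk zs) @ [Tick] @ (if b then [] else [Emit]) @ (if d = 1 then [] else [Pop]) \<Longrightarrow>
      base s' \<Longrightarrow> rg s' 19 = d - 1 \<Longrightarrow> rg s' 20 = (if b then 0 else 1) \<Longrightarrow> rg s' 8 = hp \<Longrightarrow>
      (\<And>a. a < HT \<or> ST \<le> a \<and> a < ST + 2 * d \<or> HP0 \<le> a \<and> a < hp \<Longrightarrow> mm s' a = mm s a) \<Longrightarrow> lwp X W LOOP Q s'"
  shows "lwp X W LOOP Q s"
  using assms
proof (induction k arbitrary: s d b h ks hp Q rule: less_induct)
  case (less k)
  note outer = less.IH
  from less.prems show ?case
  proof (induction ks arbitrary: s Q)
    case Nil
    note p = Nil.prems
    have z: "mm s (ST + 2 * d) = 0" using p(6) by simp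
    define s1 where "s1 = s\<lparr>gh := gh s @ [Tick] @ (if b then [] else [Emit]) @ (if d = 1 then [] else [Pop]),
      rg := (rg s)(18 := ST + 2 * d, 8 := hp, 20 := if b then 0 else 1, 19 := d - 1)\<rparr>"
    have "base s1" by (rule base_cong[OF p(1)]) (simp_all add: s1_def)
    note bs1 = this
    have "lwp X W LOOP Q s1"
    proof (rule p(13)[of "[]"])
      show "base s1" by (rule bs1)
    qed (auto simp: s1_def)
    note q1 = this
    have adr: "ST + 2 * d + 3 < X" "2 * d \<le> W" using p(11) layout by linarith+
    have r: "rg s 7 = ST" "rg s 19 = d" "d \<noteq> 0" "rg s 20 = (if b then 1 else 0)" "mm s (ST + (d + d)) = 0" "mm s (Suc (ST + (d + d))) = hp"
      using p(1-4,7) z by (simp_all add: baseD mult_2)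
    have o: "d + d \<le> W" "ST + (d + d) \<le> W" "ST + (d + d) < X" "Suc (ST + (d + d)) \<le> W" "Suc (ST + (d + d)) < X" "1 \<le> W"
      using adr layout by linarith+
    have s1: "s1 = s\<lparr>gh := gh s @ [Tick] @ (if b then [] else [Emit]) @ (if d = 1 then [] else [Pop]),
      rg := (rg s)(18 := ST + (d + d), 8 := hp, 20 := if b then 0 else 1, 19 := d - 1)\<rparr>"
      by (simp add: s1_def mult_2)
    have "lwp X W (Asg 18 (Plus (V 7) (Plus (V 19) (V 19))) ;; If (Ld (V 18)) DESC ASC) (lwp X W LOOP Q) (logev Tick s)"
      by (cases b; cases "d = 1") (use q1 r o in \<open>simp_all add: s1 ASC_def lwp_simps lwp_If st_swap decode_def\<close>)
    then show ?case by (subst lwp_LOOP) (use r in simp)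
  next
    case (Cons kd ks)
    note p = Cons.prems
    obtain c P where kd: "kd = (c, P)" by (cases kd)
    define b' where "b' = (\<not> b)"
    define p0 where "p0 = mm s (ST + 2 * d)"
    define A where "A = ST + 2 * d"
    have kl: "HP0 \<le> p0" "p0 + 2 < h" "mm s p0 = c" "lst h (mm s) (mm s (p0 + 1)) P" "klst h (mm s) (mm s (p0 + 2)) ks"
      using p(6) kd by (auto simp: p0_def)
    have P: "c < n" "wf P" "sdir P" "length P < k" using p(10)[of c P] kd by auto
    \<comment> \<open>The spine of the kid takes \<open>4 * inc P + 3 * length P\<close> words and
      the reversed copy of its list \<open>3 * length P\<close> more; the hypothesis on
      \<open>X\<close> reserves that much for each of \<open>k\<close> levels.\<close>
    have "4 * inc P + 6 * length P \<le> 6 * n + 4 * q" using inc_le_q[OF P(2)] length_le_n[OF P(2)] by linarith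
    moreover have "(length P + 1) * (6 * n + 4 * q) \<le> k * (6 * n + 4 * q)" using P(4) by (intro mult_le_mono1) simp
    ultimately have heap: "h + 4 * inc P + 6 * length P + length P * (6 * n + 4 * q) \<le> X"
      using p(12) by (simp add: algebra_simps)
    have lay: "A + 3 < HP0" "A + 3 < X" "HP0 \<le> h" "h \<le> X" "X \<le> W" "ST \<le> A" "d + 1 < W" "HT < ST" "2 * d < W"
      "p0 + 2 < X" "0 < p0" "c + 2 \<le> W" "2 \<le> W"
      using layout p(8,9,11) P(1,4) kl(1,2) heap unfolding A_def by linarith+
    define s1 where "s1 = s\<lparr>mm := (mm s)(A := mm s (p0 + 2), A + 3 := h),
      gh := gh s @ [Tick, Push c] @ (if b' then [Emit] else []),
      rg := (rg s)(18 := A, 13 := p0, 9 := mm s (p0 + 1), 20 := if b' then 1 else 0)\<rparr>"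
    have low: "mm s1 a = mm s a" if "a \<noteq> A" "a \<noteq> A + 3" for a using that by (simp add: s1_def)
    have b1: "base s1" by (rule base_cong[OF p(1)]) (use lay in \<open>simp_all add: s1_def\<close>)
    \<comment> \<open>Common end of both kinds of call. They differ only in the order of
      \<open>ks3\<close> relative to the spine and in the ticks \<open>y\<close>, which include the
      reversal.\<close>
    have fin: "lwp X W LOOP Q (s3\<lparr>rg := (rg s3)(19 := d + 1), mm := (mm s3)(A + 2 := rg s3 17)\<rparr>)"
      if a: "base s3" "rg s3 20 = (if b' then 1 else 0)" "klst (rg s3 8) (mm s3) (rg s3 17) ks3" "h \<le> rg s3 8"
         "rg s3 8 \<le> h + 4 * inc P + 6 * length P" "\<And>a. a < HT \<or> ST \<le> a \<and> a < h \<Longrightarrow> mm s3 a = mm s1 a"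
         "gh s3 = gh s1 @ replicate y Tick" "spine P (if b' then ks3 else rev ks3) x"
         "y \<le> (if b' then x else x + length P)" "b' \<Longrightarrow> y = x" "\<And>c. c \<in> set ks3 \<Longrightarrow> sdir (snd c)" for s3 :: "ev list st" and ks3 y x
    proof -
      define s4 where "s4 = s3\<lparr>rg := (rg s3)(19 := d + 1), mm := (mm s3)(A + 2 := rg s3 17)\<rparr>"
      have b4: "base s4" by (rule base_cong[OF a(1)]) (use lay in \<open>simp_all add: s4_def\<close>)
      have adr: "ST + 2 * (d + 1) = A + 2" "ST + 2 * (d + 1) + 1 = A + 3" by (simp_all add: A_def)
      have k4: "klst (rg s3 8) (mm s4) (mm s4 (ST + 2 * (d + 1))) ks3" unfolding adr
        by (rule klst_cong[where m = "mm s3"]) (use a(3) lay in \<open>auto simp: s4_def\<close>)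
      have m4: "mm s4 (A + 3) = h" using a(6)[of "A + 3"] lay by (simp add: s4_def s1_def)
      have "lwp X W LOOP Q s4"
      proof (rule outer[OF P(4), of s4 "d + 1" b' "rg s3 8" ks3 h])
        show "c' < n \<and> wf P' \<and> sdir P' \<and> length P' < length P" if c': "(c', P') \<in> set ks3" for c' P'
        proof -
          have "(c', P') \<in> set (if b' then ks3 else rev ks3)" using c' by simp
          from spine_kid[OF a(8) P(2) this]
          have w: "wf P'" "c' \<in> set P" "c' \<notin> set P'" "set P' \<subseteq> set P" by blast+
          have "card (set P') < card (set P)" by (rule psubset_card_mono) (use w in auto)
          then show ?thesis using w P(2) a(11)[OF c'] by (auto simp: wf_def distinct_card)
        qed
        show "d + 1 + length P \<le> n + 1" using p(11) P(4) by linarith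
        show "rg s3 8 + length P * (6 * n + 4 * q) \<le> X" using a(5) heap by linarith
        show "base s4" "klst (rg s3 8) (mm s4) (mm s4 (ST + 2 * (d + 1))) ks3" by fact+
        show "mm s4 (ST + 2 * (d + 1) + 1) = h" using m4 adr by (simp add: eval_nat_numeral)
        show "rg s4 19 = d + 1" "1 \<le> d + 1" "rg s4 20 = (if b' then 1 else 0)" "rg s4 8 = rg s3 8" "HP0 \<le> h" "h \<le> rg s3 8"
          using a(2,4) lay by (simp_all add: s4_def)
        fix zs s'
        assume z: "map kid zs = ks3" "\<And>z. z \<in> set zs \<Longrightarrow> node (\<not> b') (fst (snd z)) (snd (snd z))"
          "gh s' = gh s4 @ concat (map blk zs) @ [Tick] @ (if b' then [] else [Emit]) @ (if d + 1 = 1 then [] else [Pop])"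
          "base s'" "rg s' 19 = d + 1 - 1" "rg s' 20 = (if b' then 0 else 1)" "rg s' 8 = h"
          "\<And>a. a < HT \<or> ST \<le> a \<and> a < ST + 2 * (d + 1) \<or> HP0 \<le> a \<and> a < h \<Longrightarrow> mm s' a = mm s4 a"
        define u where "u = (if b' then [Emit] else []) @ replicate y Tick @ concat (map blk zs) @ [Tick] @ (if b' then [] else [Emit])"
        have nd: "node b' P u"
        proof (cases b')
          case True
          then show ?thesis using node.first[of P zs x] a(8,10) z(1,2) by (simp add: u_def)
        next
          case False
          then show ?thesis using node.last[of P zs x y] a(8,9) z(1,2) by (simp add: u_def)
        qed
        have gu: "gh s' = gh s @ blk (c, P, u)" using z(3) a(7) p(3)
          by (simp add: s4_def s1_def u_def)
        have same: "mm s' a = mm s a" if "a < HT \<or> ST \<le> a \<and> a < A + 2 \<and> a \<noteq> A \<or> HP0 \<le> a \<and> a < h" for a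
        proof -
          have "mm s' a = mm s4 a" by (rule z(8)) (use that in \<open>auto simp: A_def\<close>)
          also have "\<dots> = mm s3 a" using that lay by (auto simp: s4_def)
          also have "\<dots> = mm s1 a" by (rule a(6)) (use that lay in auto)
          also have "\<dots> = mm s a" by (rule low) (use that lay in auto)
          finally show ?thesis .
        qed
        have mA: "mm s' A = mm s (p0 + 2)"
        proof -
          have "mm s' A = mm s4 A" by (rule z(8)) (use lay in \<open>auto simp: A_def\<close>)
          also have "\<dots> = mm s3 A" by (auto simp: s4_def)
          also have "\<dots> = mm s1 A" by (rule a(6)) (use lay in auto)
          finally show ?thesis by (simp add: s1_def)
        qed
        show "lwp X W LOOP Q s'"
        proof (rule Cons.IH)
          show "base s'" "rg s' 19 = d" "1 \<le> d" "rg s' 20 = (if b then 1 else 0)" "rg s' 8 = h" "HP0 \<le> hp" "hp \<le> h"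
            "d + k \<le> n + 1" "h + k * (6 * n + 4 * q) \<le> X"
            using z(4-7) p(3,8,9,11,12) by (simp_all add: b'_def)
          show "klst h (mm s') (mm s' (ST + 2 * d)) ks" unfolding A_def[symmetric] mA
            by (rule klst_cong[OF kl(5)]) (use same in auto)
          show "mm s' (ST + 2 * d + 1) = hp" using same[of "A + 1"] p(7) lay by (simp add: A_def)
          show "c' < n \<and> wf P' \<and> sdir P' \<and> length P' < k" if "(c', P') \<in> set ks" for c' P'
            using p(10)[of c' P'] that by simp
          fix zs2 s''
          assume y: "map kid zs2 = ks" "\<And>z. z \<in> set zs2 \<Longrightarrow> node (\<not> b) (fst (snd z)) (snd (snd z))"
            "gh s'' = gh s' @ concat (map blk zs2) @ [Tick] @ (if b then [] else [Emit]) @ (if d = 1 then [] else [Pop])"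
            "base s''" "rg s'' 19 = d - 1" "rg s'' 20 = (if b then 0 else 1)" "rg s'' 8 = hp"
            "\<And>a. a < HT \<or> ST \<le> a \<and> a < ST + 2 * d \<or> HP0 \<le> a \<and> a < hp \<Longrightarrow> mm s'' a = mm s' a"
          show "lwp X W LOOP Q s''"
          proof (rule p(13)[of "(c, P, u) # zs2"])
            show "map kid ((c, P, u) # zs2) = kd # ks" using y(1) kd by simp
            show "node (\<not> b) (fst (snd z)) (snd (snd z))" if "z \<in> set ((c, P, u) # zs2)" for z
              using that y(2)[of z] nd by (cases "z \<in> set zs2") (simp_all add: b'_def)
            show "gh s'' = gh s @ concat (map blk ((c, P, u) # zs2)) @ [Tick] @ (if b then [] else [Emit]) @ (if d = 1 then [] else [Pop])"
              unfolding y(3) gu by simp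
            show "mm s'' a = mm s a" if "a < HT \<or> ST \<le> a \<and> a < ST + 2 * d \<or> HP0 \<le> a \<and> a < hp" for a
              using y(8)[OF that] same[of a] that p(9) lay by (auto simp: A_def)
          qed (use y in auto)
        qed
      qed
      then show ?thesis by (simp add: s4_def)
    qed
    have "lwp X W SPINE (lwp X W (If (V 20) Skip REV) (lwp X W (Asg 19 (Plus (V 19) (N 1)) ;; Sto (Plus (V 18) (N 2)) (V 17)) (lwp X W LOOP Q))) s1"
    proof (rule lwp_mono[OF lwp_SPINE[OF b1 _ lay(3) _ P(2,3)]], goal_cases)
      case 1 show ?case using p(5) by (simp add: s1_def)
    next
      case 2
      have "lst h (mm s1) (mm s (p0 + 1)) P" by (rule lst_cong[OF kl(4)]) (use low lay in auto)
      then show ?case by (simp add: s1_def)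
    next
      case 3 show ?case using heap by linarith
    next
      case (4 s2)
      then obtain chs x where sp: "spine P chs x" "\<forall>c\<in>set chs. sdir (snd c)" "klst (rg s2 8) (mm s2) (rg s2 17) chs"
        "gh s2 = gh s1 @ replicate x Tick" "h \<le> rg s2 8" "rg s2 8 \<le> h + 4 * inc P + 3 * length P"
        "\<forall>i. i \<notin> {8..17} \<longrightarrow> rg s2 i = rg s1 i" "\<forall>a. a < HT \<or> ST \<le> a \<and> a < h \<longrightarrow> mm s2 a = mm s1 a" by blast
      have b2: "base s2"
        by (rule base_cong[OF b1]) (use sp in auto)
      have r2: "rg s2 20 = (if b' then 1 else 0)" "rg s2 18 = A" "rg s2 19 = d" using sp(7) p(2) by (auto simp: s1_def)
      have len: "length chs = length P" using length_spine[OF sp(1) P(2)] .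
      show ?case
      proof (cases b')
        case True
        have "lwp X W LOOP Q (s2\<lparr>rg := (rg s2)(19 := d + 1), mm := (mm s2)(A + 2 := rg s2 17)\<rparr>)"
          by (rule fin[OF b2 r2(1) sp(3), of x x]) (use sp True in auto)
        then show ?thesis using r2 True lay layout by (simp add: lwp_simps lwp_If)
      next
        case False
        have "h + 3 * length P + 4 * inc P + 3 * length chs \<le> X" using heap len by linarith
        then have r8: "rg s2 8 + 3 * length chs \<le> X" "HP0 \<le> rg s2 8" using sp(5,6) lay by linarith+
        have "lwp X W REV (lwp X W (Asg 19 (Plus (V 19) (N 1)) ;; Sto (Plus (V 18) (N 2)) (V 17)) (lwp X W LOOP Q)) s2"
        proof (rule lwp_mono[OF lwp_REV[OF b2 refl r8(2,1) sp(3)]], elim conjE)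
          fix s3 :: "ev list st"
          assume a: "klst (rg s3 8) (mm s3) (rg s3 17) (rev chs)" "rg s3 8 = rg s2 8 + 3 * length chs"
            "\<forall>a<rg s2 8. mm s3 a = mm s2 a" "\<forall>i. i \<notin> {8, 12, 17} \<longrightarrow> rg s3 i = rg s2 i"
            "gh s3 = gh s2 @ replicate (length chs) Tick"
          have b3: "base s3" by (rule base_cong[OF b2]) (use a r8 lay in auto)
          have r3: "rg s3 20 = (if b' then 1 else 0)" "rg s3 18 = A" "rg s3 19 = d" using a(4) r2 by auto
          have "lwp X W LOOP Q (s3\<lparr>rg := (rg s3)(19 := d + 1), mm := (mm s3)(A + 2 := rg s3 17)\<rparr>)"
          proof (rule fin[OF b3 r3(1) a(1), of "x + length chs" x])
            show "mm s3 a = mm s1 a" if "a < HT \<or> ST \<le> a \<and> a < h" for a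
              using a(3) sp(5,8) that lay by auto
          qed (use sp a False len in \<open>auto simp: replicate_add\<close>)
          then show "lwp X W (Asg 19 (Plus (V 19) (N 1)) ;; Sto (Plus (V 18) (N 2)) (V 17)) (lwp X W LOOP Q) s3"
            using r3 lay layout by (simp add: lwp_simps)
        qed
        then show ?thesis using r2 False by (simp add: lwp_simps lwp_If)
      qed
    qed
    note q1 = this
    have r: "rg s 7 = ST" "rg s 19 = d" "d \<noteq> 0" "rg s 20 = (if b then 1 else 0)" "mm s A = p0" "rg s 8 = h"
      using p(1-5) by (simp_all add: baseD A_def p0_def)
    have dd: "ST + (d + d) = A" "d + d \<le> W" "A \<le> W" "p0 \<noteq> A" "p0 + 1 \<noteq> A" "p0 + 1 \<noteq> A + 3" "p0 + 2 < X" "p0 + 1 < X" "p0 < X" "A < X"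
      "p0 + 2 \<le> W" "p0 + 1 \<le> W" "A + 3 \<le> W"
      using lay kl(1) unfolding A_def by linarith+
    have "lwp X W (Asg 18 (Plus (V 7) (Plus (V 19) (V 19))) ;; If (Ld (V 18)) DESC ASC) (lwp X W LOOP Q) (logev Tick s)"
      by (cases b) (use q1 r dd lay kl(3) in \<open>simp_all add: lwp_Seq lwp_simps lwp_If DESC_def s1_def b'_def st_swap decode_def\<close>)
    then show ?case by (subst lwp_LOOP) (use r in simp)
  qed
qed

end

section \<open>Sorting into a linear extension\<close>

text \<open>The loop counter indexes the invariant, so termination comes with the induction on
  it.\<close>

lemma lwp_descend:
  assumes "\<And>j s. j < m \<Longrightarrow> I (Suc j) s \<Longrightarrow> rg s i = Suc j \<Longrightarrow> lwp X W c (\<lambda>s'. rg s' i = j \<and> I j s') (logev Tick s)"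
    "I m s" "rg s i = m"
  shows "lwp X W (While (V i) c) (I 0) s"
  using assms
proof (induction m arbitrary: s)
  case 0
  then show ?case by (subst lwp_While) simp
next
  case (Suc m)
  have "lwp X W c (lwp X W (While (V i) c) (I 0)) (logev Tick s)"
    by (rule lwp_mono[OF Suc.prems(1)[of m s]]) (use Suc in auto)
  then show ?case by (subst lwp_While) (use Suc.prems(3) in simp)
qed

text \<open>Sorting by the number of predecessors gives a linear extension.\<close>

abbreviation COUNT_LOOP :: com where
  "COUNT_LOOP \<equiv> While (V 12) (Asg 12 (Minus (V 12) (N 1)) ;;
     Asg 13 (Plus (V 13) (Ld (Plus (N 1) (Plus (Times (V 12) (V 1)) (V 11))))))"

definition COUNTS :: com where
  "COUNTS = Asg 11 (V 1) ;; While (V 11) (Asg 11 (Minus (V 11) (N 1)) ;; Asg 12 (V 1) ;; Asg 13 (N 0) ;;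
     COUNT_LOOP ;;
     Sto (ADR 2 (V 11)) (V 13))"

abbreviation SORT_STEP :: com where
  "SORT_STEP \<equiv> Asg 11 (Minus (V 11) (N 1)) ;;
       If (Plus (Minus (ARR 2 (V 11)) (V 14)) (Minus (V 14) (ARR 2 (V 11)))) Skip
         (Sto (V 8) (V 11) ;; Sto (Plus (V 8) (N 1)) (V 9) ;; Asg 9 (V 8) ;; Asg 8 (Plus (V 8) (N 2)))"

abbreviation SORT_LOOP :: com where
  "SORT_LOOP \<equiv> While (V 14) (Asg 11 (V 1) ;; While (V 11) (SORT_STEP) ;; Asg 14 (Minus (V 14) (N 1)))"

definition SORT :: com where
  "SORT = Asg 9 (N 0) ;; Asg 14 (V 1) ;; SORT_LOOP"

definition MAIN :: com where
  "MAIN = COUNTS ;; SORT ;; Enq (N 1) ;; SPINE ;; Sto (Plus (V 7) (N 2)) (V 17) ;; Sto (Plus (V 7) (N 3)) (V 8) ;;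
     Asg 19 (N 1) ;; Asg 20 (N 1) ;; LOOP"

context program
begin

definition down :: "nat \<Rightarrow> nat" where "down v = card {u. u < n \<and> (u, v) \<in> r}"

lemma down_bounds: "v < n \<Longrightarrow> 1 \<le> down v \<and> down v \<le> n"
proof
  assume v: "v < n"
  have "card {v} \<le> down v" unfolding down_def by (rule card_mono) (use v refl_r in auto)
  then show "1 \<le> down v" by simp
  have "down v \<le> card {..<n}" unfolding down_def by (rule card_mono) auto
  then show "down v \<le> n" by simp
qed

text \<open>By transitivity and antisymmetry the set of predecessors grows strictly, so a list
  sorted by its size is a linear extension.\<close>

lemma down_less: "(u, v) \<in> r \<Longrightarrow> u \<noteq> v \<Longrightarrow> down u < down v"
proof -
  assume a: "(u, v) \<in> r" "u \<noteq> v"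
  have uv: "u < n" "v < n" using a(1) po by (auto simp: partial_order_on_def preorder_on_def refl_on_def)
  have t: "(w, v) \<in> r" if "(w, u) \<in> r" for w
    using partial_order_onD(2)[OF po] that a(1) by (meson transD)
  have "(v, u) \<notin> r" using partial_order_onD(3)[OF po] a by (meson antisymD)
  then have "{w. w < n \<and> (w, u) \<in> r} \<subset> {w. w < n \<and> (w, v) \<in> r}" using t uv refl_r[of v] by blast
  then show ?thesis unfolding down_def by (rule psubset_card_mono[rotated]) simp
qed

definition counted :: "nat \<Rightarrow> ev list st \<Rightarrow> bool" where
  "counted v s \<longleftrightarrow> base s \<and> rg s 8 = HP0 \<and> (\<forall>w. v \<le> w \<longrightarrow> w < n \<longrightarrow> mm s (HT + w) = down w)
     \<and> (\<exists>t. gh s = replicate t Tick \<and> t + v * (n + 1) \<le> n * (n + 1))"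

lemma lwp_COUNTS:
  assumes "base s" "rg s 8 = HP0" "gh s = []"
  shows "lwp X W COUNTS (counted 0) s"
proof -
  have "lwp X W (While (V 11) (Asg 11 (Minus (V 11) (N 1)) ;; Asg 12 (V 1) ;; Asg 13 (N 0) ;;
     COUNT_LOOP ;;
     Sto (ADR 2 (V 11)) (V 13))) (counted 0) (upd_rg 11 n s)"
  proof (rule lwp_descend[where m = n])
    show "counted n (upd_rg 11 n s)" using assms by (auto simp: counted_def)
  next
    fix v s0 assume v: "v < n" "counted (Suc v) s0" "rg s0 11 = Suc v"
    then obtain t0 where t0: "gh s0 = replicate t0 Tick" "t0 + Suc v * (n + 1) \<le> n * (n + 1)"
      and b0: "base s0" "rg s0 8 = HP0" and h0: "\<And>w. Suc v \<le> w \<Longrightarrow> w < n \<Longrightarrow> mm s0 (HT + w) = down w"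
      unfolding counted_def by blast
    define I where "I = (\<lambda>j (s1 :: ev list st). mm s1 = mm s0 \<and> (\<forall>i. i \<notin> {11, 12, 13} \<longrightarrow> rg s1 i = rg s0 i) \<and> rg s1 11 = v
      \<and> rg s1 13 = card {u. j \<le> u \<and> u < n \<and> (u, v) \<in> r}
      \<and> (\<exists>t. gh s1 = replicate t Tick \<and> t + j \<le> t0 + 1 + n))"
    let ?s1 = "(logev Tick s0)\<lparr>rg := (rg s0)(11 := v, 12 := n, 13 := 0)\<rparr>"
    have lay: "HT + v < X" "HT + v \<le> W" "X \<le> W" "1 \<le> W" using v(1) layout by linarith+
    have "lwp X W (COUNT_LOOP) (I 0) ?s1"
    proof (rule lwp_descend[where m = n])
      have "replicate t0 Tick @ [Tick] = replicate (Suc t0) Tick" by (simp add: replicate_append_same)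
      then show "I n ?s1" unfolding I_def using t0(1) by (auto intro!: exI[of _ "Suc t0"])
    next
      fix j s1 assume j: "j < n" "I (Suc j) s1" "rg s1 12 = Suc j"
      then obtain t where t: "gh s1 = replicate t Tick" "t + Suc j \<le> t0 + 1 + n" and m1: "mm s1 = mm s0"
        and r1: "\<And>i. i \<notin> {11, 12, 13} \<Longrightarrow> rg s1 i = rg s0 i" "rg s1 11 = v"
          "rg s1 13 = card {u. Suc j \<le> u \<and> u < n \<and> (u, v) \<in> r}" unfolding I_def by blast
      have mx: "mm s0 (Suc (j * n + v)) = (if (j, v) \<in> r then 1 else 0)" using b0(1) j(1) v(1) by (simp add: base_on_def)
      have ad: "Suc (j * n + v) \<le> n * n" by (rule matrix_address[OF j(1) v(1)])
      have W: "Suc (j * n + v) < X" "Suc (j * n + v) \<le> W" "j * n + v \<le> W" "j * n \<le> W" using ad layout by linarith+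
      have "{u. j \<le> u \<and> u < n \<and> (u, v) \<in> r} = (if (j, v) \<in> r then insert j {u. Suc j \<le> u \<and> u < n \<and> (u, v) \<in> r}
         else {u. Suc j \<le> u \<and> u < n \<and> (u, v) \<in> r})" using j(1) by (auto simp: Suc_le_eq le_less)
      then have c: "card {u. j \<le> u \<and> u < n \<and> (u, v) \<in> r} = rg s1 13 + (if (j, v) \<in> r then 1 else 0)"
        unfolding r1(3) by simp
      have "card {u. j \<le> u \<and> u < n \<and> (u, v) \<in> r} \<le> card {..<n}" by (rule card_mono) auto
      then have c2: "rg s1 13 + (if (j, v) \<in> r then 1 else 0) \<le> n" "n \<le> W" using c layout by auto
      have "replicate t Tick @ [Tick] = replicate (Suc t) Tick" by (simp add: replicate_append_same)
      moreover have "rg s1 (Suc 0) = n" using r1(1)[of 1] b0(1) by (simp add: baseD)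
      moreover have "rg s1 13 + mm s0 (Suc (j * n + v)) \<le> W" using c2 mx by simp
      moreover have "rg s1 13 + mm s0 (Suc (j * n + v)) = card {u. j \<le> u \<and> u < n \<and> (u, v) \<in> r}" using c mx by simp
      ultimately show "lwp X W (Asg 12 (Minus (V 12) (N 1)) ;; Asg 13 (Plus (V 13) (Ld (Plus (N 1) (Plus (Times (V 12) (V 1)) (V 11))))))
         (\<lambda>s'. rg s' 12 = j \<and> I j s') (logev Tick s1)"
        using j(3) r1(1,2) m1 W t lay by (auto simp: lwp_simps I_def intro!: exI[of _ "Suc t"])
    qed simp
    then have "lwp X W (COUNT_LOOP)
       (lwp X W (Sto (ADR 2 (V 11)) (V 13)) (\<lambda>s'. rg s' 11 = v \<and> counted v s')) ?s1"
    proof (rule lwp_mono)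
      fix s2 assume "I 0 s2"
      then obtain t where t: "gh s2 = replicate t Tick" "t \<le> t0 + 1 + n" and m2: "mm s2 = mm s0"
        and r2: "\<And>i. i \<notin> {11, 12, 13} \<Longrightarrow> rg s2 i = rg s0 i" "rg s2 11 = v" "rg s2 13 = down v" unfolding I_def down_def by auto
      have b2: "base s2" by (rule base_cong[OF b0(1)]) (use m2 r2 in auto)
      have h2: "mm s2 (HT + w) = down w" if "v \<le> w" "w < n" "w \<noteq> v" for w using h0[of w] m2 that by simp
      have "t + v * (n + 1) \<le> n * (n + 1)" using t(2) t0(2) by simp
      then show "lwp X W (Sto (ADR 2 (V 11)) (V 13)) (\<lambda>s'. rg s' 11 = v \<and> counted v s') s2"
        using lay b2 h2 r2 b0(2) t(1) by (auto simp: lwp_simps baseD counted_def)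
    qed
    moreover have "rg s0 (Suc 0) = n" using b0(1) by (simp add: baseD)
    ultimately show "lwp X W (Asg 11 (Minus (V 11) (N 1)) ;; Asg 12 (V 1) ;; Asg 13 (N 0) ;;
     COUNT_LOOP ;;
     Sto (ADR 2 (V 11)) (V 13)) (\<lambda>s'. rg s' 11 = v \<and> counted v s') (logev Tick s0)"
      using v(3) lay by (simp add: lwp_Seq lwp_simps st_swap)
  qed (use assms in auto)
  then show ?thesis unfolding COUNTS_def using assms by (simp add: lwp_simps baseD)
qed

text \<open>The values \<open>k\<close> are treated from n down to 1, each in one descending pass
  over all elements, and prepending leaves the list sorted upwards. The clock bound is a potential
  linear in \<open>k\<close> and \<open>v\<close>, which totals O(n * n).\<close>

definition sinv :: "nat \<Rightarrow> nat \<Rightarrow> ev list st \<Rightarrow> bool" where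
  "sinv k v s \<longleftrightarrow> base s \<and> (\<forall>w<n. mm s (HT + w) = down w) \<and>
     (\<exists>qs. lst (rg s 8) (mm s) (rg s 9) qs \<and> distinct qs \<and> set qs = {w. w < n \<and> (k < down w \<or> down w = k \<and> v \<le> w)}
       \<and> sorted (map down qs) \<and> rg s 8 = HP0 + 2 * length qs)
     \<and> (\<exists>t. gh s = replicate t Tick \<and> t + k * (n + 1) + v \<le> 2 * (n * (n + 1)) + n + 1)"

lemma sort_step:
  assumes s: "sinv k (Suc v) s" and r: "rg s 11 = Suc v" "rg s 14 = k" "v < n" "k \<le> n" and h: "HP0 + 2 * n \<le> X"
  shows "lwp X W (SORT_STEP)
     (\<lambda>s'. rg s' 11 = v \<and> sinv k v s' \<and> rg s' 14 = k) (logev Tick s)"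
proof -
  from s obtain qs t where b: "base s" and d: "\<And>w. w < n \<Longrightarrow> mm s (HT + w) = down w" and q: "lst (rg s 8) (mm s) (rg s 9) qs"
    "distinct qs" "set qs = {w. w < n \<and> (k < down w \<or> down w = k \<and> Suc v \<le> w)}" "sorted (map down qs)"
    and r8: "rg s 8 = HP0 + 2 * length qs" and t: "gh s = replicate t Tick" "t + k * (n + 1) + Suc v \<le> 2 * (n * (n + 1)) + n + 1"
    unfolding sinv_def by blast
  have dv: "down v \<le> n" using down_bounds[OF r(3)] by simp
  have lay: "HT + v < X" "HT + v \<le> W" "X \<le> W" "n + n \<le> W" using r(3) h layout by linarith+
  have rep: "replicate t Tick @ [Tick] = replicate (Suc t) Tick" by (simp add: replicate_append_same)
  show ?thesis
  proof (cases "down v = k")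
    case False
    have e: "{w. w < n \<and> (k < down w \<or> down w = k \<and> v \<le> w)} = set qs" unfolding q(3)
      using False by (auto simp: Suc_le_eq le_less)
    have "sinv k v ((logev Tick s)\<lparr>rg := (rg s)(11 := v)\<rparr>)" unfolding sinv_def e
      by (intro conjI exI[of _ qs] exI[of _ "Suc t"]) (use b d q(1,2,4) r8 t rep in simp_all)
    moreover have "down v - k + (k - down v) \<noteq> 0" "down v - k + (k - down v) \<le> W" using False dv r(4) lay(4) by linarith+
    ultimately show ?thesis
      using b lay d[OF r(3)] r layout by (simp add: lwp_simps lwp_If baseD st_swap)
  next
    case True
    have nv: "v \<notin> set qs" using q(3) True by auto
    have e: "{w. w < n \<and> (k < down w \<or> down w = k \<and> v \<le> w)} = set (v # qs)"
    proof -
      have "v \<le> w \<longleftrightarrow> w = v \<or> Suc v \<le> w" for w by auto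
      then show ?thesis unfolding list.set q(3) using True r(3) by blast
    qed
    have "distinct (v # qs)" "set (v # qs) \<subseteq> {..<n}" using nv q(2,3) r(3) by auto
    then have "length (v # qs) \<le> n" using length_le_if_distinct by blast
    then have hX: "rg s 8 + 2 \<le> X" "HP0 \<le> rg s 8" using r8 h by simp_all
    define s1 where "s1 = s\<lparr>mm := (mm s)(rg s 8 := v, Suc (rg s 8) := rg s 9), gh := gh s @ [Tick],
       rg := (rg s)(11 := v, 9 := rg s 8, 8 := rg s 8 + 2)\<rparr>"
    have low: "mm s1 a = mm s a" if "a < rg s 8" for a using that by (simp add: s1_def)
    have l: "lst (rg s 8 + 2) (mm s1) (rg s 9) qs" by (rule lst_cong[OF q(1)]) (use low in auto)
    have b1: "base s1" by (rule base_cong[OF b]) (use hX layout in \<open>auto simp: s1_def\<close>)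
    have "sinv k v s1" unfolding sinv_def e
    proof (intro conjI exI)
      show "\<forall>w<n. mm s1 (HT + w) = down w"
      proof (intro allI impI)
        fix w assume w: "w < n"
        have "HT + w < rg s 8" using w hX layout by linarith
        then show "mm s1 (HT + w) = down w" using low d[OF w] by simp
      qed
      show "lst (rg s1 8) (mm s1) (rg s1 9) (v # qs)" using l hX(2) by (simp add: s1_def)
      have "k \<le> down w" if "w \<in> set qs" for w
      proof -
        have "k < down w \<or> down w = k" using that unfolding q(3) by blast
        then show ?thesis by linarith
      qed
      then show "sorted (map down (v # qs))" using q(4) unfolding list.map sorted_simps True by (simp only: ball_simps image_iff list.set_map) blast
      show "gh s1 = replicate (Suc t) Tick" using t rep by (simp add: s1_def)
      show "base s1" by (rule b1)
      show "distinct (v # qs)" using nv q(2) by simp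
      show "rg s1 8 = HP0 + 2 * length (v # qs)" using r8 by (simp add: s1_def)
      show "Suc t + k * (n + 1) + v \<le> 2 * (n * (n + 1)) + n + 1" using t(2) by simp
    qed (rule refl)
    then show ?thesis
      using b lay d[OF r(3)] r hX True layout by (simp add: lwp_simps lwp_If baseD st_swap s1_def)
  qed
qed

lemma lwp_SORT:
  assumes s: "counted 0 s" and h: "HP0 + 2 * n \<le> X"
  shows "lwp X W SORT (\<lambda>s'. base s' \<and> (\<exists>qs. lst (rg s' 8) (mm s') (rg s' 9) qs \<and> wf qs \<and> set qs = {..<n} \<and> sdir qs
      \<and> rg s' 8 = HP0 + 2 * n) \<and> (\<exists>t. gh s' = replicate t Tick \<and> t \<le> 2 * (n * (n + 1)) + n)) s"
proof -
  from s obtain t where b: "base s" "rg s 8 = HP0" "\<And>w. w < n \<Longrightarrow> mm s (HT + w) = down w"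
    and t: "gh s = replicate t Tick" "t \<le> n * (n + 1)" by (auto simp: counted_def)
  let ?s = "s\<lparr>rg := (rg s)(9 := 0, 14 := n)\<rparr>"
  have "lwp X W (SORT_LOOP) (sinv (Suc 0) 0) ?s"
  proof (rule lwp_descend[where m = n and I = "\<lambda>k. sinv (Suc k) 0"])
    have e: "{w. w < n \<and> (Suc n < down w \<or> down w = Suc n \<and> 0 \<le> w)} = set []" using down_bounds by fastforce
    show "sinv (Suc n) 0 ?s" unfolding sinv_def e
      by (intro conjI exI[of _ "[]"] exI[of _ t]) (use b t in auto)
  next
    fix k s1 assume k: "k < n" "sinv (Suc (Suc k)) 0 s1" "rg s1 14 = Suc k"
    let ?s2 = "(logev Tick s1)\<lparr>rg := (rg s1)(11 := n)\<rparr>"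
    have b1: "base s1" using k(2) by (simp add: sinv_def)
    have "sinv (Suc k) n ?s2"
    proof -
      have e: "{w. w < n \<and> (Suc k < down w \<or> down w = Suc k \<and> n \<le> w)} = {w. w < n \<and> (Suc (Suc k) < down w \<or> down w = Suc (Suc k) \<and> 0 \<le> w)}"
        by auto
      from k(2) obtain t1 where t1: "gh s1 = replicate t1 Tick" "t1 + Suc (Suc k) * (n + 1) + 0 \<le> 2 * (n * (n + 1)) + n + 1"
        unfolding sinv_def by blast
      have "gh ?s2 = replicate (Suc t1) Tick" using t1(1) by (simp add: replicate_append_same)
      moreover have "Suc t1 + Suc k * (n + 1) + n \<le> 2 * (n * (n + 1)) + n + 1" using t1(2) by simp
      ultimately have "\<exists>t. gh ?s2 = replicate t Tick \<and> t + Suc k * (n + 1) + n \<le> 2 * (n * (n + 1)) + n + 1" by blast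
      then show ?thesis using k(2) unfolding sinv_def e by simp
    qed
    then have "lwp X W (While (V 11) (SORT_STEP))
       (\<lambda>s'. sinv (Suc k) 0 s' \<and> rg s' 14 = Suc k) ?s2"
      by (intro lwp_descend[where m = n and I = "\<lambda>v s. sinv (Suc k) v s \<and> rg s 14 = Suc k"])
        (use k sort_step[of "Suc k"] h in auto)
    then have "lwp X W (While (V 11) (SORT_STEP))
       (lwp X W (Asg 14 (Minus (V 14) (N 1))) (\<lambda>s'. rg s' 14 = k \<and> sinv (Suc k) 0 s')) ?s2"
      by (rule lwp_mono) (use layout in \<open>auto simp: lwp_simps sinv_def\<close>)
    moreover have "rg s1 (Suc 0) = n" using b1 by (simp add: baseD)
    ultimately show "lwp X W (Asg 11 (V 1) ;;
     While (V 11) (SORT_STEP) ;;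
     Asg 14 (Minus (V 14) (N 1))) (\<lambda>s'. rg s' 14 = k \<and> sinv (Suc k) 0 s') (logev Tick s1)"
      by (simp add: lwp_Seq lwp_simps st_swap)
  qed simp
  then have "lwp X W (SORT_LOOP) (\<lambda>s'. base s' \<and> (\<exists>qs. lst (rg s' 8) (mm s') (rg s' 9) qs \<and> wf qs \<and> set qs = {..<n} \<and> sdir qs
      \<and> rg s' 8 = HP0 + 2 * n) \<and> (\<exists>t. gh s' = replicate t Tick \<and> t \<le> 2 * (n * (n + 1)) + n)) ?s"
  proof (rule lwp_mono)
    fix s1 assume "sinv (Suc 0) 0 s1"
    then obtain qs t1 where b1: "base s1" and q: "lst (rg s1 8) (mm s1) (rg s1 9) qs"
    "distinct qs" "set qs = {w. w < n \<and> (Suc 0 < down w \<or> down w = Suc 0 \<and> 0 \<le> w)}" "sorted (map down qs)"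
      and r8: "rg s1 8 = HP0 + 2 * length qs" and t1: "gh s1 = replicate t1 Tick" "t1 + Suc 0 * (n + 1) + 0 \<le> 2 * (n * (n + 1)) + n + 1"
      unfolding sinv_def by blast
    have sq: "set qs = {..<n}"
    proof -
      have "Suc 0 < down w \<or> down w = Suc 0" if "w < n" for w using down_bounds[OF that] by linarith
      then show ?thesis unfolding q(3) by auto
    qed
    have len: "length qs = n" using q(2) sq distinct_card[of qs] by simp
    have "sorted_wrt (\<lambda>u v. (v, u) \<notin> r) qs" unfolding sorted_wrt_iff_nth_less
    proof (intro allI impI notI)
      fix i j assume ij: "i < j" "j < length qs" and jr: "(qs ! j, qs ! i) \<in> r"
      have "qs ! j \<noteq> qs ! i" using q(2) ij by (simp add: nth_eq_iff_index_eq)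
      then have "down (qs ! j) < down (qs ! i)" using jr by (intro down_less)
      moreover have "down (qs ! i) \<le> down (qs ! j)" using sorted_nth_mono[OF q(4), of i j] ij by simp
      ultimately show False by simp
    qed
    then have "sdir qs" by (simp add: sdir_def)
    moreover have "wf qs" using q(2) sq by (simp add: wf_def)
    ultimately show "base s1 \<and> (\<exists>qs. lst (rg s1 8) (mm s1) (rg s1 9) qs \<and> wf qs \<and> set qs = {..<n} \<and> sdir qs
      \<and> rg s1 8 = HP0 + 2 * n) \<and> (\<exists>t. gh s1 = replicate t Tick \<and> t \<le> 2 * (n * (n + 1)) + n)"
      using b1 q(1) sq r8 len t1 by auto
  qed
  then show ?thesis unfolding SORT_def using b by (simp add: lwp_simps baseD)
qed

lemma lwp_MAIN:
  assumes "base s" "rg s 8 = HP0" "gh s = []" and h: "HP0 + (n + 1) * (6 * n + 4 * q) \<le> X"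
  shows "lwp X W MAIN (\<lambda>s'. \<exists>x t qs. gh s' = replicate x Tick @ t \<and> node True qs t \<and> wf qs \<and> set qs = {..<n}
      \<and> x \<le> 2 * (n * (n + 1)) + n) s"
proof -
  let ?Q = "\<lambda>s'. \<exists>x t qs. gh s' = replicate x Tick @ t \<and> node True qs t \<and> wf qs \<and> set qs = {..<n}
      \<and> x \<le> 2 * (n * (n + 1)) + n"
  \<comment> \<open>The part outside the last product covers the sorted list, \<open>2 * n\<close>
    words, and the spine of the root; the product is for the n levels below.\<close>
  have B: "(n + 1) * (6 * n + 4 * q) = 6 * n + 4 * q + n * (6 * n + 4 * q)" by simp
  have "HP0 + 2 * n \<le> X" using h unfolding B by linarith
  note sort = lwp_SORT[OF _ this]
  have "lwp X W COUNTS (lwp X W SORT (lwp X W (Enq (N 1) ;; SPINE ;; Sto (Plus (V 7) (N 2)) (V 17) ;; Sto (Plus (V 7) (N 3)) (V 8) ;;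
     Asg 19 (N 1) ;; Asg 20 (N 1) ;; LOOP) ?Q)) s"
  proof (rule lwp_mono[OF lwp_COUNTS[OF assms(1-3)]], rule lwp_mono[OF sort], assumption, elim conjE exE)
    fix s0 s1 :: "ev list st" and qs x
    assume b: "base s1" and q: "lst (rg s1 8) (mm s1) (rg s1 9) qs" "wf qs" "set qs = {..<n}" "sdir qs"
      "rg s1 8 = HP0 + 2 * n" and x: "gh s1 = replicate x Tick" "x \<le> 2 * (n * (n + 1)) + n"
    have len: "length qs = n" using q(2,3) distinct_card[of qs] by (simp add: wf_def)
    let ?s2 = "s1\<lparr>gh := gh s1 @ [Emit]\<rparr>"
    have i: "4 * inc qs \<le> 4 * q" using inc_le_q[OF q(2)] by simp
    have heap: "HP0 + 2 * n + 4 * inc qs + 3 * length qs + n * (6 * n + 4 * q) \<le> X"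
      using h i unfolding B len by linarith
    have lay: "HP0 \<le> HP0 + 2 * n" "ST + 3 < HP0" "X \<le> W" "HT < ST" "HP0 \<le> X" "1 \<le> W" using layout by linarith+
    have "lwp X W SPINE (lwp X W (Sto (Plus (V 7) (N 2)) (V 17) ;; Sto (Plus (V 7) (N 3)) (V 8) ;;
     Asg 19 (N 1) ;; Asg 20 (N 1) ;; LOOP) ?Q) ?s2"
    proof (rule lwp_mono[OF lwp_SPINE[OF _ _ lay(1) _ q(2,4)]], goal_cases)
      case 4
      show ?case using heap by linarith
    next
      case (5 s3)
      then obtain chs y where c: "spine qs chs y" "\<forall>c\<in>set chs. sdir (snd c)" "klst (rg s3 8) (mm s3) (rg s3 17) chs"
        "gh s3 = gh ?s2 @ replicate y Tick" "HP0 + 2 * n \<le> rg s3 8" "rg s3 8 \<le> HP0 + 2 * n + 4 * inc qs + 3 * length qs"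
        "\<forall>i. i \<notin> {8..17} \<longrightarrow> rg s3 i = rg ?s2 i" "\<forall>a. a < HT \<or> ST \<le> a \<and> a < HP0 + 2 * n \<longrightarrow> mm s3 a = mm ?s2 a" by blast
      have b3: "base s3" by (rule base_cong[OF b]) (use c in auto)
      define s4 where "s4 = s3\<lparr>mm := (mm s3)(ST + 2 := rg s3 17, ST + 3 := rg s3 8), rg := (rg s3)(19 := 1, 20 := 1)\<rparr>"
      have k4: "klst (rg s3 8) (mm s4) (rg s3 17) chs"
        by (rule klst_cong[OF c(3)]) (use lay in \<open>auto simp: s4_def\<close>)
      have "lwp X W LOOP ?Q s4"
      proof (rule run_frame[of s4 1 True "rg s3 8" chs "rg s3 8" n])
        show "base s4" by (rule base_cong[OF b3]) (use lay in \<open>auto simp: s4_def\<close>)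
        show "klst (rg s3 8) (mm s4) (mm s4 (ST + 2 * 1)) chs" using k4 by (simp add: s4_def)
        show "mm s4 (ST + 2 * 1 + 1) = rg s3 8" by (simp add: s4_def eval_nat_numeral)
        show "HP0 \<le> rg s3 8" using c(5) by linarith
        show "rg s3 8 + n * (6 * n + 4 * q) \<le> X" using c(6) heap by linarith
        show "c' < n \<and> wf P' \<and> sdir P' \<and> length P' < n" if c': "(c', P') \<in> set chs" for c' P'
        proof -
          from spine_kid[OF c(1) q(2) c']
          have w: "wf P'" "c' \<in> set qs" "c' \<notin> set P'" "set P' \<subseteq> set qs" by blast+
          have "card (set P') < card (set qs)" by (rule psubset_card_mono) (use w in auto)
          then show ?thesis using w q(2,3) c(2) c' by (auto simp: wf_def distinct_card)
        qed
        fix zs and s' :: "ev list st"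
        assume z: "map kid zs = chs" "\<And>z. z \<in> set zs \<Longrightarrow> node (\<not> True) (fst (snd z)) (snd (snd z))"
          "gh s' = gh s4 @ concat (map blk zs) @ [Tick] @ (if True then [] else [Emit]) @ (if (1::nat) = 1 then [] else [Pop])"
          "rg s' 19 = 1 - 1"
        have "node True qs (Emit # replicate y Tick @ concat (map blk zs) @ [Tick])"
          by (rule node.first) (use z c(1) in auto)
        moreover have "gh s' = replicate x Tick @ (Emit # replicate y Tick @ concat (map blk zs) @ [Tick])"
          using z(3) c(4) x(1) by (simp add: s4_def)
        ultimately have "?Q s'" using q(2,3) x(2) by blast
        then show "lwp X W LOOP ?Q s'" by (subst lwp_LOOP) (use z(4) in simp)
      qed (auto simp: s4_def)
      moreover have "rg s3 7 = ST" using b3 by (simp add: baseD)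
      ultimately show ?case using lay by (simp add: lwp_Seq lwp_simps s4_def)
    qed (use b q in auto)
    then show "lwp X W (Enq (N 1) ;; SPINE ;; Sto (Plus (V 7) (N 2)) (V 17) ;; Sto (Plus (V 7) (N 3)) (V 8) ;;
     Asg 19 (N 1) ;; Asg 20 (N 1) ;; LOOP) ?Q s1"
      using lay by (simp add: lwp_Seq lwp_simps decode_def)
  qed
  then show ?thesis unfolding MAIN_def by (simp add: lwp_Seq)
qed

end

section \<open>Computing q and the memory layout\<close>

text \<open>The layout depends on q, which the input does not contain. The sum of the matrix entries
  is the number of related pairs, and \<open>card_r\<close> yields \<open>2 * q\<close> from it, in
  O(n * n) steps.\<close>

definition COUNT :: com where
  "COUNT = While (V 10) (Asg 11 (Plus (V 11) (Ld (V 10))) ;; Asg 10 (Minus (V 10) (N 1)))"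

text \<open>Register 12 becomes \<open>2 * q\<close> and register 13 the heap need
  \<open>6 * n + 4 * q\<close> of one level. The heap has n + 1 such levels; the queue begins where
  it ends, and the output set where the queue ends.\<close>

definition LAYOUT :: com where
  "LAYOUT = Asg 12 (Minus (Plus (Times (V 1) (V 1)) (V 1)) (Plus (V 11) (V 11))) ;;
     Asg 2 (Plus (Times (V 1) (V 1)) (N 1)) ;; Asg 3 (Plus (V 2) (V 1)) ;; Asg 4 (Plus (V 3) (V 1)) ;;
     Asg 5 (Plus (Plus (V 4) (V 1)) (N 1)) ;; Asg 6 (Plus (Plus (V 5) (V 1)) (N 2)) ;; Asg 7 (Plus (V 6) (V 1)) ;;
     Asg 8 (Plus (V 7) (Plus (Times (N 2) (V 1)) (N 6))) ;;
     Asg 13 (Plus (Times (N 6) (V 1)) (Times (N 2) (V 12))) ;; Asg 40 (Plus (V 8) (Plus (V 13) (Times (V 1) (V 13)))) ;;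
     Asg 45 (Plus (Plus (Times (V 1) (V 1)) (Times (V 1) (V 12))) (N 1)) ;;
     Asg 41 (Plus (V 40) (Plus (Times (N 4) (V 45)) (N 8))) ;; Asg 42 (V 40) ;; Asg 43 (V 40) ;; Asg 48 (V 41)"

definition START :: com where
  "START = Asg 1 (Ld (N 0)) ;; Asg 10 (Times (V 1) (V 1))"

definition PROG :: com where
  "PROG = START ;; COUNT ;; LAYOUT ;; lower MAIN ;; While (V 44) (EMIT 4)"

lemma wp_While_0: "eval e s = 0 \<Longrightarrow> ok S W e s \<Longrightarrow> Q (tick (elen e + 1) s) \<Longrightarrow> wp S W (While e c) Q s"
  unfolding wp_def by (blast intro: big.WhileF)

lemma wp_While_Suc:
  assumes "eval e s \<noteq> 0" "ok S W e s" "wp S W c (\<lambda>s'. wp S W (While e c) Q (tick 1 s')) (tick (elen e + 1) s)"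
  shows "wp S W (While e c) Q s"
  using assms unfolding wp_def by (blast intro: big.WhileT)

lemma wp_COUNT:
  assumes "rg s 10 = m" "rg s 11 + (\<Sum>a\<in>{1..m}. mm s a) \<le> W" "m < S" "1 \<le> W"
  shows "wp S W COUNT (\<lambda>s'. rg s' 11 = rg s 11 + (\<Sum>a\<in>{1..m}. mm s a) \<and> (\<forall>i. i \<notin> {10, 11} \<longrightarrow> rg s' i = rg s i)
     \<and> mm s' = mm s \<and> snd (gh s') = snd (gh s) \<and> fst (gh s') \<le> fst (gh s) + (m + 1) * clen COUNT) s"
  using assms
proof (induction m arbitrary: s)
  case 0
  then show ?case unfolding COUNT_def by (intro wp_While_0) auto
next
  case (Suc m)
  define s1 where "s1 = s\<lparr>rg := (rg s)(11 := rg s 11 + mm s (Suc m), 10 := m), gh := (fst (gh s) + 12, snd (gh s))\<rparr>"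
  have sum: "(\<Sum>a\<in>{1..Suc m}. mm s a) = (\<Sum>a\<in>{1..m}. mm s a) + mm s (Suc m)" by simp
  have "wp S W COUNT (\<lambda>s'. rg s' 11 = rg s1 11 + (\<Sum>a\<in>{1..m}. mm s1 a) \<and> (\<forall>i. i \<notin> {10, 11} \<longrightarrow> rg s' i = rg s1 i)
     \<and> mm s' = mm s1 \<and> snd (gh s') = snd (gh s1) \<and> fst (gh s') \<le> fst (gh s1) + (m + 1) * clen COUNT) s1"
    by (rule Suc.IH) (use Suc.prems in \<open>auto simp: s1_def sum\<close>)
  then have "wp S W COUNT (\<lambda>s'. rg s' 11 = rg s 11 + (\<Sum>a\<in>{1..Suc m}. mm s a) \<and> (\<forall>i. i \<notin> {10, 11} \<longrightarrow> rg s' i = rg s i)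
     \<and> mm s' = mm s \<and> snd (gh s') = snd (gh s) \<and> fst (gh s') \<le> fst (gh s) + (Suc m + 1) * clen COUNT) s1"
    by (rule wp_mono) (auto simp: s1_def sum COUNT_def)
  moreover have "rg s 11 + mm s (Suc m) \<le> W" using Suc.prems(2) unfolding sum by linarith
  ultimately show ?case unfolding COUNT_def
    by (intro wp_While_Suc) (use Suc.prems in \<open>simp_all add: wp_simps s1_def tick_def eval_nat_numeral\<close>)
qed

text \<open>Every address is named by an equation instead of being expanded, which keeps the terms
  of the symbolic run small and reduces the word bounds to linear arithmetic.\<close>

lemma wp_LAYOUT:
  assumes "rg s 1 = n" "rg s 11 = k" "n * n + n - (k + k) = q2" "k + k \<le> W"
    and eq: "n * n + 1 = HT" "HT + n = PR" "PR + n = LL" "LL + n + 1 = CA" "CA + n + 2 = HD" "HD + n = ST"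
      "ST + (2 * n + 6) = HP0" "6 * n + 2 * q2 = B" "HP0 + (B + n * B) = X" "n * n + n * q2 + 1 = cap" "X + (4 * cap + 8) = qe"
      "qe \<le> W"
  shows "wp S W LAYOUT (\<lambda>s'. rg s' 1 = n \<and> rg s' 2 = HT \<and> rg s' 3 = PR \<and> rg s' 4 = LL \<and> rg s' 5 = CA \<and> rg s' 6 = HD
     \<and> rg s' 7 = ST \<and> rg s' 8 = HP0 \<and> rg s' 40 = X \<and> rg s' 45 = cap \<and> rg s' 41 = qe \<and> rg s' 42 = X \<and> rg s' 43 = X
     \<and> rg s' 48 = qe \<and> rg s' 44 = rg s 44 \<and> rg s' 46 = rg s 46 \<and> mm s' = mm s \<and> snd (gh s') = snd (gh s)) s"
proof -
  have b: "n * n + n \<le> W" "n * n \<le> W" "HT \<le> W" "PR \<le> W" "LL \<le> W" "LL + n \<le> W" "CA \<le> W" "CA + n \<le> W" "HD \<le> W" "ST \<le> W"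
    "2 * n + 6 \<le> W" "2 * n \<le> W" "HP0 \<le> W" "6 * n \<le> W" "2 * q2 \<le> W" "B \<le> W" "n * B \<le> W" "B + n * B \<le> W" "X \<le> W"
    "n * n + n * q2 \<le> W" "n * q2 \<le> W" "cap \<le> W" "4 * cap \<le> W" "4 * cap + 8 \<le> W" "8 \<le> W" "6 \<le> W" "4 \<le> W" "2 \<le> W" "Suc 0 \<le> W"
    using eq by linarith+
  note eq' = eq[simplified]
  show ?thesis unfolding LAYOUT_def
    using assms(1-4) b by (simp add: wp_simps eq eq')
qed

context poset
begin

text \<open>Inclusion and exclusion: the square of the ground set consists of the
  \<open>2 * q\<close> ordered incomparable pairs and of the union of \<open>r\<close> with its
  converse, which overlap in the diagonal.\<close>

lemma card_r: "2 * card r + 2 * q = n * n + n"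
proof -
  let ?V = "{..<n} \<times> {..<n}"
  have r: "r \<subseteq> ?V" using po by (auto simp: partial_order_on_def preorder_on_def refl_on_def)
  have fr: "finite r" by (rule finite_subset[OF r]) simp
  let ?I = "{(u, v). u \<in> set [0..<n] \<and> v \<in> set [0..<n] \<and> incomparable r u v}"
  have wf: "wf [0..<n]" by (auto simp: wf_def)
  have "inc [0..<n] = q" unfolding inc_two[OF wf] q_def incomparable_pairs_def by (simp add: atLeast0LessThan)
  then have I: "card ?I = 2 * q" using inc_pairs[OF wf] by simp
  have fI: "finite ?I" by (rule finite_subset[of _ ?V]) auto
  have d: "r \<inter> r\<inverse> = (\<lambda>v. (v, v)) ` {..<n}"
    using refl_r partial_order_onD(3)[OF po] r by (auto simp: antisym_def)
  have "card (r \<inter> r\<inverse>) = n" unfolding d by (subst card_image) (auto intro: inj_onI)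
  moreover have "card (r \<union> r\<inverse>) + card (r \<inter> r\<inverse>) = card r + card (r\<inverse>)"
    using card_Un_Int[of r "r\<inverse>"] fr by simp
  moreover have "card (r\<inverse>) = card r" by (rule card_inverse)
  moreover have "card (?I \<union> (r \<union> r\<inverse>)) = card ?I + card (r \<union> r\<inverse>)"
    by (rule card_Un_disjoint) (use fI fr in \<open>auto simp: incomparable_def\<close>)
  moreover have "?I \<union> (r \<union> r\<inverse>) = ?V" using r by (auto simp: incomparable_def)
  moreover have "card ?V = n * n" by simp
  ultimately show ?thesis using I by simp
qed

lemma card_r_ge: "n \<le> card r"
proof -
  have r: "r \<subseteq> {..<n} \<times> {..<n}" using po by (auto simp: partial_order_on_def preorder_on_def refl_on_def)
  have "card ((\<lambda>v. (v, v)) ` {..<n}) \<le> card r"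
    by (rule card_mono) (use r refl_r in \<open>auto intro: finite_subset\<close>)
  then show ?thesis by (subst (asm) card_image) (auto intro: inj_onI)
qed

lemma sum_matrix: "(\<Sum>a\<in>{1..n * n}. mem (input_config n r) a) = card r"
proof -
  let ?A = "{a \<in> {1..n * n}. ((a - 1) div n, (a - 1) mod n) \<in> r}"
  have r: "r \<subseteq> {..<n} \<times> {..<n}" using po by (auto simp: partial_order_on_def preorder_on_def refl_on_def)
  have "(\<Sum>a\<in>{1..n * n}. mem (input_config n r) a) = (\<Sum>a\<in>{1..n * n}. if ((a - 1) div n, (a - 1) mod n) \<in> r then 1 else 0)"
    by (rule sum.cong) (auto simp: input_config_def)
  also have "\<dots> = card ?A" by (simp add: sum.If_cases Int_def)
  also have "\<dots> = card r"
  proof (rule bij_betw_same_card)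
    show "bij_betw (\<lambda>a. ((a - 1) div n, (a - 1) mod n)) ?A r"
    proof (rule bij_betw_byWitness[where f' = "\<lambda>(u, v). 1 + (u * n + v)"])
      show "\<forall>a\<in>?A. (case ((a - 1) div n, (a - 1) mod n) of (u, v) \<Rightarrow> 1 + (u * n + v)) = a" by auto
      show "\<forall>p\<in>r. (((case p of (u, v) \<Rightarrow> 1 + (u * n + v)) - 1) div n, ((case p of (u, v) \<Rightarrow> 1 + (u * n + v)) - 1) mod n) = p"
        using r by auto
      show "(\<lambda>(u, v). 1 + (u * n + v)) ` r \<subseteq> ?A"
      proof (rule image_subsetI)
        fix p assume p: "p \<in> r"
        obtain u v where puv: "p = (u, v)" by (cases p)
        then have uv: "(u, v) \<in> r" using p by simp
        then have "u < n" "v < n" using r by auto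
        then have "u * n + v < Suc u * n" by simp
        moreover have "Suc u * n \<le> n * n" using \<open>u < n\<close> by (intro mult_le_mono1) simp
        ultimately have "u * n + v < n * n" by linarith
        then show "(case p of (u, v) \<Rightarrow> 1 + (u * n + v)) \<in> ?A" using uv puv \<open>v < n\<close> by auto
      qed
    qed auto
  qed
  finally show ?thesis .
qed

end

lemma cvars_lower: "cvars (lower c) \<subseteq> cvars c \<union> {40..<50}"
proof -
  have "cvars (EMIT k) \<subseteq> {40..<50}" for k
    by (induction k) (auto simp: POP_def PUSHV_def POPV_def EMITV_def)
  from this[of 4] have 1: "cvars TICK \<subseteq> {40..<50}" "cvars (ENQ e) \<subseteq> vars e \<union> {40..<50}" for e
    unfolding TICK_def ENQ_def PUT_def by auto
  show ?thesis
  proof (induction c)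
    case (Enq e)
    then show ?case using 1(2) by simp
  next
    case (While e c)
    then show ?case using 1(1) by auto
  qed auto
qed

lemma cvars_MAIN: "cvars MAIN \<subseteq> {..<40}"
  unfolding MAIN_def COUNTS_def SORT_def SPINE_def LOOP_def DESC_def ASC_def REV_def HEIGHTS_def CHAIN_def DIST_def KIDS_def
    NEXT_def INSERT_def DOWN_def SHIFT_def OTHER_def UP_def INCMP_def
  by simp

lemma cvars_PROG: "cvars PROG \<subseteq> {..<100}"
proof -
  have "cvars (EMIT k) \<subseteq> {40..<50}" for k
    by (induction k) (auto simp: POP_def PUSHV_def POPV_def EMITV_def)
  from this[of 4] have 1: "cvars (EMIT 4) \<subseteq> {..<100}" by auto
  have "{..<40} \<union> {40..<50} \<subseteq> {..<(100::nat)}" by auto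
  then have 2: "cvars (lower MAIN) \<subseteq> {..<100}" using cvars_lower[of MAIN] cvars_MAIN by blast
  show ?thesis using 1 2 unfolding PROG_def START_def COUNT_def LAYOUT_def by simp
qed

lemma nth_gap_le:
  fixes ts :: "nat list"
  assumes "\<And>i. Suc i < length ts \<Longrightarrow> ts ! Suc i \<le> ts ! i + G" "k < length ts"
  shows "ts ! k \<le> ts ! 0 + k * G"
  using assms(2)
proof (induction k)
  case (Suc k)
  then show ?case using assms(1)[of k] by simp
qed simp

section \<open>Constants and assembly of the program\<close>

text \<open>Instructions per tick, then setup, gap between outputs, initialization and the final
  constant; all are fixed by the program text and \<open>cc\<close>. In \<open>KI\<close>, 61 and
  \<open>2 * cc\<close> come from \<open>t0 \<le> 61 * D + 10\<close> and
  \<open>cap \<le> 2 * D + 1\<close>.\<close>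

definition KB :: nat where "KB = 2 * clen (lower MAIN) + 2 * clen (While (V 44) (EMIT 4))"
definition K0 :: nat where "K0 = clen START + clen COUNT + clen LAYOUT"
definition KG :: nat where "KG = KB * (cc + 1)"
definition KI :: nat where "KI = 2 * K0 + KB * (61 + 2 * cc) + KB"
definition KC :: nat where "KC = KI + KG + cc + 200"

context poset
begin

lemma sim_start:
  assumes "n \<le> W" "1 \<le> W"
  shows "sim S W p (input_config n r) 0 \<lparr>rg = \<lambda>_. 0, mm = mem (input_config n r), gh = (0, [])\<rparr>"
  unfolding sim_def reach_def
  by (rule exI[of _ "input_config n r"]) (use assms in \<open>auto simp: run_def output_times_def input_config_def\<close>)

lemma run_PROG:
  defines "D \<equiv> n * (n + q)"
  defines "p \<equiv> ccom PROG 0" and "s0 \<equiv> input_config n r"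
  shows "\<exists>S W T F outs. reach S W p s0 T (run p s0 T) outs \<and> pc (run p s0 T) = length p
    \<and> map snd outs = vis [] F \<and> S \<le> 200 * (1 + D) \<and> W = S + cc
    \<and> (\<exists>t qs x. F = replicate x Tick @ t \<and> node True qs t \<and> wf qs \<and> set qs = {..<n})
    \<and> (outs \<noteq> [] \<longrightarrow> map fst outs ! 0 \<le> KI * (1 + D)) \<and> (\<forall>i. Suc i < length outs \<longrightarrow> map fst outs ! Suc i \<le> map fst outs ! i + KG)
    \<and> (outs \<noteq> [] \<longrightarrow> T \<le> last (map fst outs) + KG)"
proof -
  define cr where "cr = card r"
  have cr: "2 * cr + 2 * q = n * n + n" using card_r by (simp add: cr_def)
  define q2 where "q2 = 2 * q"
  define HT where "HT = n * n + 1"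
  define PR where "PR = HT + n"
  define LL where "LL = PR + n"
  define CA where "CA = LL + n + 1"
  define HD where "HD = CA + n + 2"
  define ST where "ST = HD + n"
  define HP0 where "HP0 = ST + (2 * n + 6)"
  define B where "B = 6 * n + 2 * q2"
  define X where "X = HP0 + (B + n * B)"
  \<comment> \<open>Of order n (n + q), and large enough for
    \<open>t0 \<le> cc * cap\<close>.\<close>
  define cap where "cap = n * n + n * q2 + 1"
  define qe where "qe = X + (4 * cap + 8)"
  define S where "S = qe + n + 2"
  \<comment> \<open>Words have to hold every address, and also \<open>cc\<close>, the limit of the
    tick counter.\<close>
  define W where "W = S + cc"
  \<comment> \<open>The ticks of the sorting phase and the additive term of
    \<open>F_amortized\<close>.\<close>
  define t0 where "t0 = 2 * (n * (n + 1)) + n + 28 * n * (1 + n + q) + 10"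
  define c0 where "c0 = K0 * (n * n + 1)"
  have Dn: "D = n * n + n * q" by (simp add: D_def algebra_simps)
  have nD: "n \<le> n * n" by (cases n) auto
  have qD: "q \<le> n * q"
  proof (cases n)
    case 0
    then show ?thesis using cr by simp
  qed auto
  have nB: "n * B = 6 * (n * n) + 4 * (n * q)" "n * q2 = 2 * (n * q)" by (simp_all add: B_def q2_def algebra_simps)
  have SD: "S \<le> 200 * (1 + D)"
  proof -
    have "a + 1 + n + n + n + 1 + n + 2 + n + (2 * n + 6) + (6 * n + 2 * (2 * q) + (6 * a + 4 * b)) +
      (4 * (a + 2 * b + 1) + 8) + n + 2 \<le> 200 * (1 + (a + b))" if "n \<le> a" "q \<le> b" for a b :: nat
    proof -
      obtain a' b' where "a = n + a'" "b = q + b'" using \<open>n \<le> a\<close> \<open>q \<le> b\<close> by (auto simp: le_iff_add)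
      then show ?thesis by simp
    qed
    from this[OF nD qD] show ?thesis
      unfolding S_def qe_def cap_def X_def HP0_def ST_def HD_def CA_def LL_def PR_def HT_def
      unfolding nB unfolding B_def q2_def Dn .
  qed
  have t0: "t0 = 30 * (n * n) + 31 * n + 28 * (n * q) + 10" by (simp add: t0_def algebra_simps)
  have t0D: "t0 \<le> 61 * D + 10" using mult_le_mono2[OF nD, of 31] unfolding t0 Dn distrib_left by linarith
  have t0c: "t0 \<le> cc * cap"
  proof -
    have "t0 \<le> 100 * cap" using mult_le_mono2[OF nD, of 31] unfolding t0 cap_def nB distrib_left by linarith
    also have "\<dots> \<le> cc * cap" by (intro mult_le_mono1) (simp add: cc_def)
    finally show ?thesis .
  qed
  have capD: "cap \<le> 2 * D + 1" unfolding cap_def nB Dn by simp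
  have le: "n * n + n < S" "qe \<le> W" "S \<le> W" "cr + cr \<le> W" "n \<le> W" "1 \<le> W" "cr \<le> W" "n * n \<le> W"
    using cr unfolding W_def S_def qe_def X_def HP0_def ST_def HD_def CA_def LL_def PR_def HT_def by linarith+
  let ?s0 = "\<lparr>rg = \<lambda>_. 0, mm = mem s0, gh = (0, [])\<rparr> :: clock st"
  let ?Q = "\<lambda>s. rg s 1 = n \<and> rg s 2 = HT \<and> rg s 3 = PR \<and> rg s 4 = LL \<and> rg s 5 = CA \<and> rg s 6 = HD
     \<and> rg s 7 = ST \<and> rg s 8 = HP0 \<and> rg s 40 = X \<and> rg s 45 = cap \<and> rg s 41 = qe \<and> rg s 42 = X \<and> rg s 43 = X
     \<and> rg s 48 = qe \<and> rg s 44 = 0 \<and> rg s 46 = 0 \<and> mm s = mem s0 \<and> snd (gh s) = [] \<and> fst (gh s) \<le> c0"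
  have "wp S W START (wp S W COUNT (wp S W LAYOUT ?Q)) ?s0"
  proof (rule wp_mono[OF wp_clock[where Q = "\<lambda>s. rg s = (\<lambda>_. 0)(1 := n, 10 := n * n) \<and> mm s = mem s0 \<and> snd (gh s) = []"]], goal_cases)
    case 1
    have "mem s0 0 = n" by (simp add: s0_def input_config_def)
    then show ?case using le by (simp add: START_def wp_simps)
  next
    case 2 show ?case by (simp add: START_def)
  next
    case (3 s1)
    have sum: "(\<Sum>a\<in>{1..n * n}. mm s1 a) = cr" using 3 sum_matrix by (simp add: s0_def cr_def)
    show ?case
    proof (rule wp_mono[OF wp_COUNT[of s1 "n * n" W S]], goal_cases)
      case (5 s2)
      note s2 = this[unfolded sum]
      have r2: "rg s2 1 = n" "rg s2 11 = cr" "rg s2 44 = 0" "rg s2 46 = 0" "mm s2 = mem s0" "snd (gh s2) = []"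
        using s2 3 by auto
      have "n * n + n - (cr + cr) = q2" using cr by (simp add: q2_def)
      note lay = wp_LAYOUT[of s2 n cr q2 W HT PR LL CA HD ST HP0 B X cap qe S, OF r2(1,2) this le(4)
        HT_def[symmetric] PR_def[symmetric] LL_def[symmetric] CA_def[symmetric] HD_def[symmetric] ST_def[symmetric]
        HP0_def[symmetric] B_def[symmetric] X_def[symmetric] cap_def[symmetric] qe_def[symmetric] le(2)]
      have "loopfree LAYOUT" by (simp add: LAYOUT_def)
      note lay2 = wp_clock[OF lay this]
      have c: "fst (gh s2) + clen LAYOUT \<le> c0"
      proof -
        have "fst (gh s2) + clen LAYOUT \<le> clen START + (n * n + 1) * clen COUNT + clen LAYOUT" using s2 3 by simp
        also have "\<dots> \<le> K0 * (n * n + 1)" unfolding K0_def by (simp add: algebra_simps)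
        finally show ?thesis by (simp add: c0_def)
      qed
      show ?case by (rule wp_mono[OF lay2]) (use r2 c in auto)
    qed (use 3 le sum in auto)
  qed
  then obtain \<sigma>1 \<sigma>2 \<sigma>3 where big1: "big S W START ?s0 \<sigma>1" "big S W COUNT \<sigma>1 \<sigma>2" "big S W LAYOUT \<sigma>2 \<sigma>3" and Q3: "?Q \<sigma>3"
    unfolding wp_def by blast
  interpret P: program n r X W HT PR LL CA HD ST HP0
    by unfold_locales (auto simp: W_def S_def qe_def X_def HP0_def ST_def HD_def CA_def LL_def PR_def HT_def)
  define s1 :: "ev list st" where "s1 = \<lparr>rg = rg \<sigma>3, mm = mm \<sigma>3, gh = []\<rparr>"
  have "P.base s1" unfolding P.base_on_def
  proof (intro conjI allI impI)
    fix u v assume uv: "u < n" "v < n"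
    show "mm s1 (1 + (u * n + v)) = (if (u, v) \<in> r then 1 else 0)"
      using P.matrix_address[OF uv] uv Q3 by (simp add: s1_def s0_def input_config_def)
  qed (use Q3 in \<open>simp_all add: s1_def\<close>)
  moreover have "HP0 + (n + 1) * (6 * n + 4 * q) \<le> X" by (simp add: X_def B_def q2_def)
  ultimately have "lwp X W MAIN (\<lambda>s'. \<exists>x t qs. gh s' = replicate x Tick @ t \<and> node True qs t \<and> wf qs \<and> set qs = {..<n}
      \<and> x \<le> 2 * (n * (n + 1)) + n) s1"
    using Q3 by (intro P.lwp_MAIN) (simp_all add: s1_def)
  then obtain s2 x t qs where lb: "lbig X W MAIN s1 s2" and F: "gh s2 = replicate x Tick @ t" and nd: "node True qs t"
    and qs: "wf qs" "set qs = {..<n}" and x: "x \<le> 2 * (n * (n + 1)) + n" unfolding lwp_def by blast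
  have dq: "distinct qs" using qs(1) by (simp add: wf_def)
  interpret L: layer n X S W X cap t0 c0 KB "gh s2"
  proof
    show "okst n [] (gh s2)" by (rule F_okst[OF F nd dq qs(2)])
    show "gp 0 (gh s2) \<noteq> None" by (rule F_gp[OF F nd dq qs(2)])
    show "ticks ys \<le> t0 + cc * emits ys" if "gh s2 = xs @ ys @ zs" for xs ys zs
      using F_amortized[OF F nd dq qs(2) that] x unfolding t0_def by linarith
  qed (use t0c in \<open>auto simp: S_def qe_def W_def\<close>)
  have qe: "L.qe = qe" by (simp add: L.qe_def qe_def)
  \<comment> \<open>The output set starts out empty because its cardinality cell lies beyond the
    input matrix, where memory is 0.\<close>
  have "n * n < qe" unfolding qe_def X_def HP0_def ST_def HD_def CA_def LL_def PR_def HT_def by linarith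
  then have z: "mem s0 qe = 0" by (simp add: s0_def input_config_def)
  have "L.linv (gh s1) 0 \<sigma>3"
    by (rule L.linvI[of _ "[]" "[]"])
      (use Q3 z in \<open>auto simp: s1_def ops_def L.qrep_def L.srep_def L.timing_def L.qpos_def qe qe_def\<close>)
  moreover have "L.agree \<sigma>3 s1" by (simp add: L.agree_def s1_def)
  ultimately obtain \<sigma>4 where big4: "big S W (lower MAIN) \<sigma>3 \<sigma>4"
    and l4: "L.linv (gh s2) (max (0 + L.straight MAIN) (clen (lower MAIN))) \<sigma>4"
    using L.lower_sim[OF lb cvars_MAIN, of \<sigma>3 0] by (auto simp: L.prefix_of_F_def KB_def)
  have "L.finv \<sigma>4"
    by (rule L.linv_finv[OF l4]) (use L.straight_le[of MAIN] in \<open>simp add: KB_def\<close>)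
  then obtain \<sigma>5 where big5: "big S W (While (V 44) (EMIT 4)) \<sigma>4 \<sigma>5" and v5: "map snd (snd (gh \<sigma>5)) = vis [] (gh s2)"
    "L.gaps_ok (map fst (snd (gh \<sigma>5)))" "snd (gh \<sigma>5) \<noteq> [] \<longrightarrow> fst (gh \<sigma>5) \<le> last (map fst (snd (gh \<sigma>5))) + KB * (cc + 1)"
    using L.wp_flush[of \<sigma>4 "rg \<sigma>4 44"] by (auto simp: KB_def)
  have "big S W PROG ?s0 \<sigma>5" unfolding PROG_def using big1 big4 big5 by (blast intro: big.Seq)
  moreover have "sim S W p s0 0 ?s0" unfolding s0_def by (rule sim_start[OF le(5,6)])
  moreover have "code_at p 0 (ccom PROG 0)" unfolding code_at_def p_def by (rule exI[of _ "[]"]) simp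
  ultimately have "sim S W p s0 (0 + clen PROG) \<sigma>5" using cvars_PROG by (rule big_sim)
  then obtain s where s: "reach S W p s0 (fst (gh \<sigma>5)) s (snd (gh \<sigma>5))" "pc s = clen PROG" unfolding sim_def by auto
  define T where "T = fst (gh \<sigma>5)"
  define outs where "outs = snd (gh \<sigma>5)"
  have rs: "run p s0 T = s" using s(1) by (simp add: reach_def T_def)
  have first: "c0 + KB * (t0 + cc * (cap + 1)) + KB \<le> KI * (1 + D)"
  proof -
    have "c0 \<le> K0 * (1 + D)" unfolding c0_def Dn by (intro mult_le_mono2) simp
    moreover have "KB * (t0 + cc * (cap + 1)) \<le> KB * ((61 + 2 * cc) * (1 + D))"
    proof (rule mult_le_mono2)
      have "cc * (cap + 1) \<le> cc * (2 * (1 + D))" using capD by (intro mult_le_mono2) simp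
      then show "t0 + cc * (cap + 1) \<le> (61 + 2 * cc) * (1 + D)" using t0D by (simp add: algebra_simps)
    qed
    moreover have "KI * (1 + D) = K0 * (1 + D) + K0 * (1 + D) + KB * ((61 + 2 * cc) * (1 + D)) + (KB + KB * D)"
      unfolding KI_def by (simp add: algebra_simps)
    ultimately show ?thesis by linarith
  qed
  show ?thesis
  proof (rule exI[of _ S], rule exI[of _ W], rule exI[of _ T], rule exI[of _ "gh s2"], rule exI[of _ outs], intro conjI)
    show "reach S W p s0 T (run p s0 T) outs" unfolding rs using s(1) by (simp add: T_def outs_def)
    show "pc (run p s0 T) = length p" using s(2) unfolding rs by (simp add: p_def)
    show "map snd outs = vis [] (gh s2)" using v5(1) by (simp add: outs_def)
    show "\<exists>t qs x. gh s2 = replicate x Tick @ t \<and> node True qs t \<and> wf qs \<and> set qs = {..<n}" using F nd qs by blast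
    show "outs \<noteq> [] \<longrightarrow> map fst outs ! 0 \<le> KI * (1 + D)"
      using v5(2) first unfolding L.gaps_ok_def outs_def by auto
    show "\<forall>i. Suc i < length outs \<longrightarrow> map fst outs ! Suc i \<le> map fst outs ! i + KG"
      using v5(2) unfolding L.gaps_ok_def outs_def KG_def by simp
    show "outs \<noteq> [] \<longrightarrow> T \<le> last (map fst outs) + KG" using v5(3) by (simp add: outs_def T_def KG_def)
  qed (use SD W_def in auto)
qed

end

lemma run_after:
  assumes "halted p (run p s T)" "T \<le> t"
  shows "run p s t = run p s T"
  using assms(2)
proof (induction rule: dec_induct)
  case (step t)
  then show ?case using assms(1) by (simp add: run_Suc step_def)
qed simp

lemma reach_bounded:
  assumes r: "reach S W p s T (run p s T) outs" and h: "halted p (run p s T)"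
  shows "space_bounded p s S" "word_bounded p s W"
proof -
  have c: "t < T \<or> run p s t = run p s T" for t using run_after[OF h, of t] by (cases "t < T") auto
  have "accessed p (run p s T) = {}" using h by (simp add: accessed_def)
  then show "space_bounded p s S" using r c unfolding space_bounded_def reach_def by (metis empty_subsetI)
  have "run p s t = run p s (min t T)" for t using run_after[OF h, of t] by (cases "t \<le> T") (auto simp: min_def)
  then show "word_bounded p s W" using r unfolding word_bounded_def reach_def by (metis min.cobounded2)
qed

theorem theorem4p7:
  shows "\<exists>(p :: program) (c :: nat). \<forall>(n :: nat) (r :: nat rel).
    partial_order_on {..<n} r \<longrightarrow>
    (let V = {..<n}; q = card (incomparable_pairs V r); s = input_config n r in
     \<exists>(T :: nat) (As :: nat set list).
       let ts = output_times p s T in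
         \<comment> \<open>the run halts, and \<open>As\<close> is the sequence of visited sets, at the times \<open>ts\<close>\<close>
         halted p (run p s T)
       \<and> list_all2 (\<lambda>t A. visits p (run p s t) A) ts As
         \<comment> \<open>every antichain is visited exactly once\<close>
       \<and> distinct As \<and> set As = antichains V r
         \<comment> \<open>the order of visits is one of the recursive procedure\<close>
       \<and> enumerate_order r V {} As
         \<comment> \<open>consecutive antichains differ in at most three elements\<close>
       \<and> (\<forall>i. Suc i < length As \<longrightarrow> card (sym_diff (As ! i) (As ! Suc i)) \<le> 3)
         \<comment> \<open>initialization time\<close>
       \<and> ts ! 0 \<le> c * (1 + n * (n + q))
         \<comment> \<open>constant delay, also between the last visit and termination\<close>
       \<and> (\<forall>i. Suc i < length ts \<longrightarrow> ts ! Suc i \<le> ts ! i + c)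
       \<and> T \<le> last ts + c
         \<comment> \<open>time until the first k antichains have been visited\<close>
       \<and> (\<forall>k. 1 \<le> k \<and> k \<le> length ts \<longrightarrow> ts ! (k - 1) \<le> c * (k + n * (n + q)))
         \<comment> \<open>space, in words of \<open>O(log n)\<close> bits\<close>
       \<and> space_bounded p s (c * (1 + n * (n + q)))
       \<and> word_bounded p s (c * (n + 1) ^ c))"
proof -
  let ?p = "ccom PROG 0"
  have main: "\<exists>T As. halted ?p (run ?p (input_config n r) T)
       \<and> list_all2 (\<lambda>t A. visits ?p (run ?p (input_config n r) t) A) (output_times ?p (input_config n r) T) As
       \<and> distinct As \<and> set As = antichains {..<n} r
       \<and> enumerate_order r {..<n} {} As
       \<and> (\<forall>i. Suc i < length As \<longrightarrow> card (sym_diff (As ! i) (As ! Suc i)) \<le> 3)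
       \<and> output_times ?p (input_config n r) T ! 0 \<le> KC * (1 + n * (n + q))
       \<and> (\<forall>i. Suc i < length (output_times ?p (input_config n r) T) \<longrightarrow>
           output_times ?p (input_config n r) T ! Suc i \<le> output_times ?p (input_config n r) T ! i + KC)
       \<and> T \<le> last (output_times ?p (input_config n r) T) + KC
       \<and> (\<forall>k. 1 \<le> k \<and> k \<le> length (output_times ?p (input_config n r) T) \<longrightarrow>
           output_times ?p (input_config n r) T ! (k - 1) \<le> KC * (k + n * (n + q)))
       \<and> space_bounded ?p (input_config n r) (KC * (1 + n * (n + q)))
       \<and> word_bounded ?p (input_config n r) (KC * (n + 1) ^ KC)"
    if po: "partial_order_on {..<n} r" and q0: "q = card (incomparable_pairs {..<n} r)" for n r q
  proof -
    interpret P: poset n r by unfold_locales (rule po)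
    have q: "P.q = q" by (simp add: q0 P.q_def)
    define s where "s = input_config n r"
    define D where "D = n * (n + q)"
    obtain S W T F outs t qs x where R: "reach S W ?p s T (run ?p s T) outs" "pc (run ?p s T) = length ?p"
      "map snd outs = vis [] F" "S \<le> 200 * (1 + D)" "W = S + cc" and F: "F = replicate x Tick @ t" "P.node True qs t"
      and qs: "P.wf qs" "set qs = {..<n}"
      and ts: "outs \<noteq> [] \<longrightarrow> map fst outs ! 0 \<le> KI * (1 + D)"
        "\<forall>i. Suc i < length outs \<longrightarrow> map fst outs ! Suc i \<le> map fst outs ! i + KG"
        "outs \<noteq> [] \<longrightarrow> T \<le> last (map fst outs) + KG"
      using P.run_PROG unfolding q s_def[symmetric] D_def[symmetric] by blast
    have dq: "distinct qs" using qs(1) by (simp add: P.wf_def)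
    define As where "As = vis [] F"
    define us where "us = map fst outs"
    have times: "output_times ?p s T = us" and vis: "list_all2 (\<lambda>t A. visits ?p (run ?p s t) A) us As"
      using R(1,3) by (auto simp: reach_def us_def As_def)
    \<comment> \<open>The empty antichain is always visited, also for n = 0, so the first and the
      last output time are meaningful.\<close>
    have ne: "outs \<noteq> []"
    proof
      assume "outs = []"
      then have "emits F = 0" using R(3) length_vis[of "[]" F] by simp
      then show False using P.F_vis(4)[OF F dq qs(2)] by simp
    qed
    have h: "halted ?p (run ?p s T)" using R(2) by (simp add: halted_def)
    have gap: "us ! Suc i \<le> us ! i + KG" if "Suc i < length us" for i using ts(2) that by (simp add: us_def)
    have first: "us ! 0 \<le> KI * (1 + D)" using ts(1) ne by (simp add: us_def)
    have KI: "KI * (1 + D) \<le> KC * (1 + D)" by (intro mult_le_mono1) (simp add: KC_def)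
    have sp: "S \<le> KC * (1 + D)" "W \<le> KC * (1 + D)"
      using R(4,5) by (simp_all add: KC_def algebra_simps)
    have "q \<le> n * n" using P.card_r q P.card_r_ge by linarith
    \<comment> \<open>As q is at most \<open>n * n\<close>, the bound \<open>D\<close> is at most
      cubic, which is what keeps words at O(log n) bits.\<close>
    have D3: "1 + D \<le> (n + 1) ^ KC"
    proof -
      have "n * q \<le> n * (n * n)" using \<open>q \<le> n * n\<close> by (intro mult_le_mono2)
      moreover have "D = n * n + n * q" "(n + 1) ^ 3 = n * (n * n) + 3 * (n * n) + 3 * n + 1"
        by (simp_all add: D_def power3_eq_cube algebra_simps)
      ultimately have "1 + D \<le> (n + 1) ^ 3" by linarith
      also have "\<dots> \<le> (n + 1) ^ KC" by (intro power_increasing) (simp_all add: KC_def)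
      finally show ?thesis .
    qed
    have "W \<le> KC * (n + 1) ^ KC" using sp(2) mult_le_mono2[OF D3, of KC] by linarith
    then have wb: "word_bounded ?p s (KC * (n + 1) ^ KC)"
      using reach_bounded(2)[OF R(1) h] unfolding word_bounded_def by (meson order_trans)
    have sb: "space_bounded ?p s (KC * (1 + D))"
      using reach_bounded(1)[OF R(1) h] sp(1) unfolding space_bounded_def by (meson lessThan_subset_iff order_trans)
    have k: "us ! (k - 1) \<le> KC * (k + D)" if "1 \<le> k" "k \<le> length us" for k
    proof -
      have "us ! (k - 1) \<le> us ! 0 + (k - 1) * KG" by (rule nth_gap_le) (use gap that in auto)
      also have "\<dots> \<le> KI * (1 + D) + k * KG" using first by (intro add_mono mult_le_mono1) auto
      also have "\<dots> \<le> KI * (k + D) + (k + D) * KG" using that by (intro add_mono mult_le_mono1 mult_le_mono2) simp_all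
      also have "\<dots> \<le> KC * (k + D)" by (simp add: KC_def algebra_simps)
      finally show ?thesis .
    qed
    show ?thesis unfolding s_def[symmetric] D_def[symmetric]
    proof (rule exI[of _ T], rule exI[of _ As], unfold times, intro conjI)
      show "distinct As" "set As = antichains {..<n} r" "enumerate_order r {..<n} {} As"
        unfolding As_def using P.F_vis[OF F dq qs(2)] by auto
      show "\<forall>i. Suc i < length As \<longrightarrow> card (sym_diff (As ! i) (As ! Suc i)) \<le> 3"
        unfolding As_def using P.F_gray[OF F dq qs(2)] by blast
      show "us ! 0 \<le> KC * (1 + D)" using first KI by linarith
      show "\<forall>i. Suc i < length us \<longrightarrow> us ! Suc i \<le> us ! i + KC" using gap by (force simp: KC_def)
      show "T \<le> last us + KC" using ts(3) ne by (simp add: us_def KC_def)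
      show "\<forall>k. 1 \<le> k \<and> k \<le> length us \<longrightarrow> us ! (k - 1) \<le> KC * (k + D)" using k by blast
    qed (use h vis sb wb in auto)
  qed
  show ?thesis
    unfolding Let_def by (rule exI[of _ ?p], rule exI[of _ KC], intro allI impI main) auto
qed

end
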